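(* Let $\beta>0$, $\beta'=\beta/2$, and suppose $$\frac{\beta' n}{a_n}\to\tau\in(0,1],\qquad\frac{b_n}{n}\to\infty\qquad(n\to\infty).$$ Let $(\lambda_1,\dots,\lambda_n;w_1,\dots,w_n)\sim\mathcal{J}\beta\mathcal{E}(a_n,b_n)$ and let $\mu_n=\sum_i w_i\delta_{(b_n/a_n)\lambda_i}$ be the spectral measure of the rescaled eigenvalues $\frac{b_n}{a_n}\lambda_i$. Then the laws of $(\mu_n)_n$ on $\mathcal{M}_c$ satisfy a large deviation principle with speed $a_n$ and good rate function $\mathcal I_L$ (with parameter $\tau$).
   Context: Jacobi ensemble $\mathcal{J}\beta\mathcal{E}(a,b)$ in dimension $n$ ($a,b>\beta'(n-1)$): eigenvalues $(\lambda_1,\dots,\lambda_n)$ with density $c_{a,b,\beta}\prod_{i<j}|\lambda_i-\lambda_j|^\beta\prod_i\lambda_i^{a-e_\beta}(1-\lambda_i)^{b-e_\beta}\mathbb{1}_{\{0<\lambda_i<1\}}$, $e_\beta=\frac\beta2(n-1)+1$, and independent weights $(w_1,\dots,w_n)\sim$ Dirichlet$(\beta',\dots,\beta')$. $\mathcal{M}_c$ is the set of compactly supported probability measures on $\mathbb{R}$ with the weak topology; LDP with speed $s_n$ and rate $\mathcal I$: $\limsup s_n^{-1}\log P(\mu_n\in F)\le-\inf_F\mathcal I$ for closed $F$, $\liminf s_n^{-1}\log P(\mu_n\in O)\ge-\inf_O\mathcal I$ for open $O$; good = compact level sets. For $\mu\in\mathcal M_c$, let $d_1,d_2,\dots$ and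 $c_1,c_2,\dots\ge0$ be its Jacobi recursion coefficients, i.e. the diagonal and off-diagonal entries of the tridiagonal (Jacobi) matrix associated with $\mu$, given by the three-term recursion $xP_j(x)=c_{j+1}P_{j+1}(x)+d_{j+1}P_j(x)+c_jP_{j-1}(x)$ of the orthonormal polynomials $P_j$ of $\mu$. If $\mu$ is supported in $[0,\infty)$ there are nonnegative $z_1,z_2,\dots$ with $z_0=0$, $d_k=z_{2k-2}+z_{2k-1}$, $c_k=\sqrt{z_{2k-1}z_{2k}}$. With $g(x)=x-\log x-1$ for $x>0$ and $g(x)=\infty$ for $x\le0$, $$\mathcal I_L(\mu)=\sum_{k=1}^\infty\Big(g(z_{2k-1})+\tau\,g(z_{2k}/\tau)\Big)$$ for such $\mu$, and $\mathcal I_L(\mu)=\infty$ if $\mathrm{supp}(\mu)\not\subset[0,\infty)$. *)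

theory Defs
  imports "HOL-Probability.Probability" "HOL-Computational_Algebra.Polynomial"
begin

definition msupp :: "real measure \<Rightarrow> real set" where
  "msupp \<mu> = {x. \<forall>e>0. emeasure \<mu> (ball x e) > 0}"

definition Mc :: "real measure set" where
  "Mc = {\<mu>. sets \<mu> = sets borel \<and> prob_space \<mu> \<and> compact (msupp \<mu>)}"

definition weak_top :: "real measure topology" where
  "weak_top = topology_generated_by
     {{\<mu> \<in> Mc. (\<integral>x. f x \<partial>\<mu>) \<in> U} | (f :: real \<Rightarrow> real) U.
        continuous_on UNIV f \<and> bounded (range f) \<and> open U}"

definition eln :: "real \<Rightarrow> ereal" where
  "eln p = (if p > 0 then ereal (ln p) else -\<infinity>)"

definition LDP :: "'a topology \<Rightarrow> (nat \<Rightarrow> 'a set \<Rightarrow> real) \<Rightarrow> (nat \<Rightarrow> real)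
                    \<Rightarrow> ('a \<Rightarrow> ereal) \<Rightarrow> bool" where
  "LDP T Pr s I \<longleftrightarrow>
     (\<forall>F. closedin T F \<longrightarrow>
        limsup (\<lambda>n. eln (Pr n F) / ereal (s n)) \<le> - (\<Sqinter>\<mu>\<in>F. I \<mu>)) \<and>
     (\<forall>G. openin T G \<longrightarrow>
        liminf (\<lambda>n. eln (Pr n G) / ereal (s n)) \<ge> - (\<Sqinter>\<mu>\<in>G. I \<mu>))"

definition good_rate_function :: "'a topology \<Rightarrow> ('a \<Rightarrow> ereal) \<Rightarrow> bool" where
  "good_rate_function T I \<longleftrightarrow>
     (\<forall>\<mu>\<in>topspace T. I \<mu> \<ge> 0) \<and>
     (\<forall>c::real. compactin T {\<mu> \<in> topspace T. I \<mu> \<le> ereal c})"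

definition orthonormal_polys :: "real measure \<Rightarrow> nat \<Rightarrow> (nat \<Rightarrow> real poly) \<Rightarrow> bool" where
  "orthonormal_polys \<mu> N P \<longleftrightarrow>
     (\<forall>j<N. degree (P j) = j \<and> lead_coeff (P j) > 0) \<and>
     (\<forall>i<N. \<forall>j<N. (\<integral>x. poly (P i) x * poly (P j) x \<partial>\<mu>) = (if i = j then 1 else 0))"

definition has_orth_poly :: "real measure \<Rightarrow> nat \<Rightarrow> bool" where
  "has_orth_poly \<mu> j \<longleftrightarrow> (\<exists>P. orthonormal_polys \<mu> (Suc j) P)"

definition orth_poly :: "real measure \<Rightarrow> nat \<Rightarrow> real poly" where
  "orth_poly \<mu> j = (THE p. \<exists>P. orthonormal_polys \<mu> (Suc j) P \<and> P j = p)"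

text \<open>Jacobi matrix entries (matrix of multiplication by x in the orthonormal
  basis): d_(j+1) = <x P_j, P_j>, c_(j+1) = <x P_j, P_(j+1)>, so that
  x P_j = c_(j+1) P_(j+1) + d_(j+1) P_j + c_j P_(j-1).  For a measure with
  finite support of N points, c_N = 0 and all later coefficients are 0.
  Indices start at 1; the value at index 0 is irrelevant (set to 0).\<close>
definition jacobi_d :: "real measure \<Rightarrow> nat \<Rightarrow> real" where
  "jacobi_d \<mu> k = (if k \<ge> 1 \<and> has_orth_poly \<mu> (k - 1)
      then \<integral>x. x * (poly (orth_poly \<mu> (k - 1)) x)\<^sup>2 \<partial>\<mu> else 0)"

definition jacobi_c :: "real measure \<Rightarrow> nat \<Rightarrow> real" where
  "jacobi_c \<mu> k = (if k \<ge> 1 \<and> has_orth_poly \<mu> k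
      then \<integral>x. x * poly (orth_poly \<mu> (k - 1)) x * poly (orth_poly \<mu> k) x \<partial>\<mu> else 0)"

definition gfun :: "real \<Rightarrow> ereal" where
  "gfun x = (if x > 0 then ereal (x - ln x - 1) else \<infinity>)"

definition z_params :: "real measure \<Rightarrow> (nat \<Rightarrow> real) \<Rightarrow> bool" where
  "z_params \<mu> z \<longleftrightarrow> z 0 = 0 \<and> (\<forall>k. z k \<ge> 0) \<and>
     (\<forall>k\<ge>1. jacobi_d \<mu> k = z (2*k - 2) + z (2*k - 1) \<and>
             jacobi_c \<mu> k = sqrt (z (2*k - 1) * z (2*k)))"

definition I_L :: "real \<Rightarrow> real measure \<Rightarrow> ereal" where
  "I_L \<tau> \<mu> = (if msupp \<mu> \<subseteq> {0..}
      then (\<Sqinter>z\<in>{z. z_params \<mu> z}.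
              \<Sum>k. gfun (z (2*k + 1)) + ereal \<tau> * gfun (z (2*k + 2) / \<tau>))
      else \<infinity>)"

definition normalized_density :: "'a measure \<Rightarrow> ('a \<Rightarrow> ennreal) \<Rightarrow> 'a measure" where
  "normalized_density M f = density M (\<lambda>x. f x / (\<integral>\<^sup>+y. f y \<partial>M))"

definition jacobi_eig :: "nat \<Rightarrow> real \<Rightarrow> real \<Rightarrow> real \<Rightarrow> (nat \<Rightarrow> real) measure" where
  "jacobi_eig n \<beta> a b =
     (let e = \<beta> / 2 * (real n - 1) + 1 in
      normalized_density (PiM {..<n} (\<lambda>_. lborel))
        (\<lambda>l. ennreal ((\<Prod>i<n. \<Prod>j\<in>{i<..<n}. \<bar>l i - l j\<bar> powr \<beta>) *
                      (\<Prod>i<n. l i powr (a - e) * (1 - l i) powr (b - e))) *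
             (\<Prod>i<n. indicator {0<..<1} (l i))))"

text \<open>Dirichlet(p,...,p) law of (w_0,...,w_(n-1)) on the simplex: density
  with respect to Lebesgue measure of (w_0,...,w_(n-2)), w_(n-1) = 1 - sum.\<close>
definition dirichlet :: "nat \<Rightarrow> real \<Rightarrow> (nat \<Rightarrow> real) measure" where
  "dirichlet n p =
     distr (normalized_density (PiM {..<n-1} (\<lambda>_. lborel))
              (\<lambda>v. ennreal ((\<Prod>i<n-1. v i powr (p - 1)) * (1 - (\<Sum>i<n-1. v i)) powr (p - 1)) *
                   (\<Prod>i<n-1. indicator {0<..} (v i)) * indicator {..<1} (\<Sum>i<n-1. v i)))
           (PiM {..<n} (\<lambda>_. lborel))
           (\<lambda>v. \<lambda>i\<in>{..<n}. if i < n - 1 then v i else 1 - (\<Sum>j<n-1. v j))"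

definition jacobi_ensemble :: "nat \<Rightarrow> real \<Rightarrow> real \<Rightarrow> real \<Rightarrow> ((nat \<Rightarrow> real) \<times> (nat \<Rightarrow> real)) measure" where
  "jacobi_ensemble n \<beta> a b = jacobi_eig n \<beta> a b \<Otimes>\<^sub>M dirichlet n (\<beta> / 2)"

definition spectral_measure :: "nat \<Rightarrow> (nat \<Rightarrow> real) \<Rightarrow> (nat \<Rightarrow> real) \<Rightarrow> real measure" where
  "spectral_measure n x w =
     measure_of UNIV (sets borel) (\<lambda>A. \<Sum>i<n. ennreal (w i) * indicator A (x i))"

definition jacobi_prob :: "nat \<Rightarrow> real \<Rightarrow> real \<Rightarrow> real \<Rightarrow> real measure set \<Rightarrow> real" where
  "jacobi_prob n \<beta> a b A =
     measure (jacobi_ensemble n \<beta> a b)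
       {p \<in> space (jacobi_ensemble n \<beta> a b).
          spectral_measure n (\<lambda>i. (b / a) * fst p i) (snd p) \<in> A}"

end

theory Submission
  imports Defs
begin

text \<open>The moment sequence of the spectral measure of the Jacobi ensemble is a Stieltjes continued fraction in
\<open>z k = (1 - p (k - 1)) * p k\<close> with independent Beta distributed canonical moments \<open>p k\<close>. This is proved by splitting off one
canonical moment at a time: expressing a spectral measure with nodes \<open>y\<close> through the zeros \<open>x\<close> of its Stieltjes
transform, with the explicit Jacobian of a rank-one perturbation, exchanges the Jacobi weight on \<open>Suc m\<close> positive nodes
with the same kind of weight on \<open>m\<close> positive nodes and the node \<open>0\<close>, and polar coordinates release a Beta factor.

After rescaling by \<open>b / a\<close>, each \<open>p k\<close> satisfies a large deviation principle at speed \<open>a\<close> with rate \<open>gfun\<close> (even index) or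
\<open>\<tau> * gfun (\<cdot> / \<tau>)\<close> (odd index), and the factors \<open>1 - p (k - 1)\<close> tend to \<open>1\<close>, so cylinder sets of recursion coefficients
have the rates given by the partial sums of the rate function. Since on measures supported in a fixed compact interval the moments
determine the weak topology, and since the coefficients leave a large box only with exponentially negligible probability,
these cylinder estimates carry over to the spectral measures.\<close>

section \<open>Integration over finite products of Lebesgue measure\<close>

text \<open>The upper endpoint 1 of the Jacobi weight dictates the parametrization. An exchange of
  nodes and zeros turns the product of all \<open>1 - x\<close> into the same product for the new
  nodes times \<open>1 - R\<close>, with \<open>R\<close> linear in the new weights, and the factor
  \<open>1 - q * S\<close> inherited from the previous step into \<open>1 - q / (1 - R)\<close>.
  Together they give \<open>1 - q - R\<close>, which separates only if the total mass of the new
  weights is written \<open>(1 - q) * p\<close>; this is the origin of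
  \<open>z k = (1 - p (k - 1)) * p k\<close>. The power of \<open>1 - q\<close> left over at one
  step completes the Beta density of the moment released before it. The infimum over parameters in
  \<open>I_L\<close> is no obstacle: a finite value forces all parameters to be positive, and
  positive parameters are unique. The factor 4 that recurs in the bounds comes from a count:
  nonnegative coefficients at most \<open>M\<close> give a \<open>k\<close>-th moment at most
  \<open>(4 * M) ^ k\<close>, hence support in \<open>{0..4 * M}\<close>.\<close>

abbreviation Leb :: "nat \<Rightarrow> (nat \<Rightarrow> real) measure" where
  "Leb n \<equiv> PiM {..<n} (\<lambda>_. lborel)"

interpretation leb: product_sigma_finite "\<lambda>_::nat. lborel :: real measure"
  by standard

lemma sigma_finite_Leb: "sigma_finite_measure (Leb n)"
  by (rule leb.sigma_finite) simp

lemma nn_integral_Leb_0: "integral\<^sup>N (Leb 0) f = f (\<lambda>_. undefined)"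
  by (simp add: leb.nn_integral_empty)

lemma nn_integral_Leb_Suc:
  assumes [measurable]: "f \<in> borel_measurable (Leb (Suc n))"
  shows "integral\<^sup>N (Leb (Suc n)) f = (\<integral>\<^sup>+x. \<integral>\<^sup>+t. f (x(n := t)) \<partial>lborel \<partial>Leb n)"
  using leb.product_nn_integral_insert[of "{..<n}" n f] assms by (simp add: lessThan_Suc)

lemma measurable_Leb_Suc_upd [measurable]:
  "(\<lambda>(x, t). x(n := t)) \<in> measurable (Leb n \<Otimes>\<^sub>M lborel) (Leb (Suc n))"
  using measurable_add_dim[of n "{..<n}" "\<lambda>_. lborel :: real measure"] by (simp add: lessThan_Suc)

lemma measurable_Leb_component:
  assumes "f \<in> measurable M (Leb n)" "i < n"
  shows "(\<lambda>u. f u i) \<in> borel_measurable M"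
  using measurable_compose[OF assms(1) measurable_component_singleton[of i "{..<n}" "\<lambda>_. lborel"]] assms(2)
  by simp

lemma measurable_restrict_Leb:
  assumes "\<And>i. i < n \<Longrightarrow> (\<lambda>u. f u i) \<in> borel_measurable M"
  shows "(\<lambda>u. \<lambda>i\<in>{..<n}. f u i) \<in> measurable M (Leb n)"
  using assms by (intro measurable_restrict) auto

lemma Fubini_Leb_lborel:
  fixes f :: "(nat \<Rightarrow> real) \<Rightarrow> real \<Rightarrow> ennreal"
  assumes "case_prod f \<in> borel_measurable (Leb n \<Otimes>\<^sub>M lborel)"
  shows "(\<integral>\<^sup>+x. \<integral>\<^sup>+t. f x t \<partial>lborel \<partial>Leb n) = (\<integral>\<^sup>+t. \<integral>\<^sup>+x. f x t \<partial>Leb n \<partial>lborel)"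
proof -
  interpret pair_sigma_finite "Leb n" "lborel :: real measure"
    by (simp add: pair_sigma_finite_def sigma_finite_Leb sigma_finite_lborel)
  show ?thesis
    by (rule Fubini'[symmetric]) (use assms in measurable)
qed

lemma Fubini_Leb_Leb:
  assumes "case_prod f \<in> borel_measurable (Leb n \<Otimes>\<^sub>M Leb m)"
  shows "(\<integral>\<^sup>+x. \<integral>\<^sup>+t. f x t \<partial>Leb m \<partial>Leb n) = (\<integral>\<^sup>+t. \<integral>\<^sup>+x. f x t \<partial>Leb n \<partial>Leb m)"
proof -
  interpret pair_sigma_finite "Leb n" "Leb m"
    by (simp add: pair_sigma_finite_def sigma_finite_Leb)
  show ?thesis
    by (rule Fubini'[symmetric]) (use assms in measurable)
qed

lemma nn_integral_Leb_scale:
  assumes "f \<in> borel_measurable (Leb n)" "\<And>j. j < n \<Longrightarrow> c j > 0"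
  shows "integral\<^sup>N (Leb n) f = ennreal (\<Prod>j<n. c j) * (\<integral>\<^sup>+x. f (\<lambda>j\<in>{..<n}. c j * x j) \<partial>Leb n)"
  using assms
proof (induction n arbitrary: f)
  case 0
  then show ?case by (simp add: PiM_empty nn_integral_count_space_finite)
next
  case (Suc n)
  note [measurable] = Suc.prems(1)
  have c: "c n > 0" "\<And>j. j < n \<Longrightarrow> c j > 0" using Suc.prems by auto
  have upd: "(\<lambda>j\<in>{..<Suc n}. c j * (x(n := t)) j) = (\<lambda>j\<in>{..<n}. c j * x j)(n := c n * t)" for x t
    by (auto simp: fun_eq_iff)
  have "integral\<^sup>N (Leb (Suc n)) f = (\<integral>\<^sup>+x. \<integral>\<^sup>+t. f (x(n := t)) \<partial>lborel \<partial>Leb n)"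
    by (rule nn_integral_Leb_Suc) measurable
  also have "\<dots> = (\<integral>\<^sup>+x. ennreal (c n) * (\<integral>\<^sup>+t. f (x(n := c n * t)) \<partial>lborel) \<partial>Leb n)"
    using c(1) by (intro nn_integral_cong, subst nn_integral_real_affine[where c = "c n" and t = 0]) auto
  also have "\<dots> = ennreal (c n) * (\<integral>\<^sup>+x. (\<integral>\<^sup>+t. f (x(n := c n * t)) \<partial>lborel) \<partial>Leb n)"
    by (rule nn_integral_cmult) measurable
  also have "\<dots> = ennreal (c n) * (ennreal (\<Prod>j<n. c j) *
      (\<integral>\<^sup>+x. (\<integral>\<^sup>+t. f ((\<lambda>j\<in>{..<n}. c j * x j)(n := c n * t)) \<partial>lborel) \<partial>Leb n))"
    using c(2) by (subst Suc.IH) (simp_all add: restrict_def, measurable)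
  also have "(\<integral>\<^sup>+x. (\<integral>\<^sup>+t. f ((\<lambda>j\<in>{..<n}. c j * x j)(n := c n * t)) \<partial>lborel) \<partial>Leb n) =
      (\<integral>\<^sup>+x. f (\<lambda>j\<in>{..<Suc n}. c j * x j) \<partial>Leb (Suc n))"
    by (subst nn_integral_Leb_Suc) (measurable, simp only: upd)
  moreover have "ennreal (\<Prod>j<Suc n. c j) = ennreal (c n) * ennreal (\<Prod>j<n. c j)"
    using c by (subst ennreal_mult[symmetric]) (auto intro!: prod_nonneg intro: less_imp_le simp: mult.commute)
  ultimately show ?case by (simp only: mult.assoc)
qed

text \<open>The set \<open>{x. a < x \<and> 0 < g x}\<close> is a half line on which \<open>g\<close> is an increasing bijection onto the
positive reals, although \<open>g\<close> need not be monotone on all of \<open>{a<..}\<close>.\<close>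

lemma nn_integral_substitution_open:
  fixes g g' :: "real \<Rightarrow> real"
  assumes f [measurable]: "f \<in> borel_measurable borel"
    and D: "\<And>x. x > a \<Longrightarrow> (g has_real_derivative g' x) (at x)"
    and cont: "continuous_on {a<..} g'"
    and pos: "\<And>x. x > a \<Longrightarrow> g x > 0 \<Longrightarrow> g' x > 0"
    and up: "\<And>x y. a < x \<Longrightarrow> x < y \<Longrightarrow> g x > 0 \<Longrightarrow> g x < g y"
    and surj: "\<And>t. t > 0 \<Longrightarrow> \<exists>x>a. g x = t"
  shows "(\<integral>\<^sup>+t. f t * indicator {0<..} t \<partial>lborel) =
         (\<integral>\<^sup>+x. f (g x) * ennreal (g' x) * indicator {x. a < x \<and> g x > 0} x \<partial>lborel)" (is "?lhs = ?rhs")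
proof -
  \<comment> \<open>The positive half line is exhausted by the intervals from
    \<open>1 / (k + 2)\<close> to \<open>k + 2\<close>; their preimages are the compact intervals
    \<open>{l k..u k}\<close>, where the substitution rule for closed intervals applies. The offset
    2 keeps the interval nondegenerate at \<open>k = 0\<close>.\<close>
  define l where "l k = (SOME x. x > a \<and> g x = 1 / (real k + 2))" for k :: nat
  define u where "u k = (SOME x. x > a \<and> g x = real k + 2)" for k :: nat
  have l: "l k > a" "g (l k) = 1 / (real k + 2)" for k
    using someI_ex[OF surj[of "1 / (real k + 2)"]] by (auto simp: l_def)
  have u: "u k > a" "g (u k) = real k + 2" for k
    using someI_ex[OF surj[of "real k + 2"]] by (auto simp: u_def)
  have lt: "x < y" if "x > a" "y > a" "g x > 0" "g y > 0" "g x < g y" for x y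
    using that up[of y x] by (cases x y rule: linorder_cases) auto
  have le: "x \<le> y \<longleftrightarrow> g x \<le> g y" if "x > a" "y > a" "g x > 0" "g y > 0" for x y
    using that up[of y x] up[of x y] by (cases x y rule: linorder_cases) auto
  have gpos: "g x > 0" if "x \<ge> l k" for x k
  proof -
    have "0 < g (l k)" using l[of k] by simp
    then have "g (l k) < g x" if "l k < x" using up[OF l(1) that] by blast
    then show ?thesis using that \<open>0 < g (l k)\<close> by (cases "l k < x") auto
  qed
  have inI: "x \<in> {l k..u k} \<longleftrightarrow> a < x \<and> g x > 0 \<and> g x \<in> {1 / (real k + 2)..real k + 2}" for x k
  proof (cases "a < x \<and> g x > 0")
    case True
    have "0 < g (l k)" "0 < g (u k)" using l[of k] u[of k] by simp_all
    then show ?thesis using True le[of "l k" x] le[of x "u k"] l[of k] u[of k] by simp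
  next
    case False
    then have "\<not> l k \<le> x" using gpos[of k x] l(1)[of k] by linarith
    with False show ?thesis by auto
  qed
  have exk: "\<exists>K. \<forall>k\<ge>K. t \<in> {1 / (real k + 2)..real k + 2}" if "t > 0" for t
  proof -
    obtain K1 :: nat where K1: "real K1 > t" using reals_Archimedean2 by blast
    obtain K2 :: nat where K2: "real K2 > 1 / t" using reals_Archimedean2 by blast
    have "t \<in> {1 / (real k + 2)..real k + 2}" if "k \<ge> max K1 K2" for k
    proof -
      have "real k \<ge> real K1" "real k \<ge> real K2" using that by auto
      then have "1 / t < real k + 2" "t < real k + 2" using K1 K2 by linarith+
      then show ?thesis using \<open>t > 0\<close> by (auto simp: field_simps)
    qed
    then show ?thesis by blast
  qed
  have mono: "1 / (real k + 2) \<le> t \<and> t \<le> real k + 2" if "1 / (real j + 2) \<le> t \<and> t \<le> real j + 2" "j \<le> k" for j k t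
  proof -
    have "1 / (real k + 2) \<le> 1 / (real j + 2)" using that(2) by (intro divide_left_mono) auto
    then show ?thesis using that by auto
  qed
  \<comment> \<open>\<open>g\<close> and \<open>g'\<close> are arbitrary to the left of
    \<open>a\<close>, so both are replaced by cut-offs that agree with them on
    \<open>{l k..u k}\<close>.\<close>
  have [measurable]: "(\<lambda>x. f (g x) * ennreal (g' x) * indicator {l k..u k} x) \<in> borel_measurable borel" for k
  proof -
    have "continuous_on {l k..u k} g"
    proof (rule DERIV_continuous_on[of _ g g'])
      fix x assume "x \<in> {l k..u k}"
      then have "a < x" using l(1)[of k] by simp
      then show "(g has_real_derivative g' x) (at x within {l k..u k})"
        by (rule has_field_derivative_at_within[OF D])
    qed
    then have "(\<lambda>x. if x \<in> {l k..u k} then g x else 0) \<in> borel_measurable borel"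
      by (intro borel_measurable_continuous_on_if) auto
    moreover have "continuous_on {l k..u k} g'"
      using cont l(1)[of k] by (auto intro: continuous_on_subset)
    then have "(\<lambda>x. if x \<in> {l k..u k} then g' x else 0) \<in> borel_measurable borel"
      by (intro borel_measurable_continuous_on_if) auto
    ultimately have "(\<lambda>x. f (if x \<in> {l k..u k} then g x else 0) * ennreal (if x \<in> {l k..u k} then g' x else 0)
        * indicator {l k..u k} x) \<in> borel_measurable borel"
      by measurable
    also have "(\<lambda>x. f (if x \<in> {l k..u k} then g x else 0) * ennreal (if x \<in> {l k..u k} then g' x else 0)
        * indicator {l k..u k} x) = (\<lambda>x. f (g x) * ennreal (g' x) * indicator {l k..u k} x)"
      by (auto simp: fun_eq_iff indicator_def)
    finally show ?thesis .
  qed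
  have eq: "(\<integral>\<^sup>+t. f t * indicator {1 / (real k + 2)..real k + 2} t \<partial>lborel) =
      (\<integral>\<^sup>+x. f (g x) * ennreal (g' x) * indicator {l k..u k} x \<partial>lborel)" for k
  proof -
    have "1 / (real k + 2) \<le> 1 / 2" by (simp add: field_simps)
    then have "1 / (real k + 2) < real k + 2" by linarith
    moreover have "0 < g (l k)" "0 < g (u k)" using l[of k] u[of k] by simp_all
    ultimately have "l k < u k" using l[of k] u[of k] by (rule_tac lt) simp_all
    have in_dom: "a < x" "g x > 0" if "x \<in> {l k..u k}" for x
      using that inI[of x k] by blast+
    have "(\<integral>\<^sup>+t. f t * indicator {g (l k)..g (u k)} t \<partial>lborel) =
      (\<integral>\<^sup>+x. f (g x) * ennreal (g' x) * indicator {l k..u k} x \<partial>lborel)"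
    proof (rule nn_integral_substitution_aux[OF f _ _ _ _ \<open>l k < u k\<close>])
      fix x assume "x \<in> {l k..u k}"
      note x = in_dom[OF this]
      show "(g has_real_derivative g' x) (at x)" by (rule D[OF x(1)])
      show "0 \<le> g' x" using pos[OF x] by simp
    next
      show "continuous_on {l k..u k} g'"
        by (rule continuous_on_subset[OF cont]) (use l(1)[of k] in auto)
    qed simp
    then show ?thesis by (simp only: l u)
  qed
  have S1: "(\<lambda>k. \<integral>\<^sup>+t. f t * indicator {1 / (real k + 2)..real k + 2} t \<partial>lborel)
      \<longlonglongrightarrow> ?lhs"
  proof (rule nn_integral_LIMSEQ)
    show "incseq (\<lambda>k t. f t * indicator {1 / (real k + 2)..real k + 2} t)"
      unfolding incseq_def le_fun_def
    proof (intro allI impI)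
      fix j k :: nat and t assume "j \<le> k"
      from mono[OF _ this, of t]
      show "f t * indicator {1 / (real j + 2)..real j + 2} t \<le> f t * indicator {1 / (real k + 2)..real k + 2} t"
        by (intro mult_left_mono indicator_leI) simp_all
    qed
    fix t show "(\<lambda>k. f t * indicator {1 / (real k + 2)..real k + 2} t) \<longlonglongrightarrow> f t * indicator {0<..} t"
    proof (cases "t > 0")
      case True
      from exk[OF True] obtain K where K: "\<forall>k\<ge>K. t \<in> {1 / (real k + 2)..real k + 2}" ..
      show ?thesis
      proof (rule tendsto_eventually, rule eventually_sequentiallyI[of K])
        fix k assume "K \<le> k"
        then have "t \<in> {1 / (real k + 2)..real k + 2}" using K by blast
        then show "f t * indicator {1 / (real k + 2)..real k + 2} t = f t * indicator {0<..} t"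
          using True by simp
      qed
    next
      case False
      have "indicator {1 / (real k + 2)..real k + 2} t = (0::ennreal)" for k
      proof -
        have "1 / (real k + 2) > 0" by simp
        then have "\<not> 1 / (real k + 2) \<le> t" using False by linarith
        then show ?thesis by simp
      qed
      then show ?thesis using False by simp
    qed
  qed measurable
  have S2: "(\<lambda>k. \<integral>\<^sup>+x. f (g x) * ennreal (g' x) * indicator {l k..u k} x \<partial>lborel)
      \<longlonglongrightarrow> ?rhs"
  proof (rule nn_integral_LIMSEQ)
    show "incseq (\<lambda>k x. f (g x) * ennreal (g' x) * indicator {l k..u k} x)"
      unfolding incseq_def le_fun_def
    proof (intro allI impI)
      fix j k :: nat and x assume "j \<le> k"
      from mono[OF _ this, of "g x"] inI[of x j] inI[of x k] have "x \<in> {l j..u j} \<Longrightarrow> x \<in> {l k..u k}"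
        by simp
      then show "f (g x) * ennreal (g' x) * indicator {l j..u j} x \<le> f (g x) * ennreal (g' x) * indicator {l k..u k} x"
        by (intro mult_left_mono indicator_leI) simp_all
    qed
    fix x show "(\<lambda>k. f (g x) * ennreal (g' x) * indicator {l k..u k} x)
        \<longlonglongrightarrow> f (g x) * ennreal (g' x) * indicator {x. a < x \<and> g x > 0} x"
    proof (cases "a < x \<and> g x > 0")
      case True
      then obtain K where "\<forall>k\<ge>K. g x \<in> {1 / (real k + 2)..real k + 2}" using exk[of "g x"] by blast
      with True have K: "\<forall>k\<ge>K. x \<in> {l k..u k}" using inI by blast
      show ?thesis
      proof (rule tendsto_eventually, rule eventually_sequentiallyI[of K])
        fix k assume "K \<le> k"
        then have "x \<in> {l k..u k}" using K by blast
        then show "f (g x) * ennreal (g' x) * indicator {l k..u k} x =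
            f (g x) * ennreal (g' x) * indicator {x. a < x \<and> g x > 0} x"
          using True by simp
      qed
    next
      case False
      then have "indicator {l k..u k} x = (0::ennreal)" for k
        using inI[of x k] by (simp only: indicator_def) auto
      then show ?thesis using False by auto
    qed
  qed measurable
  show ?thesis using LIMSEQ_unique[OF S1] S2 unfolding eq by blast
qed

section \<open>Interlacing sequences and rank-one perturbations\<close>

text \<open>If \<open>y\<close> and \<open>x\<close> interlace, then \<open>1 - (\<Sum>j<n. \<rho> j / (z - y j))\<close> with \<open>\<rho> = res n y x\<close> is the rational function with poles
\<open>y\<close> and zeros \<open>x\<close>; thus \<open>x\<close> is the spectrum of the rank-one perturbation of \<open>diag y\<close> with squared coupling vector \<open>\<rho>\<close>.\<close>

definition vand :: "nat \<Rightarrow> (nat \<Rightarrow> real) \<Rightarrow> real" where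
  "vand n x = (\<Prod>i<n. \<Prod>j\<in>{i<..<n}. x j - x i)"

definition res :: "nat \<Rightarrow> (nat \<Rightarrow> real) \<Rightarrow> (nat \<Rightarrow> real) \<Rightarrow> nat \<Rightarrow> real" where
  "res n y x j = - (\<Prod>i<n. y j - x i) / (\<Prod>i\<in>{..<n} - {j}. y j - y i)"

definition incr :: "nat \<Rightarrow> (nat \<Rightarrow> real) \<Rightarrow> bool" where
  "incr n y \<longleftrightarrow> (\<forall>j. Suc j < n \<longrightarrow> y j < y (Suc j))"

definition inter :: "nat \<Rightarrow> (nat \<Rightarrow> real) \<Rightarrow> (nat \<Rightarrow> real) \<Rightarrow> bool" where
  "inter n y x \<longleftrightarrow> (\<forall>j<n. y j < x j) \<and> (\<forall>j. Suc j < n \<longrightarrow> x j < y (Suc j))"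

lemma incr_less: "incr n y \<Longrightarrow> i < j \<Longrightarrow> j < n \<Longrightarrow> y i < y j"
proof (induction j)
  case (Suc j)
  then have "y j < y (Suc j)" by (auto simp: incr_def)
  with Suc show ?case by (cases "i = j") auto
qed simp

lemma incr_inj: "incr n y \<Longrightarrow> inj_on y {..<n}"
  by (rule inj_onI) (metis incr_less lessThan_iff less_irrefl linorder_neqE_nat)

lemma incr_mono: "incr n y \<Longrightarrow> m \<le> n \<Longrightarrow> incr m y"
  by (auto simp: incr_def)

lemma inter_incr: "inter n y x \<Longrightarrow> incr n x"
  unfolding inter_def incr_def by (meson Suc_lessD less_trans)

lemma inter_incr_nodes: "inter n y x \<Longrightarrow> incr n y"
  unfolding inter_def incr_def by (meson Suc_lessD less_trans)

lemma vand_0 [simp]: "vand 0 x = 1" by (simp add: vand_def)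

lemma vand_Suc: "vand (Suc n) x = vand n x * (\<Prod>i<n. x n - x i)"
proof -
  have "{i<..<Suc n} = insert n {i<..<n}" if "i < n" for i using that by auto
  then have "(\<Prod>j\<in>{i<..<Suc n}. x j - x i) = (x n - x i) * (\<Prod>j\<in>{i<..<n}. x j - x i)" if "i < n" for i
    using that by simp
  moreover have "{n<..<Suc n} = {}" by auto
  ultimately show ?thesis by (simp add: vand_def prod.distrib mult.commute)
qed

lemma vand_cong: "(\<And>i. i < n \<Longrightarrow> x i = y i) \<Longrightarrow> vand n x = vand n y"
  by (auto simp: vand_def intro!: prod.cong)

lemma vand_pos: "incr n x \<Longrightarrow> vand n x > 0"
  unfolding vand_def by (intro prod_pos) (auto simp: incr_less)

lemma res_cong: "(\<And>i. i < n \<Longrightarrow> x i = x' i) \<Longrightarrow> res n y x j = res n y x' j"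
  by (auto simp: res_def intro!: prod.cong)

lemma res_Suc: 
  assumes "j < n"
  shows "res (Suc n) y x j = res n y x j * ((y j - x n) / (y j - y n))"
proof -
  have "{..<Suc n} - {j} = insert n ({..<n} - {j})" using assms by auto
  then show ?thesis using assms by (simp add: res_def)
qed

lemma res_Suc_last: "res (Suc n) y x n = (x n - y n) * ((\<Prod>i<n. y n - x i) / (\<Prod>i<n. y n - y i))"
proof -
  have "{..<Suc n} - {n} = {..<n}" by auto
  then show ?thesis by (simp add: res_def algebra_simps)
qed

lemma coeff_prod_monic_linear:
  "degree (\<Prod>i\<in>A. [:- f i, 1:] :: real poly) = card A" "coeff (\<Prod>i\<in>A. [:- f i, 1 :: real:]) (card A) = 1"
proof -
  show d: "degree (\<Prod>i\<in>A. [:- f i, 1:] :: real poly) = card A"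
    by (subst degree_prod_eq_sum_degree) auto
  have "lead_coeff (\<Prod>i\<in>A. [:- f i, 1:] :: real poly) = 1" by (simp add: lead_coeff_prod)
  then show "coeff (\<Prod>i\<in>A. [:- f i, 1 :: real:]) (card A) = 1" by (simp add: d)
qed

text \<open>Both sides are monic of degree \<open>n\<close> in \<open>z\<close>, so it suffices to
  compare them at the \<open>n\<close> distinct nodes \<open>y k\<close>. There the first product on
  the right and all summands except the \<open>k\<close>-th vanish, and \<open>res\<close> is
  defined so that this summand fits.\<close>

lemma partial_fraction_poly:
  assumes inj: "inj_on y {..<n}"
  shows "(\<Prod>i<n. z - x i) = (\<Prod>i<n. z - y i) - (\<Sum>j<n. res n y x j * (\<Prod>i\<in>{..<n} - {j}. z - y i))"
proof -
  define p where "p = (\<Prod>i<n. [:- x i, 1:])"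
  define q where "q = (\<Prod>i<n. [:- y i, 1:]) - (\<Sum>j<n. smult (res n y x j) (\<Prod>i\<in>{..<n} - {j}. [:- y i, 1:]))"
  have dg: "degree (\<Sum>j<n. smult (res n y x j) (\<Prod>i\<in>{..<n} - {j}. [:- y i, 1:])) < n" if "n > 0"
  proof (rule degree_sum_less)
    fix j assume "j \<in> {..<n}"
    then show "degree (smult (res n y x j) (\<Prod>i\<in>{..<n} - {j}. [:- y i, 1:])) < n"
      using coeff_prod_monic_linear(1)[of y "{..<n} - {j}"] that
      by (intro le_less_trans[OF degree_smult_le]) auto
  qed (use that in auto)
  have "p = q"
  proof (cases "n = 0")
    case False
    show ?thesis
    proof (rule poly_eqI_degree_lead_coeff[where n = n and A = "y ` {..<n}"])
      show "coeff p n = coeff q n"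
        using coeff_prod_monic_linear(2)[of x "{..<n}"] coeff_prod_monic_linear(2)[of y "{..<n}"] dg False
        by (auto simp: p_def q_def coeff_eq_0)
      show "degree p \<le> n" using coeff_prod_monic_linear(1)[of x "{..<n}"] by (simp add: p_def)
      show "degree q \<le> n"
        using coeff_prod_monic_linear(1)[of y "{..<n}"] dg False unfolding q_def
        by (intro degree_diff_le) auto
      show "card (y ` {..<n}) \<ge> n" using inj by (simp add: card_image)
      fix t assume "t \<in> y ` {..<n}"
      then obtain k where k: "k < n" "t = y k" by auto
      have 0: "(\<Prod>i\<in>{..<n} - {j}. y k - y i) = 0" if "j < n" "j \<noteq> k" for j
        using that k by (intro prod_zero) auto
      have 1: "(\<Prod>i\<in>{..<n} - {k}. y k - y i) \<noteq> 0"
        using inj k by (auto simp: inj_on_def)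
      have "(\<Sum>j<n. res n y x j * (\<Prod>i\<in>{..<n} - {j}. y k - y i)) = 
            (\<Sum>j<n. if j = k then res n y x k * (\<Prod>i\<in>{..<n} - {k}. y k - y i) else 0)"
        by (intro sum.cong) (auto simp: 0)
      also have "\<dots> = - (\<Prod>i<n. y k - x i)" using k 1 by (simp add: res_def)
      finally have 2: "(\<Prod>i<n. y k - x i) = - (\<Sum>j<n. res n y x j * (\<Prod>i\<in>{..<n} - {j}. y k - y i))"
        by simp
      have "(\<Prod>i<n. y k - y i) = 0" using k by (intro prod_zero) auto
      then show "poly p t = poly q t"
        using k 2 by (simp only: p_def q_def poly_prod poly_sum poly_diff poly_smult) simp
    qed
  qed (simp add: p_def q_def)
  then have "poly p z = poly q z" by simp
  then show ?thesis by (simp add: p_def q_def poly_prod poly_sum)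
qed

lemma partial_fraction:
  assumes inj: "inj_on y {..<n}" and z: "\<And>j. j < n \<Longrightarrow> z \<noteq> y j"
  shows "1 - (\<Sum>j<n. res n y x j / (z - y j)) = (\<Prod>i<n. z - x i) / (\<Prod>i<n. z - y i)"
proof -
  have nz: "(\<Prod>i<n. z - y i) \<noteq> 0" using z by auto
  have e: "res n y x j * (\<Prod>i\<in>{..<n} - {j}. z - y i) = (\<Prod>i<n. z - y i) * (res n y x j / (z - y j))" if "j < n" for j
  proof -
    have "(\<Prod>i<n. z - y i) = (z - y j) * (\<Prod>i\<in>{..<n} - {j}. z - y i)"
      using that by (subst prod.remove[of "{..<n}" j]) auto
    then show ?thesis using z[OF that] by simp
  qed
  have "(\<Sum>j<n. res n y x j * (\<Prod>i\<in>{..<n} - {j}. z - y i)) = (\<Sum>j<n. (\<Prod>i<n. z - y i) * (res n y x j / (z - y j)))"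
    by (intro sum.cong refl e) auto
  also have "\<dots> = (\<Prod>i<n. z - y i) * (\<Sum>j<n. res n y x j / (z - y j))"
    by (rule sum_distrib_left[symmetric])
  finally have "(\<Prod>i<n. z - x i) = (\<Prod>i<n. z - y i) * (1 - (\<Sum>j<n. res n y x j / (z - y j)))"
    unfolding partial_fraction_poly[OF inj, of z x] by (simp only: right_diff_distrib mult_1_right)
  then show ?thesis using nz by (metis nonzero_mult_div_cancel_left)
qed

text \<open>\<open>t\<close> is the last weight and \<open>x\<close> the largest zero: solving
  \<open>(\<Sum>j<n. \<rho> j / (x - y j)) + t / (x - y n) = 1\<close> for \<open>t\<close> gives
  the argument of \<open>f\<close>, and its derivative in \<open>x\<close> is the second factor.
  That the sum stays below 1 expresses \<open>t > 0\<close>.\<close>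

lemma nn_integral_secular_substitution:
  fixes y \<rho> :: "nat \<Rightarrow> real"
  assumes f [measurable]: "f \<in> borel_measurable borel"
    and y: "\<And>j. j < n \<Longrightarrow> y j < y n" and \<rho>: "\<And>j. j < n \<Longrightarrow> 0 < \<rho> j"
  shows "(\<integral>\<^sup>+t. (if 0 < t then f t else 0) \<partial>lborel) =
         (\<integral>\<^sup>+x. (if y n < x \<and> (\<Sum>j<n. \<rho> j / (x - y j)) < 1
            then f ((x - y n) * (1 - (\<Sum>j<n. \<rho> j / (x - y j))))
              * ennreal (1 - (\<Sum>j<n. \<rho> j / (x - y j)) + (x - y n) * (\<Sum>j<n. \<rho> j / (x - y j)\<^sup>2))
            else 0) \<partial>lborel)" (is "?lhs = _")
proof -
  define S where "S x = (\<Sum>j<n. \<rho> j / (x - y j))" for x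
  define S' where "S' x = (\<Sum>j<n. \<rho> j / (x - y j)\<^sup>2)" for x
  define g where "g x = (x - y n) * (1 - S x)" for x
  define g' where "g' x = 1 - S x + (x - y n) * S' x" for x
  have gt: "y j < x" if "j < n" "y n < x" for j x using y[of j] that by linarith
  have S'0: "S' x \<ge> 0" for x unfolding S'_def using \<rho> by (intro sum_nonneg) (simp add: less_imp_le)
  have DS: "(S has_real_derivative - S' x) (at x)" if "y n < x" for x
  proof -
    have "((\<lambda>x. \<rho> j / (x - y j)) has_real_derivative - (\<rho> j / (x - y j)\<^sup>2)) (at x)" if "j < n" for j
      using gt[OF that \<open>y n < x\<close>] by (auto intro!: derivative_eq_intros simp: power2_eq_square)
    then have "(S has_real_derivative (\<Sum>j<n. - (\<rho> j / (x - y j)\<^sup>2))) (at x)"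
      unfolding S_def by (intro DERIV_sum) simp
    then show ?thesis by (simp add: S'_def sum_negf)
  qed
  have D: "(g has_real_derivative g' x) (at x)" if "y n < x" for x
    unfolding g_def g'_def by (rule derivative_eq_intros DS that refl)+ (simp add: algebra_simps)
  have cont: "continuous_on {y n<..} g'"
    unfolding g'_def S_def S'_def by (intro continuous_intros) (auto dest: gt)
  have posiff: "g x > 0 \<longleftrightarrow> S x < 1" if "y n < x" for x
    using that by (auto simp: g_def zero_less_mult_iff)
  have pos: "g' x > 0" if "y n < x" "g x > 0" for x
  proof -
    have "(x - y n) * S' x \<ge> 0" using S'0[of x] that by simp
    then show ?thesis using that posiff[of x] by (simp add: g'_def)
  qed
  have Smono: "S z \<le> S x" if "y n < x" "x < z" for x z
    unfolding S_def
  proof (rule sum_mono)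
    fix j assume "j \<in> {..<n}"
    then show "\<rho> j / (z - y j) \<le> \<rho> j / (x - y j)"
      using gt[of j x] \<rho>[of j] that by (intro divide_left_mono mult_pos_pos) auto
  qed
  have up: "g x < g z" if "y n < x" "x < z" "g x > 0" for x z
  proof -
    have "S x < 1" using posiff[OF that(1)] that(3) by simp
    then have "(x - y n) * (1 - S x) < (z - y n) * (1 - S x)" using that by simp
    also have "\<dots> \<le> (z - y n) * (1 - S z)" using Smono[OF that(1,2)] that by (intro mult_left_mono) auto
    finally show ?thesis by (simp add: g_def)
  qed
  have surj: "\<exists>x>y n. g x = c" if "c > 0" for c
  proof -
    \<comment> \<open>Brackets for the intermediate value theorem: at distance \<open>c / 2\<close>
      from \<open>y n\<close> the value is at most \<open>c / 2\<close>, and at distance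
      \<open>c + R\<close> the sum is at most \<open>R / (c + R)\<close>, which makes the value at
      least \<open>c\<close>.\<close>
    define R where "R = (\<Sum>j<n. \<rho> j)"
    have R0: "R \<ge> 0" unfolding R_def using \<rho> by (intro sum_nonneg) (simp add: less_imp_le)
    define u where "u = y n + c / 2"
    define v where "v = y n + (c + R)"
    have uv: "y n < u" "u < v" using that R0 by (auto simp: u_def v_def)
    have "S u \<ge> 0" unfolding S_def using \<rho> gt[OF _ uv(1)] by (intro sum_nonneg) (simp add: less_imp_le)
    then have "(c / 2) * (1 - S u) \<le> (c / 2) * 1" using that by (intro mult_left_mono) auto
    then have gu: "g u \<le> c" using that by (simp add: g_def u_def)
    have "S v \<le> (\<Sum>j<n. \<rho> j / (c + R))" unfolding S_def
    proof (rule sum_mono)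
      fix j assume "j \<in> {..<n}"
      then show "\<rho> j / (v - y j) \<le> \<rho> j / (c + R)"
        using y[of j] \<rho>[of j] that R0 by (intro divide_left_mono mult_pos_pos) (auto simp: v_def)
    qed
    then have "S v \<le> R / (c + R)" by (simp add: R_def sum_divide_distrib)
    then have "(c + R) * (1 - S v) \<ge> (c + R) * (1 - R / (c + R))" using that R0 by (intro mult_left_mono) auto
    moreover have "(c + R) * (1 - R / (c + R)) = c" using that R0 by (simp add: field_simps)
    ultimately have gv: "c \<le> g v" by (simp add: g_def v_def)
    have "\<exists>x. u \<le> x \<and> x \<le> v \<and> g x = c"
    proof (rule IVT[of g u c v, OF gu gv])
      show "u \<le> v" using uv by simp
      show "\<forall>x. u \<le> x \<and> x \<le> v \<longrightarrow> isCont g x" using D uv by (auto intro!: DERIV_isCont[OF D])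
    qed
    then obtain x where "u \<le> x" "g x = c" by blast
    then show ?thesis using uv(1) by (intro exI[of _ x]) simp
  qed
  have "(\<integral>\<^sup>+t. f t * indicator {0<..} t \<partial>lborel) =
         (\<integral>\<^sup>+x. f (g x) * ennreal (g' x) * indicator {x. y n < x \<and> g x > 0} x \<partial>lborel)"
    by (rule nn_integral_substitution_open[OF f]) (fact D cont pos up surj)+
  also have "\<dots> = (\<integral>\<^sup>+x. (if y n < x \<and> S x < 1 then f (g x) * ennreal (g' x) else 0) \<partial>lborel)"
    by (intro nn_integral_cong) (auto simp: posiff)
  also have "(\<integral>\<^sup>+t. f t * indicator {0<..} t \<partial>lborel) = ?lhs"
    by (intro nn_integral_cong) auto
  finally show ?thesis unfolding g_def g'_def S_def S'_def .
qed

text \<open>Interlacing already puts every \<open>x i\<close> with \<open>i < n - 1\<close> below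
  \<open>y n\<close>, so the sign of the product decides the one condition that is still open,
  \<open>x (n - 1) < y n\<close>. In this form it can be matched with the value at
  \<open>y n\<close> of the rational function with zeros \<open>x\<close>.\<close>

lemma inter_Suc_iff:
  assumes y: "incr (Suc n) y"
  shows "inter (Suc n) y (x(n := t)) \<longleftrightarrow>
    y n < t \<and> inter n y x \<and> 0 < (\<Prod>i<n. y n - x i)"
proof -
  have "inter (Suc n) y (x(n := t)) \<longleftrightarrow> y n < t \<and> inter n y x \<and> (n > 0 \<longrightarrow> x (n - 1) < y n)"
    by (cases n) (auto simp: inter_def less_Suc_eq)
  also have "inter n y x \<and> (n > 0 \<longrightarrow> x (n - 1) < y n) \<longleftrightarrow> inter n y x \<and> 0 < (\<Prod>i<n. y n - x i)"
  proof (cases n)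
    case (Suc m)
    have "x i < y n" if "inter n y x" "i < m" for i
    proof -
      have "x i < y (Suc i)" using that Suc by (auto simp: inter_def)
      also have "y (Suc i) < y n" using incr_less[OF y, of "Suc i" n] that Suc by simp
      finally show ?thesis .
    qed
    then have "0 < (\<Prod>i<m. y n - x i)" if "inter n y x" using that by (intro prod_pos) auto
    then show ?thesis using Suc by (auto simp: zero_less_mult_iff)
  qed simp
  finally show ?thesis .
qed

lemma measurable_vand [measurable (raw)]:
  assumes [measurable]: "\<And>i. i < n \<Longrightarrow> (\<lambda>u. x u i) \<in> borel_measurable M"
  shows "(\<lambda>u. vand n (x u)) \<in> borel_measurable M"
  unfolding vand_def by measurable

lemma measurable_res [measurable (raw)]:
  assumes [measurable]: "\<And>i. i < n \<Longrightarrow> (\<lambda>u. x u i) \<in> borel_measurable M" "\<And>i. i < n \<Longrightarrow> (\<lambda>u. y u i) \<in> borel_measurable M"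
  shows "j < n \<Longrightarrow> (\<lambda>u. res n (y u) (x u) j) \<in> borel_measurable M"
  unfolding res_def by measurable

lemma measurable_inter [measurable (raw)]:
  assumes [measurable]: "\<And>i. i < n \<Longrightarrow> (\<lambda>u. x u i) \<in> borel_measurable M" "\<And>i. i < n \<Longrightarrow> (\<lambda>u. y u i) \<in> borel_measurable M"
  shows "Measurable.pred M (\<lambda>u. inter n (y u) (x u))"
proof -
  have "Measurable.pred M (\<lambda>u. (\<forall>j\<in>{..<n}. y u j < x u j) \<and> (\<forall>j\<in>{..<n - 1}. x u j < y u (Suc j)))"
    by measurable
  also have "(\<lambda>u. (\<forall>j\<in>{..<n}. y u j < x u j) \<and> (\<forall>j\<in>{..<n - 1}. x u j < y u (Suc j))) = (\<lambda>u. inter n (y u) (x u))"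
    by (auto simp: inter_def fun_eq_iff)
  finally show ?thesis .
qed

lemma measurable_incr [measurable (raw)]:
  assumes [measurable]: "\<And>i. i < n \<Longrightarrow> (\<lambda>u. x u i) \<in> borel_measurable M"
  shows "Measurable.pred M (\<lambda>u. incr n (x u))"
proof -
  have "Measurable.pred M (\<lambda>u. (\<forall>j\<in>{..<n - 1}. x u j < x u (Suc j)))"
    by measurable
  also have "(\<lambda>u. (\<forall>j\<in>{..<n - 1}. x u j < x u (Suc j))) = (\<lambda>u. incr n (x u))"
    by (auto simp: incr_def fun_eq_iff)
  finally show ?thesis .
qed

text \<open>Change of variables from the weights \<open>\<rho>\<close> to the zeros \<open>x\<close>. The induction peels off the last weight: for fixed
\<open>\<rho> 0, \<dots>, \<rho> (n - 1)\<close> the largest zero is a one-dimensional substitution, and the remaining zeros solve the same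
problem with rescaled weights.\<close>

lemma nn_integral_rank_one:
  assumes "F \<in> borel_measurable (Leb n)" "incr n y"
  shows "(\<integral>\<^sup>+\<rho>. (if \<forall>j<n. 0 < \<rho> j then F \<rho> else 0) \<partial>Leb n) =
    (\<integral>\<^sup>+x. (if inter n y x then F (\<lambda>j\<in>{..<n}. res n y x j) * ennreal (vand n x / vand n y) else 0) \<partial>Leb n)"
  using assms
proof (induction n arbitrary: F)
  case 0
  have "(\<lambda>j\<in>{}. res 0 y (\<lambda>_. undefined) j) = (\<lambda>_. undefined)" by auto
  then show ?case by (simp add: nn_integral_Leb_0 inter_def del: lessThan_0) simp
next
  case (Suc n)
  note [measurable] = Suc.prems(1)
  note y = incr_less[OF Suc.prems(2)]
  have y_inj: "inj_on y {..<n}" by (rule incr_inj[OF incr_mono[OF Suc.prems(2)]]) simp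
  define S where "S \<rho> x = (\<Sum>j<n. \<rho> j / (x - y j))" for \<rho> :: "nat \<Rightarrow> real" and x
  define h where "h \<rho> x = (x - y n) * (1 - S \<rho> x)" for \<rho> x
  define h' where "h' \<rho> x = 1 - S \<rho> x + (x - y n) * (\<Sum>j<n. \<rho> j / (x - y j)\<^sup>2)" for \<rho> :: "nat \<Rightarrow> real" and x
  define K where "K \<rho> x = (if (\<forall>j<n. 0 < \<rho> j) \<and> y n < x \<and> S \<rho> x < 1
      then F (\<rho>(n := h \<rho> x)) * ennreal (h' \<rho> x) else 0)" for \<rho> x
  \<comment> \<open>By \<open>res_Suc\<close> this is the factor by which one more zero
    \<open>x\<close> and one more pole \<open>y n\<close> change the \<open>j\<close>-th residue. It
    is positive for \<open>x > y n\<close>, so scaling the weights by it leads back to the problem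
    with \<open>n\<close> nodes.\<close>
  define c where "c x j = (x - y j) / (y n - y j)" for x j
  define cm where "cm x \<rho> = (\<lambda>j\<in>{..<n}. c x j * \<rho> j)" for x \<rho>
  define G where "G x \<rho> = (if S (cm x \<rho>) x < 1
      then F ((cm x \<rho>)(n := h (cm x \<rho>) x)) * ennreal (h' (cm x \<rho>) x) else 0)" for x \<rho>
  define RHS where "RHS x = (if inter (Suc n) y x then F (\<lambda>j\<in>{..<Suc n}. res (Suc n) y x j)
      * ennreal (vand (Suc n) x / vand (Suc n) y) else 0)" for x
  have cpos: "c x j > 0" if "y n < x" "j < n" for x j
    using y[of j n] that by (auto simp: c_def)
  have [measurable]: "(\<lambda>(\<rho>, x). S \<rho> x) \<in> borel_measurable (Leb n \<Otimes>\<^sub>M lborel)"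
    unfolding S_def by measurable
  have [measurable]: "(\<lambda>(\<rho>, x). h \<rho> x) \<in> borel_measurable (Leb n \<Otimes>\<^sub>M lborel)"
    unfolding h_def by measurable
  have [measurable]: "(\<lambda>(\<rho>, x). h' \<rho> x) \<in> borel_measurable (Leb n \<Otimes>\<^sub>M lborel)"
    unfolding h'_def by measurable
  have [measurable]: "cm x \<in> measurable (Leb n) (Leb n)" for x
    unfolding cm_def by (rule measurable_restrict_Leb) measurable
  have K_meas: "case_prod K \<in> borel_measurable (Leb n \<Otimes>\<^sub>M lborel)"
    unfolding K_def by measurable
  have G_meas: "G x \<in> borel_measurable (Leb n)" for x
    unfolding G_def by measurable
  have res_meas [measurable]: "(\<lambda>x. res m y x j) \<in> borel_measurable (Leb m)" if "j < m" for m j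
    using that by (intro measurable_res) measurable
  have inter_meas [measurable]: "Measurable.pred (Leb m) (inter m y)" for m
    by (rule measurable_inter) measurable
  have vand_meas [measurable]: "vand m \<in> borel_measurable (Leb m)" for m
    by (rule measurable_vand) measurable
  have RHS_meas [measurable]: "RHS \<in> borel_measurable (Leb (Suc n))"
  proof -
    have [measurable]: "(\<lambda>x. \<lambda>j\<in>{..<Suc n}. res (Suc n) y x j) \<in> measurable (Leb (Suc n)) (Leb (Suc n))"
      by (rule measurable_restrict_Leb) measurable
    show ?thesis unfolding RHS_def by measurable
  qed
  have point: "ennreal (\<Prod>j<n. c x j) * (if inter n y \<xi> then G x (\<lambda>j\<in>{..<n}. res n y \<xi> j) * ennreal (vand n \<xi> / vand n y) else 0)
     = RHS (\<xi>(n := x))" if x: "y n < x" for x \<xi>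
  proof (cases "inter n y \<xi>")
    case False
    then show ?thesis by (simp add: RHS_def inter_Suc_iff[OF Suc.prems(2)])
  next
    case True
    define r where "r = (\<lambda>j\<in>{..<n}. res n y \<xi> j)"
    define P where "P z = (\<Prod>i<n. z - \<xi> i) / (\<Prod>i<n. z - y i)" for z
    have xy: "x - y j > 0" if "j < n" for j using y[of j n] x that by simp
    have ny: "y n - y j > 0" if "j < n" for j using y[of j n] that by simp
    have pf: "1 - (\<Sum>j<n. res n y \<xi> j / (z - y j)) = P z" if "y n \<le> z" for z
      unfolding P_def by (rule partial_fraction[OF y_inj]) (use y[of _ n] that in force)
    have cr: "cm x r j = c x j * res n y \<xi> j" if "j < n" for j
      using that by (simp add: cm_def r_def)
    have "S (cm x r) x = (\<Sum>j<n. res n y \<xi> j / (y n - y j))"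
      unfolding S_def
    proof (rule sum.cong)
      fix j assume "j \<in> {..<n}"
      then show "cm x r j / (x - y j) = res n y \<xi> j / (y n - y j)"
        using xy[of j] ny[of j] by (simp add: cr c_def)
    qed simp
    with pf[of "y n"] have S: "S (cm x r) x = 1 - P (y n)" by simp
    have h: "h (cm x r) x = (x - y n) * P (y n)" by (simp add: h_def S)
    have aux: "(A - B) * (A / B * u / A\<^sup>2) = u / B - u / A" if "A > 0" "B > 0" for A B u :: real
      using that by (simp add: field_simps power2_eq_square)
    \<comment> \<open>For the rescaled weights the sum in the derivative of the substitution
      collapses to \<open>P x - P (y n)\<close>, so the Jacobian \<open>h'\<close> is
      \<open>P x\<close> itself. Multiplied by all \<open>c x j\<close> it gives the quotient of the
      Vandermonde factors that index \<open>n\<close> adds.\<close>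
    have "(x - y n) * (\<Sum>j<n. cm x r j / (x - y j)\<^sup>2) = (\<Sum>j<n. res n y \<xi> j / (y n - y j) - res n y \<xi> j / (x - y j))"
      unfolding sum_distrib_left
    proof (rule sum.cong)
      fix j assume "j \<in> {..<n}"
      then show "(x - y n) * (cm x r j / (x - y j)\<^sup>2) = res n y \<xi> j / (y n - y j) - res n y \<xi> j / (x - y j)"
        using xy[of j] ny[of j] aux[of "x - y j" "y n - y j" "res n y \<xi> j"] by (simp add: cr c_def)
    qed simp
    also have "\<dots> = P x - P (y n)" using pf[of "y n"] pf[of x] x by (simp add: sum_subtractf)
    finally have h': "h' (cm x r) x = P x" by (simp add: h'_def S)
    have den: "(\<Prod>i<n. y n - y i) > 0" using ny by (intro prod_pos) auto
    have den_x: "(\<Prod>i<n. x - y i) > 0" using xy by (intro prod_pos) auto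
    have Piff: "P (y n) > 0 \<longleftrightarrow> inter (Suc n) y (\<xi>(n := x))"
      using den True x by (auto simp: inter_Suc_iff[OF Suc.prems(2)] P_def zero_less_divide_iff)
    show ?thesis
    proof (cases "P (y n) > 0")
      case False
      then show ?thesis using True S Piff by (simp add: RHS_def G_def r_def)
    next
      case P: True
      then have int: "inter (Suc n) y (\<xi>(n := x))" using Piff by simp
      have "\<xi> i < x" if "i < n" for i
        using incr_less[OF inter_incr[OF int], of i n] that by simp
      then have num: "(\<Prod>i<n. x - \<xi> i) > 0" by (intro prod_pos) auto
      have arg: "(cm x r)(n := h (cm x r) x) = (\<lambda>j\<in>{..<Suc n}. res (Suc n) y (\<xi>(n := x)) j)"
      proof
        fix j
        consider "j < n" | "j = n" | "j > n" by linarith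
        then show "((cm x r)(n := h (cm x r) x)) j = (\<lambda>j\<in>{..<Suc n}. res (Suc n) y (\<xi>(n := x)) j) j"
        proof cases
          case 1
          have "res n y (\<xi>(n := x)) j = res n y \<xi> j" by (rule res_cong) auto
          moreover have "(y j - x) / (y j - y n) = c x j"
            unfolding c_def by (metis minus_diff_eq minus_divide_divide)
          ultimately show ?thesis using 1 by (simp add: cr res_Suc)
        next
          case 2
          have "(\<Prod>i<n. y n - (\<xi>(n := x)) i) = (\<Prod>i<n. y n - \<xi> i)" by (rule prod.cong) auto
          then show ?thesis using 2 by (simp add: res_Suc_last h P_def)
        qed (simp add: cm_def)
      qed
      have aux2: "A / B * (X / A * (u / w)) = u * X / (w * B)" if "A > 0" for A B X u w :: real
        using that by (simp add: field_simps)
      have v: "vand n (\<xi>(n := x)) = vand n \<xi>" by (rule vand_cong) auto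
      have v2: "(\<Prod>i<n. x - (\<xi>(n := x)) i) = (\<Prod>i<n. x - \<xi> i)" by (rule prod.cong) auto
      have vp: "vand n \<xi> > 0" "vand n y > 0"
        using inter_incr[OF True] inter_incr_nodes[OF True] by (auto intro: vand_pos)
      have "(\<Prod>j<n. c x j) = (\<Prod>i<n. x - y i) / (\<Prod>i<n. y n - y i)"
        unfolding c_def by (rule prod_dividef)
      then have "(\<Prod>j<n. c x j) * (P x * (vand n \<xi> / vand n y)) = vand (Suc n) (\<xi>(n := x)) / vand (Suc n) y"
        unfolding P_def vand_Suc v fun_upd_same v2 by (simp only: aux2[OF den_x])
      moreover have "P x > 0" using num den_x by (simp add: P_def)
      moreover have "(\<Prod>j<n. c x j) > 0" using cpos[OF x] by (intro prod_pos) auto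
      ultimately have eq: "ennreal (\<Prod>j<n. c x j) * (ennreal (P x) * ennreal (vand n \<xi> / vand n y)) =
          ennreal (vand (Suc n) (\<xi>(n := x)) / vand (Suc n) y)"
        using vp by (simp add: ennreal_mult[symmetric])
      have "G x r = F (\<lambda>j\<in>{..<Suc n}. res (Suc n) y (\<xi>(n := x)) j) * ennreal (P x)"
        using P S arg h' by (simp add: G_def)
      moreover have "RHS (\<xi>(n := x)) = F (\<lambda>j\<in>{..<Suc n}. res (Suc n) y (\<xi>(n := x)) j) *
          ennreal (vand (Suc n) (\<xi>(n := x)) / vand (Suc n) y)"
        using int by (simp add: RHS_def)
      ultimately show ?thesis
        unfolding r_def[symmetric] if_P[OF True] eq[symmetric] by (simp only: ac_simps)
    qed
  qed
  have "(\<integral>\<^sup>+\<rho>. (if \<forall>j<Suc n. 0 < \<rho> j then F \<rho> else 0) \<partial>Leb (Suc n)) =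
      (\<integral>\<^sup>+\<rho>. \<integral>\<^sup>+t. (if \<forall>j<Suc n. 0 < (\<rho>(n := t)) j then F (\<rho>(n := t)) else 0) \<partial>lborel \<partial>Leb n)"
    by (rule nn_integral_Leb_Suc) measurable
  also have "\<dots> = (\<integral>\<^sup>+\<rho>. \<integral>\<^sup>+x. K \<rho> x \<partial>lborel \<partial>Leb n)"
  proof (rule nn_integral_cong)
    fix \<rho> assume [measurable]: "\<rho> \<in> space (Leb n)"
    have iff: "(\<forall>j<Suc n. 0 < (\<rho>(n := t)) j) \<longleftrightarrow> (\<forall>j<n. 0 < \<rho> j) \<and> 0 < t" for t
      by (auto simp: less_Suc_eq)
    show "(\<integral>\<^sup>+t. (if \<forall>j<Suc n. 0 < (\<rho>(n := t)) j then F (\<rho>(n := t)) else 0) \<partial>lborel) = (\<integral>\<^sup>+x. K \<rho> x \<partial>lborel)"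
    proof (cases "\<forall>j<n. 0 < \<rho> j")
      case True
      have [measurable]: "(\<lambda>t. F (\<rho>(n := t))) \<in> borel_measurable borel" by measurable
      have "(\<integral>\<^sup>+t. (if 0 < t then F (\<rho>(n := t)) else 0) \<partial>lborel) = (\<integral>\<^sup>+x. K \<rho> x \<partial>lborel)"
        unfolding K_def h_def h'_def S_def
        using True nn_integral_secular_substitution[of "\<lambda>t. F (\<rho>(n := t))" n y \<rho>] y[of _ n]
        by simp
      then show ?thesis unfolding iff using True by simp
    next
      case False
      then have "K \<rho> x = 0" for x by (auto simp: K_def)
      moreover have neg: "(\<forall>j<n. 0 < \<rho> j) = False" using False by blast
      ultimately show ?thesis unfolding iff neg by simp
    qed
  qed
  also have "\<dots> = (\<integral>\<^sup>+x. \<integral>\<^sup>+\<rho>. K \<rho> x \<partial>Leb n \<partial>lborel)"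
    by (rule Fubini_Leb_lborel[OF K_meas])
  also have "\<dots> = (\<integral>\<^sup>+x. \<integral>\<^sup>+\<xi>. RHS (\<xi>(n := x)) \<partial>Leb n \<partial>lborel)"
  proof (rule nn_integral_cong)
    fix x :: real
    show "(\<integral>\<^sup>+\<rho>. K \<rho> x \<partial>Leb n) = (\<integral>\<^sup>+\<xi>. RHS (\<xi>(n := x)) \<partial>Leb n)"
    proof (cases "y n < x")
      case False
      then show ?thesis by (simp add: K_def RHS_def inter_Suc_iff[OF Suc.prems(2)])
    next
      case True
      have Kx: "(\<lambda>\<rho>. K \<rho> x) \<in> borel_measurable (Leb n)" using K_meas by measurable
      have "(\<integral>\<^sup>+\<rho>. K \<rho> x \<partial>Leb n) = ennreal (\<Prod>j<n. c x j) * (\<integral>\<^sup>+\<rho>. K (cm x \<rho>) x \<partial>Leb n)"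
        unfolding cm_def by (rule nn_integral_Leb_scale[OF Kx]) (use cpos[OF True] in auto)
      also have "(\<integral>\<^sup>+\<rho>. K (cm x \<rho>) x \<partial>Leb n) = (\<integral>\<^sup>+\<rho>. (if \<forall>j<n. 0 < \<rho> j then G x \<rho> else 0) \<partial>Leb n)"
      proof (rule nn_integral_cong)
        fix \<rho>
        have "(\<forall>j<n. 0 < cm x \<rho> j) \<longleftrightarrow> (\<forall>j<n. 0 < \<rho> j)"
          using cpos[OF True] by (simp add: cm_def zero_less_mult_iff) (metis less_asym)
        then show "K (cm x \<rho>) x = (if \<forall>j<n. 0 < \<rho> j then G x \<rho> else 0)"
          using True by (auto simp: K_def G_def)
      qed
      also have "\<dots> = (\<integral>\<^sup>+\<xi>. (if inter n y \<xi> then G x (\<lambda>j\<in>{..<n}. res n y \<xi> j) * ennreal (vand n \<xi> / vand n y) else 0) \<partial>Leb n)"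
        by (rule Suc.IH[OF G_meas incr_mono[OF Suc.prems(2)]]) simp
      also have "ennreal (\<Prod>j<n. c x j) * \<dots> = (\<integral>\<^sup>+\<xi>. ennreal (\<Prod>j<n. c x j) * (if inter n y \<xi> then G x (\<lambda>j\<in>{..<n}. res n y \<xi> j) * ennreal (vand n \<xi> / vand n y) else 0) \<partial>Leb n)"
      proof (rule nn_integral_cmult[symmetric])
        have [measurable]: "(\<lambda>x. \<lambda>j\<in>{..<n}. res n y x j) \<in> measurable (Leb n) (Leb n)"
          by (rule measurable_restrict_Leb) measurable
        show "(\<lambda>\<xi>. if inter n y \<xi> then G x (\<lambda>j\<in>{..<n}. res n y \<xi> j) * ennreal (vand n \<xi> / vand n y) else 0) \<in> borel_measurable (Leb n)"
          using G_meas by measurable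
      qed
      also have "\<dots> = (\<integral>\<^sup>+\<xi>. RHS (\<xi>(n := x)) \<partial>Leb n)"
        by (simp only: point[OF True])
      finally show ?thesis .
    qed
  qed
  also have "\<dots> = integral\<^sup>N (Leb (Suc n)) RHS"
    by (subst nn_integral_Leb_Suc) (measurable, rule Fubini_Leb_lborel[symmetric], measurable)
  finally show ?case unfolding RHS_def .
qed

text \<open>\<open>sext m\<close> is the chart of the simplex by its first \<open>m\<close> coordinates. \<open>wres m y x\<close> are the weights of the probability
measure on the nodes \<open>y\<close> whose Stieltjes transform has the zeros \<open>x\<close>.\<close>

definition osimplex :: "nat \<Rightarrow> (nat \<Rightarrow> real) \<Rightarrow> bool" where
  "osimplex m v \<longleftrightarrow> (\<forall>j<m. 0 < v j) \<and> (\<Sum>j<m. v j) < 1"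

definition sext :: "nat \<Rightarrow> (nat \<Rightarrow> real) \<Rightarrow> nat \<Rightarrow> real" where
  "sext m v = (\<lambda>j\<in>{..<Suc m}. if j < m then v j else 1 - (\<Sum>i<m. v i))"

definition wres :: "nat \<Rightarrow> (nat \<Rightarrow> real) \<Rightarrow> (nat \<Rightarrow> real) \<Rightarrow> nat \<Rightarrow> real" where
  "wres m y x = (\<lambda>j\<in>{..<Suc m}. (\<Prod>i<m. y j - x i) / (\<Prod>i\<in>{..<Suc m} - {j}. y j - y i))"

definition dint :: "nat \<Rightarrow> (nat \<Rightarrow> real) \<Rightarrow> (nat \<Rightarrow> real) \<Rightarrow> bool" where
  "dint m y x \<longleftrightarrow> (\<forall>j<m. y j < x j \<and> x j < y (Suc j))"

lemma measurable_osimplex [measurable]: "Measurable.pred (Leb m) (osimplex m)"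
  unfolding osimplex_def by measurable

lemma measurable_sext [measurable]: "sext m \<in> measurable (Leb m) (Leb (Suc m))"
  unfolding sext_def
proof (rule measurable_restrict_Leb)
  fix j assume "j < Suc m"
  show "(\<lambda>v. if j < m then v j else 1 - (\<Sum>i<m. v i)) \<in> borel_measurable (Leb m)"
    by (cases "j < m") (simp_all, measurable)
qed

lemma measurable_dint [measurable (raw)]:
  assumes [measurable]: "\<And>i. i < m \<Longrightarrow> (\<lambda>u. x u i) \<in> borel_measurable M" "\<And>i. i < Suc m \<Longrightarrow> (\<lambda>u. y u i) \<in> borel_measurable M"
  shows "Measurable.pred M (\<lambda>u. dint m (y u) (x u))"
proof -
  have "Measurable.pred M (\<lambda>u. (\<forall>j\<in>{..<m}. y u j < x u j \<and> x u j < y u (Suc j)))"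
    by measurable
  also have "(\<lambda>u. (\<forall>j\<in>{..<m}. y u j < x u j \<and> x u j < y u (Suc j))) = (\<lambda>u. dint m (y u) (x u))"
    by (auto simp: dint_def fun_eq_iff)
  finally show ?thesis .
qed

lemma measurable_wres [measurable (raw)]:
  assumes [measurable]: "\<And>i. i < m \<Longrightarrow> (\<lambda>u. x u i) \<in> borel_measurable M" "\<And>i. i < Suc m \<Longrightarrow> (\<lambda>u. y u i) \<in> borel_measurable M"
  shows "(\<lambda>u. wres m (y u) (x u)) \<in> measurable M (Leb (Suc m))"
  unfolding wres_def by (rule measurable_restrict_Leb) measurable

text \<open>Multiplying the Stieltjes transform of the weights \<open>v\<close> on the nodes
  \<open>y\<close> by \<open>z - y m\<close> gives
  \<open>1 - (\<Sum>j<m. (y m - y j) * v j / (z - y j))\<close>, because the weights sum to one.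
  This is the rank-one problem for the first \<open>m\<close> nodes with weights scaled by
  \<open>y m - y j\<close>. The remaining condition, positivity of the last weight, says that the
  largest zero stays below \<open>y m\<close>.\<close>

lemma nn_integral_simplex_interlacing:
  assumes G [measurable]: "G \<in> borel_measurable (Leb (Suc m))" and y: "incr (Suc m) y"
  shows "(\<integral>\<^sup>+v. (if osimplex m v then G (sext m v) else 0) \<partial>Leb m) =
    (\<integral>\<^sup>+x. (if dint m y x then G (wres m y x) * ennreal (vand m x / vand (Suc m) y) else 0) \<partial>Leb m)" (is "?lhs = ?rhs")
proof -
  define c where "c j = 1 / (y m - y j)" for j
  have ym: "y m - y j > 0" if "j < m" for j using incr_less[OF y, of j m] that by simp
  have c: "c j > 0" if "j < m" for j using ym[OF that] by (simp add: c_def)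
  have y': "incr m y" using incr_mono[OF y] by simp
  define cm where "cm \<rho> = (\<lambda>j\<in>{..<m}. c j * \<rho> j)" for \<rho>
  have [measurable]: "cm \<in> measurable (Leb m) (Leb m)"
    unfolding cm_def by (rule measurable_restrict_Leb) measurable
  define F where "F \<rho> = (if (\<Sum>j<m. \<rho> j / (y m - y j)) < 1 then G (sext m (cm \<rho>)) else 0)" for \<rho>
  have F_meas: "F \<in> borel_measurable (Leb m)" unfolding F_def by measurable
  have res_meas [measurable]: "(\<lambda>x. \<lambda>j\<in>{..<m}. res m y x j) \<in> measurable (Leb m) (Leb m)"
    by (rule measurable_restrict_Leb, rule measurable_res) measurable
  have vand_meas [measurable]: "vand m \<in> borel_measurable (Leb m)"
    by (rule measurable_vand) measurable
  have inter_meas [measurable]: "Measurable.pred (Leb m) (inter m y)"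
    by (rule measurable_inter) measurable
  have "?lhs =
      ennreal (\<Prod>j<m. c j) * (\<integral>\<^sup>+\<rho>. (if osimplex m (cm \<rho>) then G (sext m (cm \<rho>)) else 0) \<partial>Leb m)"
    unfolding cm_def by (rule nn_integral_Leb_scale) (measurable, rule c)
  also have "(\<integral>\<^sup>+\<rho>. (if osimplex m (cm \<rho>) then G (sext m (cm \<rho>)) else 0) \<partial>Leb m) =
      (\<integral>\<^sup>+\<rho>. (if \<forall>j<m. 0 < \<rho> j then F \<rho> else 0) \<partial>Leb m)"
  proof (rule nn_integral_cong)
    fix \<rho>
    have "(\<forall>j<m. 0 < cm \<rho> j) \<longleftrightarrow> (\<forall>j<m. 0 < \<rho> j)"
      using c by (simp add: cm_def zero_less_mult_iff) (metis less_asym)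
    moreover have "(\<Sum>j<m. cm \<rho> j) = (\<Sum>j<m. \<rho> j / (y m - y j))"
      by (intro sum.cong) (auto simp: cm_def c_def)
    ultimately show "(if osimplex m (cm \<rho>) then G (sext m (cm \<rho>)) else 0) = (if \<forall>j<m. 0 < \<rho> j then F \<rho> else 0)"
      by (auto simp: osimplex_def F_def)
  qed
  also have "\<dots> = (\<integral>\<^sup>+x. (if inter m y x then F (\<lambda>j\<in>{..<m}. res m y x j) * ennreal (vand m x / vand m y) else 0) \<partial>Leb m)"
    by (rule nn_integral_rank_one[OF F_meas y'])
  also have "ennreal (\<Prod>j<m. c j) * \<dots> = (\<integral>\<^sup>+x. ennreal (\<Prod>j<m. c j) *
      (if inter m y x then F (\<lambda>j\<in>{..<m}. res m y x j) * ennreal (vand m x / vand m y) else 0) \<partial>Leb m)"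
    by (rule nn_integral_cmult[symmetric]) (use F_meas in measurable)
  also have "\<dots> = ?rhs"
  proof (rule nn_integral_cong)
    fix x
    define P where "P = (\<Prod>i<m. y m - x i) / (\<Prod>i<m. y m - y i)"
    have den: "(\<Prod>i<m. y m - y i) > 0" using ym by (intro prod_pos) auto
    have "1 - (\<Sum>j<m. res m y x j / (y m - y j)) = P"
      unfolding P_def by (rule partial_fraction[OF incr_inj[OF y']]) (use ym in force)
    then have S: "(\<Sum>j<m. (\<lambda>j\<in>{..<m}. res m y x j) j / (y m - y j)) = 1 - P"
      by simp
    have "dint m y x \<longleftrightarrow> inter m y x \<and> (m > 0 \<longrightarrow> x (m - 1) < y m)"
      by (cases m) (auto simp: dint_def inter_def less_Suc_eq, (metis Suc_lessI)+)
    also have "\<dots> \<longleftrightarrow> inter (Suc m) y (x(m := y m + 1))"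
      by (cases m) (auto simp: inter_def less_Suc_eq)
    finally have dint: "dint m y x \<longleftrightarrow> inter m y x \<and> P > 0"
      using den by (auto simp: inter_Suc_iff[OF y] P_def zero_less_divide_iff)
    show "ennreal (\<Prod>j<m. c j) * (if inter m y x then F (\<lambda>j\<in>{..<m}. res m y x j) * ennreal (vand m x / vand m y) else 0) =
        (if dint m y x then G (wres m y x) * ennreal (vand m x / vand (Suc m) y) else 0)"
    proof (cases "inter m y x \<and> P > 0")
      case False
      then show ?thesis using dint S by (auto simp: F_def)
    next
      case True
      have "sext m (cm (\<lambda>j\<in>{..<m}. res m y x j)) = wres m y x"
      proof
        fix j
        consider "j < m" | "j = m" | "j > m" by linarith
        then show "sext m (cm (\<lambda>j\<in>{..<m}. res m y x j)) j = wres m y x j"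
        proof cases
          case 1
          have "{..<Suc m} - {j} = insert m ({..<m} - {j})" using 1 by auto
          then have "(\<Prod>i\<in>{..<Suc m} - {j}. y j - y i) = (y j - y m) * (\<Prod>i\<in>{..<m} - {j}. y j - y i)" by simp
          moreover have "1 / (b - a) * (- N / D) = N / ((a - b) * D)" for a b N D :: real
            by (cases "D = 0"; cases "a = b") (auto simp: field_simps)
          ultimately show ?thesis using 1
            by (simp only: sext_def cm_def c_def wres_def res_def restrict_apply lessThan_iff if_True less_SucI)
        next
          case 2
          have "{..<Suc m} - {m} = {..<m}" by auto
          moreover have "(\<Sum>i<m. cm (\<lambda>j\<in>{..<m}. res m y x j) i) = 1 - P"
            unfolding S[symmetric] by (intro sum.cong) (auto simp: cm_def c_def)
          ultimately show ?thesis using 2 by (simp add: sext_def wres_def P_def)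
        qed (simp add: sext_def wres_def)
      qed
      moreover have "(\<Sum>j<m. (\<lambda>j\<in>{..<m}. res m y x j) j / (y m - y j)) < 1" using S True by simp
      ultimately have F: "F (\<lambda>j\<in>{..<m}. res m y x j) = G (wres m y x)" unfolding F_def by simp
      have vp: "vand m x > 0" "vand m y > 0"
        using True inter_incr inter_incr_nodes by (auto intro: vand_pos)
      have "(\<Prod>j<m. c j) = 1 / (\<Prod>i<m. y m - y i)" by (simp add: c_def prod_dividef)
      then have "(\<Prod>j<m. c j) * (vand m x / vand m y) = vand m x / vand (Suc m) y"
        by (simp add: vand_Suc)
      then have eq: "ennreal (\<Prod>j<m. c j) * ennreal (vand m x / vand m y) = ennreal (vand m x / vand (Suc m) y)"
        using vp c by (subst ennreal_mult[symmetric]) (auto intro!: prod_nonneg intro: less_imp_le)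
      have "dint m y x" using True dint by simp
      then show ?thesis using True F unfolding eq[symmetric] by (simp add: ac_simps)
    qed
  qed
  finally show ?thesis .
qed

text \<open>The last coordinate is traded for the total mass \<open>s\<close>, which is a
  translation; scaling the other \<open>m\<close> coordinates by \<open>s\<close> then produces
  \<open>s ^ m\<close>.\<close>

lemma nn_integral_polar:
  assumes F [measurable]: "F \<in> borel_measurable (Leb (Suc m))"
  shows "(\<integral>\<^sup>+\<rho>. (if \<forall>j<Suc m. 0 < \<rho> j then F \<rho> else 0) \<partial>Leb (Suc m)) =
    (\<integral>\<^sup>+s. (if 0 < s then ennreal (s ^ m) *
        (\<integral>\<^sup>+v. (if osimplex m v then F (\<lambda>j\<in>{..<Suc m}. s * sext m v j) else 0) \<partial>Leb m) else 0) \<partial>lborel)" (is "?lhs = ?rhs")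
proof -
  define K where "K \<rho> s = (if (\<forall>j<m. 0 < \<rho> j) \<and> (\<Sum>j<m. \<rho> j) < s then F (\<rho>(m := s - (\<Sum>j<m. \<rho> j))) else 0)"
    for \<rho> :: "nat \<Rightarrow> real" and s
  have K_meas: "case_prod K \<in> borel_measurable (Leb m \<Otimes>\<^sub>M lborel)"
    unfolding K_def by measurable
  have "?lhs =
      (\<integral>\<^sup>+\<rho>. \<integral>\<^sup>+t. (if \<forall>j<Suc m. 0 < (\<rho>(m := t)) j then F (\<rho>(m := t)) else 0) \<partial>lborel \<partial>Leb m)"
    by (rule nn_integral_Leb_Suc) measurable
  also have "\<dots> = (\<integral>\<^sup>+\<rho>. \<integral>\<^sup>+s. K \<rho> s \<partial>lborel \<partial>Leb m)"
  proof (rule nn_integral_cong)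
    fix \<rho> assume [measurable]: "\<rho> \<in> space (Leb m)"
    have "(\<integral>\<^sup>+t. (if \<forall>j<Suc m. 0 < (\<rho>(m := t)) j then F (\<rho>(m := t)) else 0) \<partial>lborel) =
      ennreal \<bar>1\<bar> * (\<integral>\<^sup>+s. (if \<forall>j<Suc m. 0 < (\<rho>(m := - (\<Sum>j<m. \<rho> j) + 1 * s)) j then F (\<rho>(m := - (\<Sum>j<m. \<rho> j) + 1 * s)) else 0) \<partial>lborel)"
      by (rule nn_integral_real_affine) simp_all
    also have "\<dots> = (\<integral>\<^sup>+s. K \<rho> s \<partial>lborel)"
      unfolding abs_one ennreal_1 mult_1
    proof (rule nn_integral_cong)
      fix s
      have A: "(\<forall>j<Suc m. 0 < (\<rho>(m := - (\<Sum>j<m. \<rho> j) + s)) j) \<longleftrightarrow> (\<forall>j<m. 0 < \<rho> j) \<and> (\<Sum>j<m. \<rho> j) < s"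
        by (auto simp: less_Suc_eq)
      have B: "- (\<Sum>j<m. \<rho> j) + s = s - (\<Sum>j<m. \<rho> j)" by simp
      show "(if \<forall>j<Suc m. 0 < (\<rho>(m := - (\<Sum>j<m. \<rho> j) + s)) j then F (\<rho>(m := - (\<Sum>j<m. \<rho> j) + s)) else 0) = K \<rho> s"
        unfolding A unfolding B K_def by (rule refl)
    qed
    finally show "(\<integral>\<^sup>+t. (if \<forall>j<Suc m. 0 < (\<rho>(m := t)) j then F (\<rho>(m := t)) else 0) \<partial>lborel) = (\<integral>\<^sup>+s. K \<rho> s \<partial>lborel)" .
  qed
  also have "\<dots> = (\<integral>\<^sup>+s. \<integral>\<^sup>+\<rho>. K \<rho> s \<partial>Leb m \<partial>lborel)"
    by (rule Fubini_Leb_lborel[OF K_meas])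
  also have "\<dots> = ?rhs"
  proof (rule nn_integral_cong)
    fix s :: real
    show "(\<integral>\<^sup>+\<rho>. K \<rho> s \<partial>Leb m) = (if 0 < s then ennreal (s ^ m) *
        (\<integral>\<^sup>+v. (if osimplex m v then F (\<lambda>j\<in>{..<Suc m}. s * sext m v j) else 0) \<partial>Leb m) else 0)"
    proof (cases "0 < s")
      case False
      have "K \<rho> s = 0" for \<rho>
      proof -
        have "(\<Sum>j<m. \<rho> j) \<ge> 0" if "\<forall>j<m. 0 < \<rho> j" using that by (intro sum_nonneg) (auto intro: less_imp_le)
        then show ?thesis using False by (auto simp: K_def)
      qed
      then show ?thesis using False by simp
    next
      case True
      have "(\<integral>\<^sup>+\<rho>. K \<rho> s \<partial>Leb m) = ennreal (\<Prod>j<m. s) * (\<integral>\<^sup>+v. K (\<lambda>j\<in>{..<m}. s * v j) s \<partial>Leb m)"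
        by (rule nn_integral_Leb_scale) (use K_meas True in measurable)
      also have "(\<integral>\<^sup>+v. K (\<lambda>j\<in>{..<m}. s * v j) s \<partial>Leb m) =
         (\<integral>\<^sup>+v. (if osimplex m v then F (\<lambda>j\<in>{..<Suc m}. s * sext m v j) else 0) \<partial>Leb m)"
      proof (rule nn_integral_cong)
        fix v :: "nat \<Rightarrow> real"
        have s: "(\<Sum>j<m. (\<lambda>j\<in>{..<m}. s * v j) j) = s * (\<Sum>j<m. v j)"
          by (simp add: sum_distrib_left)
        have A: "(s * (\<Sum>j<m. v j) < s) \<longleftrightarrow> (\<Sum>j<m. v j) < 1" using True by simp
        have B: "(\<forall>j<m. 0 < (\<lambda>j\<in>{..<m}. s * v j) j) \<longleftrightarrow> (\<forall>j<m. 0 < v j)"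
          using True by (simp add: zero_less_mult_iff)
        have C: "(\<lambda>j\<in>{..<m}. s * v j)(m := s - s * (\<Sum>j<m. v j)) = (\<lambda>j\<in>{..<Suc m}. s * sext m v j)"
          by (auto simp: fun_eq_iff sext_def algebra_simps)
        show "K (\<lambda>j\<in>{..<m}. s * v j) s = (if osimplex m v then F (\<lambda>j\<in>{..<Suc m}. s * sext m v j) else 0)"
          unfolding K_def s osimplex_def A B C by (rule refl)
      qed
      finally show ?thesis using True by simp
    qed
  qed
  finally show ?thesis .
qed

section \<open>Exchanging nodes and zeros\<close>

text \<open>\<open>case_nat 0 \<nu>\<close> adds the node \<open>0\<close> to the positive nodes \<open>\<nu>\<close>.\<close>

definition pincr :: "nat \<Rightarrow> (nat \<Rightarrow> real) \<Rightarrow> bool" where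
  "pincr n x \<longleftrightarrow> incr (Suc n) (case_nat 0 x)"

lemma pincr_iff: "pincr n x \<longleftrightarrow> incr n x \<and> (n > 0 \<longrightarrow> 0 < x 0)"
proof
  assume "pincr n x"
  then have *: "case_nat 0 x j < x j" if "j < n" for j
    using that by (auto simp: pincr_def incr_def)
  then have "x j < x (Suc j)" if "Suc j < n" for j using *[OF that] by simp
  then show "incr n x \<and> (n > 0 \<longrightarrow> 0 < x 0)" using *[of 0] by (auto simp: incr_def)
next
  assume *: "incr n x \<and> (n > 0 \<longrightarrow> 0 < x 0)"
  show "pincr n x"
    unfolding pincr_def incr_def
  proof (intro allI impI)
    fix j assume "Suc j < Suc n"
    then show "case_nat 0 x j < case_nat 0 x (Suc j)" using * by (cases j) (auto simp: incr_def)
  qed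
qed

lemma pincr_pos: "pincr n x \<Longrightarrow> j < n \<Longrightarrow> 0 < x j"
  using incr_less[of "Suc n" "case_nat 0 x" 0 "Suc j"] by (simp add: pincr_def)

lemma inter_case_nat_iff: "inter (Suc m) (case_nat 0 \<nu>) l \<longleftrightarrow> 0 < l 0 \<and> dint m l \<nu>"
proof
  assume i: "inter (Suc m) (case_nat 0 \<nu>) l"
  then have 1: "j < Suc m \<Longrightarrow> case_nat 0 \<nu> j < l j" and 2: "j < m \<Longrightarrow> l j < \<nu> j" for j
    by (auto simp: inter_def)
  show "0 < l 0 \<and> dint m l \<nu>" using 1[of 0] 1[of "Suc j" for j] 2 by (auto simp: dint_def)
next
  assume i: "0 < l 0 \<and> dint m l \<nu>"
  show "inter (Suc m) (case_nat 0 \<nu>) l"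
    unfolding inter_def
  proof (intro conjI allI impI)
    fix j assume "j < Suc m"
    then show "case_nat 0 \<nu> j < l j" using i by (cases j) (auto simp: dint_def)
  qed (use i in \<open>auto simp: dint_def\<close>)
qed

lemma dint_incr: "dint m y x \<Longrightarrow> incr (Suc m) y"
  unfolding dint_def incr_def by (meson Suc_less_SucD less_trans)

lemma dint_incr': "dint m y x \<Longrightarrow> incr m x"
  unfolding dint_def incr_def by (meson Suc_lessD less_trans)

lemma dint_case_nat_iff: "dint m (case_nat 0 \<nu>) \<xi> \<longleftrightarrow> inter m \<xi> \<nu> \<and> (m > 0 \<longrightarrow> 0 < \<xi> 0)"
proof
  assume i: "dint m (case_nat 0 \<nu>) \<xi>"
  then have 1: "j < m \<Longrightarrow> case_nat 0 \<nu> j < \<xi> j" and 2: "j < m \<Longrightarrow> \<xi> j < \<nu> j" for j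
    by (auto simp: dint_def)
  show "inter m \<xi> \<nu> \<and> (m > 0 \<longrightarrow> 0 < \<xi> 0)" using 1[of 0] 1[of "Suc j" for j] 2 by (auto simp: inter_def)
next
  assume i: "inter m \<xi> \<nu> \<and> (m > 0 \<longrightarrow> 0 < \<xi> 0)"
  show "dint m (case_nat 0 \<nu>) \<xi>"
    unfolding dint_def
  proof (intro conjI allI impI)
    fix j assume "j < m"
    then show "case_nat 0 \<nu> j < \<xi> j" using i by (cases j) (auto simp: inter_def)
  qed (use i in \<open>auto simp: inter_def\<close>)
qed

lemma measurable_case_nat_component:
  assumes "\<And>i. i < n \<Longrightarrow> (\<lambda>u. x u i) \<in> borel_measurable M" "i < Suc n"
  shows "(\<lambda>u. case_nat (0::real) (x u) i) \<in> borel_measurable M"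
  using assms by (cases i) auto

lemma measurable_pincr [measurable (raw)]:
  assumes "\<And>i. i < n \<Longrightarrow> (\<lambda>u. x u i) \<in> borel_measurable M"
  shows "Measurable.pred M (\<lambda>u. pincr n (x u))"
  unfolding pincr_def by (rule measurable_incr, rule measurable_case_nat_component[OF assms])

text \<open>Two changes of variables around one use of Fubini. For fixed \<open>l\<close> the
  simplex becomes the zeros \<open>\<nu>\<close> of the Stieltjes transform; for fixed
  \<open>\<nu>\<close> the nodes \<open>l\<close> become residues, since the reciprocal of
  \<open>z\<close> times the transform has zeros \<open>l\<close> and poles \<open>0, \<nu>\<close>.
  Each of the two Jacobians uses up one factor \<open>vand (Suc m) l\<close>, which is why its
  square stands on the left.\<close>

lemma nn_integral_swap_roots:
  assumes \<Phi> [measurable]: "case_prod \<Phi> \<in> borel_measurable (Leb (Suc m) \<Otimes>\<^sub>M Leb (Suc m))"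
    and \<Phi>' [measurable]: "case_prod \<Phi>' \<in> borel_measurable (Leb m \<Otimes>\<^sub>M Leb (Suc m))"
    and eq: "\<And>l \<nu>. inter (Suc m) (case_nat 0 \<nu>) l \<Longrightarrow>
      \<Phi> l (wres m l \<nu>) = \<Phi>' \<nu> (\<lambda>j\<in>{..<Suc m}. res (Suc m) (case_nat 0 \<nu>) l j)"
  shows "(\<integral>\<^sup>+l. \<integral>\<^sup>+v. (if pincr (Suc m) l \<and> osimplex m v
      then \<Phi> l (sext m v) * ennreal ((vand (Suc m) l)\<^sup>2) else 0) \<partial>Leb m \<partial>Leb (Suc m)) =
    (\<integral>\<^sup>+\<nu>. \<integral>\<^sup>+\<rho>. (if pincr m \<nu> \<and> (\<forall>j<Suc m. 0 < \<rho> j)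
      then \<Phi>' \<nu> \<rho> * ennreal (vand m \<nu> * vand (Suc m) (case_nat 0 \<nu>)) else 0) \<partial>Leb (Suc m) \<partial>Leb m)" (is "?lhs = ?rhs")
proof -
  define H where "H l \<nu> = (if pincr (Suc m) l \<and> dint m l \<nu>
    then \<Phi> l (wres m l \<nu>) * ennreal (vand m \<nu> * vand (Suc m) l) else 0)" for l \<nu>
  have H_meas: "case_prod H \<in> borel_measurable (Leb (Suc m) \<Otimes>\<^sub>M Leb m)"
  proof -
    have "(\<lambda>u. if pincr (Suc m) (fst u) \<and> dint m (fst u) (snd u)
      then \<Phi> (fst u) (wres m (fst u) (snd u)) * ennreal (vand m (snd u) * vand (Suc m) (fst u)) else 0)
      \<in> borel_measurable (Leb (Suc m) \<Otimes>\<^sub>M Leb m)"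
      by measurable
    then show ?thesis by (simp only: H_def case_prod_beta')
  qed
  have "?lhs =
    (\<integral>\<^sup>+l. \<integral>\<^sup>+\<nu>. H l \<nu> \<partial>Leb m \<partial>Leb (Suc m))"
  proof (rule nn_integral_cong)
    fix l assume [measurable]: "l \<in> space (Leb (Suc m))"
    show "(\<integral>\<^sup>+v. (if pincr (Suc m) l \<and> osimplex m v
      then \<Phi> l (sext m v) * ennreal ((vand (Suc m) l)\<^sup>2) else 0) \<partial>Leb m) = (\<integral>\<^sup>+\<nu>. H l \<nu> \<partial>Leb m)"
    proof (cases "pincr (Suc m) l")
      case True
      then have inc: "incr (Suc m) l" by (simp add: pincr_iff)
      have "(\<integral>\<^sup>+v. (if osimplex m v then \<Phi> l (sext m v) * ennreal ((vand (Suc m) l)\<^sup>2) else 0) \<partial>Leb m) =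
        (\<integral>\<^sup>+\<nu>. (if dint m l \<nu> then (\<Phi> l (wres m l \<nu>) * ennreal ((vand (Suc m) l)\<^sup>2)) * ennreal (vand m \<nu> / vand (Suc m) l) else 0) \<partial>Leb m)"
        by (rule nn_integral_simplex_interlacing[OF _ inc]) measurable
      also have "\<dots> = (\<integral>\<^sup>+\<nu>. H l \<nu> \<partial>Leb m)"
      proof (rule nn_integral_cong)
        fix \<nu>
        show "(if dint m l \<nu> then (\<Phi> l (wres m l \<nu>) * ennreal ((vand (Suc m) l)\<^sup>2)) * ennreal (vand m \<nu> / vand (Suc m) l) else 0) = H l \<nu>"
        proof (cases "dint m l \<nu>")
          case d: True
          have "vand (Suc m) l > 0" "vand m \<nu> > 0" using vand_pos[OF inc] vand_pos[OF dint_incr'[OF d]] by auto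
          then have "ennreal ((vand (Suc m) l)\<^sup>2) * ennreal (vand m \<nu> / vand (Suc m) l) = ennreal (vand m \<nu> * vand (Suc m) l)"
            by (simp add: ennreal_mult[symmetric] power2_eq_square)
          then show ?thesis using True d by (simp add: H_def mult.assoc)
        qed (simp add: H_def)
      qed
      finally show ?thesis using True by simp
    qed (simp add: H_def)
  qed
  also have "\<dots> = (\<integral>\<^sup>+\<nu>. \<integral>\<^sup>+l. H l \<nu> \<partial>Leb (Suc m) \<partial>Leb m)"
    by (rule Fubini_Leb_Leb[OF H_meas])
  also have "\<dots> = ?rhs"
  proof (rule nn_integral_cong)
    fix \<nu> assume [measurable]: "\<nu> \<in> space (Leb m)"
    have H0: "H l \<nu> = (if inter (Suc m) (case_nat 0 \<nu>) l then
       (\<Phi>' \<nu> (\<lambda>j\<in>{..<Suc m}. res (Suc m) (case_nat 0 \<nu>) l j) * ennreal (vand m \<nu> * vand (Suc m) (case_nat 0 \<nu>)))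
        * ennreal (vand (Suc m) l / vand (Suc m) (case_nat 0 \<nu>)) else 0)" for l
    proof (cases "inter (Suc m) (case_nat 0 \<nu>) l")
      case True
      then have *: "0 < l 0" "dint m l \<nu>" by (auto simp: inter_case_nat_iff)
      then have p: "pincr (Suc m) l" by (simp add: pincr_iff dint_incr)
      have "vand (Suc m) l > 0" "vand m \<nu> > 0" "vand (Suc m) (case_nat 0 \<nu>) > 0"
        using vand_pos[OF dint_incr[OF *(2)]] vand_pos[OF dint_incr'[OF *(2)]] vand_pos[OF inter_incr_nodes[OF True]] by auto
      then have "ennreal (vand m \<nu> * vand (Suc m) (case_nat 0 \<nu>)) * ennreal (vand (Suc m) l / vand (Suc m) (case_nat 0 \<nu>)) = ennreal (vand m \<nu> * vand (Suc m) l)"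
        by (simp add: ennreal_mult[symmetric])
      then show ?thesis using True p * eq[OF True] by (simp add: H_def mult.assoc)
    qed (auto simp: H_def inter_case_nat_iff pincr_iff)
    show "(\<integral>\<^sup>+l. H l \<nu> \<partial>Leb (Suc m)) = (\<integral>\<^sup>+\<rho>. (if pincr m \<nu> \<and> (\<forall>j<Suc m. 0 < \<rho> j)
      then \<Phi>' \<nu> \<rho> * ennreal (vand m \<nu> * vand (Suc m) (case_nat 0 \<nu>)) else 0) \<partial>Leb (Suc m))"
    proof (cases "pincr m \<nu>")
      case True
      have "(\<integral>\<^sup>+\<rho>. (if \<forall>j<Suc m. 0 < \<rho> j then \<Phi>' \<nu> \<rho> * ennreal (vand m \<nu> * vand (Suc m) (case_nat 0 \<nu>)) else 0) \<partial>Leb (Suc m)) =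
        (\<integral>\<^sup>+l. H l \<nu> \<partial>Leb (Suc m))"
        unfolding H0 by (rule nn_integral_rank_one) (use True in \<open>simp_all add: pincr_def\<close>)
      then show ?thesis using True by simp
    next
      case False
      then have "H l \<nu> = 0" for l
        using inter_incr_nodes[of "Suc m" "case_nat 0 \<nu>" l] by (auto simp: H0 pincr_def)
      then show ?thesis using False by simp
    qed
  qed
  finally show ?thesis .
qed

text \<open>The counterpart for a measure on \<open>0, \<nu>\<close>: its Stieltjes transform times
  \<open>z\<close> has zeros \<open>\<xi>\<close> and poles \<open>\<nu>\<close>, and the reciprocal
  has the \<open>m\<close> positive poles \<open>\<xi>\<close>. The node 0 disappears, so two
  exchanges lower the number of positive nodes by one.\<close>

lemma nn_integral_swap_roots_0:
  assumes \<Phi> [measurable]: "case_prod \<Phi> \<in> borel_measurable (Leb m \<Otimes>\<^sub>M Leb (Suc m))"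
    and \<Phi>' [measurable]: "case_prod \<Phi>' \<in> borel_measurable (Leb m \<Otimes>\<^sub>M Leb m)"
    and eq: "\<And>\<nu> \<xi>. dint m (case_nat 0 \<nu>) \<xi> \<Longrightarrow>
      \<Phi> \<nu> (wres m (case_nat 0 \<nu>) \<xi>) = \<Phi>' \<xi> (\<lambda>j\<in>{..<m}. res m \<xi> \<nu> j)"
  shows "(\<integral>\<^sup>+\<nu>. \<integral>\<^sup>+v. (if pincr m \<nu> \<and> osimplex m v
      then \<Phi> \<nu> (sext m v) * ennreal (vand m \<nu> * vand (Suc m) (case_nat 0 \<nu>)) else 0) \<partial>Leb m \<partial>Leb m) =
    (\<integral>\<^sup>+\<xi>. \<integral>\<^sup>+\<rho>. (if pincr m \<xi> \<and> (\<forall>j<m. 0 < \<rho> j)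
      then \<Phi>' \<xi> \<rho> * ennreal ((vand m \<xi>)\<^sup>2) else 0) \<partial>Leb m \<partial>Leb m)" (is "?lhs = ?rhs")
proof -
  define H where "H \<nu> \<xi> = (if pincr m \<nu> \<and> dint m (case_nat 0 \<nu>) \<xi>
    then \<Phi> \<nu> (wres m (case_nat 0 \<nu>) \<xi>) * ennreal (vand m \<xi> * vand m \<nu>) else 0)" for \<nu> \<xi>
  have H_meas: "case_prod H \<in> borel_measurable (Leb m \<Otimes>\<^sub>M Leb m)"
  proof -
    have [measurable]: "(\<lambda>u. case_nat 0 (fst u) i) \<in> borel_measurable (Leb m \<Otimes>\<^sub>M Leb m)" if "i < Suc m" for i
      by (rule measurable_case_nat_component[OF _ that]) measurable
    have "(\<lambda>u. if pincr m (fst u) \<and> dint m (case_nat 0 (fst u)) (snd u)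
      then \<Phi> (fst u) (wres m (case_nat 0 (fst u)) (snd u)) * ennreal (vand m (snd u) * vand m (fst u)) else 0)
      \<in> borel_measurable (Leb m \<Otimes>\<^sub>M Leb m)"
      by measurable
    then show ?thesis by (simp only: H_def case_prod_beta')
  qed
  have "?lhs =
    (\<integral>\<^sup>+\<nu>. \<integral>\<^sup>+\<xi>. H \<nu> \<xi> \<partial>Leb m \<partial>Leb m)"
  proof (rule nn_integral_cong)
    fix \<nu> assume [measurable]: "\<nu> \<in> space (Leb m)"
    show "(\<integral>\<^sup>+v. (if pincr m \<nu> \<and> osimplex m v
      then \<Phi> \<nu> (sext m v) * ennreal (vand m \<nu> * vand (Suc m) (case_nat 0 \<nu>)) else 0) \<partial>Leb m) = (\<integral>\<^sup>+\<xi>. H \<nu> \<xi> \<partial>Leb m)"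
    proof (cases "pincr m \<nu>")
      case True
      then have inc: "incr (Suc m) (case_nat 0 \<nu>)" "incr m \<nu>" by (simp_all add: pincr_def pincr_iff[unfolded pincr_def])
      have "(\<integral>\<^sup>+v. (if osimplex m v then \<Phi> \<nu> (sext m v) * ennreal (vand m \<nu> * vand (Suc m) (case_nat 0 \<nu>)) else 0) \<partial>Leb m) =
        (\<integral>\<^sup>+\<xi>. (if dint m (case_nat 0 \<nu>) \<xi> then (\<Phi> \<nu> (wres m (case_nat 0 \<nu>) \<xi>) * ennreal (vand m \<nu> * vand (Suc m) (case_nat 0 \<nu>)))
           * ennreal (vand m \<xi> / vand (Suc m) (case_nat 0 \<nu>)) else 0) \<partial>Leb m)"
        by (rule nn_integral_simplex_interlacing[OF _ inc(1)]) measurable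
      also have "\<dots> = (\<integral>\<^sup>+\<xi>. H \<nu> \<xi> \<partial>Leb m)"
      proof (rule nn_integral_cong)
        fix \<xi>
        show "(if dint m (case_nat 0 \<nu>) \<xi> then (\<Phi> \<nu> (wres m (case_nat 0 \<nu>) \<xi>) * ennreal (vand m \<nu> * vand (Suc m) (case_nat 0 \<nu>)))
           * ennreal (vand m \<xi> / vand (Suc m) (case_nat 0 \<nu>)) else 0) = H \<nu> \<xi>"
        proof (cases "dint m (case_nat 0 \<nu>) \<xi>")
          case d: True
          have "vand (Suc m) (case_nat 0 \<nu>) > 0" "vand m \<xi> > 0" "vand m \<nu> > 0"
            using vand_pos[OF inc(1)] vand_pos[OF dint_incr'[OF d]] vand_pos[OF inc(2)] by auto
          then have "ennreal (vand m \<nu> * vand (Suc m) (case_nat 0 \<nu>)) * ennreal (vand m \<xi> / vand (Suc m) (case_nat 0 \<nu>)) = ennreal (vand m \<xi> * vand m \<nu>)"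
            by (simp add: ennreal_mult[symmetric] mult.commute)
          then show ?thesis using True d by (simp add: H_def mult.assoc)
        qed (simp add: H_def)
      qed
      finally show ?thesis using True by simp
    qed (simp add: H_def)
  qed
  also have "\<dots> = (\<integral>\<^sup>+\<xi>. \<integral>\<^sup>+\<nu>. H \<nu> \<xi> \<partial>Leb m \<partial>Leb m)"
    by (rule Fubini_Leb_Leb[OF H_meas])
  also have "\<dots> = ?rhs"
  proof (rule nn_integral_cong)
    fix \<xi> assume [measurable]: "\<xi> \<in> space (Leb m)"
    show "(\<integral>\<^sup>+\<nu>. H \<nu> \<xi> \<partial>Leb m) = (\<integral>\<^sup>+\<rho>. (if pincr m \<xi> \<and> (\<forall>j<m. 0 < \<rho> j)
      then \<Phi>' \<xi> \<rho> * ennreal ((vand m \<xi>)\<^sup>2) else 0) \<partial>Leb m)"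
    proof (cases "pincr m \<xi>")
      case True
      have H0: "H \<nu> \<xi> = (if inter m \<xi> \<nu> then (\<Phi>' \<xi> (\<lambda>j\<in>{..<m}. res m \<xi> \<nu> j) * ennreal ((vand m \<xi>)\<^sup>2))
          * ennreal (vand m \<nu> / vand m \<xi>) else 0)" for \<nu>
      proof (cases "inter m \<xi> \<nu>")
        case i: True
        then have d: "dint m (case_nat 0 \<nu>) \<xi>" using True by (simp add: dint_case_nat_iff pincr_iff)
        then have p: "pincr m \<nu>" by (simp add: pincr_def dint_incr)
        have "vand m \<xi> > 0" "vand m \<nu> > 0" using vand_pos[OF inter_incr[OF i]] vand_pos[OF inter_incr_nodes[OF i]] by auto
        then have "ennreal ((vand m \<xi>)\<^sup>2) * ennreal (vand m \<nu> / vand m \<xi>) = ennreal (vand m \<xi> * vand m \<nu>)"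
          by (simp add: ennreal_mult[symmetric] power2_eq_square mult.commute)
        then show ?thesis using i p d eq[OF d] by (simp add: H_def mult.assoc)
      qed (auto simp: H_def dint_case_nat_iff)
      have "(\<integral>\<^sup>+\<rho>. (if \<forall>j<m. 0 < \<rho> j then \<Phi>' \<xi> \<rho> * ennreal ((vand m \<xi>)\<^sup>2) else 0) \<partial>Leb m) =
        (\<integral>\<^sup>+\<nu>. H \<nu> \<xi> \<partial>Leb m)"
        unfolding H0 by (rule nn_integral_rank_one) (use True in \<open>simp_all add: pincr_iff\<close>)
      then show ?thesis using True by simp
    next
      case False
      have "H \<nu> \<xi> = 0" for \<nu>
        using False inter_incr_nodes[of m \<xi> \<nu>] by (auto simp: H_def dint_case_nat_iff pincr_iff)
      then show ?thesis using False by simp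
    qed
  qed
  finally show ?thesis .
qed

section \<open>Moments of interlacing spectral measures\<close>

definition wmom :: "nat \<Rightarrow> (nat \<Rightarrow> real) \<Rightarrow> (nat \<Rightarrow> real) \<Rightarrow> nat \<Rightarrow> real" where
  "wmom n y w k = (\<Sum>i<n. w i * y i ^ k)"

text \<open>In terms of generating functions, \<open>M(t) = 1 / (1 - t K(t))\<close>.\<close>

fun stj :: "(nat \<Rightarrow> real) \<Rightarrow> nat \<Rightarrow> real" where
  "stj K 0 = 1"
| "stj K (Suc k) = (\<Sum>i\<le>k. stj K i * K (k - i))"

lemma stj_unique:
  assumes "M 0 = 1" "\<And>k. M (Suc k) = (\<Sum>i\<le>k. M i * K (k - i))"
  shows "M = stj K"
proof
  fix k show "M k = stj K k"
  proof (induction k rule: less_induct)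
    case (less k)
    show ?case
    proof (cases k)
      case (Suc j)
      have "(\<Sum>i\<le>j. M i * K (j - i)) = (\<Sum>i\<le>j. stj K i * K (j - i))"
        using Suc less by (intro sum.cong) auto
      then show ?thesis using Suc assms(2) by simp
    qed (use assms in simp)
  qed
qed

locale interlaced =
  fixes n :: nat and y x :: "nat \<Rightarrow> real"
  assumes inter: "inter n y x"
begin

definition \<rho> :: "nat \<Rightarrow> real" where "\<rho> = res n y x"
text \<open>Residues of the reciprocal function:
  \<open>1 + (\<Sum>i<n. \<theta> i / (z - x i))\<close> is the inverse of
  \<open>1 - (\<Sum>j<n. \<rho> j / (z - y j))\<close>, which explains the sign.\<close>

definition \<theta> :: "nat \<Rightarrow> real" where "\<theta> i = - res n x y i"

lemma inc_x: "incr n x" and inc_y: "incr n y"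
  using inter inter_incr inter_incr_nodes by blast+

lemma y_less_x: "j < n \<Longrightarrow> y j < x j"
  using inter by (simp add: inter_def)

lemma x_less_y: "i < j \<Longrightarrow> j < n \<Longrightarrow> x i < y j"
proof -
  assume "i < j" "j < n"
  then have "x i < y (Suc i)" using inter by (simp add: inter_def)
  also have "y (Suc i) \<le> y j" using incr_less[OF inc_y, of "Suc i" j] \<open>i < j\<close> \<open>j < n\<close>
    by (cases "Suc i = j") auto
  finally show ?thesis .
qed

lemma neq: "i < n \<Longrightarrow> j < n \<Longrightarrow> x i \<noteq> y j"
  using y_less_x[of j] x_less_y[of i j] incr_less[OF inc_x, of j i] 
  by (cases i j rule: linorder_cases) force+

lemma pf: "(\<And>j. j < n \<Longrightarrow> z \<noteq> y j) \<Longrightarrow> 1 - (\<Sum>j<n. \<rho> j / (z - y j)) = (\<Prod>i<n. z - x i) / (\<Prod>i<n. z - y i)"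
  unfolding \<rho>_def by (rule partial_fraction[OF incr_inj[OF inc_y]])

lemma pf': "(\<And>j. j < n \<Longrightarrow> z \<noteq> x j) \<Longrightarrow> 1 + (\<Sum>i<n. \<theta> i / (z - x i)) = (\<Prod>i<n. z - y i) / (\<Prod>i<n. z - x i)"
  using partial_fraction[OF incr_inj[OF inc_x], of z y] by (simp add: \<theta>_def sum_negf)

lemma secular_x: "i < n \<Longrightarrow> (\<Sum>j<n. \<rho> j / (x i - y j)) = 1"
proof -
  assume i: "i < n"
  then have 0: "(\<Prod>k<n. x i - x k) = 0" by (intro prod_zero) auto
  have "1 - (\<Sum>j<n. \<rho> j / (x i - y j)) = (\<Prod>k<n. x i - x k) / (\<Prod>k<n. x i - y k)"
    by (rule pf) (rule neq[OF i])
  then show ?thesis unfolding 0 by simp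
qed

lemma secular_y: "j < n \<Longrightarrow> (\<Sum>i<n. \<theta> i / (x i - y j)) = 1"
proof -
  assume j: "j < n"
  then have 0: "(\<Prod>k<n. y j - y k) = 0" by (intro prod_zero) auto
  have "1 + (\<Sum>i<n. \<theta> i / (y j - x i)) = (\<Prod>k<n. y j - y k) / (\<Prod>k<n. y j - x k)"
    by (rule pf') (use neq[OF _ j] in force)
  then have "1 + (\<Sum>i<n. \<theta> i / (y j - x i)) = 0" unfolding 0 by simp
  moreover have "(\<Sum>i<n. \<theta> i / (y j - x i)) = - (\<Sum>i<n. \<theta> i / (x i - y j))"
    unfolding sum_negf[symmetric] by (intro sum.cong) (auto simp: minus_divide_right)
  ultimately show ?thesis by simp
qed

text \<open>Comparison of coefficients at infinity in the product of a function and its reciprocal.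
  It comes from the double sum of \<open>\<theta> i * \<rho> j * x i ^ k / (x i - y j)\<close>: the
  secular equation at \<open>x i\<close> sums it over \<open>j\<close> as it stands, and the one at
  \<open>y j\<close> sums it over \<open>i\<close> once \<open>x i ^ k\<close> is written as
  \<open>y j ^ k\<close> plus the factored difference of powers.\<close>

lemma moments:
  "wmom n x \<theta> k = wmom n y \<rho> k + (\<Sum>a<k. wmom n x \<theta> a * wmom n y \<rho> (k - 1 - a))"
proof -
  have "wmom n x \<theta> k = (\<Sum>i<n. \<Sum>j<n. \<theta> i * x i ^ k * (\<rho> j / (x i - y j)))"
    unfolding wmom_def
  proof (rule sum.cong)
    fix i assume "i \<in> {..<n}"
    then show "\<theta> i * x i ^ k = (\<Sum>j<n. \<theta> i * x i ^ k * (\<rho> j / (x i - y j)))"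
      by (subst sum_distrib_left[symmetric]) (simp add: secular_x)
  qed simp
  also have "\<dots> = (\<Sum>i<n. \<Sum>j<n. \<rho> j * y j ^ k * (\<theta> i / (x i - y j)) + \<theta> i * \<rho> j * (\<Sum>a<k. x i ^ a * y j ^ (k - 1 - a)))"
  proof (intro sum.cong refl)
    fix i j assume "i \<in> {..<n}" "j \<in> {..<n}"
    then have "x i - y j \<noteq> 0" using neq by simp
    moreover have "x i ^ k - y j ^ k = (x i - y j) * (\<Sum>a<k. x i ^ a * y j ^ (k - 1 - a))"
      by (simp add: power_diff_sumr2 mult.commute)
    ultimately have "(\<Sum>a<k. x i ^ a * y j ^ (k - 1 - a)) = (x i ^ k - y j ^ k) / (x i - y j)" by simp
    then show "\<theta> i * x i ^ k * (\<rho> j / (x i - y j)) = \<rho> j * y j ^ k * (\<theta> i / (x i - y j)) + \<theta> i * \<rho> j * (\<Sum>a<k. x i ^ a * y j ^ (k - 1 - a))"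
      by (simp add: diff_divide_distrib right_diff_distrib)
  qed
  also have "\<dots> = (\<Sum>j<n. \<Sum>i<n. \<rho> j * y j ^ k * (\<theta> i / (x i - y j))) + (\<Sum>i<n. \<Sum>j<n. \<theta> i * \<rho> j * (\<Sum>a<k. x i ^ a * y j ^ (k - 1 - a)))"
    by (simp add: sum.distrib) (rule sum.swap)
  also have "(\<Sum>j<n. \<Sum>i<n. \<rho> j * y j ^ k * (\<theta> i / (x i - y j))) = wmom n y \<rho> k"
    by (simp only: sum_distrib_left[symmetric]) (simp add: secular_y wmom_def)
  also have "(\<Sum>i<n. \<Sum>j<n. \<theta> i * \<rho> j * (\<Sum>a<k. x i ^ a * y j ^ (k - 1 - a))) =
      (\<Sum>i<n. \<Sum>j<n. \<Sum>a<k. \<theta> i * x i ^ a * (\<rho> j * y j ^ (k - 1 - a)))"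
    by (simp add: sum_distrib_left ac_simps)
  also have "\<dots> = (\<Sum>i<n. \<Sum>a<k. \<Sum>j<n. \<theta> i * x i ^ a * (\<rho> j * y j ^ (k - 1 - a)))"
    by (intro sum.cong refl sum.swap)
  also have "\<dots> = (\<Sum>a<k. \<Sum>i<n. \<Sum>j<n. \<theta> i * x i ^ a * (\<rho> j * y j ^ (k - 1 - a)))"
    by (rule sum.swap)
  also have "\<dots> = (\<Sum>a<k. wmom n x \<theta> a * wmom n y \<rho> (k - 1 - a))"
    by (simp only: wmom_def sum_product)
  finally show ?thesis .
qed

lemma moments_stj:
  assumes "M 0 = 1" "\<And>k. M (Suc k) = wmom n x \<theta> k"
  shows "M = stj (wmom n y \<rho>)"
proof (rule stj_unique)
  show "M 0 = 1" by fact
next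
  fix k
  have "M (Suc k) = wmom n y \<rho> k + (\<Sum>a<k. M (Suc a) * wmom n y \<rho> (k - Suc a))"
    unfolding assms(2) by (subst moments) simp
  also have "\<dots> = (\<Sum>i<Suc k. M i * wmom n y \<rho> (k - i))"
    by (simp only: sum.lessThan_Suc_shift assms(1)) simp
  finally show "M (Suc k) = (\<Sum>i\<le>k. M i * wmom n y \<rho> (k - i))"
    by (simp only: lessThan_Suc_atMost)
qed

definition R :: real where "R = (\<Sum>j<n. \<rho> j / (1 - y j))"

lemma one_minus_R:
  assumes "\<And>j. j < n \<Longrightarrow> y j < 1"
  shows "1 - R = (\<Prod>i<n. 1 - x i) / (\<Prod>i<n. 1 - y i)"
  unfolding R_def by (rule pf) (use assms in force)

text \<open>When all \<open>y i\<close> are below 1, interlacing puts all \<open>x i\<close> except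
  the largest below 1. The sign of the product of the \<open>1 - x i\<close>, which is that of
  \<open>1 - R\<close>, decides the last one.\<close>

lemma less_1_iff: "(\<forall>i<n. x i < 1) \<longleftrightarrow> (\<forall>i<n. y i < 1) \<and> R < 1"
proof (cases "\<forall>i<n. y i < 1")
  case False
  then show ?thesis using y_less_x by (meson less_trans)
next
  case True
  then have d: "(\<Prod>i<n. 1 - y i) > 0" by (intro prod_pos) auto
  have "R < 1 \<longleftrightarrow> (\<Prod>i<n. 1 - x i) > 0"
    using one_minus_R True d by (metis diff_gt_0_iff_gt zero_less_divide_iff less_asym)
  also have "\<dots> \<longleftrightarrow> (\<forall>i<n. x i < 1)"
  proof (cases n)
    case (Suc m)
    have "x i < 1" if "i < m" for i using x_less_y[of i m] True Suc that by (meson less_trans lessI)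
    then have p: "(\<Prod>i<m. 1 - x i) > 0" by (intro prod_pos) auto
    then have "(\<Prod>i<n. 1 - x i) > 0 \<longleftrightarrow> x m < 1" using Suc by (simp add: zero_less_mult_iff)
    then show ?thesis using Suc \<open>\<And>i. i < m \<Longrightarrow> x i < 1\<close> by (auto simp: less_Suc_eq)
  qed simp
  finally show ?thesis using True by simp
qed

lemma prod_one_minus:
  assumes "\<And>j. j < n \<Longrightarrow> y j < 1"
  shows "(\<Prod>i<n. 1 - x i) = (\<Prod>i<n. 1 - y i) * (1 - R)"
proof -
  have "(\<Prod>i<n. 1 - y i) \<noteq> 0" using assms by force
  moreover have "1 - R = (\<Prod>i<n. 1 - x i) / (\<Prod>i<n. 1 - y i)" by (rule one_minus_R) (rule assms)
  ultimately show ?thesis by (metis nonzero_mult_div_cancel_left times_divide_eq_right)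
qed

lemma sum_theta:
  assumes "\<And>i. i < n \<Longrightarrow> x i < 1"
  shows "1 + (\<Sum>i<n. \<theta> i / (1 - x i)) = 1 / (1 - R)"
proof -
  have "1 + (\<Sum>i<n. \<theta> i / (1 - x i)) = (\<Prod>i<n. 1 - y i) / (\<Prod>i<n. 1 - x i)"
    by (rule pf') (use assms in force)
  moreover have "y j < 1" if "j < n" for j using that assms less_1_iff by blast
  ultimately show ?thesis by (simp add: one_minus_R)
qed

end

text \<open>Written this way the square is symmetric in the nodes, and it is the product of the
  absolute denominators of all residues.\<close>

lemma vand_sq: "(vand n x)\<^sup>2 = (\<Prod>j<n. \<Prod>i\<in>{..<n} - {j}. \<bar>x j - x i\<bar>)"
proof (induction n)
  case (Suc n)
  have "(\<Prod>j<Suc n. \<Prod>i\<in>{..<Suc n} - {j}. \<bar>x j - x i\<bar>) =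
     (\<Prod>j<n. \<Prod>i\<in>{..<Suc n} - {j}. \<bar>x j - x i\<bar>) * (\<Prod>i\<in>{..<Suc n} - {n}. \<bar>x n - x i\<bar>)" by simp
  also have "{..<Suc n} - {n} = {..<n}" by auto
  also have "(\<Prod>j<n. \<Prod>i\<in>{..<Suc n} - {j}. \<bar>x j - x i\<bar>) = (\<Prod>j<n. \<bar>x j - x n\<bar> * (\<Prod>i\<in>{..<n} - {j}. \<bar>x j - x i\<bar>))"
  proof (rule prod.cong)
    fix j assume "j \<in> {..<n}"
    then have "{..<Suc n} - {j} = insert n ({..<n} - {j})" by auto
    then show "(\<Prod>i\<in>{..<Suc n} - {j}. \<bar>x j - x i\<bar>) = \<bar>x j - x n\<bar> * (\<Prod>i\<in>{..<n} - {j}. \<bar>x j - x i\<bar>)" by simp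
  qed simp
  also have "\<dots> = (\<Prod>j<n. \<bar>x n - x j\<bar>) * (vand n x)\<^sup>2"
    by (simp add: prod.distrib Suc abs_minus_commute)
  also have "\<dots> * (\<Prod>j<n. \<bar>x n - x j\<bar>) = (vand n x)\<^sup>2 * (\<Prod>j<n. \<bar>x n - x j\<bar>)\<^sup>2"
    by (simp add: power2_eq_square)
  also have "(\<Prod>j<n. \<bar>x n - x j\<bar>)\<^sup>2 = (\<Prod>j<n. x n - x j)\<^sup>2"
    by (simp add: abs_prod[symmetric])
  finally show ?case by (simp add: vand_Suc power_mult_distrib)
qed simp

lemma abs_prod_res:
  assumes "incr n y"
  shows "(\<Prod>j<n. \<bar>res n y x j\<bar>) * (vand n y)\<^sup>2 = (\<Prod>j<n. \<Prod>i<n. \<bar>y j - x i\<bar>)"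
proof -
  have "(vand n y)\<^sup>2 \<noteq> 0" using vand_pos[OF assms] by simp
  then show ?thesis
    unfolding vand_sq by (simp add: res_def abs_prod prod_dividef)
qed

section \<open>Transformation of the Jacobi weights\<close>

text \<open>\<open>wt1\<close> is the weight of the Jacobi ensemble on \<open>Suc m\<close> positive nodes, \<open>wt2\<close> that of its counterpart with the additional
node \<open>0\<close>; the primed versions are the same weights in the residue coordinates of the other family. The parameter \<open>q\<close>
carries the canonical moment that was split off in the previous step.\<close>

lemma prod_Suc_remove:
  "j < m \<Longrightarrow> (\<Prod>i\<in>{..<Suc m} - {Suc j}. g i) = g 0 * (\<Prod>i\<in>{..<m} - {j}. g (Suc i))"
proof -
  assume "j < m"
  have "{..<Suc m} - {Suc j} = insert 0 (Suc ` ({..<m} - {j}))"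
    by (auto simp: image_iff less_Suc_eq_0_disj)
  then show ?thesis by (simp add: prod.reindex)
qed

lemma prod_Suc_remove_0: "(\<Prod>i\<in>{..<Suc m} - {0}. g i) = (\<Prod>i<m. g (Suc i))"
proof -
  have "{..<Suc m} - {0} = Suc ` {..<m}"
    by (auto simp: image_iff less_Suc_eq_0_disj)
  then show ?thesis by (simp add: prod.reindex)
qed

lemma divide_mult_pos: "(0::real) < p \<Longrightarrow> x / p * p = x"
  by simp

definition wt1 :: "real \<Rightarrow> real \<Rightarrow> real \<Rightarrow> nat \<Rightarrow> real \<Rightarrow> (nat \<Rightarrow> real) \<Rightarrow> (nat \<Rightarrow> real) \<Rightarrow> real" where
  "wt1 s A B m q l w =
    (let S = (\<Sum>i<Suc m. w i / (1 - l i)) in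
     if (\<forall>i<Suc m. l i < 1) \<and> q * S < 1
     then ((vand (Suc m) l)\<^sup>2 * (\<Prod>i<Suc m. \<bar>w i\<bar>)) powr s * (\<Prod>i<Suc m. l i) powr A
       * ((\<Prod>i<Suc m. 1 - l i) * (1 - q * S)) powr B
     else 0)"

definition wt2 :: "real \<Rightarrow> real \<Rightarrow> real \<Rightarrow> nat \<Rightarrow> real \<Rightarrow> (nat \<Rightarrow> real) \<Rightarrow> (nat \<Rightarrow> real) \<Rightarrow> real" where
  "wt2 s A B m q \<nu> \<kappa> =
    (let S = (\<Sum>j<Suc m. \<kappa> j / (1 - case_nat 0 \<nu> j)) in
     if (\<forall>i<m. \<nu> i < 1) \<and> q * S < 1
     then ((\<Prod>j<m. \<bar>\<kappa> (Suc j)\<bar>) * (\<Prod>j<m. \<nu> j) * (vand m \<nu>)\<^sup>2) powr s * (\<bar>\<kappa> 0\<bar> * (\<Prod>j<m. \<nu> j)) powr A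
       * ((\<Prod>i<m. 1 - \<nu> i) * (1 - q * S)) powr B
     else 0)"

definition wt1' :: "real \<Rightarrow> real \<Rightarrow> real \<Rightarrow> nat \<Rightarrow> real \<Rightarrow> (nat \<Rightarrow> real) \<Rightarrow> (nat \<Rightarrow> real) \<Rightarrow> real" where
  "wt1' s A B m q \<nu> \<rho> =
    (let R = (\<Sum>j<Suc m. \<rho> j / (1 - case_nat 0 \<nu> j)) in
     if (\<forall>i<m. \<nu> i < 1) \<and> R < 1 \<and> q / (1 - R) < 1
     then ((\<Prod>j<m. \<bar>\<rho> (Suc j)\<bar>) * (\<Prod>j<m. \<nu> j) * (vand m \<nu>)\<^sup>2) powr s * (\<bar>\<rho> 0\<bar> * (\<Prod>j<m. \<nu> j)) powr A
       * ((\<Prod>i<m. 1 - \<nu> i) * (1 - R) * (1 - q / (1 - R))) powr B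
     else 0)"

definition wt2' :: "real \<Rightarrow> real \<Rightarrow> real \<Rightarrow> nat \<Rightarrow> real \<Rightarrow> (nat \<Rightarrow> real) \<Rightarrow> (nat \<Rightarrow> real) \<Rightarrow> real" where
  "wt2' s A B m q \<xi> \<rho> =
    (let R = (\<Sum>j<m. \<rho> j / (1 - \<xi> j)) in
     if (\<forall>i<m. \<xi> i < 1) \<and> R < 1 \<and> q / (1 - R) < 1
     then ((vand m \<xi>)\<^sup>2 * (\<Prod>j<m. \<bar>\<rho> j\<bar>)) powr s * (\<Prod>j<m. \<xi> j) powr A
       * ((\<Prod>i<m. 1 - \<xi> i) * (1 - R) * (1 - q / (1 - R))) powr B
     else 0)"

lemma wmom_cong: "(\<And>i. i < n \<Longrightarrow> w i = w' i) \<Longrightarrow> wmom n y w = wmom n y w'"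
  by (auto simp: wmom_def fun_eq_iff intro!: sum.cong)

lemma all_case_nat_less: "(\<forall>i<Suc m. case_nat 0 \<nu> i < (1::real)) \<longleftrightarrow> (\<forall>i<m. \<nu> i < 1)"
  by (auto simp: less_Suc_eq_0_disj)

section \<open>First exchange: from positive nodes to nodes with 0 added\<close>

context
  fixes m :: nat and \<nu> l :: "nat \<Rightarrow> real"
  assumes inter: "inter (Suc m) (case_nat 0 \<nu>) l"
begin

interpretation I: interlaced "Suc m" "case_nat 0 \<nu>" l
  by standard (rule inter)

lemma stage1_pos: "j < Suc m \<Longrightarrow> 0 < l j" "j < m \<Longrightarrow> 0 < \<nu> j"
  using I.y_less_x[of j] incr_less[OF I.inc_y, of 0 j] incr_less[OF I.inc_y, of 0 "Suc j"]
  by (cases j; auto)+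

lemma stage1_theta: "i < Suc m \<Longrightarrow> I.\<theta> i = l i * wres m l \<nu> i"
  by (simp add: I.\<theta>_def res_def wres_def prod.lessThan_Suc_shift del: prod.lessThan_Suc)

lemma stage1_sum: "(\<Sum>i<Suc m. wres m l \<nu> i) = 1"
proof -
  have "(\<Sum>i<Suc m. wres m l \<nu> i) = (\<Sum>i<Suc m. I.\<theta> i / (l i - case_nat 0 \<nu> 0))"
  proof (rule sum.cong)
    fix i assume "i \<in> {..<Suc m}"
    then show "wres m l \<nu> i = I.\<theta> i / (l i - case_nat 0 \<nu> 0)" using stage1_pos(1)[of i] by (simp add: stage1_theta)
  qed simp
  then show ?thesis using I.secular_y[of 0] by simp
qed

lemma stage1_wmom: "wmom (Suc m) l (wres m l \<nu>) = stj (wmom (Suc m) (case_nat 0 \<nu>) (\<lambda>j\<in>{..<Suc m}. res (Suc m) (case_nat 0 \<nu>) l j))"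
proof -
  have "wmom (Suc m) (case_nat 0 \<nu>) (\<lambda>j\<in>{..<Suc m}. res (Suc m) (case_nat 0 \<nu>) l j) = wmom (Suc m) (case_nat 0 \<nu>) I.\<rho>"
    by (rule wmom_cong) (simp add: I.\<rho>_def)
  moreover have "wmom (Suc m) l (wres m l \<nu>) = stj (wmom (Suc m) (case_nat 0 \<nu>) I.\<rho>)"
  proof (rule I.moments_stj)
    show "wmom (Suc m) l (wres m l \<nu>) 0 = 1" using stage1_sum by (simp add: wmom_def)
    show "wmom (Suc m) l (wres m l \<nu>) (Suc k) = wmom (Suc m) l I.\<theta> k" for k
      unfolding wmom_def by (intro sum.cong) (simp_all add: stage1_theta)
  qed
  ultimately show ?thesis by simp
qed

text \<open>Since \<open>\<theta> = l * w\<close>, each term splits as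
  \<open>w + \<theta> / (1 - l)\<close>, and the sum is the reciprocal function evaluated at 1. It
  turns the factor \<open>1 - q * S\<close> of \<open>wt1\<close> into
  \<open>1 - q / (1 - R)\<close>.\<close>

lemma stage1_sum_one_minus:
  assumes "\<forall>i<Suc m. l i < 1"
  shows "(\<Sum>i<Suc m. wres m l \<nu> i / (1 - l i)) = 1 / (1 - I.R)"
proof -
  have "(\<Sum>i<Suc m. wres m l \<nu> i / (1 - l i)) = (\<Sum>i<Suc m. wres m l \<nu> i + I.\<theta> i / (1 - l i))"
  proof (rule sum.cong)
    fix i assume i: "i \<in> {..<Suc m}"
    then have "1 - l i > 0" using assms by simp
    then show "wres m l \<nu> i / (1 - l i) = wres m l \<nu> i + I.\<theta> i / (1 - l i)"
      using i stage1_theta[of i] by (simp add: field_simps)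
  qed simp
  also have "\<dots> = 1 + (\<Sum>i<Suc m. I.\<theta> i / (1 - l i))" by (simp only: sum.distrib stage1_sum)
  also have "\<dots> = 1 / (1 - I.R)" by (rule I.sum_theta) (use assms in auto)
  finally show ?thesis .
qed

lemma stage1_prod_w: "(vand (Suc m) l)\<^sup>2 * (\<Prod>i<Suc m. \<bar>wres m l \<nu> i\<bar>) = (\<Prod>i<Suc m. \<Prod>j<m. \<bar>l i - \<nu> j\<bar>)"
proof -
  have "(\<Prod>i<Suc m. \<bar>wres m l \<nu> i\<bar>) = (\<Prod>i<Suc m. (\<Prod>j<m. \<bar>l i - \<nu> j\<bar>) / (\<Prod>k\<in>{..<Suc m} - {i}. \<bar>l i - l k\<bar>))"
    by (rule prod.cong) (simp_all add: wres_def abs_prod)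
  also have "\<dots> = (\<Prod>i<Suc m. \<Prod>j<m. \<bar>l i - \<nu> j\<bar>) / (vand (Suc m) l)\<^sup>2"
    unfolding vand_sq by (rule prod_dividef)
  finally show ?thesis using vand_pos[OF I.inc_x] by simp
qed

text \<open>Together with \<open>stage1_prod_w\<close>: in either coordinate system the base of the
  power \<open>s\<close> is the absolute resultant of the nodes \<open>l\<close> and the zeros
  \<open>\<nu>\<close>, so this part of the weight passes through the exchange without an extra
  factor.\<close>

lemma stage1_prod_rho:
  "(\<Prod>j<m. \<bar>I.\<rho> (Suc j)\<bar>) * (\<Prod>j<m. \<nu> j) * (vand m \<nu>)\<^sup>2 = (\<Prod>i<Suc m. \<Prod>j<m. \<bar>l i - \<nu> j\<bar>)"
proof -
  have "(\<Prod>j<m. \<bar>I.\<rho> (Suc j)\<bar>) = (\<Prod>j<m. (\<Prod>i<Suc m. \<bar>l i - \<nu> j\<bar>) / (\<nu> j * (\<Prod>i\<in>{..<m} - {j}. \<bar>\<nu> j - \<nu> i\<bar>)))"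
  proof (rule prod.cong)
    fix j assume "j \<in> {..<m}"
    then have j: "j < m" "0 < \<nu> j" using stage1_pos by auto
    have "\<bar>I.\<rho> (Suc j)\<bar> = (\<Prod>i<Suc m. \<bar>\<nu> j - l i\<bar>) / \<bar>\<Prod>i\<in>{..<Suc m} - {Suc j}. \<nu> j - case_nat 0 \<nu> i\<bar>"
      by (simp add: I.\<rho>_def res_def abs_prod del: prod.lessThan_Suc)
    also have "(\<Prod>i\<in>{..<Suc m} - {Suc j}. \<nu> j - case_nat 0 \<nu> i) = \<nu> j * (\<Prod>i\<in>{..<m} - {j}. \<nu> j - \<nu> i)"
      by (simp only: prod_Suc_remove[OF j(1)]) simp
    finally show "\<bar>I.\<rho> (Suc j)\<bar> = (\<Prod>i<Suc m. \<bar>l i - \<nu> j\<bar>) / (\<nu> j * (\<Prod>i\<in>{..<m} - {j}. \<bar>\<nu> j - \<nu> i\<bar>))"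
      using j by (simp add: abs_mult abs_prod abs_minus_commute)
  qed simp
  also have "\<dots> = (\<Prod>j<m. \<Prod>i<Suc m. \<bar>l i - \<nu> j\<bar>) / ((\<Prod>j<m. \<nu> j) * (vand m \<nu>)\<^sup>2)"
    unfolding vand_sq by (simp only: prod_dividef prod.distrib)
  also have "(\<Prod>j<m. \<Prod>i<Suc m. \<bar>l i - \<nu> j\<bar>) = (\<Prod>i<Suc m. \<Prod>j<m. \<bar>l i - \<nu> j\<bar>)" by (rule prod.swap)
  finally have eq: "(\<Prod>j<m. \<bar>I.\<rho> (Suc j)\<bar>) = (\<Prod>i<Suc m. \<Prod>j<m. \<bar>l i - \<nu> j\<bar>) / ((\<Prod>j<m. \<nu> j) * (vand m \<nu>)\<^sup>2)" .
  have "(\<Prod>j<m. \<nu> j) > 0" by (rule prod_pos) (use stage1_pos in auto)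
  moreover have "incr m \<nu>" using inter_case_nat_iff inter dint_incr' by blast
  then have "vand m \<nu> > 0" by (rule vand_pos)
  ultimately have "(\<Prod>j<m. \<nu> j) * (vand m \<nu>)\<^sup>2 > 0" by simp
  then show ?thesis unfolding eq by (simp only: mult.assoc divide_mult_pos)
qed

lemma stage1_prod_l: "\<bar>I.\<rho> 0\<bar> * (\<Prod>j<m. \<nu> j) = (\<Prod>i<Suc m. l i)"
proof -
  have p: "(\<Prod>j<m. \<nu> j) > 0" by (rule prod_pos) (use stage1_pos in auto)
  have "\<bar>I.\<rho> 0\<bar> = (\<Prod>i<Suc m. \<bar>l i\<bar>) / (\<Prod>j<m. \<bar>\<nu> j\<bar>)"
    by (simp add: I.\<rho>_def res_def abs_prod prod_Suc_remove_0 del: prod.lessThan_Suc)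
  also have "(\<Prod>j<m. \<bar>\<nu> j\<bar>) = (\<Prod>j<m. \<nu> j)"
    by (rule prod.cong) (use stage1_pos in \<open>auto simp: less_imp_le\<close>)
  also have "(\<Prod>i<Suc m. \<bar>l i\<bar>) = (\<Prod>i<Suc m. l i)"
    by (rule prod.cong) (use stage1_pos in \<open>auto simp: less_imp_le\<close>)
  finally show ?thesis by (simp only: divide_mult_pos[OF p])
qed

lemma stage1_wt:
  "wt1 s A B m q l (wres m l \<nu>) = wt1' s A B m q \<nu> (\<lambda>j\<in>{..<Suc m}. res (Suc m) (case_nat 0 \<nu>) l j)"
proof -
  have R: "(\<Sum>j<Suc m. (\<lambda>j\<in>{..<Suc m}. res (Suc m) (case_nat 0 \<nu>) l j) j / (1 - case_nat 0 \<nu> j)) = I.R"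
    unfolding I.R_def by (rule sum.cong) (simp_all add: I.\<rho>_def)
  have r: "(\<Prod>j<m. \<bar>(\<lambda>j\<in>{..<Suc m}. res (Suc m) (case_nat 0 \<nu>) l j) (Suc j)\<bar>) = (\<Prod>j<m. \<bar>I.\<rho> (Suc j)\<bar>)"
    by (rule prod.cong) (simp_all add: I.\<rho>_def)
  have r0: "(\<lambda>j\<in>{..<Suc m}. res (Suc m) (case_nat 0 \<nu>) l j) 0 = I.\<rho> 0" by (simp add: I.\<rho>_def)
  show ?thesis
  proof (cases "\<forall>i<Suc m. l i < 1")
    case False
    then have "\<not> ((\<forall>i<m. \<nu> i < 1) \<and> I.R < 1)" using I.less_1_iff all_case_nat_less by simp
    then show ?thesis unfolding wt1_def wt1'_def Let_def R using False by (simp only: simp_thms if_False) auto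
  next
    case True
    then have lt: "\<forall>i<m. \<nu> i < 1" "I.R < 1" using I.less_1_iff all_case_nat_less by simp_all
    have "(\<Prod>i<Suc m. 1 - l i) = (\<Prod>i<Suc m. 1 - case_nat 0 \<nu> i) * (1 - I.R)"
      by (rule I.prod_one_minus) (use lt(1) all_case_nat_less in blast)
    also have "(\<Prod>i<Suc m. 1 - case_nat 0 \<nu> i) = (\<Prod>i<m. 1 - \<nu> i)"
      by (simp add: prod.lessThan_Suc_shift del: prod.lessThan_Suc)
    finally have pm: "(\<Prod>i<Suc m. 1 - l i) = (\<Prod>i<m. 1 - \<nu> i) * (1 - I.R)" .
    have qd: "q * (1 / (1 - I.R)) = q / (1 - I.R)" by simp
    show ?thesis
      unfolding wt1_def wt1'_def Let_def R r r0 stage1_sum_one_minus[OF True] stage1_prod_w stage1_prod_rho stage1_prod_l pm qd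
      using lt True by simp
  qed
qed

end

section \<open>Second exchange: from nodes with 0 added to positive nodes\<close>

context
  fixes m :: nat and \<nu> \<xi> :: "nat \<Rightarrow> real"
  assumes dint: "dint m (case_nat 0 \<nu>) \<xi>"
begin

lemma stage2_inter: "inter m \<xi> \<nu>" and stage2_xi0: "m > 0 \<Longrightarrow> 0 < \<xi> 0"
  using dint by (simp_all add: dint_case_nat_iff)

interpretation I: interlaced m \<xi> \<nu>
  by standard (rule stage2_inter)

lemma stage2_pos: "j < m \<Longrightarrow> 0 < \<xi> j" "j < m \<Longrightarrow> 0 < \<nu> j"
proof -
  show "0 < \<xi> j" if "j < m" for j
    using that stage2_xi0 incr_less[OF I.inc_y, of 0 j] by (cases j) auto
  then show "j < m \<Longrightarrow> 0 < \<nu> j" using I.y_less_x[of j] by (meson less_trans)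
qed

lemma stage2_kappa_Suc: "j < m \<Longrightarrow> wres m (case_nat 0 \<nu>) \<xi> (Suc j) = I.\<theta> j / \<nu> j"
proof -
  assume j: "j < m"
  have "(\<Prod>i\<in>{..<Suc m} - {Suc j}. \<nu> j - case_nat 0 \<nu> i) = \<nu> j * (\<Prod>i\<in>{..<m} - {j}. \<nu> j - \<nu> i)"
    by (simp only: prod_Suc_remove[OF j]) simp
  then show ?thesis using j by (simp add: wres_def I.\<theta>_def res_def mult.commute)
qed

lemma stage2_kappa_0: "wres m (case_nat 0 \<nu>) \<xi> 0 = 1 - (\<Sum>i<m. I.\<theta> i / \<nu> i)"
proof -
  have "wres m (case_nat 0 \<nu>) \<xi> 0 = (\<Prod>i<m. 0 - \<xi> i) / (\<Prod>i<m. 0 - \<nu> i)"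
    by (simp add: wres_def prod_Suc_remove_0)
  also have "\<dots> = 1 + (\<Sum>i<m. I.\<theta> i / (0 - \<nu> i))"
    by (rule I.pf'[symmetric]) (use stage2_pos in force)
  finally show ?thesis by (simp add: sum_negf)
qed

lemma stage2_sum: "(\<Sum>i<Suc m. wres m (case_nat 0 \<nu>) \<xi> i) = 1"
  unfolding sum.lessThan_Suc_shift by (simp add: stage2_kappa_0 stage2_kappa_Suc)

lemma stage2_wmom: "wmom (Suc m) (case_nat 0 \<nu>) (wres m (case_nat 0 \<nu>) \<xi>) = stj (wmom m \<xi> (\<lambda>j\<in>{..<m}. res m \<xi> \<nu> j))"
proof -
  have "wmom m \<xi> (\<lambda>j\<in>{..<m}. res m \<xi> \<nu> j) = wmom m \<xi> I.\<rho>"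
    by (rule wmom_cong) (simp add: I.\<rho>_def)
  moreover have "wmom (Suc m) (case_nat 0 \<nu>) (wres m (case_nat 0 \<nu>) \<xi>) = stj (wmom m \<xi> I.\<rho>)"
  proof (rule I.moments_stj)
    show "wmom (Suc m) (case_nat 0 \<nu>) (wres m (case_nat 0 \<nu>) \<xi>) 0 = 1" using stage2_sum by (simp add: wmom_def)
    fix k
    have "wmom (Suc m) (case_nat 0 \<nu>) (wres m (case_nat 0 \<nu>) \<xi>) (Suc k) =
        (\<Sum>j<m. wres m (case_nat 0 \<nu>) \<xi> (Suc j) * \<nu> j ^ Suc k)"
      unfolding wmom_def sum.lessThan_Suc_shift by simp
    also have "\<dots> = wmom m \<nu> I.\<theta> k"
      unfolding wmom_def
    proof (rule sum.cong)
      fix j assume "j \<in> {..<m}"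
      then show "wres m (case_nat 0 \<nu>) \<xi> (Suc j) * \<nu> j ^ Suc k = I.\<theta> j * \<nu> j ^ k"
        using stage2_pos(2)[of j] by (simp add: stage2_kappa_Suc)
    qed simp
    finally show "wmom (Suc m) (case_nat 0 \<nu>) (wres m (case_nat 0 \<nu>) \<xi>) (Suc k) = wmom m \<nu> I.\<theta> k" .
  qed
  ultimately show ?thesis by simp
qed

text \<open>Here the weight at \<open>\<nu> j\<close> is \<open>\<theta> j / \<nu> j\<close>, and
  \<open>1 / (\<nu> * (1 - \<nu>))\<close> splits into \<open>1 / \<nu> + 1 / (1 - \<nu>)\<close>.
  The first parts sum to exactly what the weight at 0 lacks to 1.\<close>

lemma stage2_sum_one_minus:
  assumes "\<forall>i<m. \<nu> i < 1"
  shows "(\<Sum>j<Suc m. wres m (case_nat 0 \<nu>) \<xi> j / (1 - case_nat 0 \<nu> j)) = 1 / (1 - I.R)" (is "?lhs = _")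
proof -
  have "?lhs =
    wres m (case_nat 0 \<nu>) \<xi> 0 + (\<Sum>j<m. wres m (case_nat 0 \<nu>) \<xi> (Suc j) / (1 - \<nu> j))"
    unfolding sum.lessThan_Suc_shift by simp
  also have "(\<Sum>j<m. wres m (case_nat 0 \<nu>) \<xi> (Suc j) / (1 - \<nu> j)) = (\<Sum>j<m. I.\<theta> j / \<nu> j + I.\<theta> j / (1 - \<nu> j))"
  proof (rule sum.cong)
    fix i assume i: "i \<in> {..<m}"
    then have "1 - \<nu> i > 0" using assms by simp
    then show "wres m (case_nat 0 \<nu>) \<xi> (Suc i) / (1 - \<nu> i) = I.\<theta> i / \<nu> i + I.\<theta> i / (1 - \<nu> i)"
      using i stage2_kappa_Suc[of i] stage2_pos(2)[of i] by (simp add: field_simps)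
  qed simp
  also have "wres m (case_nat 0 \<nu>) \<xi> 0 + \<dots> = 1 + (\<Sum>i<m. I.\<theta> i / (1 - \<nu> i))"
    by (simp only: sum.distrib stage2_kappa_0)
  also have "\<dots> = 1 / (1 - I.R)" by (rule I.sum_theta) (use assms in auto)
  finally show ?thesis .
qed

lemma stage2_prod_kappa:
  "(\<Prod>j<m. \<bar>wres m (case_nat 0 \<nu>) \<xi> (Suc j)\<bar>) * (\<Prod>j<m. \<nu> j) * (vand m \<nu>)\<^sup>2 = (vand m \<xi>)\<^sup>2 * (\<Prod>j<m. \<bar>I.\<rho> j\<bar>)"
proof -
  have p: "(\<Prod>j<m. \<nu> j) > 0" by (rule prod_pos) (use stage2_pos in auto)
  have "(\<Prod>j<m. \<bar>wres m (case_nat 0 \<nu>) \<xi> (Suc j)\<bar>) = (\<Prod>j<m. \<bar>res m \<nu> \<xi> j\<bar> / \<nu> j)"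
    by (rule prod.cong) (use stage2_pos in \<open>auto simp: stage2_kappa_Suc I.\<theta>_def abs_of_pos\<close>)
  also have "\<dots> = (\<Prod>j<m. \<bar>res m \<nu> \<xi> j\<bar>) / (\<Prod>j<m. \<nu> j)" by (rule prod_dividef)
  finally have "(\<Prod>j<m. \<bar>wres m (case_nat 0 \<nu>) \<xi> (Suc j)\<bar>) * (\<Prod>j<m. \<nu> j) * (vand m \<nu>)\<^sup>2 = (\<Prod>j<m. \<bar>res m \<nu> \<xi> j\<bar>) * (vand m \<nu>)\<^sup>2"
    by (simp only: divide_mult_pos[OF p])
  also have "\<dots> = (\<Prod>j<m. \<Prod>i<m. \<bar>\<nu> j - \<xi> i\<bar>)" by (rule abs_prod_res[OF I.inc_x])
  also have "\<dots> = (\<Prod>i<m. \<Prod>j<m. \<bar>\<nu> j - \<xi> i\<bar>)" by (rule prod.swap)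
  also have "\<dots> = (\<Prod>i<m. \<Prod>j<m. \<bar>\<xi> i - \<nu> j\<bar>)" by (simp only: abs_minus_commute)
  also have "\<dots> = (\<Prod>j<m. \<bar>I.\<rho> j\<bar>) * (vand m \<xi>)\<^sup>2" unfolding I.\<rho>_def by (rule abs_prod_res[OF I.inc_y, symmetric])
  finally show ?thesis by (simp add: mult.commute)
qed

lemma stage2_prod_0: "\<bar>wres m (case_nat 0 \<nu>) \<xi> 0\<bar> * (\<Prod>j<m. \<nu> j) = (\<Prod>i<m. \<xi> i)"
proof -
  have p: "(\<Prod>j<m. \<nu> j) > 0" by (rule prod_pos) (use stage2_pos in auto)
  have "\<bar>wres m (case_nat 0 \<nu>) \<xi> 0\<bar> = (\<Prod>i<m. \<bar>\<xi> i\<bar>) / (\<Prod>j<m. \<bar>\<nu> j\<bar>)"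
    by (simp add: wres_def abs_prod prod_Suc_remove_0)
  also have "(\<Prod>j<m. \<bar>\<nu> j\<bar>) = (\<Prod>j<m. \<nu> j)"
    by (rule prod.cong) (use stage2_pos in \<open>auto simp: less_imp_le\<close>)
  also have "(\<Prod>i<m. \<bar>\<xi> i\<bar>) = (\<Prod>i<m. \<xi> i)"
    by (rule prod.cong) (use stage2_pos in \<open>auto simp: less_imp_le\<close>)
  finally show ?thesis by (simp only: divide_mult_pos[OF p])
qed

lemma stage2_wt:
  "wt2 s A B m q \<nu> (wres m (case_nat 0 \<nu>) \<xi>) = wt2' s A B m q \<xi> (\<lambda>j\<in>{..<m}. res m \<xi> \<nu> j)"
proof -
  have R: "(\<Sum>j<m. (\<lambda>j\<in>{..<m}. res m \<xi> \<nu> j) j / (1 - \<xi> j)) = I.R"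
    unfolding I.R_def by (rule sum.cong) (simp_all add: I.\<rho>_def)
  have r: "(\<Prod>j<m. \<bar>(\<lambda>j\<in>{..<m}. res m \<xi> \<nu> j) j\<bar>) = (\<Prod>j<m. \<bar>I.\<rho> j\<bar>)"
    by (rule prod.cong) (simp_all add: I.\<rho>_def)
  show ?thesis
  proof (cases "\<forall>i<m. \<nu> i < 1")
    case False
    then have "\<not> ((\<forall>i<m. \<xi> i < 1) \<and> I.R < 1)" using I.less_1_iff by simp
    then show ?thesis unfolding wt2_def wt2'_def Let_def R using False by (simp only: simp_thms if_False) auto
  next
    case True
    then have lt: "\<forall>i<m. \<xi> i < 1" "I.R < 1" using I.less_1_iff by simp_all
    have pm: "(\<Prod>i<m. 1 - \<nu> i) = (\<Prod>i<m. 1 - \<xi> i) * (1 - I.R)"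
      by (rule I.prod_one_minus) (use lt(1) in blast)
    have qd: "q * (1 / (1 - I.R)) = q / (1 - I.R)" by simp
    show ?thesis
      unfolding wt2_def wt2'_def Let_def R r stage2_sum_one_minus[OF True] stage2_prod_kappa stage2_prod_0 pm qd
      using lt True by simp
  qed
qed

end

text \<open>Both parts rest on \<open>(1 - R) * (1 - q / (1 - R)) = 1 - q - R\<close> for
  \<open>R = z * S\<close>. Writing \<open>z = (1 - q) * p\<close> factors this as
  \<open>(1 - q) * (1 - p * S)\<close>, so \<open>p\<close> takes over the role of \<open>q\<close>
  in the next step.\<close>

lemma R_scale_iff:
  fixes q z S :: real
  assumes "0 \<le> q" "q < 1" "0 < z"
  shows "z * S < 1 \<and> q / (1 - z * S) < 1 \<longleftrightarrow> z / (1 - q) * S < 1"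
    and "z * S < 1 \<Longrightarrow> (1 - z * S) * (1 - q / (1 - z * S)) = (1 - q) * (1 - z / (1 - q) * S)"
proof -
  have "z * S < 1 \<and> q / (1 - z * S) < 1 \<longleftrightarrow> z * S < 1 \<and> q < 1 - z * S"
    by (auto simp: divide_less_eq)
  also have "\<dots> \<longleftrightarrow> z / (1 - q) * S < 1"
    using assms by (auto simp: field_simps)
  finally show "z * S < 1 \<and> q / (1 - z * S) < 1 \<longleftrightarrow> z / (1 - q) * S < 1" .
  show "(1 - z * S) * (1 - q / (1 - z * S)) = (1 - q) * (1 - z / (1 - q) * S)" if "z * S < 1"
    using that assms by (simp add: field_simps)
qed

text \<open>Homogeneity in the weights: the \<open>m\<close> weights at positive nodes enter with
  exponent \<open>s\<close>, the weight at 0 with exponent \<open>A\<close>. In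
  \<open>wt2'_scale\<close> no node is at 0 and all \<open>Suc m\<close> weights carry
  \<open>s\<close>; this is the source of the two kinds of Beta parameters.\<close>

lemma wt1'_scale:
  assumes q: "0 \<le> q" "q < 1" "0 < z" and nu: "\<And>j. j < m \<Longrightarrow> 0 < \<nu> j"
  shows "wt1' s A B m q \<nu> (\<lambda>j\<in>{..<Suc m}. z * \<kappa> j) =
     z powr (real m * s + A) * (1 - q) powr B * wt2 s A B m (z / (1 - q)) \<nu> \<kappa>"
proof -
  define S where "S = (\<Sum>j<Suc m. \<kappa> j / (1 - case_nat 0 \<nu> j))"
  have R: "(\<Sum>j<Suc m. (\<lambda>j\<in>{..<Suc m}. z * \<kappa> j) j / (1 - case_nat 0 \<nu> j)) = z * S"
    unfolding S_def sum_distrib_left by (rule sum.cong) simp_all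
  have p: "(\<Prod>j<m. \<bar>(\<lambda>j\<in>{..<Suc m}. z * \<kappa> j) (Suc j)\<bar>) = z ^ m * (\<Prod>j<m. \<bar>\<kappa> (Suc j)\<bar>)"
    using q by (simp add: abs_mult prod.distrib)
  have nu0: "(\<Prod>j<m. \<nu> j) \<ge> 0" by (rule prod_nonneg) (use nu in \<open>auto simp: less_imp_le\<close>)
  show ?thesis
  proof (cases "(\<forall>i<m. \<nu> i < 1) \<and> z / (1 - q) * S < 1")
    case False
    then have "\<not> ((\<forall>i<m. \<nu> i < 1) \<and> z * S < 1 \<and> q / (1 - z * S) < 1)" using R_scale_iff(1)[OF q] by blast
    then show ?thesis using False unfolding wt1'_def wt2_def Let_def R S_def[symmetric] by (simp only: if_False)
  next
    case True
    then have c: "(\<forall>i<m. \<nu> i < 1) \<and> z * S < 1 \<and> q / (1 - z * S) < 1" using R_scale_iff(1)[OF q] by blast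
    have one: "(\<Prod>i<m. 1 - \<nu> i) \<ge> 0" by (rule prod_nonneg) (use True in \<open>auto simp: less_imp_le\<close>)
    have e1: "(z ^ m * (\<Prod>j<m. \<bar>\<kappa> (Suc j)\<bar>) * (\<Prod>j<m. \<nu> j) * (vand m \<nu>)\<^sup>2) powr s =
        z powr (real m * s) * ((\<Prod>j<m. \<bar>\<kappa> (Suc j)\<bar>) * (\<Prod>j<m. \<nu> j) * (vand m \<nu>)\<^sup>2) powr s"
      using q nu0 by (simp add: powr_mult prod_nonneg mult.assoc powr_powr[symmetric] powr_realpow)
    have e2: "(\<bar>(\<lambda>j\<in>{..<Suc m}. z * \<kappa> j) 0\<bar> * (\<Prod>j<m. \<nu> j)) powr A = z powr A * (\<bar>\<kappa> 0\<bar> * (\<Prod>j<m. \<nu> j)) powr A"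
      using q nu0 by (simp add: powr_mult abs_mult mult.assoc)
    have "(\<Prod>i<m. 1 - \<nu> i) * (1 - z * S) * (1 - q / (1 - z * S)) = (1 - q) * ((\<Prod>i<m. 1 - \<nu> i) * (1 - z / (1 - q) * S))"
      using R_scale_iff(2)[OF q, of S] c by (simp add: mult.assoc mult.left_commute)
    then have e3: "((\<Prod>i<m. 1 - \<nu> i) * (1 - z * S) * (1 - q / (1 - z * S))) powr B = (1 - q) powr B * ((\<Prod>i<m. 1 - \<nu> i) * (1 - z / (1 - q) * S)) powr B"
      using q one True by (simp only:) (subst powr_mult, simp_all)
    show ?thesis unfolding wt1'_def wt2_def Let_def R S_def[symmetric] p if_P[OF c] if_P[OF True] e1 e2 e3
      by (simp add: powr_add)
  qed
qed

lemma wt2'_scale: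
  assumes q: "0 \<le> q" "q < 1" "0 < z" and xi: "\<And>j. j < Suc m \<Longrightarrow> 0 < \<xi> j"
  shows "wt2' s A B (Suc m) q \<xi> (\<lambda>j\<in>{..<Suc m}. z * \<kappa> j) =
     z powr (real (Suc m) * s) * (1 - q) powr B * wt1 s A B m (z / (1 - q)) \<xi> \<kappa>"
proof -
  define S where "S = (\<Sum>j<Suc m. \<kappa> j / (1 - \<xi> j))"
  have R: "(\<Sum>j<Suc m. (\<lambda>j\<in>{..<Suc m}. z * \<kappa> j) j / (1 - \<xi> j)) = z * S"
    unfolding S_def sum_distrib_left by (rule sum.cong) simp_all
  have "(\<Prod>j<Suc m. \<bar>(\<lambda>j\<in>{..<Suc m}. z * \<kappa> j) j\<bar>) = (\<Prod>j<Suc m. z * \<bar>\<kappa> j\<bar>)"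
    using q by (intro prod.cong) (simp_all add: abs_mult)
  then have p: "(\<Prod>j<Suc m. \<bar>(\<lambda>j\<in>{..<Suc m}. z * \<kappa> j) j\<bar>) = z ^ Suc m * (\<Prod>j<Suc m. \<bar>\<kappa> j\<bar>)"
    by (simp only: prod.distrib prod_constant card_lessThan)
  show ?thesis
  proof (cases "(\<forall>i<Suc m. \<xi> i < 1) \<and> z / (1 - q) * S < 1")
    case False
    then have "\<not> ((\<forall>i<Suc m. \<xi> i < 1) \<and> z * S < 1 \<and> q / (1 - z * S) < 1)" using R_scale_iff(1)[OF q] by blast
    then show ?thesis using False unfolding wt2'_def wt1_def Let_def R S_def[symmetric] by (simp only: if_False)
  next
    case True
    then have c: "(\<forall>i<Suc m. \<xi> i < 1) \<and> z * S < 1 \<and> q / (1 - z * S) < 1" using R_scale_iff(1)[OF q] by blast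
    have one: "(\<Prod>i<Suc m. 1 - \<xi> i) \<ge> 0" by (rule prod_nonneg) (use True in \<open>auto simp: less_imp_le\<close>)
    have "(\<Prod>j<Suc m. \<bar>\<kappa> j\<bar>) \<ge> 0" by (rule prod_nonneg) auto
    then have "((vand (Suc m) \<xi>)\<^sup>2 * (z ^ Suc m * (\<Prod>j<Suc m. \<bar>\<kappa> j\<bar>))) powr s =
       (vand (Suc m) \<xi>)\<^sup>2 powr s * ((z ^ Suc m) powr s * (\<Prod>j<Suc m. \<bar>\<kappa> j\<bar>) powr s)"
      using q by (subst powr_mult, simp, simp, subst powr_mult) simp_all
    moreover have "(z ^ Suc m) powr s = z powr (real (Suc m) * s)"
      using q by (simp only: powr_realpow[symmetric] powr_powr)
    moreover have "((vand (Suc m) \<xi>)\<^sup>2 * (\<Prod>j<Suc m. \<bar>\<kappa> j\<bar>)) powr s = (vand (Suc m) \<xi>)\<^sup>2 powr s * (\<Prod>j<Suc m. \<bar>\<kappa> j\<bar>) powr s"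
      using \<open>(\<Prod>j<Suc m. \<bar>\<kappa> j\<bar>) \<ge> 0\<close> by (subst powr_mult) simp_all
    ultimately have e1: "((vand (Suc m) \<xi>)\<^sup>2 * (z ^ Suc m * (\<Prod>j<Suc m. \<bar>\<kappa> j\<bar>))) powr s =
       z powr (real (Suc m) * s) * ((vand (Suc m) \<xi>)\<^sup>2 * (\<Prod>j<Suc m. \<bar>\<kappa> j\<bar>)) powr s"
      by (simp only: ac_simps)
    have "(\<Prod>i<Suc m. 1 - \<xi> i) * (1 - z * S) * (1 - q / (1 - z * S)) = (1 - q) * ((\<Prod>i<Suc m. 1 - \<xi> i) * (1 - z / (1 - q) * S))"
      using R_scale_iff(2)[OF q, of S] c by (simp only: mult.assoc mult.left_commute)
    then have e3: "((\<Prod>i<Suc m. 1 - \<xi> i) * (1 - z * S) * (1 - q / (1 - z * S))) powr B = (1 - q) powr B * ((\<Prod>i<Suc m. 1 - \<xi> i) * (1 - z / (1 - q) * S)) powr B"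
      using q one True by (simp only:) (subst powr_mult, simp_all)
    show ?thesis unfolding wt2'_def wt1_def Let_def R S_def[symmetric] p if_P[OF c] if_P[OF True] e1 e3
      by (simp only: mult.assoc mult.left_commute)
  qed
qed

section \<open>Measurability of moment transforms and weights\<close>

abbreviation Mseq :: "(nat \<Rightarrow> real) measure" where
  "Mseq \<equiv> PiM UNIV (\<lambda>_. borel)"

lemma borel_measurable_nn_integral_Leb [measurable (raw)]:
  "case_prod f \<in> borel_measurable (N \<Otimes>\<^sub>M Leb n) \<Longrightarrow> (\<lambda>x. \<integral>\<^sup>+y. f x y \<partial>Leb n) \<in> borel_measurable N"
  by (rule sigma_finite_measure.borel_measurable_nn_integral[OF sigma_finite_Leb])

lemma measurable_MseqI:
  assumes "\<And>k. (\<lambda>u. f u k) \<in> borel_measurable N"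
  shows "f \<in> measurable N Mseq"
  using assms by (intro measurable_PiM_single') auto

lemma measurable_wmom [measurable (raw)]:
  assumes [measurable]: "\<And>i. i < n \<Longrightarrow> (\<lambda>u. y u i) \<in> borel_measurable N" "\<And>i. i < n \<Longrightarrow> (\<lambda>u. w u i) \<in> borel_measurable N"
  shows "(\<lambda>u. wmom n (y u) (w u)) \<in> measurable N Mseq"
  by (rule measurable_MseqI) (unfold wmom_def, measurable)

lemma measurable_stj [measurable (raw)]:
  assumes [measurable]: "\<And>k. (\<lambda>u. K u k) \<in> borel_measurable N"
  shows "(\<lambda>u. stj (K u)) \<in> measurable N Mseq"
proof (rule measurable_MseqI)
  fix k show "(\<lambda>u. stj (K u) k) \<in> borel_measurable N"
  proof (induction k rule: less_induct)
    case (less k)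
    show ?case
    proof (cases k)
      case (Suc j)
      have "(\<lambda>u. \<Sum>i\<le>j. stj (K u) i * K u (j - i)) \<in> borel_measurable N"
        using less Suc by (intro borel_measurable_sum borel_measurable_times) auto
      then show ?thesis using Suc by simp
    qed simp
  qed
qed

lemma all_less_ball: "(\<forall>i<n. P i) \<longleftrightarrow> (\<forall>i\<in>{..<n::nat}. P i)" by auto

lemma measurable_wt1 [measurable (raw)]:
  assumes [measurable]: "q \<in> borel_measurable N" "\<And>i. i < Suc m \<Longrightarrow> (\<lambda>u. l u i) \<in> borel_measurable N"
    "\<And>i. i < Suc m \<Longrightarrow> (\<lambda>u. w u i) \<in> borel_measurable N"
  shows "(\<lambda>u. wt1 s A B m (q u) (l u) (w u)) \<in> borel_measurable N"
  unfolding wt1_def Let_def all_less_ball by measurable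

lemma measurable_wt2 [measurable (raw)]:
  assumes [measurable]: "q \<in> borel_measurable N" "\<And>i. i < m \<Longrightarrow> (\<lambda>u. l u i) \<in> borel_measurable N"
    "\<And>i. i < Suc m \<Longrightarrow> (\<lambda>u. w u i) \<in> borel_measurable N"
  shows "(\<lambda>u. wt2 s A B m (q u) (l u) (w u)) \<in> borel_measurable N"
proof -
  have [measurable]: "(\<lambda>u. case_nat 0 (l u) i) \<in> borel_measurable N" if "i < Suc m" for i
    by (rule measurable_case_nat_component[OF _ that]) measurable
  show ?thesis unfolding wt2_def Let_def all_less_ball by measurable
qed

lemma measurable_wt1' [measurable (raw)]:
  assumes [measurable]: "q \<in> borel_measurable N" "\<And>i. i < m \<Longrightarrow> (\<lambda>u. l u i) \<in> borel_measurable N"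
    "\<And>i. i < Suc m \<Longrightarrow> (\<lambda>u. w u i) \<in> borel_measurable N"
  shows "(\<lambda>u. wt1' s A B m (q u) (l u) (w u)) \<in> borel_measurable N"
proof -
  have [measurable]: "(\<lambda>u. case_nat 0 (l u) i) \<in> borel_measurable N" if "i < Suc m" for i
    by (rule measurable_case_nat_component[OF _ that]) measurable
  show ?thesis unfolding wt1'_def Let_def all_less_ball by measurable
qed

lemma measurable_wt2' [measurable (raw)]:
  assumes [measurable]: "q \<in> borel_measurable N" "\<And>i. i < m \<Longrightarrow> (\<lambda>u. l u i) \<in> borel_measurable N"
    "\<And>i. i < m \<Longrightarrow> (\<lambda>u. w u i) \<in> borel_measurable N"
  shows "(\<lambda>u. wt2' s A B m (q u) (l u) (w u)) \<in> borel_measurable N"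
  unfolding wt2'_def Let_def all_less_ball by measurable

section \<open>One step of the recursion for the canonical moments\<close>

text \<open>Unnormalized expectation of a functional of the moment sequence, over increasingly
  ordered nodes. \<open>F\<close> stays arbitrary so that a step of the recursion can absorb into it
  the map from the new moments to the old ones.\<close>

definition Psi1 :: "real \<Rightarrow> real \<Rightarrow> real \<Rightarrow> nat \<Rightarrow> real \<Rightarrow> ((nat \<Rightarrow> real) \<Rightarrow> ennreal) \<Rightarrow> ennreal" where
  "Psi1 s A B m q F = (\<integral>\<^sup>+l. \<integral>\<^sup>+v. (if pincr (Suc m) l \<and> osimplex m v
      then F (wmom (Suc m) l (sext m v)) * ennreal (wt1 s A B m q l (sext m v)) * ennreal ((vand (Suc m) l)\<^sup>2)
      else 0) \<partial>Leb m \<partial>Leb (Suc m))"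

definition Psi2 :: "real \<Rightarrow> real \<Rightarrow> real \<Rightarrow> nat \<Rightarrow> real \<Rightarrow> ((nat \<Rightarrow> real) \<Rightarrow> ennreal) \<Rightarrow> ennreal" where
  "Psi2 s A B m q F = (\<integral>\<^sup>+\<nu>. \<integral>\<^sup>+v. (if pincr m \<nu> \<and> osimplex m v
      then F (wmom (Suc m) (case_nat 0 \<nu>) (sext m v)) * ennreal (wt2 s A B m q \<nu> (sext m v))
        * ennreal (vand m \<nu> * vand (Suc m) (case_nat 0 \<nu>))
      else 0) \<partial>Leb m \<partial>Leb m)"

lemma nn_integral_polar_step:
  assumes \<Phi> [measurable]: "case_prod \<Phi> \<in> borel_measurable (Leb n \<Otimes>\<^sub>M Leb (Suc m))"
    and P [measurable]: "Measurable.pred (Leb n) P" and q: "0 \<le> q" "q < 1"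
  shows "(\<integral>\<^sup>+\<nu>. \<integral>\<^sup>+\<rho>. (if P \<nu> \<and> (\<forall>j<Suc m. 0 < \<rho> j) then \<Phi> \<nu> \<rho> else 0) \<partial>Leb (Suc m) \<partial>Leb n) =
    (\<integral>\<^sup>+p. (if 0 < p then ennreal ((1 - q) ^ Suc m * p ^ m) *
       (\<integral>\<^sup>+\<nu>. \<integral>\<^sup>+v. (if P \<nu> \<and> osimplex m v then \<Phi> \<nu> (\<lambda>j\<in>{..<Suc m}. (1 - q) * p * sext m v j) else 0) \<partial>Leb m \<partial>Leb n)
      else 0) \<partial>lborel)" (is "?lhs = ?rhs")
proof -
  have sc [measurable]: "(\<lambda>u. \<lambda>j\<in>{..<Suc m}. f u * sext m (g u) j) \<in> measurable N (Leb (Suc m))"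
    if [measurable]: "f \<in> borel_measurable N" "g \<in> measurable N (Leb m)" for N :: "'c measure" and f g
  proof (rule measurable_restrict_Leb)
    fix i assume i: "i < Suc m"
    have "(\<lambda>u. sext m (g u)) \<in> measurable N (Leb (Suc m))" by measurable
    from measurable_Leb_component[OF this i] show "(\<lambda>u. f u * sext m (g u) i) \<in> borel_measurable N" by measurable
  qed
  define K where "K \<nu> p = (if P \<nu> \<and> 0 < p then ennreal ((1 - q) ^ Suc m * p ^ m) *
       (\<integral>\<^sup>+v. (if osimplex m v then \<Phi> \<nu> (\<lambda>j\<in>{..<Suc m}. (1 - q) * p * sext m v j) else 0) \<partial>Leb m) else 0)" for \<nu> p
  have K_meas: "case_prod K \<in> borel_measurable (Leb n \<Otimes>\<^sub>M lborel)"
  proof -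
    have [measurable]: "(\<lambda>u. \<lambda>j\<in>{..<Suc m}. (1 - q) * snd (fst u) * sext m (snd u) j) \<in> measurable ((Leb n \<Otimes>\<^sub>M lborel) \<Otimes>\<^sub>M Leb m) (Leb (Suc m))"
      by (rule sc[of "\<lambda>u. (1 - q) * snd (fst u)" _ snd]) measurable
    have "(\<lambda>u. if P (fst u) \<and> 0 < snd u then ennreal ((1 - q) ^ Suc m * snd u ^ m) *
       (\<integral>\<^sup>+v. (if osimplex m v then \<Phi> (fst u) (\<lambda>j\<in>{..<Suc m}. (1 - q) * snd u * sext m v j) else 0) \<partial>Leb m) else 0)
      \<in> borel_measurable (Leb n \<Otimes>\<^sub>M lborel)"
      unfolding case_prod_beta' by measurable
    then show ?thesis by (simp only: K_def case_prod_beta')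
  qed
  have "?lhs =
      (\<integral>\<^sup>+\<nu>. \<integral>\<^sup>+p. K \<nu> p \<partial>lborel \<partial>Leb n)"
  proof (rule nn_integral_cong)
    fix \<nu> assume [measurable]: "\<nu> \<in> space (Leb n)"
    show "(\<integral>\<^sup>+\<rho>. (if P \<nu> \<and> (\<forall>j<Suc m. 0 < \<rho> j) then \<Phi> \<nu> \<rho> else 0) \<partial>Leb (Suc m)) = (\<integral>\<^sup>+p. K \<nu> p \<partial>lborel)"
    proof (cases "P \<nu>")
      case True
      have [measurable]: "\<Phi> \<nu> \<in> borel_measurable (Leb (Suc m))" by measurable
      have "(\<integral>\<^sup>+\<rho>. (if \<forall>j<Suc m. 0 < \<rho> j then \<Phi> \<nu> \<rho> else 0) \<partial>Leb (Suc m)) =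
        (\<integral>\<^sup>+z. (if 0 < z then ennreal (z ^ m) *
        (\<integral>\<^sup>+v. (if osimplex m v then \<Phi> \<nu> (\<lambda>j\<in>{..<Suc m}. z * sext m v j) else 0) \<partial>Leb m) else 0) \<partial>lborel)"
        by (rule nn_integral_polar) measurable
      also have "\<dots> = ennreal \<bar>1 - q\<bar> * (\<integral>\<^sup>+p. (if 0 < 0 + (1 - q) * p then ennreal ((0 + (1 - q) * p) ^ m) *
        (\<integral>\<^sup>+v. (if osimplex m v then \<Phi> \<nu> (\<lambda>j\<in>{..<Suc m}. (0 + (1 - q) * p) * sext m v j) else 0) \<partial>Leb m) else 0) \<partial>lborel)"
      proof (rule nn_integral_real_affine)
        have "(\<lambda>u. \<lambda>j\<in>{..<Suc m}. fst u * sext m (snd u) j) \<in> measurable (borel \<Otimes>\<^sub>M Leb m) (Leb (Suc m))"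
          by (rule sc) measurable
        then have [measurable]: "(\<lambda>u. \<lambda>j\<in>{..<Suc m}. fst u * sext m (snd u) j) \<in> measurable (borel \<Otimes>\<^sub>M Leb m) (Leb (Suc m))" .
        show "(\<lambda>z. if 0 < z then ennreal (z ^ m) *
        (\<integral>\<^sup>+v. (if osimplex m v then \<Phi> \<nu> (\<lambda>j\<in>{..<Suc m}. z * sext m v j) else 0) \<partial>Leb m) else 0) \<in> borel_measurable borel"
          unfolding case_prod_beta' by measurable
      qed (use q in simp)
      also have "\<dots> = (\<integral>\<^sup>+p. ennreal \<bar>1 - q\<bar> * (if 0 < 0 + (1 - q) * p then ennreal ((0 + (1 - q) * p) ^ m) *
        (\<integral>\<^sup>+v. (if osimplex m v then \<Phi> \<nu> (\<lambda>j\<in>{..<Suc m}. (0 + (1 - q) * p) * sext m v j) else 0) \<partial>Leb m) else 0) \<partial>lborel)"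
      proof (rule nn_integral_cmult[symmetric])
        have [measurable]: "(\<lambda>u. \<lambda>j\<in>{..<Suc m}. (0 + (1 - q) * fst u) * sext m (snd u) j) \<in> measurable (lborel \<Otimes>\<^sub>M Leb m) (Leb (Suc m))"
          by (rule sc) measurable
        show "(\<lambda>p. if 0 < 0 + (1 - q) * p then ennreal ((0 + (1 - q) * p) ^ m) *
        (\<integral>\<^sup>+v. (if osimplex m v then \<Phi> \<nu> (\<lambda>j\<in>{..<Suc m}. (0 + (1 - q) * p) * sext m v j) else 0) \<partial>Leb m) else 0) \<in> borel_measurable lborel"
          unfolding case_prod_beta' by measurable
      qed
      also have "\<dots> = (\<integral>\<^sup>+p. K \<nu> p \<partial>lborel)"
      proof (rule nn_integral_cong)
        fix p :: real
        have i: "0 < 0 + (1 - q) * p \<longleftrightarrow> 0 < p" using q by (simp add: zero_less_mult_iff)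
        have e: "ennreal \<bar>1 - q\<bar> * (ennreal ((0 + (1 - q) * p) ^ m) * X) = ennreal ((1 - q) ^ Suc m * p ^ m) * X" if "0 < p" for X
          using q that by (simp add: mult.assoc[symmetric] ennreal_mult[symmetric] power_mult_distrib)
        show "ennreal \<bar>1 - q\<bar> * (if 0 < 0 + (1 - q) * p then ennreal ((0 + (1 - q) * p) ^ m) *
        (\<integral>\<^sup>+v. (if osimplex m v then \<Phi> \<nu> (\<lambda>j\<in>{..<Suc m}. (0 + (1 - q) * p) * sext m v j) else 0) \<partial>Leb m) else 0) = K \<nu> p"
          unfolding i unfolding add_0 K_def using True e by (cases "0 < p") simp_all
      qed
      finally show ?thesis using True by simp
    qed (simp add: K_def)
  qed
  also have "\<dots> = (\<integral>\<^sup>+p. \<integral>\<^sup>+\<nu>. K \<nu> p \<partial>Leb n \<partial>lborel)"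
    by (rule Fubini_Leb_lborel[OF K_meas])
  also have "\<dots> = ?rhs"
  proof (rule nn_integral_cong)
    fix p :: real
    show "(\<integral>\<^sup>+\<nu>. K \<nu> p \<partial>Leb n) = (if 0 < p then ennreal ((1 - q) ^ Suc m * p ^ m) *
       (\<integral>\<^sup>+\<nu>. \<integral>\<^sup>+v. (if P \<nu> \<and> osimplex m v then \<Phi> \<nu> (\<lambda>j\<in>{..<Suc m}. (1 - q) * p * sext m v j) else 0) \<partial>Leb m \<partial>Leb n)
      else 0)"
    proof (cases "0 < p")
      case True
      have [measurable]: "(\<lambda>u. \<lambda>j\<in>{..<Suc m}. (1 - q) * p * sext m (snd u) j) \<in> measurable (Leb n \<Otimes>\<^sub>M Leb m) (Leb (Suc m))"
        by (rule sc) measurable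
      have "(\<integral>\<^sup>+\<nu>. K \<nu> p \<partial>Leb n) = (\<integral>\<^sup>+\<nu>. ennreal ((1 - q) ^ Suc m * p ^ m) *
        (\<integral>\<^sup>+v. (if P \<nu> \<and> osimplex m v then \<Phi> \<nu> (\<lambda>j\<in>{..<Suc m}. (1 - q) * p * sext m v j) else 0) \<partial>Leb m) \<partial>Leb n)"
        by (rule nn_integral_cong) (simp add: K_def True)
      also have "\<dots> = ennreal ((1 - q) ^ Suc m * p ^ m) *
       (\<integral>\<^sup>+\<nu>. \<integral>\<^sup>+v. (if P \<nu> \<and> osimplex m v then \<Phi> \<nu> (\<lambda>j\<in>{..<Suc m}. (1 - q) * p * sext m v j) else 0) \<partial>Leb m \<partial>Leb n)"
        by (rule nn_integral_cmult, rule borel_measurable_nn_integral_Leb) (unfold case_prod_beta', measurable)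
      finally show ?thesis using True by simp
    qed (simp add: K_def)
  qed
  finally show ?thesis .
qed

lemma sext_sum: "(\<Sum>j<Suc m. sext m v j) = 1"
proof -
  have "(\<Sum>j<m. sext m v j) = (\<Sum>j<m. v j)" by (rule sum.cong) (simp_all add: sext_def)
  then show ?thesis by (simp add: sext_def)
qed

lemma sext_pos: "osimplex m v \<Longrightarrow> j < Suc m \<Longrightarrow> 0 < sext m v j"
  by (auto simp: sext_def osimplex_def)

lemma sum_div_one_minus_ge_1:
  assumes "osimplex m v" "\<And>j. j < Suc m \<Longrightarrow> 0 \<le> y j \<and> y j < 1"
  shows "1 \<le> (\<Sum>j<Suc m. sext m v j / (1 - y j))"
proof -
  have "(\<Sum>j<Suc m. sext m v j) \<le> (\<Sum>j<Suc m. sext m v j / (1 - y j))"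
  proof (rule sum_mono)
    fix j assume j: "j \<in> {..<Suc m}"
    have "sext m v j * (1 - y j) \<le> sext m v j * 1"
      using sext_pos[OF assms(1), of j] assms(2)[of j] j by (intro mult_left_mono) auto
    then show "sext m v j \<le> sext m v j / (1 - y j)"
      using assms(2)[of j] j by (simp add: pos_le_divide_eq)
  qed
  then show ?thesis by (simp only: sext_sum)
qed

lemma wmom_scale: "wmom n y (\<lambda>j\<in>{..<n}. c * \<kappa> j) = (\<lambda>k. c * wmom n y \<kappa> k)"
  by (auto simp: wmom_def fun_eq_iff sum_distrib_left mult.assoc intro!: sum.cong)

text \<open>If the integrand is homogeneous up to a factor \<open>\<Theta>\<close> that vanishes for
  \<open>p \<ge> 1\<close>, the radial variable splits off on the unit interval. The exponents
  collect \<open>m\<close> from the polar Jacobian, \<open>d\<close> from homogeneity and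
  \<open>e\<close> from the remaining power of \<open>1 - q\<close>; the additional 1 on
  \<open>1 - q\<close> comes from substituting \<open>(1 - q) * p\<close> for the radius.\<close>

lemma nn_integral_polar_factor:
  assumes \<Phi>: "case_prod \<Phi> \<in> borel_measurable (Leb n \<Otimes>\<^sub>M Leb (Suc m))"
    and P [measurable]: "Measurable.pred (Leb n) P" and q: "0 \<le> q" "q < 1"
    and \<Theta> [measurable]: "\<And>p. case_prod (\<Theta> p) \<in> borel_measurable (Leb n \<Otimes>\<^sub>M Leb m)"
    and scale: "\<And>p \<nu> v. 0 < p \<Longrightarrow> P \<nu> \<Longrightarrow> osimplex m v \<Longrightarrow>
      \<Phi> \<nu> (\<lambda>j\<in>{..<Suc m}. (1 - q) * p * sext m v j) = ennreal (((1 - q) * p) powr d * (1 - q) powr e) * \<Theta> p \<nu> v"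
    and zero: "\<And>p \<nu> v. 1 \<le> p \<Longrightarrow> P \<nu> \<Longrightarrow> osimplex m v \<Longrightarrow> \<Theta> p \<nu> v = 0"
  shows "(\<integral>\<^sup>+\<nu>. \<integral>\<^sup>+\<rho>. (if P \<nu> \<and> (\<forall>j<Suc m. 0 < \<rho> j) then \<Phi> \<nu> \<rho> else 0) \<partial>Leb (Suc m) \<partial>Leb n) =
    (\<integral>\<^sup>+p. (if 0 < p \<and> p < 1 then ennreal ((1 - q) powr (real m + 1 + d + e) * p powr (real m + d)) *
       (\<integral>\<^sup>+\<nu>. \<integral>\<^sup>+v. (if P \<nu> \<and> osimplex m v then \<Theta> p \<nu> v else 0) \<partial>Leb m \<partial>Leb n) else 0) \<partial>lborel)"
  unfolding nn_integral_polar_step[OF \<Phi> P q]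
proof (rule nn_integral_cong)
  fix p :: real
  define c where "c = ((1 - q) * p) powr d * (1 - q) powr e"
  define G where "G \<nu> v = (if P \<nu> \<and> osimplex m v then \<Theta> p \<nu> v else 0)" for \<nu> v
  define L where "L = (\<integral>\<^sup>+\<nu>. \<integral>\<^sup>+v. (if P \<nu> \<and> osimplex m v then \<Phi> \<nu> (\<lambda>j\<in>{..<Suc m}. (1 - q) * p * sext m v j) else 0) \<partial>Leb m \<partial>Leb n)"
  have G_meas [measurable]: "case_prod G \<in> borel_measurable (Leb n \<Otimes>\<^sub>M Leb m)" unfolding G_def by measurable
  have "ennreal ((1 - q) ^ Suc m * p ^ m) * L =
    (if p < 1 then ennreal ((1 - q) powr (real m + 1 + d + e) * p powr (real m + d)) * (\<integral>\<^sup>+\<nu>. \<integral>\<^sup>+v. G \<nu> v \<partial>Leb m \<partial>Leb n) else 0)" if p: "0 < p"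
  proof -
    have "(if P \<nu> \<and> osimplex m v then \<Phi> \<nu> (\<lambda>j\<in>{..<Suc m}. (1 - q) * p * sext m v j) else 0) = ennreal c * G \<nu> v" for \<nu> v
      using scale[OF p, of \<nu> v] by (simp add: G_def c_def)
    then have "L = (\<integral>\<^sup>+\<nu>. \<integral>\<^sup>+v. ennreal c * G \<nu> v \<partial>Leb m \<partial>Leb n)" unfolding L_def by simp
    also have "\<dots> = (\<integral>\<^sup>+\<nu>. ennreal c * (\<integral>\<^sup>+v. G \<nu> v \<partial>Leb m) \<partial>Leb n)"
    proof (rule nn_integral_cong)
      fix \<nu> assume [measurable]: "\<nu> \<in> space (Leb n)"
      show "(\<integral>\<^sup>+v. ennreal c * G \<nu> v \<partial>Leb m) = ennreal c * (\<integral>\<^sup>+v. G \<nu> v \<partial>Leb m)"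
        by (rule nn_integral_cmult) measurable
    qed
    also have "\<dots> = ennreal c * (\<integral>\<^sup>+\<nu>. \<integral>\<^sup>+v. G \<nu> v \<partial>Leb m \<partial>Leb n)"
      by (rule nn_integral_cmult) measurable
    finally have L: "L = ennreal c * (\<integral>\<^sup>+\<nu>. \<integral>\<^sup>+v. G \<nu> v \<partial>Leb m \<partial>Leb n)" .
    show ?thesis
    proof (cases "p < 1")
      case True
      have "(1 - q) ^ Suc m = (1 - q) powr (real m + 1)" "p ^ m = p powr real m"
        using q p by (simp_all add: powr_realpow[symmetric] powr_add)
      then have "(1 - q) ^ Suc m * p ^ m * c = (1 - q) powr (real m + 1 + d + e) * p powr (real m + d)"
        using q p by (simp add: c_def powr_mult powr_add)
      then have "ennreal ((1 - q) ^ Suc m * p ^ m) * ennreal c = ennreal ((1 - q) powr (real m + 1 + d + e) * p powr (real m + d))"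
        using q p by (subst ennreal_mult[symmetric]) (auto simp: c_def)
      then show ?thesis unfolding L mult.assoc[symmetric] using True by simp
    next
      case False
      then have "G = (\<lambda>_ _. 0)" using zero[of p] by (intro ext) (simp add: G_def)
      then show ?thesis using False unfolding L by simp
    qed
  qed
  then show "(if 0 < p then ennreal ((1 - q) ^ Suc m * p ^ m) *
      (\<integral>\<^sup>+\<nu>. \<integral>\<^sup>+v. (if P \<nu> \<and> osimplex m v then \<Phi> \<nu> (\<lambda>j\<in>{..<Suc m}. (1 - q) * p * sext m v j) else 0) \<partial>Leb m \<partial>Leb n) else 0) =
    (if 0 < p \<and> p < 1 then ennreal ((1 - q) powr (real m + 1 + d + e) * p powr (real m + d)) *
      (\<integral>\<^sup>+\<nu>. \<integral>\<^sup>+v. (if P \<nu> \<and> osimplex m v then \<Theta> p \<nu> v else 0) \<partial>Leb m \<partial>Leb n) else 0)"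
    unfolding L_def[symmetric] G_def[symmetric] by (cases "0 < p"; cases "p < 1") simp_all
qed

text \<open>The weights sum to one and every \<open>1 - y j\<close> is at most 1, so the sum is at
  least 1 and a factor \<open>p \<ge> 1\<close> cannot bring it below 1. This confines the radial
  variable to the unit interval.\<close>

lemma not_small_sum:
  assumes "osimplex m v" "1 \<le> p" "\<And>j. j < Suc m \<Longrightarrow> 0 \<le> y j"
  shows "\<not> ((\<forall>j<Suc m. y j < 1) \<and> p * (\<Sum>j<Suc m. sext m v j / (1 - y j)) < 1)"
proof
  assume "(\<forall>j<Suc m. y j < 1) \<and> p * (\<Sum>j<Suc m. sext m v j / (1 - y j)) < 1"
  moreover from this have "1 \<le> (\<Sum>j<Suc m. sext m v j / (1 - y j))"
    using assms by (intro sum_div_one_minus_ge_1) auto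
  then have "1 * 1 \<le> p * (\<Sum>j<Suc m. sext m v j / (1 - y j))" using assms(2) by (intro mult_mono) auto
  ultimately show False by linarith
qed

text \<open>The roots are exchanged and polar coordinates with total mass \<open>(1 - q) * p\<close>
  are introduced. By \<open>stage1_wmom\<close> the old moments are the \<open>stj\<close> transform
  of the moments of the residues, and these are \<open>(1 - q) * p\<close> times the moments of a
  probability measure; hence the new argument of \<open>F\<close>.\<close>

lemma Psi1_step:
  assumes F [measurable]: "F \<in> borel_measurable Mseq" and q: "0 \<le> q" "q < 1"
  shows "Psi1 s A B m q F = (\<integral>\<^sup>+p. (if 0 < p \<and> p < 1
    then ennreal ((1 - q) powr (real m + 1 + real m * s + A + B) * p powr (real m + real m * s + A))
      * Psi2 s A B m p (\<lambda>M. F (stj (\<lambda>k. (1 - q) * p * M k))) else 0) \<partial>lborel)"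
proof -
  define \<Phi> where "\<Phi> l w = F (wmom (Suc m) l w) * ennreal (wt1 s A B m q l w)" for l w
  define \<Phi>' where "\<Phi>' \<nu> \<rho> = F (stj (wmom (Suc m) (case_nat 0 \<nu>) \<rho>)) * ennreal (wt1' s A B m q \<nu> \<rho>)" for \<nu> \<rho>
  define vv where "vv \<nu> = vand m \<nu> * vand (Suc m) (case_nat 0 \<nu>)" for \<nu> :: "nat \<Rightarrow> real"
  define \<Theta> where "\<Theta> p \<nu> v = F (stj (\<lambda>k. (1 - q) * p * wmom (Suc m) (case_nat 0 \<nu>) (sext m v) k))
    * ennreal (wt2 s A B m p \<nu> (sext m v)) * ennreal (vv \<nu>)" for p \<nu> v
  have \<Phi>_meas: "case_prod \<Phi> \<in> borel_measurable (Leb (Suc m) \<Otimes>\<^sub>M Leb (Suc m))"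
    unfolding \<Phi>_def case_prod_beta' by measurable
  have cn: "(\<lambda>u. case_nat 0 (f u) i) \<in> borel_measurable N"
    if "f \<in> measurable N (Leb m)" "i < Suc m" for f :: "_ \<Rightarrow> nat \<Rightarrow> real" and i and N :: "'c measure"
    by (rule measurable_case_nat_component[OF measurable_Leb_component[OF that(1)] that(2)])
  have \<Phi>'_meas [measurable]: "case_prod \<Phi>' \<in> borel_measurable (Leb m \<Otimes>\<^sub>M Leb (Suc m))"
  proof -
    have [measurable]: "(\<lambda>u. wmom (Suc m) (case_nat 0 (fst u)) (snd u)) \<in> measurable (Leb m \<Otimes>\<^sub>M Leb (Suc m)) Mseq"
      by (rule measurable_wmom, rule cn) measurable
    show ?thesis unfolding \<Phi>'_def case_prod_beta' by measurable
  qed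
  have vv_meas [measurable]: "vv \<in> borel_measurable (Leb m)"
  proof -
    have [measurable]: "(\<lambda>\<nu>. vand (Suc m) (case_nat 0 \<nu>)) \<in> borel_measurable (Leb m)"
      by (rule measurable_vand, rule cn) measurable
    show ?thesis unfolding vv_def by measurable
  qed
  have P_meas [measurable]: "Measurable.pred (Leb m) (pincr m)" by (rule measurable_pincr) measurable
  have "Psi1 s A B m q F = (\<integral>\<^sup>+\<nu>. \<integral>\<^sup>+\<rho>. (if pincr m \<nu> \<and> (\<forall>j<Suc m. 0 < \<rho> j)
      then \<Phi>' \<nu> \<rho> * ennreal (vv \<nu>) else 0) \<partial>Leb (Suc m) \<partial>Leb m)"
    unfolding Psi1_def \<Phi>_def[symmetric] vv_def
    by (rule nn_integral_swap_roots[OF \<Phi>_meas \<Phi>'_meas]) (simp add: \<Phi>_def \<Phi>'_def stage1_wmom stage1_wt)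
  also have "\<dots> = (\<integral>\<^sup>+p. (if 0 < p \<and> p < 1
    then ennreal ((1 - q) powr (real m + 1 + (real m * s + A) + B) * p powr (real m + (real m * s + A)))
      * (\<integral>\<^sup>+\<nu>. \<integral>\<^sup>+v. (if pincr m \<nu> \<and> osimplex m v then \<Theta> p \<nu> v else 0) \<partial>Leb m \<partial>Leb m) else 0) \<partial>lborel)"
  proof (rule nn_integral_polar_factor[where \<Phi> = "\<lambda>\<nu> \<rho>. \<Phi>' \<nu> \<rho> * ennreal (vv \<nu>)", OF _ P_meas q])
    show "case_prod (\<Theta> p) \<in> borel_measurable (Leb m \<Otimes>\<^sub>M Leb m)" for p
    proof -
      have sx: "(\<lambda>u. sext m (snd u) i) \<in> borel_measurable (Leb m \<Otimes>\<^sub>M Leb m)" if "i < Suc m" for i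
        by (rule measurable_Leb_component[OF _ that]) measurable
      have [measurable]: "(\<lambda>u. wmom (Suc m) (case_nat 0 (fst u)) (sext m (snd u))) \<in> measurable (Leb m \<Otimes>\<^sub>M Leb m) Mseq"
        by (rule measurable_wmom, rule cn[OF measurable_fst], assumption, erule sx)
      have [measurable]: "(\<lambda>u. wt2 s A B m p (fst u) (sext m (snd u))) \<in> borel_measurable (Leb m \<Otimes>\<^sub>M Leb m)"
        by (rule measurable_wt2) (simp_all add: sx measurable_Leb_component[OF measurable_fst])
      show ?thesis unfolding \<Theta>_def case_prod_beta' by measurable
    qed
  next
    fix p :: real and \<nu> v assume p: "0 < p" "pincr m \<nu>" "osimplex m v"
    have "wt1' s A B m q \<nu> (\<lambda>j\<in>{..<Suc m}. (1 - q) * p * sext m v j) =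
       ((1 - q) * p) powr (real m * s + A) * (1 - q) powr B * wt2 s A B m ((1 - q) * p / (1 - q)) \<nu> (sext m v)"
      by (rule wt1'_scale) (use q p pincr_pos in auto)
    also have "(1 - q) * p / (1 - q) = p" using q by simp
    finally have w: "ennreal (wt1' s A B m q \<nu> (\<lambda>j\<in>{..<Suc m}. (1 - q) * p * sext m v j)) =
        ennreal (((1 - q) * p) powr (real m * s + A) * (1 - q) powr B) * ennreal (wt2 s A B m p \<nu> (sext m v))"
      by (simp only:) (simp add: ennreal_mult')
    show "\<Phi>' \<nu> (\<lambda>j\<in>{..<Suc m}. (1 - q) * p * sext m v j) * ennreal (vv \<nu>) =
        ennreal (((1 - q) * p) powr (real m * s + A) * (1 - q) powr B) * \<Theta> p \<nu> v"
      unfolding \<Phi>'_def \<Theta>_def wmom_scale w by (simp only: ac_simps)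
  next
    fix p :: real and \<nu> v assume p: "1 \<le> p" "pincr m \<nu>" "osimplex m v"
    have "0 \<le> case_nat 0 \<nu> j" if "j < Suc m" for j
      using that pincr_pos[OF p(2)] by (cases j) (auto intro: less_imp_le)
    then have "\<not> ((\<forall>j<Suc m. case_nat 0 \<nu> j < 1) \<and> p * (\<Sum>j<Suc m. sext m v j / (1 - case_nat 0 \<nu> j)) < 1)"
      by (rule not_small_sum[OF p(3,1)])
    then have "wt2 s A B m p \<nu> (sext m v) = 0" unfolding wt2_def Let_def all_case_nat_less by (simp only: if_False)
    then show "\<Theta> p \<nu> v = 0" by (simp add: \<Theta>_def)
  qed measurable
  finally show ?thesis unfolding Psi2_def \<Theta>_def vv_def by (simp only: add.assoc)
qed

lemma Psi2_step:
  assumes F [measurable]: "F \<in> borel_measurable Mseq" and q: "0 \<le> q" "q < 1"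
  shows "Psi2 s A B (Suc m) q F = (\<integral>\<^sup>+p. (if 0 < p \<and> p < 1
    then ennreal ((1 - q) powr (real m + 1 + real (Suc m) * s + B) * p powr (real m + real (Suc m) * s))
      * Psi1 s A B m p (\<lambda>M. F (stj (\<lambda>k. (1 - q) * p * M k))) else 0) \<partial>lborel)"
proof -
  define \<Phi> where "\<Phi> l w = F (wmom (Suc (Suc m)) (case_nat 0 l) w) * ennreal (wt2 s A B (Suc m) q l w)" for l w
  define \<Phi>' where "\<Phi>' \<xi> \<rho> = F (stj (wmom (Suc m) \<xi> \<rho>)) * ennreal (wt2' s A B (Suc m) q \<xi> \<rho>)" for \<xi> \<rho>
  define vv where "vv \<xi> = (vand (Suc m) \<xi>)\<^sup>2" for \<xi> :: "nat \<Rightarrow> real"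
  define \<Theta> where "\<Theta> p \<xi> v = F (stj (\<lambda>k. (1 - q) * p * wmom (Suc m) \<xi> (sext m v) k))
    * ennreal (wt1 s A B m p \<xi> (sext m v)) * ennreal (vv \<xi>)" for p \<xi> v
  have cn: "(\<lambda>u. case_nat 0 (f u) i) \<in> borel_measurable N"
    if "f \<in> measurable N (Leb (Suc m))" "i < Suc (Suc m)" for f :: "_ \<Rightarrow> nat \<Rightarrow> real" and i and N :: "'c measure"
    by (rule measurable_case_nat_component[OF measurable_Leb_component[OF that(1)] that(2)])
  have \<Phi>_meas: "case_prod \<Phi> \<in> borel_measurable (Leb (Suc m) \<Otimes>\<^sub>M Leb (Suc (Suc m)))"
  proof -
    have [measurable]: "(\<lambda>u. wmom (Suc (Suc m)) (case_nat 0 (fst u)) (snd u)) \<in> measurable (Leb (Suc m) \<Otimes>\<^sub>M Leb (Suc (Suc m))) Mseq"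
      by (rule measurable_wmom, rule cn) measurable
    show ?thesis unfolding \<Phi>_def case_prod_beta' by measurable
  qed
  have \<Phi>'_meas [measurable]: "case_prod \<Phi>' \<in> borel_measurable (Leb (Suc m) \<Otimes>\<^sub>M Leb (Suc m))"
  proof -
    have [measurable]: "(\<lambda>u. wmom (Suc m) (fst u) (snd u)) \<in> measurable (Leb (Suc m) \<Otimes>\<^sub>M Leb (Suc m)) Mseq"
      by (rule measurable_wmom) measurable
    have [measurable]: "(\<lambda>u. stj (wmom (Suc m) (fst u) (snd u))) \<in> measurable (Leb (Suc m) \<Otimes>\<^sub>M Leb (Suc m)) Mseq"
      by (rule measurable_stj) measurable
    have [measurable]: "(\<lambda>u. wt2' s A B (Suc m) q (fst u) (snd u)) \<in> borel_measurable (Leb (Suc m) \<Otimes>\<^sub>M Leb (Suc m))"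
      by (rule measurable_wt2') measurable
    show ?thesis unfolding \<Phi>'_def case_prod_beta' by measurable
  qed
  have vv_meas [measurable]: "vv \<in> borel_measurable (Leb (Suc m))"
    unfolding vv_def by measurable
  have P_meas [measurable]: "Measurable.pred (Leb (Suc m)) (pincr (Suc m))" by (rule measurable_pincr) measurable
  have "Psi2 s A B (Suc m) q F = (\<integral>\<^sup>+\<xi>. \<integral>\<^sup>+\<rho>. (if pincr (Suc m) \<xi> \<and> (\<forall>j<Suc m. 0 < \<rho> j)
      then \<Phi>' \<xi> \<rho> * ennreal (vv \<xi>) else 0) \<partial>Leb (Suc m) \<partial>Leb (Suc m))"
    unfolding Psi2_def \<Phi>_def[symmetric] vv_def
    by (rule nn_integral_swap_roots_0[OF \<Phi>_meas \<Phi>'_meas]) (simp only: \<Phi>_def \<Phi>'_def stage2_wmom stage2_wt)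
  also have "\<dots> = (\<integral>\<^sup>+p. (if 0 < p \<and> p < 1
    then ennreal ((1 - q) powr (real m + 1 + real (Suc m) * s + B) * p powr (real m + real (Suc m) * s))
      * (\<integral>\<^sup>+\<xi>. \<integral>\<^sup>+v. (if pincr (Suc m) \<xi> \<and> osimplex m v then \<Theta> p \<xi> v else 0) \<partial>Leb m \<partial>Leb (Suc m)) else 0) \<partial>lborel)"
  proof (rule nn_integral_polar_factor[where \<Phi> = "\<lambda>\<xi> \<rho>. \<Phi>' \<xi> \<rho> * ennreal (vv \<xi>)", OF _ P_meas q])
    show "case_prod (\<Theta> p) \<in> borel_measurable (Leb (Suc m) \<Otimes>\<^sub>M Leb m)" for p
    proof -
      have sx: "(\<lambda>u. sext m (snd u) i) \<in> borel_measurable (Leb (Suc m) \<Otimes>\<^sub>M Leb m)" if "i < Suc m" for i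
        by (rule measurable_Leb_component[OF _ that]) measurable
      have [measurable]: "(\<lambda>u. wmom (Suc m) (fst u) (sext m (snd u))) \<in> measurable (Leb (Suc m) \<Otimes>\<^sub>M Leb m) Mseq"
        by (rule measurable_wmom) (simp_all add: sx measurable_Leb_component[OF measurable_fst])
      have [measurable]: "(\<lambda>u. wt1 s A B m p (fst u) (sext m (snd u))) \<in> borel_measurable (Leb (Suc m) \<Otimes>\<^sub>M Leb m)"
        by (rule measurable_wt1) (simp_all add: sx measurable_Leb_component[OF measurable_fst])
      show ?thesis unfolding \<Theta>_def case_prod_beta' by measurable
    qed
  next
    fix p :: real and \<xi> v assume p: "0 < p" "pincr (Suc m) \<xi>" "osimplex m v"
    have "wt2' s A B (Suc m) q \<xi> (\<lambda>j\<in>{..<Suc m}. (1 - q) * p * sext m v j) =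
       ((1 - q) * p) powr (real (Suc m) * s) * (1 - q) powr B * wt1 s A B m ((1 - q) * p / (1 - q)) \<xi> (sext m v)"
      by (rule wt2'_scale) (use q p pincr_pos in auto)
    also have "(1 - q) * p / (1 - q) = p" using q by simp
    finally have w: "ennreal (wt2' s A B (Suc m) q \<xi> (\<lambda>j\<in>{..<Suc m}. (1 - q) * p * sext m v j)) =
        ennreal (((1 - q) * p) powr (real (Suc m) * s) * (1 - q) powr B) * ennreal (wt1 s A B m p \<xi> (sext m v))"
      by (simp only:) (simp add: ennreal_mult')
    show "\<Phi>' \<xi> (\<lambda>j\<in>{..<Suc m}. (1 - q) * p * sext m v j) * ennreal (vv \<xi>) =
        ennreal (((1 - q) * p) powr (real (Suc m) * s) * (1 - q) powr B) * \<Theta> p \<xi> v"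
      unfolding \<Phi>'_def \<Theta>_def wmom_scale w by (simp only: ac_simps)
  next
    fix p :: real and \<xi> v assume p: "1 \<le> p" "pincr (Suc m) \<xi>" "osimplex m v"
    from not_small_sum[where y = \<xi>, OF p(3,1) less_imp_le[OF pincr_pos[OF p(2)]]]
    have "wt1 s A B m p \<xi> (sext m v) = 0" unfolding wt1_def Let_def by (simp only: if_False)
    then show "\<Theta> p \<xi> v = 0" by (simp add: \<Theta>_def)
  qed measurable
  finally show ?thesis unfolding Psi1_def \<Theta>_def vv_def .
qed

section \<open>Canonical moments and their Beta law\<close>

text \<open>\<open>mS z\<close> are the moments whose generating function is the continued fraction
\<open>1 / (1 - z 0 * t / (1 - z 1 * t / (1 - \<dots>)))\<close>. Indices are shifted by one: \<open>z i\<close> here is \<open>z (i + 1)\<close> of the recursion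
coefficients in the statement.\<close>

fun mS :: "(nat \<Rightarrow> real) \<Rightarrow> nat \<Rightarrow> real" where
  "mS z 0 = 1"
| "mS z (Suc k) = (\<Sum>i\<le>k. mS z i * (z 0 * mS (\<lambda>j. z (Suc j)) (k - i)))"

lemma mS_stj: "mS z = stj (\<lambda>k. z 0 * mS (\<lambda>j. z (Suc j)) k)"
  by (rule stj_unique) simp_all

lemma measurable_mS [measurable (raw)]:
  assumes "\<And>i. (\<lambda>u. z u i) \<in> borel_measurable N"
  shows "(\<lambda>u. mS (z u) k) \<in> borel_measurable N"
  using assms
proof (induction k arbitrary: z rule: less_induct)
  case (less k)
  show ?case
  proof (cases k)
    case (Suc j)
    have "(\<lambda>u. \<Sum>i\<le>j. mS (z u) i * (z u 0 * mS (\<lambda>j. z u (Suc j)) (j - i))) \<in> borel_measurable N"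
    proof (intro borel_measurable_sum borel_measurable_times)
      fix i assume "i \<in> {..j}"
      then show "(\<lambda>u. mS (z u) i) \<in> borel_measurable N" "(\<lambda>u. mS (\<lambda>j. z u (Suc j)) (j - i)) \<in> borel_measurable N"
        using Suc less.prems by (auto intro!: less.IH)
    qed (rule less.prems)
    then show ?thesis using Suc by simp
  qed simp
qed

text \<open>The recursion coefficients are \<open>z i = (1 - p (i - 1)) * p i\<close> for the canonical moments \<open>p\<close>, where \<open>p (-1) = q\<close>.\<close>

definition zv :: "real \<Rightarrow> (nat \<Rightarrow> real) \<Rightarrow> nat \<Rightarrow> real" where
  "zv q x = (\<lambda>i. (1 - case_nat q x i) * x i)"

text \<open>A measure with finitely many atoms has a terminating continued fraction, so canonical
  moments from index \<open>N\<close> on are set to 0. The offset \<open>j\<close> drops the moments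
  that have already been split off.\<close>

definition trunc :: "nat \<Rightarrow> nat \<Rightarrow> (nat \<Rightarrow> real) \<Rightarrow> nat \<Rightarrow> real" where
  "trunc N j p = (\<lambda>i. if j + i < N then p (j + i) else 0)"

definition beta_distr :: "real \<Rightarrow> real \<Rightarrow> real measure" where
  "beta_distr \<alpha> \<gamma> = density lborel (\<lambda>p. ennreal (indicator {0<..<1} p * (p powr (\<alpha> - 1) * (1 - p) powr (\<gamma> - 1)) / Beta \<alpha> \<gamma>))"

lemma sets_beta_distr [measurable_cong, simp]: "sets (beta_distr \<alpha> \<gamma>) = sets borel"
  by (simp add: beta_distr_def)

lemma space_beta_distr [simp]: "space (beta_distr \<alpha> \<gamma>) = UNIV"
  by (simp add: beta_distr_def)

lemma Beta_real_pos: "\<alpha> > 0 \<Longrightarrow> \<gamma> > 0 \<Longrightarrow> Beta \<alpha> (\<gamma>::real) > 0"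
  by (simp add: Beta_def Gamma_real_pos)

lemma nn_integral_Beta:
  assumes "\<alpha> > 0" "\<gamma> > 0"
  shows "(\<integral>\<^sup>+p. ennreal (indicator {0<..<1} p * (p powr (\<alpha> - 1) * (1 - p) powr (\<gamma> - 1))) \<partial>lborel) = ennreal (Beta \<alpha> \<gamma>)"
proof (rule nn_integral_has_integral_lborel)
  have e: "(\<lambda>p. indicator {0<..<1} p * (p powr (\<alpha> - 1) * (1 - p) powr (\<gamma> - 1))) =
      (\<lambda>p. if p \<in> {0<..<1} then p powr (\<alpha> - 1) * (1 - p) powr (\<gamma> - 1) else (0::real))"
    by (auto simp: fun_eq_iff indicator_def)
  have "((\<lambda>t. t powr (\<alpha> - 1) * (1 - t) powr (\<gamma> - 1)) has_integral Beta \<alpha> \<gamma>) {0..1}"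
    by (rule has_integral_Beta_real[OF assms])
  then have "((\<lambda>t. t powr (\<alpha> - 1) * (1 - t) powr (\<gamma> - 1)) has_integral Beta \<alpha> \<gamma>) {0<..<1}"
    by (subst (asm) has_integral_Icc_iff_Ioo)
  then show "((\<lambda>p. indicator {0<..<1} p * (p powr (\<alpha> - 1) * (1 - p) powr (\<gamma> - 1))) has_integral Beta \<alpha> \<gamma>) UNIV"
    by (subst (asm) has_integral_restrict_UNIV[symmetric]) (simp only: e)
qed (auto intro!: mult_nonneg_nonneg)

lemma nn_integral_beta_distr:
  assumes [measurable]: "f \<in> borel_measurable borel" and "\<alpha> > 0" "\<gamma> > 0"
  shows "(\<integral>\<^sup>+p. (if 0 < p \<and> p < 1 then ennreal (p powr (\<alpha> - 1) * (1 - p) powr (\<gamma> - 1)) * f p else 0) \<partial>lborel) =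
     ennreal (Beta \<alpha> \<gamma>) * (\<integral>\<^sup>+p. f p \<partial>beta_distr \<alpha> \<gamma>)" (is "?lhs = _")
proof -
  have "(\<integral>\<^sup>+p. f p \<partial>beta_distr \<alpha> \<gamma>) =
     (\<integral>\<^sup>+p. ennreal (indicator {0<..<1} p * (p powr (\<alpha> - 1) * (1 - p) powr (\<gamma> - 1)) / Beta \<alpha> \<gamma>) * f p \<partial>lborel)"
    unfolding beta_distr_def by (subst nn_integral_density) auto
  then have "ennreal (Beta \<alpha> \<gamma>) * (\<integral>\<^sup>+p. f p \<partial>beta_distr \<alpha> \<gamma>) =
     (\<integral>\<^sup>+p. ennreal (Beta \<alpha> \<gamma>) * (ennreal (indicator {0<..<1} p * (p powr (\<alpha> - 1) * (1 - p) powr (\<gamma> - 1)) / Beta \<alpha> \<gamma>) * f p) \<partial>lborel)"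
    by (simp add: nn_integral_cmult)
  also have "\<dots> = ?lhs"
  proof (rule nn_integral_cong)
    fix p :: real
    have "ennreal (Beta \<alpha> \<gamma>) * ennreal (indicator {0<..<1} p * (p powr (\<alpha> - 1) * (1 - p) powr (\<gamma> - 1)) / Beta \<alpha> \<gamma>) =
      ennreal (indicator {0<..<1} p * (p powr (\<alpha> - 1) * (1 - p) powr (\<gamma> - 1)))"
      using Beta_real_pos[OF assms(2,3)] by (subst ennreal_mult[symmetric]) (auto simp: indicator_def)
    then show "ennreal (Beta \<alpha> \<gamma>) * (ennreal (indicator {0<..<1} p * (p powr (\<alpha> - 1) * (1 - p) powr (\<gamma> - 1)) / Beta \<alpha> \<gamma>) * f p) =
       (if 0 < p \<and> p < 1 then ennreal (p powr (\<alpha> - 1) * (1 - p) powr (\<gamma> - 1)) * f p else 0)"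
      by (simp add: mult.assoc[symmetric] indicator_def)
  qed
  finally show ?thesis by simp
qed

lemma prob_space_beta_distr: "\<alpha> > 0 \<Longrightarrow> \<gamma> > 0 \<Longrightarrow> prob_space (beta_distr \<alpha> \<gamma>)"
proof (rule prob_spaceI)
  assume a: "\<alpha> > 0" "\<gamma> > 0"
  have "ennreal (Beta \<alpha> \<gamma>) * (\<integral>\<^sup>+p. 1 \<partial>beta_distr \<alpha> \<gamma>) =
      (\<integral>\<^sup>+p. ennreal (indicator {0<..<1} p * (p powr (\<alpha> - 1) * (1 - p) powr (\<gamma> - 1))) \<partial>lborel)"
    by (subst nn_integral_beta_distr[of "\<lambda>_. 1", OF _ a, symmetric]) (auto intro!: nn_integral_cong simp: indicator_def)
  then have "ennreal (Beta \<alpha> \<gamma>) * (\<integral>\<^sup>+p. 1 \<partial>beta_distr \<alpha> \<gamma>) = ennreal (Beta \<alpha> \<gamma>) * 1"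
    using nn_integral_Beta[OF a] by simp
  then have "(\<integral>\<^sup>+p. 1 \<partial>beta_distr \<alpha> \<gamma>) = 1"
    using Beta_real_pos[OF a] unfolding ennreal_mult_cancel_left by simp
  then show "emeasure (beta_distr \<alpha> \<gamma>) (space (beta_distr \<alpha> \<gamma>)) = 1" by simp
qed

text \<open>Exponents that arise when \<open>r\<close> canonical moments are left to split off.\<close>

definition al :: "real \<Rightarrow> real \<Rightarrow> nat \<Rightarrow> real" where
  "al s A r = (if odd r then real (r div 2) * (1 + s) + A + 1 else real (r div 2) * (1 + s))"

definition ee :: "real \<Rightarrow> real \<Rightarrow> real \<Rightarrow> nat \<Rightarrow> real" where
  "ee s A B r = (if odd r then real (r div 2) * (1 + s) + 1 + A + B else real (r div 2) * (1 + s) + B)"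

text \<open>A probability measure on \<open>m + 1\<close> positive nodes has
  \<open>2 * m + 1\<close> free canonical moments, one on \<open>m\<close> positive nodes and the
  node 0 has \<open>2 * m\<close>; the parity of \<open>r\<close> therefore records which family is
  meant.\<close>

definition Psi :: "real \<Rightarrow> real \<Rightarrow> real \<Rightarrow> nat \<Rightarrow> real \<Rightarrow> ((nat \<Rightarrow> real) \<Rightarrow> ennreal) \<Rightarrow> ennreal" where
  "Psi s A B r q F = (if odd r then Psi1 s A B (r div 2) q F else Psi2 s A B (r div 2) q F)"

lemma Psi_Suc:
  assumes "F \<in> borel_measurable Mseq" "0 \<le> q" "q < 1"
  shows "Psi s A B (Suc r) q F = (\<integral>\<^sup>+p. (if 0 < p \<and> p < 1
    then ennreal ((1 - q) powr ee s A B (Suc r) * p powr (al s A (Suc r) - 1))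
      * Psi s A B r p (\<lambda>M. F (stj (\<lambda>k. (1 - q) * p * M k))) else 0) \<partial>lborel)"
proof (cases "odd r")
  case False
  then obtain m where m: "r = 2 * m" by (auto elim: evenE)
  have e: "ee s A B (Suc r) = real m + 1 + real m * s + A + B" "al s A (Suc r) - 1 = real m + real m * s + A"
    by (simp_all add: ee_def al_def m algebra_simps)
  have "Psi s A B (Suc r) q F = Psi1 s A B m q F" "\<And>q F. Psi s A B r q F = Psi2 s A B m q F"
    by (simp_all add: Psi_def m)
  then show ?thesis unfolding e by (simp only: Psi1_step[OF assms])
next
  case True
  then obtain m where m: "r = 2 * m + 1" by (elim oddE) auto
  have e: "ee s A B (Suc r) = real m + 1 + real (Suc m) * s + B" "al s A (Suc r) - 1 = real m + real (Suc m) * s"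
    by (simp_all add: ee_def al_def m algebra_simps)
  have "Psi s A B (Suc r) q F = Psi2 s A B (Suc m) q F" "\<And>q F. Psi s A B r q F = Psi1 s A B m q F"
    by (simp_all add: Psi_def m)
  then show ?thesis unfolding e by (simp only: Psi2_step[OF assms])
qed

lemma mS_0: "mS (\<lambda>_. 0) k = (if k = 0 then 1 else 0)"
  by (cases k) simp_all

text \<open>With nothing left to split off, the only node is 0 with mass 1, and its moments are
  those of the continued fraction without coefficients.\<close>

lemma Psi_0:
  assumes "0 \<le> q" "q < 1"
  shows "Psi s A B 0 q F = ennreal ((1 - q) powr ee s A B 0) * F (mS (\<lambda>_. 0))"
proof -
  have m: "wmom (Suc 0) (case_nat 0 \<nu>) (sext 0 v) = mS (\<lambda>_. 0)" for \<nu> v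
    by (auto simp: wmom_def fun_eq_iff mS_0 sext_def power_0_left)
  have w: "wt2 s A B 0 q \<nu> (sext 0 v) = (1 - q) powr B" for \<nu> v
    using assms by (simp add: wt2_def sext_def)
  have "Psi s A B 0 q F = Psi2 s A B 0 q F" by (simp add: Psi_def)
  also have "\<dots> = ennreal ((1 - q) powr ee s A B 0) * F (mS (\<lambda>_. 0))"
    unfolding Psi2_def nn_integral_Leb_0 m w
    by (simp add: pincr_iff incr_def osimplex_def vand_Suc ee_def mult.commute)
  finally show ?thesis .
qed

lemma zv_shift: "zv q (case_nat y t) = case_nat ((1 - q) * y) (zv y t)"
  by (auto simp: zv_def fun_eq_iff split: nat.split)

lemma mS_zv: "mS (zv q (case_nat y t)) = stj (\<lambda>k. (1 - q) * y * mS (zv y t) k)"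
  by (subst mS_stj) (simp add: zv_shift)

lemma trunc_upd: "i < N \<Longrightarrow> trunc N i (x(i := y)) = case_nat y (trunc N (Suc i) x)"
  by (auto simp: trunc_def fun_eq_iff split: nat.split)

lemma measurable_zv_trunc:
  assumes "\<And>k. k \<in> {i..<N} \<Longrightarrow> (\<lambda>u. x u k) \<in> borel_measurable M" "(\<lambda>u. q u) \<in> borel_measurable M"
  shows "(\<lambda>u. zv (q u) (trunc N i (x u)) j) \<in> borel_measurable M"
proof -
  have [measurable]: "(\<lambda>u. trunc N i (x u) k) \<in> borel_measurable M" for k
    using assms(1)[of "i + k"] by (cases "i + k < N") (auto simp: trunc_def)
  have [measurable]: "(\<lambda>u. case_nat (q u) (trunc N i (x u)) j) \<in> borel_measurable M"
    using assms(2) by (cases j) auto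
  show ?thesis unfolding zv_def by measurable
qed

context
  fixes s A B :: real and N :: nat
  assumes al: "\<And>r. r > 0 \<Longrightarrow> r \<le> N \<Longrightarrow> al s A r > 0" and ee: "\<And>r. r < N \<Longrightarrow> ee s A B r + 1 > 0"
begin

text \<open>Moment \<open>j\<close> is released when \<open>N - j\<close> moments are left, which
  gives the exponent of \<open>p\<close>; the exponent of \<open>1 - p\<close> is the power of
  \<open>1 - q\<close> that the following step leaves for \<open>q = p\<close>. From index
  \<open>N\<close> on the uniform law is filled in so that \<open>Bet\<close> is a family of
  probability measures on all indices.\<close>

definition Bet :: "nat \<Rightarrow> real measure" where
  "Bet j = (if j < N then beta_distr (al s A (N - j)) (ee s A B (N - Suc j) + 1) else beta_distr 1 1)"

lemma prob_space_Bet: "prob_space (Bet j)"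
  unfolding Bet_def using al[of "N - j"] ee[of "N - Suc j"] by (auto intro!: prob_space_beta_distr)

lemma sets_Bet [measurable_cong, simp]: "sets (Bet j) = sets borel"
  by (simp add: Bet_def)

interpretation Bet: product_sigma_finite Bet
  using prob_space_Bet by (simp add: product_sigma_finite_def prob_space_imp_sigma_finite)

text \<open>\<open>q\<close> has to stay general: the induction hypothesis is applied with
  \<open>q\<close> equal to the moment \<open>p\<close> just released, and the resulting power of
  \<open>1 - p\<close> supplies the second Beta exponent of that moment.\<close>

lemma Psi_iterate:
  assumes "F \<in> borel_measurable Mseq" "r \<le> N" "0 \<le> q" "q < 1"
  shows "Psi s A B r q F = ennreal ((1 - q) powr ee s A B r) *
      (ennreal (\<Prod>j<r. Beta (al s A (Suc j)) (ee s A B j + 1)) *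
      (\<integral>\<^sup>+p. F (mS (zv q (trunc N (N - r) p))) \<partial>PiM {N - r..<N} Bet))"
  using assms
proof (induction r arbitrary: F q)
  case 0
  have "zv q (trunc N N p) = (\<lambda>_. 0)" for p by (auto simp: zv_def trunc_def)
  then show ?case using Psi_0[OF 0(3,4)] by (simp add: PiM_empty nn_integral_count_space_finite)
next
  case (Suc r)
  note [measurable] = Suc.prems(1)
  define i where "i = N - Suc r"
  have i: "i < N" "N - r = Suc i" "Suc i \<le> N" using Suc.prems by (auto simp: i_def)
  have ins: "{i..<N} = insert i {Suc i..<N}" using i by auto
  have Bi: "Bet i = beta_distr (al s A (Suc r)) (ee s A B r + 1)"
    using Suc.prems by (simp add: Bet_def i_def Suc_diff_Suc)
  have pos: "al s A (Suc r) > 0" "ee s A B r + 1 > 0" using al[of "Suc r"] ee[of r] Suc.prems by auto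
  define Z where "Z = (\<Prod>j<r. Beta (al s A (Suc j)) (ee s A B j + 1))"
  have Z0: "Z \<ge> 0" unfolding Z_def
    using al ee Suc.prems by (intro prod_nonneg less_imp_le[OF Beta_real_pos] ballI) auto
  define h where "h p = (\<integral>\<^sup>+x. F (stj (\<lambda>k. (1 - q) * p * mS (zv p (trunc N (Suc i) x)) k)) \<partial>PiM {Suc i..<N} Bet)" for p
  have meas: "(\<lambda>u. F (stj (\<lambda>k. (1 - q) * fst u * mS (zv (fst u) (trunc N (Suc i) (snd u))) k))) \<in> borel_measurable (borel \<Otimes>\<^sub>M PiM {Suc i..<N} Bet)"
  proof -
    have [measurable]: "(\<lambda>u. mS (zv (fst u) (trunc N (Suc i) (snd u))) k) \<in> borel_measurable (borel \<Otimes>\<^sub>M PiM {Suc i..<N} Bet)" for k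
    proof (rule measurable_mS, rule measurable_zv_trunc)
      fix k assume "k \<in> {Suc i..<N}"
      then have "(\<lambda>x. x k) \<in> measurable (PiM {Suc i..<N} Bet) (Bet k)" by (rule measurable_component_singleton)
      then have [measurable]: "(\<lambda>x. x k) \<in> borel_measurable (PiM {Suc i..<N} Bet)" by (simp cong: measurable_cong_sets)
      show "(\<lambda>u. snd u k) \<in> borel_measurable (borel \<Otimes>\<^sub>M PiM {Suc i..<N} Bet)" by measurable
    qed measurable
    show ?thesis by measurable
  qed
  have h_meas [measurable]: "h \<in> borel_measurable borel"
  proof -
    have "sigma_finite_measure (PiM {Suc i..<N} Bet)" by (rule Bet.sigma_finite) simp
    then show ?thesis unfolding h_def[abs_def]
      by (rule sigma_finite_measure.borel_measurable_nn_integral) (use meas in \<open>simp add: case_prod_beta'\<close>)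
  qed
  have "Psi s A B (Suc r) q F = (\<integral>\<^sup>+p. (if 0 < p \<and> p < 1
    then ennreal ((1 - q) powr ee s A B (Suc r) * p powr (al s A (Suc r) - 1))
      * Psi s A B r p (\<lambda>M. F (stj (\<lambda>k. (1 - q) * p * M k))) else 0) \<partial>lborel)"
    by (rule Psi_Suc) (use Suc.prems in auto)
  also have "\<dots> = (\<integral>\<^sup>+p. (ennreal ((1 - q) powr ee s A B (Suc r)) * ennreal Z) *
     (if 0 < p \<and> p < 1 then ennreal (p powr (al s A (Suc r) - 1) * (1 - p) powr (ee s A B r + 1 - 1)) * h p else 0) \<partial>lborel)"
  proof (rule nn_integral_cong)
    fix p :: real
    show "(if 0 < p \<and> p < 1
    then ennreal ((1 - q) powr ee s A B (Suc r) * p powr (al s A (Suc r) - 1))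
      * Psi s A B r p (\<lambda>M. F (stj (\<lambda>k. (1 - q) * p * M k))) else 0) =
      (ennreal ((1 - q) powr ee s A B (Suc r)) * ennreal Z) *
     (if 0 < p \<and> p < 1 then ennreal (p powr (al s A (Suc r) - 1) * (1 - p) powr (ee s A B r + 1 - 1)) * h p else 0)"
    proof (cases "0 < p \<and> p < 1")
      case True
      have "Psi s A B r p (\<lambda>M. F (stj (\<lambda>k. (1 - q) * p * M k))) = ennreal ((1 - p) powr ee s A B r) * (ennreal Z * h p)"
        unfolding Z_def h_def i(2)[symmetric] by (rule Suc.IH) (use Suc.prems True in auto)
      then show ?thesis using True by (simp add: ennreal_mult' ac_simps)
    qed (auto simp del: not_less)
  qed
  also have "\<dots> = (ennreal ((1 - q) powr ee s A B (Suc r)) * ennreal Z) *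
    (\<integral>\<^sup>+p. (if 0 < p \<and> p < 1 then ennreal (p powr (al s A (Suc r) - 1) * (1 - p) powr (ee s A B r + 1 - 1)) * h p else 0) \<partial>lborel)"
    by (rule nn_integral_cmult) measurable
  also have "(\<integral>\<^sup>+p. (if 0 < p \<and> p < 1 then ennreal (p powr (al s A (Suc r) - 1) * (1 - p) powr (ee s A B r + 1 - 1)) * h p else 0) \<partial>lborel) =
      ennreal (Beta (al s A (Suc r)) (ee s A B r + 1)) * (\<integral>\<^sup>+p. h p \<partial>Bet i)"
    unfolding Bi by (rule nn_integral_beta_distr[OF h_meas pos])
  also have "(\<integral>\<^sup>+p. h p \<partial>Bet i) = (\<integral>\<^sup>+p. F (mS (zv q (trunc N i p))) \<partial>PiM {i..<N} Bet)"
  proof -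
    have "(\<lambda>p. mS (zv q (trunc N i p)) k) \<in> borel_measurable (PiM {i..<N} Bet)" for k
    proof (rule measurable_mS, rule measurable_zv_trunc)
      fix k assume "k \<in> {i..<N}"
      then have "(\<lambda>x. x k) \<in> measurable (PiM {i..<N} Bet) (Bet k)" by (rule measurable_component_singleton)
      then show "(\<lambda>x. x k) \<in> borel_measurable (PiM {i..<N} Bet)" by (simp cong: measurable_cong_sets)
    qed simp
    then have "(\<lambda>p. mS (zv q (trunc N i p))) \<in> measurable (PiM {i..<N} Bet) Mseq" by (rule measurable_MseqI)
    then have m: "(\<lambda>p. F (mS (zv q (trunc N i p)))) \<in> borel_measurable (PiM (insert i {Suc i..<N}) Bet)"
      unfolding ins by measurable
    show ?thesis
      unfolding ins h_def
      by (subst Bet.product_nn_integral_insert_rev[OF _ _ m]) (simp_all only: trunc_upd[OF i(1)] mS_zv finite_atLeastLessThan, simp)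
  qed
  finally have "Psi s A B (Suc r) q F = ennreal ((1 - q) powr ee s A B (Suc r)) * (ennreal Z * ennreal (Beta (al s A (Suc r)) (ee s A B r + 1))) *
     (\<integral>\<^sup>+p. F (mS (zv q (trunc N i p))) \<partial>PiM {i..<N} Bet)"
    by (simp only: mult.assoc)
  also have "ennreal Z * ennreal (Beta (al s A (Suc r)) (ee s A B r + 1)) = ennreal (\<Prod>j<Suc r. Beta (al s A (Suc j)) (ee s A B j + 1))"
    using Z0 Beta_real_pos[OF pos] by (simp add: Z_def ennreal_mult[symmetric])
  finally show ?case by (simp only: i_def mult.assoc)
qed

end

section \<open>Symmetrization\<close>

definition pmt :: "nat \<Rightarrow> (nat \<Rightarrow> nat) \<Rightarrow> (nat \<Rightarrow> real) \<Rightarrow> nat \<Rightarrow> real" where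
  "pmt n \<sigma> x = (\<lambda>i\<in>{..<n}. x (\<sigma> i))"

lemma permutes_lessThan: "\<sigma> permutes {..<n} \<Longrightarrow> i < n \<Longrightarrow> \<sigma> i < (n::nat)"
  by (metis lessThan_iff permutes_in_image)

lemma measurable_pmt:
  assumes "\<sigma> permutes {..<n}"
  shows "pmt n \<sigma> \<in> measurable (Leb n) (Leb n)"
  unfolding pmt_def[abs_def]
proof (rule measurable_restrict_Leb)
  fix i assume "i < n"
  then have lt: "\<sigma> i < n" by (rule permutes_lessThan[OF assms])
  have "(\<lambda>x. x (\<sigma> i)) \<in> measurable (Leb n) lborel" by (rule measurable_component_singleton) (simp add: lt)
  then show "(\<lambda>x. x (\<sigma> i)) \<in> borel_measurable (Leb n)" by simp
qed

lemma distr_Leb_pmt: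
  assumes s: "\<sigma> permutes {..<n}"
  shows "distr (Leb n) (Leb n) (pmt n \<sigma>) = Leb n"
proof (rule leb.PiM_eqI)
  fix A assume A: "\<And>i. i \<in> {..<n} \<Longrightarrow> A i \<in> sets (lborel :: real measure)"
  have inv: "inv \<sigma> permutes {..<n}" by (rule permutes_inv[OF s])
  have "pmt n \<sigma> -` (Pi\<^sub>E {..<n} A) \<inter> space (Leb n) = Pi\<^sub>E {..<n} (\<lambda>k. A (inv \<sigma> k))"
  proof (intro set_eqI iffI)
    fix x assume x: "x \<in> pmt n \<sigma> -` (Pi\<^sub>E {..<n} A) \<inter> space (Leb n)"
    have "x k \<in> A (inv \<sigma> k)" if "k < n" for k
    proof -
      have k: "inv \<sigma> k < n" by (rule permutes_lessThan[OF inv that])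
      have "pmt n \<sigma> x \<in> Pi\<^sub>E {..<n} A" using x by simp
      then have "pmt n \<sigma> x (inv \<sigma> k) \<in> A (inv \<sigma> k)" using k by blast
      then show ?thesis using k by (simp add: pmt_def permutes_inverses(1)[OF s])
    qed
    then show "x \<in> Pi\<^sub>E {..<n} (\<lambda>k. A (inv \<sigma> k))" using x by (auto simp: space_PiM PiE_def)
  next
    fix x assume x: "x \<in> Pi\<^sub>E {..<n} (\<lambda>k. A (inv \<sigma> k))"
    have "x (\<sigma> i) \<in> A i" if "i < n" for i
    proof -
      have "x (\<sigma> i) \<in> A (inv \<sigma> (\<sigma> i))" using x permutes_lessThan[OF s that] by blast
      then show ?thesis by (simp add: permutes_inverses(2)[OF s])
    qed
    then show "x \<in> pmt n \<sigma> -` (Pi\<^sub>E {..<n} A) \<inter> space (Leb n)"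
      using x by (auto simp: pmt_def space_PiM PiE_def)
  qed
  moreover have "A (inv \<sigma> k) \<in> sets lborel" if "k \<in> {..<n}" for k
    using A permutes_lessThan[OF inv] that by simp
  ultimately have "emeasure (distr (Leb n) (Leb n) (pmt n \<sigma>)) (Pi\<^sub>E {..<n} A) = (\<Prod>k<n. emeasure lborel (A (inv \<sigma> k)))"
    using A by (subst emeasure_distr)
      (auto intro!: sets_PiM_I_finite leb.emeasure_PiM simp: measurable_pmt[OF s] simp del: sets_lborel)
  also have "\<dots> = (\<Prod>i<n. emeasure lborel (A i))"
    using prod.permute[OF inv, of "\<lambda>i. emeasure lborel (A i)"] by (simp add: comp_def)
  finally show "emeasure (distr (Leb n) (Leb n) (pmt n \<sigma>)) (Pi\<^sub>E {..<n} A) = (\<Prod>i<n. emeasure lborel (A i))" .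
qed simp_all

lemma nn_integral_Leb_pmt:
  assumes "\<sigma> permutes {..<n}" "F \<in> borel_measurable (Leb n)"
  shows "(\<integral>\<^sup>+x. F (pmt n \<sigma> x) \<partial>Leb n) = integral\<^sup>N (Leb n) F"
proof -
  have "integral\<^sup>N (Leb n) F = integral\<^sup>N (distr (Leb n) (Leb n) (pmt n \<sigma>)) F" by (simp add: distr_Leb_pmt[OF assms(1)])
  also have "\<dots> = (\<integral>\<^sup>+x. F (pmt n \<sigma> x) \<partial>Leb n)" by (subst nn_integral_distr) (simp_all add: measurable_pmt assms)
  finally show ?thesis by simp
qed

lemma incr_sorted: "incr n y \<Longrightarrow> sorted_wrt (<) (map y [0..<n])"
  by (auto simp: sorted_wrt_iff_nth_less incr_less)

lemma ex1_sorting: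
  fixes l :: "nat \<Rightarrow> real"
  assumes inj: "inj_on l {..<n}"
  shows "\<exists>!\<sigma>. \<sigma> permutes {..<n} \<and> incr n (\<lambda>i. l (\<sigma> i))"
proof (rule ex_ex1I)
  define xs where "xs = sorted_list_of_set (l ` {..<n})"
  have len: "length xs = n" using inj by (simp add: xs_def card_image)
  have xs: "sorted_wrt (<) xs" "set xs = l ` {..<n}" by (simp_all add: xs_def)
  define \<sigma> where "\<sigma> i = (if i < n then inv_into {..<n} l (xs ! i) else i)" for i
  have mem: "xs ! i \<in> l ` {..<n}" if "i < n" for i using that len xs(2) nth_mem by metis
  have ls: "l (\<sigma> i) = xs ! i" if "i < n" for i
    using that f_inv_into_f[OF mem[OF that]] by (simp add: \<sigma>_def)
  have lt: "\<sigma> i < n" if "i < n" for i using inv_into_into[OF mem[OF that]] that by (simp add: \<sigma>_def)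
  have "inj_on \<sigma> {..<n}"
  proof (rule inj_onI)
    fix i j assume ij: "i \<in> {..<n}" "j \<in> {..<n}" "\<sigma> i = \<sigma> j"
    then have "xs ! i = xs ! j" using ls by (metis lessThan_iff)
    moreover have "distinct xs" by (simp add: xs_def)
    ultimately show "i = j" using ij len by (simp add: nth_eq_iff_index_eq)
  qed
  moreover have "\<sigma> ` {..<n} \<subseteq> {..<n}" using lt by auto
  ultimately have "bij_betw \<sigma> {..<n} {..<n}" using endo_inj_surj[of "{..<n}" \<sigma>] by (simp add: bij_betw_def)
  then have "\<sigma> permutes {..<n}" by (rule bij_imp_permutes) (simp add: \<sigma>_def)
  moreover have "incr n (\<lambda>i. l (\<sigma> i))"
    using xs(1) len ls by (auto simp: incr_def sorted_wrt_iff_nth_less)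
  ultimately show "\<exists>\<sigma>. \<sigma> permutes {..<n} \<and> incr n (\<lambda>i. l (\<sigma> i))" by blast
next
  fix \<sigma> \<tau> assume a: "\<sigma> permutes {..<n} \<and> incr n (\<lambda>i. l (\<sigma> i))" "\<tau> permutes {..<n} \<and> incr n (\<lambda>i. l (\<tau> i))"
  have st: "set (map (\<lambda>i. l (\<rho> i)) [0..<n]) = l ` {..<n}" if "\<rho> permutes {..<n}" for \<rho>
  proof -
    have "set (map (\<lambda>i. l (\<rho> i)) [0..<n]) = l ` (\<rho> ` {..<n})" by (simp add: image_image atLeast0LessThan)
    then show ?thesis by (simp add: permutes_image[OF that])
  qed
  have "map (\<lambda>i. l (\<sigma> i)) [0..<n] = map (\<lambda>i. l (\<tau> i)) [0..<n]"
    by (rule strict_sorted_equal) (use a st incr_sorted in auto)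
  then have "l (\<sigma> i) = l (\<tau> i)" if "i < n" for i using that by simp
  then have "\<sigma> i = \<tau> i" if "i < n" for i
    using that inj a permutes_lessThan by (meson inj_onD lessThan_iff)
  moreover have "\<sigma> i = \<tau> i" if "\<not> i < n" for i using that a by (metis lessThan_iff permutes_not_in)
  ultimately show "\<sigma> = \<tau>" by blast
qed

text \<open>Every injective configuration has exactly one increasing rearrangement, and the integral
  is invariant under each of the \<open>fact n\<close> permutations. Configurations with ties
  contribute nothing because the integrand is assumed to vanish there.\<close>

lemma nn_integral_symmetric:
  assumes g [measurable]: "g \<in> borel_measurable (Leb n)"
    and sym: "\<And>l \<sigma>. l \<in> space (Leb n) \<Longrightarrow> \<sigma> permutes {..<n} \<Longrightarrow> g (pmt n \<sigma> l) = g l"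
    and 0: "\<And>l. \<not> inj_on l {..<n} \<Longrightarrow> g l = 0"
  shows "(\<integral>\<^sup>+l. (if \<forall>i<n. 0 < l i then g l else 0) \<partial>Leb n) =
     fact n * (\<integral>\<^sup>+l. (if pincr n l then g l else 0) \<partial>Leb n)"
proof -
  define h where "h l = (if \<forall>i<n. 0 < l i then g l else 0)" for l
  define K where "K l = (if incr n l then h l else 0)" for l
  define S where "S = {\<sigma>. \<sigma> permutes {..<n}}"
  have S: "finite S" "card S = fact n"
    unfolding S_def using finite_permutations[of "{..<n}"] card_permutations[of "{..<n}" n] by auto
  have h_meas [measurable]: "h \<in> borel_measurable (Leb n)" unfolding h_def all_less_ball by measurable
  have K_meas [measurable]: "K \<in> borel_measurable (Leb n)" unfolding K_def by measurable
  have hsym: "h (pmt n \<sigma> l) = h l" if "l \<in> space (Leb n)" "\<sigma> \<in> S" for l \<sigma>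
  proof -
    have s: "\<sigma> permutes {..<n}" using that by (simp add: S_def)
    have "(\<forall>i<n. 0 < pmt n \<sigma> l i) \<longleftrightarrow> (\<forall>i<n. 0 < l i)"
    proof
      assume a: "\<forall>i<n. 0 < pmt n \<sigma> l i"
      show "\<forall>i<n. 0 < l i"
      proof (intro allI impI)
        fix i assume "i < n"
        then have "inv \<sigma> i < n" by (rule permutes_lessThan[OF permutes_inv[OF s]])
        then show "0 < l i" using a by (auto simp: pmt_def permutes_inverses(1)[OF s] dest: spec[of _ "inv \<sigma> i"])
      qed
    qed (auto simp: pmt_def permutes_lessThan[OF s])
    then show ?thesis using sym[OF that(1) s] by (simp only: h_def)
  qed
  have "h l = (\<Sum>\<sigma>\<in>S. K (pmt n \<sigma> l))" if l: "l \<in> space (Leb n)" for l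
  proof (cases "inj_on l {..<n}")
    case False
    then have "h l = 0" by (simp add: h_def 0)
    moreover from this have "K (pmt n \<sigma> l) = 0" if "\<sigma> \<in> S" for \<sigma> using hsym[OF l that] by (simp add: K_def)
    ultimately show ?thesis by simp
  next
    case True
    then obtain \<tau> where t: "\<tau> \<in> S" "incr n (\<lambda>i. l (\<tau> i))" "\<And>\<sigma>. \<sigma> \<in> S \<Longrightarrow> incr n (\<lambda>i. l (\<sigma> i)) \<Longrightarrow> \<sigma> = \<tau>"
      using ex1_sorting[OF True] unfolding S_def by blast
    have i: "incr n (pmt n \<sigma> l) \<longleftrightarrow> incr n (\<lambda>i. l (\<sigma> i))" for \<sigma> by (auto simp: incr_def pmt_def)
    have "(\<Sum>\<sigma>\<in>S. K (pmt n \<sigma> l)) = (\<Sum>\<sigma>\<in>S. if \<sigma> = \<tau> then h l else 0)"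
    proof (rule sum.cong)
      fix \<sigma> assume S: "\<sigma> \<in> S"
      have "incr n (\<lambda>i. l (\<sigma> i)) \<longleftrightarrow> \<sigma> = \<tau>" using t(2) t(3)[OF S] by blast
      then show "K (pmt n \<sigma> l) = (if \<sigma> = \<tau> then h l else 0)"
        unfolding K_def i hsym[OF l S] by simp
    qed simp
    also have "\<dots> = h l" using t(1) S by simp
    finally show ?thesis by simp
  qed
  then have "(\<integral>\<^sup>+l. h l \<partial>Leb n) = (\<integral>\<^sup>+l. (\<Sum>\<sigma>\<in>S. K (pmt n \<sigma> l)) \<partial>Leb n)"
    by (intro nn_integral_cong) auto
  also have "\<dots> = (\<Sum>\<sigma>\<in>S. \<integral>\<^sup>+l. K (pmt n \<sigma> l) \<partial>Leb n)"
    by (rule nn_integral_sum) (auto simp: S_def intro!: measurable_compose[OF measurable_pmt K_meas])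
  also have "\<dots> = (\<Sum>\<sigma>\<in>S. integral\<^sup>N (Leb n) K)"
    by (rule sum.cong) (auto simp: S_def nn_integral_Leb_pmt)
  also have "\<dots> = fact n * integral\<^sup>N (Leb n) K" using S by simp
  also have "integral\<^sup>N (Leb n) K = (\<integral>\<^sup>+l. (if pincr n l then g l else 0) \<partial>Leb n)"
  proof (rule nn_integral_cong)
    fix l
    have "pincr n l \<longleftrightarrow> incr n l \<and> (\<forall>i<n. 0 < l i)"
      using pincr_pos[of n l] by (auto simp: pincr_iff)
    then show "K l = (if pincr n l then g l else 0)" by (auto simp: K_def h_def)
  qed
  finally show ?thesis by (simp add: h_def)
qed

text \<open>In the chart the last weight plays a special role, so a permutation of all weights is
  not a permutation of coordinates. It becomes one on the positive orthant: integrating a function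
  of the normalized vector against the exponential of minus the total mass gives, in polar
  coordinates, the simplex integral times the Gamma integral \<open>fact m\<close>, and this
  constant cancels.\<close>

lemma nn_integral_simplex_pmt:
  assumes G [measurable]: "G \<in> borel_measurable (Leb (Suc m))" and s: "\<sigma> permutes {..<Suc m}"
  shows "(\<integral>\<^sup>+v. (if osimplex m v then G (pmt (Suc m) \<sigma> (sext m v)) else 0) \<partial>Leb m) =
     (\<integral>\<^sup>+v. (if osimplex m v then G (sext m v) else 0) \<partial>Leb m)" (is "?lhs = ?rhs")
proof -
  define nrm where "nrm \<rho> = (\<lambda>j\<in>{..<Suc m}. \<rho> j / (\<Sum>i<Suc m. \<rho> i))" for \<rho> :: "nat \<Rightarrow> real"
  have [measurable]: "nrm \<in> measurable (Leb (Suc m)) (Leb (Suc m))"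
    unfolding nrm_def by (rule measurable_restrict_Leb) measurable
  define c where "c = (\<integral>\<^sup>+s. ennreal (s ^ m * exp (- s)) * indicator {0 ..} s \<partial>lborel)"
  have c: "c = ennreal (fact m)" unfolding c_def by (simp add: nn_intergal_power_times_exp_Ici)
  have polar: "(\<integral>\<^sup>+\<rho>. (if \<forall>j<Suc m. 0 < \<rho> j then ennreal (exp (- (\<Sum>i<Suc m. \<rho> i))) * G' (nrm \<rho>) else 0) \<partial>Leb (Suc m)) =
     c * (\<integral>\<^sup>+v. (if osimplex m v then G' (sext m v) else 0) \<partial>Leb m)"
    if [measurable]: "G' \<in> borel_measurable (Leb (Suc m))" for G'
  proof -
    define I where "I = (\<integral>\<^sup>+v. (if osimplex m v then G' (sext m v) else 0) \<partial>Leb m)"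
    have "(\<integral>\<^sup>+\<rho>. (if \<forall>j<Suc m. 0 < \<rho> j then ennreal (exp (- (\<Sum>i<Suc m. \<rho> i))) * G' (nrm \<rho>) else 0) \<partial>Leb (Suc m)) =
      (\<integral>\<^sup>+s. (if 0 < s then ennreal (s ^ m) *
        (\<integral>\<^sup>+v. (if osimplex m v then ennreal (exp (- (\<Sum>i<Suc m. (\<lambda>j\<in>{..<Suc m}. s * sext m v j) i))) * G' (nrm (\<lambda>j\<in>{..<Suc m}. s * sext m v j)) else 0) \<partial>Leb m) else 0) \<partial>lborel)"
      by (rule nn_integral_polar) measurable
    also have "\<dots> = (\<integral>\<^sup>+s. (ennreal (s ^ m * exp (- s)) * indicator {0..} s) * I \<partial>lborel)"
    proof (rule nn_integral_cong_AE)
      have "AE s in lborel. s \<noteq> (0::real)" by (rule AE_lborel_singleton)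
      then show "AE s in lborel. (if 0 < s then ennreal (s ^ m) *
        (\<integral>\<^sup>+v. (if osimplex m v then ennreal (exp (- (\<Sum>i<Suc m. (\<lambda>j\<in>{..<Suc m}. s * sext m v j) i))) * G' (nrm (\<lambda>j\<in>{..<Suc m}. s * sext m v j)) else 0) \<partial>Leb m) else 0) =
        (ennreal (s ^ m * exp (- s)) * indicator {0..} s) * I"
      proof eventually_elim
        fix s :: real assume "s \<noteq> 0"
        show "(if 0 < s then ennreal (s ^ m) *
        (\<integral>\<^sup>+v. (if osimplex m v then ennreal (exp (- (\<Sum>i<Suc m. (\<lambda>j\<in>{..<Suc m}. s * sext m v j) i))) * G' (nrm (\<lambda>j\<in>{..<Suc m}. s * sext m v j)) else 0) \<partial>Leb m) else 0) =
        (ennreal (s ^ m * exp (- s)) * indicator {0..} s) * I"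
        proof (cases "0 < s")
          case True
          have sm: "(\<Sum>i<Suc m. (\<lambda>j\<in>{..<Suc m}. s * sext m v j) i) = s" for v
          proof -
            have "(\<Sum>i<Suc m. (\<lambda>j\<in>{..<Suc m}. s * sext m v j) i) = s * (\<Sum>i<Suc m. sext m v i)"
              unfolding sum_distrib_left by (rule sum.cong) auto
            then show ?thesis by (simp only: sext_sum)
          qed
          have nr: "nrm (\<lambda>j\<in>{..<Suc m}. s * sext m v j) = sext m v" for v
            unfolding nrm_def sm using True by (auto simp: fun_eq_iff sext_def)
          have "(\<integral>\<^sup>+v. (if osimplex m v then ennreal (exp (- s)) * G' (sext m v) else 0) \<partial>Leb m) =
             (\<integral>\<^sup>+v. ennreal (exp (- s)) * (if osimplex m v then G' (sext m v) else 0) \<partial>Leb m)"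
            by (rule nn_integral_cong) simp
          also have "\<dots> = ennreal (exp (- s)) * I" unfolding I_def by (rule nn_integral_cmult) measurable
          finally show ?thesis unfolding sm nr using True by (simp add: ennreal_mult mult.assoc)
        qed (use \<open>s \<noteq> 0\<close> in simp)
      qed
    qed
    also have "\<dots> = c * I" unfolding c_def by (rule nn_integral_multc) measurable
    finally show ?thesis by (simp only: I_def)
  qed
  define F where "F \<rho> = (if \<forall>j<Suc m. 0 < \<rho> j then ennreal (exp (- (\<Sum>i<Suc m. \<rho> i))) * G (nrm \<rho>) else 0)" for \<rho>
  have F_meas: "F \<in> borel_measurable (Leb (Suc m))" unfolding F_def all_less_ball by measurable
  have sum_pmt: "(\<Sum>i<Suc m. pmt (Suc m) \<sigma> \<rho> i) = (\<Sum>i<Suc m. \<rho> i)" for \<rho>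
    using sum.permute[OF s, of \<rho>] by (simp add: pmt_def comp_def del: sum.lessThan_Suc)
  have "(\<integral>\<^sup>+\<rho>. F (pmt (Suc m) \<sigma> \<rho>) \<partial>Leb (Suc m)) = integral\<^sup>N (Leb (Suc m)) F"
    by (rule nn_integral_Leb_pmt[OF s F_meas])
  moreover have "F (pmt (Suc m) \<sigma> \<rho>) = (if \<forall>j<Suc m. 0 < \<rho> j then ennreal (exp (- (\<Sum>i<Suc m. \<rho> i))) * G (pmt (Suc m) \<sigma> (nrm \<rho>)) else 0)" for \<rho>
  proof -
    have "(\<forall>i<Suc m. 0 < pmt (Suc m) \<sigma> \<rho> i) \<longleftrightarrow> (\<forall>i<Suc m. 0 < \<rho> i)"
    proof
      assume a: "\<forall>i<Suc m. 0 < pmt (Suc m) \<sigma> \<rho> i"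
      show "\<forall>i<Suc m. 0 < \<rho> i"
      proof (intro allI impI)
        fix i assume "i < Suc m"
        then have "inv \<sigma> i < Suc m" by (rule permutes_lessThan[OF permutes_inv[OF s]])
        then show "0 < \<rho> i" using a by (auto simp: pmt_def permutes_inverses(1)[OF s] dest: spec[of _ "inv \<sigma> i"])
      qed
    qed (auto simp: pmt_def permutes_lessThan[OF s])
    moreover have "nrm (pmt (Suc m) \<sigma> \<rho>) = pmt (Suc m) \<sigma> (nrm \<rho>)"
      unfolding nrm_def sum_pmt by (auto simp: pmt_def fun_eq_iff permutes_lessThan[OF s])
    ultimately show ?thesis by (simp only: F_def sum_pmt)
  qed
  moreover have "integral\<^sup>N (Leb (Suc m)) F = (\<integral>\<^sup>+\<rho>. (if \<forall>j<Suc m. 0 < \<rho> j then ennreal (exp (- (\<Sum>i<Suc m. \<rho> i))) * G (nrm \<rho>) else 0) \<partial>Leb (Suc m))"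
    unfolding F_def[abs_def] by (rule refl)
  ultimately have "c * ?lhs =
    c * ?rhs"
    using polar[OF G] polar[OF measurable_compose[OF measurable_pmt[OF s] G]] by simp
  then show ?thesis unfolding c ennreal_mult_cancel_left by auto
qed

section \<open>Law of the moments of the Jacobi ensemble\<close>

lemma wmom_pmt:
  assumes "\<sigma> permutes {..<n}"
  shows "wmom n (pmt n \<sigma> l) (pmt n \<sigma> w) = wmom n l w"
proof
  fix k
  show "wmom n (pmt n \<sigma> l) (pmt n \<sigma> w) k = wmom n l w k"
    using sum.permute[OF assms, of "\<lambda>i. w i * l i ^ k"] by (simp add: wmom_def pmt_def comp_def)
qed

lemma vand_sq_pmt:
  assumes s: "\<sigma> permutes {..<n}"
  shows "(vand n (pmt n \<sigma> l))\<^sup>2 = (vand n l)\<^sup>2"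
proof -
  have "(vand n (pmt n \<sigma> l))\<^sup>2 = (\<Prod>j<n. \<Prod>i\<in>{..<n} - {j}. \<bar>l (\<sigma> j) - l (\<sigma> i)\<bar>)"
    unfolding vand_sq by (intro prod.cong refl) (auto simp: pmt_def)
  also have "\<dots> = (\<Prod>j<n. \<Prod>i\<in>{..<n} - {\<sigma> j}. \<bar>l (\<sigma> j) - l i\<bar>)"
  proof (rule prod.cong)
    fix j
    have "\<sigma> ` ({..<n} - {j}) = {..<n} - {\<sigma> j}"
      using permutes_image[OF s] by (simp add: image_set_diff[OF permutes_inj[OF s]])
    then have "bij_betw \<sigma> ({..<n} - {j}) ({..<n} - {\<sigma> j})"
      using permutes_inj[OF s] by (simp add: bij_betw_def inj_on_subset[OF _ subset_UNIV])
    then show "(\<Prod>i\<in>{..<n} - {j}. \<bar>l (\<sigma> j) - l (\<sigma> i)\<bar>) = (\<Prod>i\<in>{..<n} - {\<sigma> j}. \<bar>l (\<sigma> j) - l i\<bar>)"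
      by (rule prod.reindex_bij_betw)
  qed simp
  also have "\<dots> = (vand n l)\<^sup>2"
    unfolding vand_sq using prod.permute[OF s, of "\<lambda>j. \<Prod>i\<in>{..<n} - {j}. \<bar>l j - l i\<bar>"] by (simp add: comp_def)
  finally show ?thesis .
qed

lemma wt1_pmt:
  assumes s: "\<sigma> permutes {..<Suc m}"
  shows "wt1 t A B m q (pmt (Suc m) \<sigma> l) (pmt (Suc m) \<sigma> w) = wt1 t A B m q l w"
proof -
  have all: "(\<forall>i<Suc m. pmt (Suc m) \<sigma> l i < 1) \<longleftrightarrow> (\<forall>i<Suc m. l i < 1)"
  proof
    assume a: "\<forall>i<Suc m. pmt (Suc m) \<sigma> l i < 1"
    show "\<forall>i<Suc m. l i < 1"
    proof (intro allI impI)
      fix i assume "i < Suc m"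
      then have "inv \<sigma> i < Suc m" by (rule permutes_lessThan[OF permutes_inv[OF s]])
      then show "l i < 1" using a by (auto simp: pmt_def permutes_inverses(1)[OF s] dest: spec[of _ "inv \<sigma> i"])
    qed
  qed (auto simp: pmt_def permutes_lessThan[OF s])
  have S: "(\<Sum>i<Suc m. pmt (Suc m) \<sigma> w i / (1 - pmt (Suc m) \<sigma> l i)) = (\<Sum>i<Suc m. w i / (1 - l i))"
    using sum.permute[OF s, of "\<lambda>i. w i / (1 - l i)"] by (simp add: pmt_def comp_def del: sum.lessThan_Suc)
  have P: "(\<Prod>i<Suc m. f (pmt (Suc m) \<sigma> x i)) = (\<Prod>i<Suc m. f (x i))" for f :: "real \<Rightarrow> real" and x
    using prod.permute[OF s, of "\<lambda>i. f (x i)"] by (simp add: pmt_def comp_def del: prod.lessThan_Suc)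
  show ?thesis unfolding wt1_def all S vand_sq_pmt[OF s] P[of abs] P[of "\<lambda>x. x"] P[of "\<lambda>x. 1 - x"] ..
qed

definition eig_dens :: "nat \<Rightarrow> real \<Rightarrow> real \<Rightarrow> real \<Rightarrow> (nat \<Rightarrow> real) \<Rightarrow> ennreal" where
  "eig_dens n \<beta> A B l = ennreal ((\<Prod>i<n. \<Prod>j\<in>{i<..<n}. \<bar>l i - l j\<bar> powr \<beta>) *
                      (\<Prod>i<n. l i powr A * (1 - l i) powr B)) *
             (\<Prod>i<n. indicator {0<..<1} (l i))"

definition dir_dens :: "nat \<Rightarrow> real \<Rightarrow> (nat \<Rightarrow> real) \<Rightarrow> ennreal" where
  "dir_dens m s v = ennreal ((\<Prod>i<m. v i powr s) * (1 - (\<Sum>i<m. v i)) powr s) *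
                   (\<Prod>i<m. indicator {0<..} (v i)) * indicator {..<1} (\<Sum>i<m. v i)"

lemma prod_indicator_eq:
  fixes n :: nat
  shows "(\<Prod>i<n. indicator (S i) (x i) :: ennreal) = (if \<forall>i<n. x i \<in> S i then 1 else 0)"
proof (cases "\<forall>i<n. x i \<in> S i")
  case True
  then show ?thesis by (simp add: indicator_def)
next
  case False
  then show ?thesis by (auto simp: indicator_def intro!: prod_zero)
qed

lemma measurable_eig_dens [measurable]: "eig_dens n \<beta> A B \<in> borel_measurable (Leb n)"
  unfolding eig_dens_def by measurable

lemma measurable_dir_dens [measurable]: "dir_dens m s \<in> borel_measurable (Leb m)"
  unfolding dir_dens_def by measurable

text \<open>The Dirichlet exponent \<open>\<beta> / 2 - 1\<close> is half of what remains of the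
  Vandermonde exponent \<open>\<beta>\<close> after a square is set aside. Hence the squared
  Vandermonde product and the weights merge under one exponent into \<open>wt1\<close> with
  \<open>q = 0\<close>, and the square stays outside as the factor required by the exchange of nodes
  and zeros.\<close>

lemma eig_dir_dens:
  assumes "\<beta> > 0"
  shows "eig_dens (Suc m) \<beta> A B l * dir_dens m (\<beta> / 2 - 1) v =
    (if (\<forall>i<Suc m. 0 < l i) \<and> osimplex m v
     then ennreal (wt1 (\<beta> / 2 - 1) A B m 0 l (sext m v)) * ennreal ((vand (Suc m) l)\<^sup>2) else 0)"
proof -
  define s where "s = \<beta> / 2 - 1"
  consider "(\<forall>i<Suc m. 0 < l i) \<and> (\<forall>i<Suc m. l i < 1) \<and> osimplex m v"
    | "\<not> (\<forall>i<Suc m. 0 < l i) \<or> \<not> osimplex m v" | "\<not> (\<forall>i<Suc m. l i < 1)" by blast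
  then show ?thesis
  proof cases
    case 1
    have "(\<Prod>i<Suc m. \<Prod>j\<in>{i<..<Suc m}. \<bar>l i - l j\<bar> powr \<beta>) = \<bar>vand (Suc m) l\<bar> powr \<beta>"
      unfolding vand_def abs_prod
      by (simp add: prod_powr_distrib[symmetric] prod_nonneg abs_minus_commute del: prod.lessThan_Suc)
    also have "\<dots> = ((vand (Suc m) l)\<^sup>2) powr s * (vand (Suc m) l)\<^sup>2"
    proof (cases "vand (Suc m) l = 0")
      case False
      have "\<bar>vand (Suc m) l\<bar> powr \<beta> = \<bar>vand (Suc m) l\<bar> powr (2 * s + 2)" by (simp add: s_def)
      also have "\<dots> = (\<bar>vand (Suc m) l\<bar> powr 2) powr s * \<bar>vand (Suc m) l\<bar> powr 2"
        by (simp only: powr_add powr_powr)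
      also have "\<bar>vand (Suc m) l\<bar> powr 2 = (vand (Suc m) l)\<^sup>2"
        using False powr_realpow[of "\<bar>vand (Suc m) l\<bar>" 2] by simp
      finally show ?thesis .
    qed (use assms in simp)
    finally have v: "(\<Prod>i<Suc m. \<Prod>j\<in>{i<..<Suc m}. \<bar>l i - l j\<bar> powr \<beta>) = ((vand (Suc m) l)\<^sup>2) powr s * (vand (Suc m) l)\<^sup>2" .
    have l: "(\<Prod>i<Suc m. l i powr A * (1 - l i) powr B) = (\<Prod>i<Suc m. l i) powr A * (\<Prod>i<Suc m. 1 - l i) powr B"
      using 1 by (simp add: prod.distrib prod_powr_distrib less_imp_le del: prod.lessThan_Suc)
    have "(\<Prod>i<m. \<bar>v i\<bar>) = (\<Prod>i<m. v i)"
      using 1 by (intro prod.cong) (auto simp: osimplex_def)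
    then have "(\<Prod>i<Suc m. \<bar>sext m v i\<bar>) = (\<Prod>i<m. v i) * (1 - (\<Sum>i<m. v i))"
      using 1 by (simp add: sext_def osimplex_def)
    then have w: "(\<Prod>i<m. v i powr s) * (1 - (\<Sum>i<m. v i)) powr s = (\<Prod>i<Suc m. \<bar>sext m v i\<bar>) powr s"
      using 1 by (simp add: powr_mult prod_powr_distrib prod_nonneg osimplex_def less_imp_le)
    have W: "wt1 s A B m 0 l (sext m v) * (vand (Suc m) l)\<^sup>2 =
        (((vand (Suc m) l)\<^sup>2) powr s * (vand (Suc m) l)\<^sup>2 * ((\<Prod>i<Suc m. l i) powr A * (\<Prod>i<Suc m. 1 - l i) powr B)) * (\<Prod>i<Suc m. \<bar>sext m v i\<bar>) powr s"
      using 1 by (simp add: wt1_def Let_def powr_mult prod_nonneg del: prod.lessThan_Suc sum.lessThan_Suc)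
    have i1: "(\<Prod>i<Suc m. indicator {0<..<1} (l i) :: ennreal) = 1" using 1 unfolding prod_indicator_eq by simp
    have i2: "(\<Prod>i<m. indicator {0<..} (v i) :: ennreal) = 1" using 1 unfolding prod_indicator_eq by (simp add: osimplex_def)
    have i3: "indicator {..<1} (\<Sum>i<m. v i) = (1 :: ennreal)" using 1 by (simp add: osimplex_def)
    have "eig_dens (Suc m) \<beta> A B l * dir_dens m s v = ennreal (wt1 s A B m 0 l (sext m v) * (vand (Suc m) l)\<^sup>2)"
      unfolding eig_dens_def dir_dens_def i1 i2 i3 v l w W by (simp add: ennreal_mult'')
    also have "\<dots> = ennreal (wt1 s A B m 0 l (sext m v)) * ennreal ((vand (Suc m) l)\<^sup>2)"
      by (rule ennreal_mult'') simp
    finally show ?thesis using 1 by (simp add: s_def)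
  next
    case 2
    then have "eig_dens (Suc m) \<beta> A B l = 0 \<or> dir_dens m (\<beta> / 2 - 1) v = 0"
      unfolding eig_dens_def dir_dens_def prod_indicator_eq osimplex_def by (auto simp: indicator_def)
    then show ?thesis using 2 by auto
  next
    case 3
    then have "eig_dens (Suc m) \<beta> A B l = 0" unfolding eig_dens_def prod_indicator_eq by auto
    moreover have "wt1 (\<beta> / 2 - 1) A B m 0 l (sext m v) = 0" using 3 unfolding wt1_def Let_def by (simp only: simp_thms if_False)
    ultimately show ?thesis by simp
  qed
qed

lemma nn_integral_eig_dir:
  assumes "\<beta> > 0" and F [measurable]: "F \<in> borel_measurable Mseq"
  shows "(\<integral>\<^sup>+l. \<integral>\<^sup>+v. eig_dens (Suc m) \<beta> A B l * dir_dens m (\<beta> / 2 - 1) v * F (wmom (Suc m) l (sext m v)) \<partial>Leb m \<partial>Leb (Suc m)) =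
    fact (Suc m) * Psi1 (\<beta> / 2 - 1) A B m 0 F" (is "?lhs = _")
proof -
  define s where "s = \<beta> / 2 - 1"
  define G where "G l w = F (wmom (Suc m) l w) * ennreal (wt1 s A B m 0 l w) * ennreal ((vand (Suc m) l)\<^sup>2)" for l w
  define g where "g l = (\<integral>\<^sup>+v. (if osimplex m v then G l (sext m v) else 0) \<partial>Leb m)" for l
  have G_meas [measurable]: "case_prod G \<in> borel_measurable (Leb (Suc m) \<Otimes>\<^sub>M Leb (Suc m))"
    unfolding G_def case_prod_beta' by measurable
  have g_meas [measurable]: "g \<in> borel_measurable (Leb (Suc m))"
    unfolding g_def[abs_def] by (rule borel_measurable_nn_integral_Leb) (unfold case_prod_beta', measurable)
  have "?lhs =
    (\<integral>\<^sup>+l. (if \<forall>i<Suc m. 0 < l i then g l else 0) \<partial>Leb (Suc m))"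
  proof (rule nn_integral_cong)
    fix l
    show "(\<integral>\<^sup>+v. eig_dens (Suc m) \<beta> A B l * dir_dens m (\<beta> / 2 - 1) v * F (wmom (Suc m) l (sext m v)) \<partial>Leb m) =
      (if \<forall>i<Suc m. 0 < l i then g l else 0)"
    proof (cases "\<forall>i<Suc m. 0 < l i")
      case True
      have "(\<integral>\<^sup>+v. eig_dens (Suc m) \<beta> A B l * dir_dens m (\<beta> / 2 - 1) v * F (wmom (Suc m) l (sext m v)) \<partial>Leb m) = g l"
        unfolding g_def
      proof (rule nn_integral_cong)
        fix v
        show "eig_dens (Suc m) \<beta> A B l * dir_dens m (\<beta> / 2 - 1) v * F (wmom (Suc m) l (sext m v)) = (if osimplex m v then G l (sext m v) else 0)"
          unfolding eig_dir_dens[OF assms(1)] G_def s_def using True by (cases "osimplex m v") (simp_all add: ac_simps)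
      qed
      then show ?thesis using True by simp
    next
      case False
      then show ?thesis unfolding eig_dir_dens[OF assms(1)] by (simp only: simp_thms if_False mult_zero_left nn_integral_const)
    qed
  qed
  also have "\<dots> = fact (Suc m) * (\<integral>\<^sup>+l. (if pincr (Suc m) l then g l else 0) \<partial>Leb (Suc m))"
  proof (rule nn_integral_symmetric[OF g_meas])
    fix l \<sigma> assume l [measurable]: "l \<in> space (Leb (Suc m))" and p: "\<sigma> permutes {..<Suc m}"
    have [measurable]: "pmt (Suc m) \<sigma> l \<in> space (Leb (Suc m))" using measurable_space[OF measurable_pmt[OF p] l] .
    have "g (pmt (Suc m) \<sigma> l) = (\<integral>\<^sup>+v. (if osimplex m v then G (pmt (Suc m) \<sigma> l) (pmt (Suc m) \<sigma> (sext m v)) else 0) \<partial>Leb m)"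
      unfolding g_def by (rule nn_integral_simplex_pmt[OF _ p, symmetric]) measurable
    also have "\<dots> = g l" unfolding g_def G_def wmom_pmt[OF p] wt1_pmt[OF p] vand_sq_pmt[OF p] ..
    finally show "g (pmt (Suc m) \<sigma> l) = g l" .
  next
    fix l :: "nat \<Rightarrow> real" assume "\<not> inj_on l {..<Suc m}"
    then obtain i j where ij: "i < Suc m" "j < Suc m" "i \<noteq> j" "l i = l j" unfolding inj_on_def by auto
    have "(\<Prod>k\<in>{..<Suc m} - {i}. \<bar>l i - l k\<bar>) = 0" by (rule prod_zero) (use ij in auto)
    then have "(vand (Suc m) l)\<^sup>2 = 0" unfolding vand_sq by (intro prod_zero) (use ij in auto)
    then have "G l w = 0" for w unfolding G_def by (simp only:) simp
    then show "g l = 0" unfolding g_def by (simp cong: if_cong)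
  qed
  also have "(\<integral>\<^sup>+l. (if pincr (Suc m) l then g l else 0) \<partial>Leb (Suc m)) = Psi1 (\<beta> / 2 - 1) A B m 0 F"
    unfolding Psi1_def g_def G_def s_def by (rule nn_integral_cong) simp
  finally show ?thesis .
qed

lemma jacobi_eig_eq:
  "jacobi_eig (Suc m) \<beta> a b = normalized_density (Leb (Suc m))
     (eig_dens (Suc m) \<beta> (a - (\<beta> / 2 * real m + 1)) (b - (\<beta> / 2 * real m + 1)))"
  by (simp add: jacobi_eig_def eig_dens_def[abs_def] Let_def)

lemma dirichlet_eq:
  "dirichlet (Suc m) p = distr (normalized_density (Leb m) (dir_dens m (p - 1))) (Leb (Suc m)) (sext m)"
  unfolding dirichlet_def dir_dens_def[abs_def] sext_def[abs_def] diff_Suc_1 ..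

section \<open>The ensemble in dimension \<open>Suc m\<close> and its canonical moments\<close>

locale jacobi_params =
  fixes m :: nat and \<beta> a b :: real
  assumes beta: "\<beta> > 0" and a: "a > \<beta> / 2 * real m" and b: "b > \<beta> / 2 * real m"
begin

definition "s = \<beta> / 2 - 1"
definition "A = a - (\<beta> / 2 * real m + 1)"
definition "B = b - (\<beta> / 2 * real m + 1)"
definition "N = Suc (2 * m)"
definition "alj j = al s A (N - j)"
definition "gaj j = ee s A B (N - Suc j) + 1"

lemma al_pos: "r > 0 \<Longrightarrow> r \<le> N \<Longrightarrow> al s A r > 0"
proof -
  assume r: "r > 0" "r \<le> N"
  show ?thesis
  proof (cases "odd r")
    case True
    then show ?thesis using a beta by (simp add: al_def s_def A_def add_nonneg_pos)
  next
    case False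
    then have "r div 2 > 0" using r by (auto elim: evenE)
    then show ?thesis using False beta by (simp add: al_def s_def)
  qed
qed

lemma ee_pos: "ee s A B r + 1 > 0"
proof (cases "odd r")
  case True
  have "real (r div 2) * (\<beta> / 2) \<ge> 0" using beta by simp
  then show ?thesis using True a b by (simp add: ee_def s_def A_def B_def)
next
  case False
  have "real (r div 2) * (\<beta> / 2) \<ge> 0" using beta by simp
  then show ?thesis using False b by (simp add: ee_def s_def A_def B_def)
qed

definition Pb :: "nat \<Rightarrow> real measure" where
  "Pb = Bet s A B N"

definition PP :: "(nat \<Rightarrow> real) measure" where
  "PP = PiM {0..<N} Pb"

lemma Pb_eq: "j < N \<Longrightarrow> Pb j = beta_distr (alj j) (gaj j)"
  unfolding Pb_def alj_def gaj_def by (subst Bet_def[OF al_pos ee_pos]) auto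

lemma prob_space_Pb: "prob_space (Pb j)"
  unfolding Pb_def by (rule prob_space_Bet[OF al_pos ee_pos])

lemma sets_Pb [measurable_cong, simp]: "sets (Pb j) = sets borel"
  unfolding Pb_def by (rule sets_Bet[OF al_pos ee_pos])

sublocale Pb: product_prob_space Pb "{0..<N}"
  using prob_space_Pb
  by (simp add: product_prob_space_def product_sigma_finite_def product_prob_space_axioms_def prob_space_imp_sigma_finite)

sublocale PP: prob_space PP
  unfolding PP_def using prob_space_Pb by (rule prob_space_PiM)

definition zz :: "(nat \<Rightarrow> real) \<Rightarrow> nat \<Rightarrow> real" where
  "zz p = zv 0 (trunc N 0 p)"

lemma measurable_PP_component: "j < N \<Longrightarrow> (\<lambda>p. p j) \<in> borel_measurable PP"
proof -
  assume "j < N"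
  then have "(\<lambda>p. p j) \<in> measurable PP (Pb j)" unfolding PP_def by (intro measurable_component_singleton) simp
  then show ?thesis by (simp cong: measurable_cong_sets)
qed

lemma measurable_zz: "(\<lambda>p. zz p j) \<in> borel_measurable PP"
  unfolding zz_def by (rule measurable_zv_trunc) (auto intro: measurable_PP_component)

lemma measurable_mS_zz: "(\<lambda>p. mS (zz p)) \<in> measurable PP Mseq"
  by (rule measurable_MseqI, rule measurable_mS, rule measurable_zz)

definition CC :: real where
  "CC = fact (Suc m) * (\<Prod>j<N. Beta (al s A (Suc j)) (ee s A B j + 1))"

lemma CC_pos: "CC > 0"
  unfolding CC_def
proof (intro mult_pos_pos prod_pos ballI)
  fix j assume "j \<in> {..<N}"
  then show "0 < Beta (al s A (Suc j)) (ee s A B j + 1)" using al_pos[of "Suc j"] ee_pos[of j] by (intro Beta_real_pos) auto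
qed simp

lemma nn_integral_eig_dir_beta:
  assumes F [measurable]: "F \<in> borel_measurable Mseq"
  shows "(\<integral>\<^sup>+l. \<integral>\<^sup>+v. eig_dens (Suc m) \<beta> A B l * dir_dens m s v * F (wmom (Suc m) l (sext m v)) \<partial>Leb m \<partial>Leb (Suc m)) =
    ennreal CC * (\<integral>\<^sup>+p. F (mS (zz p)) \<partial>PP)"
proof -
  have "Psi1 s A B m 0 F = Psi s A B N 0 F" by (simp add: Psi_def N_def)
  also have "\<dots> = ennreal ((1 - 0) powr ee s A B N) *
      (ennreal (\<Prod>j<N. Beta (al s A (Suc j)) (ee s A B j + 1)) * (\<integral>\<^sup>+p. F (mS (zv 0 (trunc N (N - N) p))) \<partial>PiM {N - N..<N} (Bet s A B N)))"
    by (rule Psi_iterate[OF al_pos ee_pos F]) auto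
  also have "\<dots> = ennreal (\<Prod>j<N. Beta (al s A (Suc j)) (ee s A B j + 1)) * (\<integral>\<^sup>+p. F (mS (zz p)) \<partial>PP)"
    by (simp add: PP_def Pb_def zz_def)
  finally have "fact (Suc m) * Psi1 s A B m 0 F = (ennreal (fact (Suc m)) * ennreal (\<Prod>j<N. Beta (al s A (Suc j)) (ee s A B j + 1))) * (\<integral>\<^sup>+p. F (mS (zz p)) \<partial>PP)"
    by (simp only: mult.assoc ennreal_fact)
  also have "ennreal (fact (Suc m)) * ennreal (\<Prod>j<N. Beta (al s A (Suc j)) (ee s A B j + 1)) = ennreal CC"
    unfolding CC_def by (rule ennreal_mult'[symmetric]) simp
  finally show ?thesis unfolding nn_integral_eig_dir[OF beta F, folded s_def] .
qed

definition "Z1 = (\<integral>\<^sup>+l. eig_dens (Suc m) \<beta> A B l \<partial>Leb (Suc m))"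
definition "Z2 = (\<integral>\<^sup>+v. dir_dens m s v \<partial>Leb m)"

text \<open>The case of constant \<open>F\<close>. Only the product of the two normalizing constants
  is computed; being positive and finite it forces each factor to be so, which makes both normalized
  densities probability measures.\<close>

lemma Z1_Z2: "Z1 * Z2 = ennreal CC"
proof -
  have "(\<integral>\<^sup>+l. \<integral>\<^sup>+v. eig_dens (Suc m) \<beta> A B l * dir_dens m s v \<partial>Leb m \<partial>Leb (Suc m)) = ennreal CC * (\<integral>\<^sup>+p. 1 \<partial>PP)"
    using nn_integral_eig_dir_beta[of "\<lambda>_. 1"] by simp
  also have "\<dots> = ennreal CC" by (simp add: PP.emeasure_space_1)
  finally show ?thesis
    unfolding Z1_def Z2_def by (simp add: nn_integral_cmult nn_integral_multc)
qed

lemma Z_pos: "Z1 \<noteq> 0" "Z1 \<noteq> \<infinity>" "Z2 \<noteq> 0" "Z2 \<noteq> \<infinity>"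
proof -
  show "Z1 \<noteq> 0" "Z2 \<noteq> 0" using Z1_Z2 CC_pos by auto
  then show "Z1 \<noteq> \<infinity>" "Z2 \<noteq> \<infinity>" using Z1_Z2 by (auto simp: ennreal_top_mult ennreal_mult_top)
qed

definition "EE = jacobi_ensemble (Suc m) \<beta> a b"

lemma prob_space_normalized_density:
  assumes "f \<in> borel_measurable M" "integral\<^sup>N M f \<noteq> 0" "integral\<^sup>N M f \<noteq> \<infinity>"
  shows "prob_space (normalized_density M f)"
proof (rule prob_spaceI)
  have "emeasure (normalized_density M f) (space (normalized_density M f)) = (\<integral>\<^sup>+x. f x / integral\<^sup>N M f \<partial>M)"
    unfolding normalized_density_def using assms(1)
    by (subst emeasure_density) (auto intro!: nn_integral_cong)
  also have "\<dots> = integral\<^sup>N M f / integral\<^sup>N M f" by (rule nn_integral_divide[OF assms(1)])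
  finally show "emeasure (normalized_density M f) (space (normalized_density M f)) = 1"
    using assms by (simp add: ennreal_divide_self top.not_eq_extremum)
qed

lemma nn_integral_normalized_density:
  assumes [measurable]: "f \<in> borel_measurable M" "h \<in> borel_measurable M"
  shows "integral\<^sup>N (normalized_density M f) h = (\<integral>\<^sup>+x. f x * h x \<partial>M) / integral\<^sup>N M f"
proof -
  have "integral\<^sup>N (normalized_density M f) h = (\<integral>\<^sup>+x. f x / integral\<^sup>N M f * h x \<partial>M)"
    unfolding normalized_density_def by (rule nn_integral_density) measurable
  also have "\<dots> = (\<integral>\<^sup>+x. (f x * h x) / integral\<^sup>N M f \<partial>M)"
    by (intro nn_integral_cong) (simp add: divide_ennreal_def ac_simps)
  also have "\<dots> = (\<integral>\<^sup>+x. f x * h x \<partial>M) / integral\<^sup>N M f" by (rule nn_integral_divide) measurable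
  finally show ?thesis .
qed

lemma eig_eq: "jacobi_eig (Suc m) \<beta> a b = normalized_density (Leb (Suc m)) (eig_dens (Suc m) \<beta> A B)"
  unfolding A_def B_def by (rule jacobi_eig_eq)

lemma dir_eq: "dirichlet (Suc m) (\<beta> / 2) = distr (normalized_density (Leb m) (dir_dens m s)) (Leb (Suc m)) (sext m)"
  unfolding s_def by (rule dirichlet_eq)

lemma prob_space_eig: "prob_space (jacobi_eig (Suc m) \<beta> a b)"
  unfolding eig_eq by (rule prob_space_normalized_density) (use Z_pos in \<open>auto simp: Z1_def\<close>)

lemma measurable_sext_nd: "sext m \<in> measurable (normalized_density (Leb m) f) (Leb (Suc m))"
  using measurable_sext by (simp add: normalized_density_def)

lemma prob_space_dir: "prob_space (dirichlet (Suc m) (\<beta> / 2))"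
proof -
  interpret prob_space "normalized_density (Leb m) (dir_dens m s)"
    by (rule prob_space_normalized_density) (use Z_pos in \<open>auto simp: Z2_def\<close>)
  show ?thesis unfolding dir_eq by (rule prob_space_distr[OF measurable_sext_nd])
qed

sublocale EE: prob_space EE
proof -
  interpret p1: prob_space "jacobi_eig (Suc m) \<beta> a b" by (rule prob_space_eig)
  interpret p2: prob_space "dirichlet (Suc m) (\<beta> / 2)" by (rule prob_space_dir)
  interpret pair_prob_space "jacobi_eig (Suc m) \<beta> a b" "dirichlet (Suc m) (\<beta> / 2)" ..
  show "prob_space EE" unfolding EE_def jacobi_ensemble_def by (rule P.prob_space_axioms)
qed

lemma sets_EE [measurable_cong]: "sets EE = sets (Leb (Suc m) \<Otimes>\<^sub>M Leb (Suc m))"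
  unfolding EE_def jacobi_ensemble_def eig_eq dir_eq
  by (rule sets_pair_measure_cong) (simp_all add: normalized_density_def)

lemma nn_integral_EE:
  assumes H [measurable]: "H \<in> borel_measurable (Leb (Suc m) \<Otimes>\<^sub>M Leb (Suc m))"
  shows "integral\<^sup>N EE H = (\<integral>\<^sup>+l. \<integral>\<^sup>+v. eig_dens (Suc m) \<beta> A B l * dir_dens m s v * H (l, sext m v) \<partial>Leb m \<partial>Leb (Suc m)) / ennreal CC"
proof -
  interpret p2: prob_space "dirichlet (Suc m) (\<beta> / 2)" by (rule prob_space_dir)
  have sd: "sets (dirichlet (Suc m) (\<beta> / 2)) = sets (Leb (Suc m))" by (simp add: dir_eq)
  have se: "sets (jacobi_eig (Suc m) \<beta> a b) = sets (Leb (Suc m))" by (simp add: eig_eq normalized_density_def)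
  have sed: "sets (jacobi_eig (Suc m) \<beta> a b \<Otimes>\<^sub>M dirichlet (Suc m) (\<beta> / 2)) = sets (Leb (Suc m) \<Otimes>\<^sub>M Leb (Suc m))"
    by (rule sets_pair_measure_cong[OF se sd])
  have H': "H \<in> borel_measurable (jacobi_eig (Suc m) \<beta> a b \<Otimes>\<^sub>M dirichlet (Suc m) (\<beta> / 2))"
    using H by (simp add: measurable_cong_sets[OF sed refl])
  have in2: "(\<integral>\<^sup>+w. H (l, w) \<partial>dirichlet (Suc m) (\<beta> / 2)) = (\<integral>\<^sup>+v. dir_dens m s v * H (l, sext m v) \<partial>Leb m) / Z2"
    if [measurable]: "l \<in> space (Leb (Suc m))" for l
  proof -
    have "(\<integral>\<^sup>+w. H (l, w) \<partial>dirichlet (Suc m) (\<beta> / 2)) = (\<integral>\<^sup>+v. H (l, sext m v) \<partial>normalized_density (Leb m) (dir_dens m s))"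
      unfolding dir_eq by (rule nn_integral_distr[OF measurable_sext_nd]) measurable
    also have "\<dots> = (\<integral>\<^sup>+v. dir_dens m s v * H (l, sext m v) \<partial>Leb m) / Z2"
      unfolding Z2_def by (rule nn_integral_normalized_density) measurable
    finally show ?thesis .
  qed
  have [measurable]: "(\<lambda>l. \<integral>\<^sup>+v. dir_dens m s v * H (l, sext m v) \<partial>Leb m) \<in> borel_measurable (Leb (Suc m))"
    by (rule borel_measurable_nn_integral_Leb) (unfold case_prod_beta', measurable)
  have "integral\<^sup>N EE H = (\<integral>\<^sup>+l. \<integral>\<^sup>+w. H (l, w) \<partial>dirichlet (Suc m) (\<beta> / 2) \<partial>jacobi_eig (Suc m) \<beta> a b)"
    unfolding EE_def jacobi_ensemble_def by (rule p2.nn_integral_fst[OF H', symmetric])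
  also have "\<dots> = (\<integral>\<^sup>+l. (\<integral>\<^sup>+v. dir_dens m s v * H (l, sext m v) \<partial>Leb m) / Z2 \<partial>jacobi_eig (Suc m) \<beta> a b)"
    by (rule nn_integral_cong) (use in2 sets_eq_imp_space_eq[OF se] in blast)
  also have "\<dots> = (\<integral>\<^sup>+l. eig_dens (Suc m) \<beta> A B l * ((\<integral>\<^sup>+v. dir_dens m s v * H (l, sext m v) \<partial>Leb m) / Z2) \<partial>Leb (Suc m)) / Z1"
    unfolding eig_eq Z1_def by (rule nn_integral_normalized_density) measurable
  also have "(\<integral>\<^sup>+l. eig_dens (Suc m) \<beta> A B l * ((\<integral>\<^sup>+v. dir_dens m s v * H (l, sext m v) \<partial>Leb m) / Z2) \<partial>Leb (Suc m)) =
     (\<integral>\<^sup>+l. (\<integral>\<^sup>+v. eig_dens (Suc m) \<beta> A B l * dir_dens m s v * H (l, sext m v) \<partial>Leb m) / Z2 \<partial>Leb (Suc m))"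
  proof (rule nn_integral_cong)
    fix l assume [measurable]: "l \<in> space (Leb (Suc m))"
    have "(\<integral>\<^sup>+v. eig_dens (Suc m) \<beta> A B l * (dir_dens m s v * H (l, sext m v)) \<partial>Leb m) =
      eig_dens (Suc m) \<beta> A B l * (\<integral>\<^sup>+v. dir_dens m s v * H (l, sext m v) \<partial>Leb m)"
      by (rule nn_integral_cmult) measurable
    then show "eig_dens (Suc m) \<beta> A B l * ((\<integral>\<^sup>+v. dir_dens m s v * H (l, sext m v) \<partial>Leb m) / Z2) =
      (\<integral>\<^sup>+v. eig_dens (Suc m) \<beta> A B l * dir_dens m s v * H (l, sext m v) \<partial>Leb m) / Z2"
      by (simp add: mult.assoc divide_ennreal_def)
  qed
  also have "\<dots> = (\<integral>\<^sup>+l. (\<integral>\<^sup>+v. eig_dens (Suc m) \<beta> A B l * dir_dens m s v * H (l, sext m v) \<partial>Leb m) \<partial>Leb (Suc m)) / Z2"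
    by (rule nn_integral_divide, rule borel_measurable_nn_integral_Leb) (unfold case_prod_beta', measurable)
  also have "\<dots> / Z1 = (\<integral>\<^sup>+l. (\<integral>\<^sup>+v. eig_dens (Suc m) \<beta> A B l * dir_dens m s v * H (l, sext m v) \<partial>Leb m) \<partial>Leb (Suc m)) / ennreal CC"
    unfolding Z1_Z2[symmetric] using Z_pos
    by (simp add: divide_ennreal_def ennreal_inverse_mult top.not_eq_extremum mult.assoc mult.commute[of "inverse Z1"])
  finally show ?thesis .
qed

lemma wmom_EE: "(\<lambda>p. wmom (Suc m) (fst p) (snd p)) \<in> measurable EE Mseq"
  by (rule measurable_wmom) measurable

text \<open>The canonical moments of the spectral measure are independent and Beta distributed.\<close>

theorem emeasure_EE_wmom:
  assumes X [measurable]: "X \<in> sets Mseq"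
  shows "emeasure EE {p \<in> space EE. wmom (Suc m) (fst p) (snd p) \<in> X} = emeasure PP {p \<in> space PP. mS (zz p) \<in> X}"
proof -
  note [measurable] = measurable_mS_zz wmom_EE
  have ind: "emeasure M {p \<in> space M. f p \<in> X} = (\<integral>\<^sup>+p. indicator X (f p) \<partial>M)"
    if [measurable]: "f \<in> measurable M Mseq" for M :: "'c measure" and f
  proof -
    have "emeasure M {p \<in> space M. f p \<in> X} = (\<integral>\<^sup>+p. indicator {p \<in> space M. f p \<in> X} p \<partial>M)"
      by (rule nn_integral_indicator[symmetric]) measurable
    also have "\<dots> = (\<integral>\<^sup>+p. indicator X (f p) \<partial>M)" by (intro nn_integral_cong) (auto simp: indicator_def)
    finally show ?thesis .
  qed
  have "emeasure EE {p \<in> space EE. wmom (Suc m) (fst p) (snd p) \<in> X} = (\<integral>\<^sup>+p. indicator X (wmom (Suc m) (fst p) (snd p)) \<partial>EE)"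
    by (rule ind) measurable
  also have "\<dots> = (\<integral>\<^sup>+l. \<integral>\<^sup>+v. eig_dens (Suc m) \<beta> A B l * dir_dens m s v * indicator X (wmom (Suc m) l (sext m v)) \<partial>Leb m \<partial>Leb (Suc m)) / ennreal CC"
    by (subst nn_integral_EE) simp_all
  also have "\<dots> = (\<integral>\<^sup>+p. indicator X (mS (zz p)) \<partial>PP)"
    using CC_pos by (subst nn_integral_eig_dir_beta) (simp_all add: ennreal_mult_divide_eq mult.commute[of "ennreal CC"])
  also have "\<dots> = emeasure PP {p \<in> space PP. mS (zz p) \<in> X}"
    by (rule ind[symmetric]) measurable
  finally show ?thesis .
qed

lemma AE_EE:
  "AE p in EE. (\<forall>i<Suc m. 0 < fst p i \<and> fst p i < 1) \<and> (\<forall>i<Suc m. 0 < snd p i) \<and> (\<Sum>i<Suc m. snd p i) = 1"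
proof -
  define Q where "Q p \<longleftrightarrow> (\<forall>i<Suc m. 0 < fst p i \<and> fst p i < 1) \<and> (\<forall>i<Suc m. 0 < snd p i) \<and> (\<Sum>i<Suc m. snd p i) = 1"
    for p :: "(nat \<Rightarrow> real) \<times> (nat \<Rightarrow> real)"
  have Qm [measurable]: "Measurable.pred (Leb (Suc m) \<Otimes>\<^sub>M Leb (Suc m)) Q" unfolding Q_def[abs_def] all_less_ball by measurable
  have zero: "eig_dens (Suc m) \<beta> A B l * dir_dens m s v * (if Q (l, sext m v) then 0 else 1) = 0" for l v
  proof (cases "(\<forall>i<Suc m. 0 < l i \<and> l i < 1) \<and> osimplex m v")
    case True
    then have "Q (l, sext m v)" using sext_sum[of m v] sext_pos[of m v] unfolding Q_def by (auto simp del: sum.lessThan_Suc)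
    then show ?thesis by simp
  next
    case False
    then have "eig_dens (Suc m) \<beta> A B l = 0 \<or> dir_dens m s v = 0"
      unfolding eig_dens_def dir_dens_def prod_indicator_eq osimplex_def by (auto simp: indicator_def)
    then show ?thesis by auto
  qed
  have "(\<integral>\<^sup>+p. (if Q p then 0 else 1) \<partial>EE) = (\<integral>\<^sup>+l. \<integral>\<^sup>+v. eig_dens (Suc m) \<beta> A B l * dir_dens m s v * (if Q (l, sext m v) then 0 else 1) \<partial>Leb m \<partial>Leb (Suc m)) / ennreal CC"
    by (rule nn_integral_EE) measurable
  also have "\<dots> = 0" unfolding zero by simp
  finally have "(\<integral>\<^sup>+p. (if Q p then 0 else 1) \<partial>EE) = 0" .
  then have "AE p in EE. (if Q p then 0 else 1) = (0::ennreal)"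
    by (subst (asm) nn_integral_0_iff_AE) measurable
  then show ?thesis unfolding Q_def by eventually_elim (auto split: if_splits)
qed

end

section \<open>Orthogonal polynomials from recursion coefficients\<close>

unbundle fps_syntax

lemma continuous_mS:
  assumes "\<And>i. continuous_on S (\<lambda>u. z u i)"
  shows "continuous_on S (\<lambda>u. mS (z u) k)"
  using assms
proof (induction k arbitrary: z rule: less_induct)
  case (less k)
  show ?case
  proof (cases k)
    case (Suc j)
    have "continuous_on S (\<lambda>u. \<Sum>i\<le>j. mS (z u) i * (z u 0 * mS (\<lambda>j. z u (Suc j)) (j - i)))"
    proof (intro continuous_on_sum continuous_on_mult)
      fix i assume "i \<in> {..j}"
      then show "continuous_on S (\<lambda>u. mS (z u) i)" "continuous_on S (\<lambda>u. mS (\<lambda>j. z u (Suc j)) (j - i))"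
        using Suc less.prems by (auto intro!: less.IH)
    qed (rule less.prems)
    then show ?thesis using Suc by simp
  qed simp
qed

lemma mS_scale: "mS (\<lambda>i. c * z i) k = c ^ k * mS z k"
proof (induction k arbitrary: z rule: less_induct)
  case (less k)
  show ?case
  proof (cases k)
    case (Suc j)
    have "mS (\<lambda>i. c * z i) i * (c * z 0 * mS (\<lambda>i. c * z (Suc i)) (j - i)) = c ^ Suc j * (mS z i * (z 0 * mS (\<lambda>j. z (Suc j)) (j - i)))"
      if "i \<le> j" for i
    proof -
      have "c ^ Suc j = c ^ i * (c * c ^ (j - i))" using that by (simp add: power_add[symmetric])
      moreover have "mS (\<lambda>i. c * z i) i = c ^ i * mS z i" using that Suc by (intro less.IH) simp
      moreover have "mS (\<lambda>i. c * z (Suc i)) (j - i) = c ^ (j - i) * mS (\<lambda>j. z (Suc j)) (j - i)"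
        using that Suc by (intro less.IH) simp
      ultimately show ?thesis by (simp only: ac_simps)
    qed
    then show ?thesis unfolding Suc mS.simps sum_distrib_left by (intro sum.cong) auto
  qed simp
qed

definition Gf :: "(nat \<Rightarrow> real) \<Rightarrow> nat \<Rightarrow> real fps" where
  "Gf z i = Abs_fps (mS (\<lambda>j. z (i + j)))"

lemma Gf_rec: "Gf z i = 1 + fps_const (z i) * fps_X * (Gf z i * Gf z (Suc i))"
proof (rule fps_ext)
  fix k
  show "Gf z i $ k = (1 + fps_const (z i) * fps_X * (Gf z i * Gf z (Suc i))) $ k"
  proof (cases k)
    case (Suc j)
    have "(Gf z i * Gf z (Suc i)) $ j = (\<Sum>a\<le>j. mS (\<lambda>j. z (i + j)) a * mS (\<lambda>j. z (Suc (i + j))) (j - a))"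
      by (simp add: fps_mult_nth Gf_def atLeast0AtMost)
    then show ?thesis using Suc
      by (simp add: Gf_def mult.assoc sum_distrib_left mult.left_commute)
  qed (simp add: Gf_def)
qed

text \<open>Telescoping products of the continued fraction tails turn the continued fraction into linear three-term relations.\<close>

definition Tf :: "(nat \<Rightarrow> real) \<Rightarrow> nat \<Rightarrow> real fps" where
  "Tf z j = (\<Prod>i\<le>j. Gf z i)"

lemma Tf_0: "Tf z 0 = 1 + fps_const (z 0) * fps_X * Tf z 1"
  using Gf_rec[of z 0] by (simp add: Tf_def)

lemma Tf_Suc: "Tf z (Suc j) = Tf z j + fps_const (z (Suc j)) * fps_X * Tf z (Suc (Suc j))"
proof -
  have "Tf z (Suc j) = Tf z j * (1 + fps_const (z (Suc j)) * fps_X * (Gf z (Suc j) * Gf z (Suc (Suc j))))"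
    using Gf_rec[of z "Suc j"] by (simp add: Tf_def)
  also have "\<dots> = Tf z j + fps_const (z (Suc j)) * fps_X * Tf z (Suc (Suc j))"
    by (simp add: Tf_def algebra_simps)
  finally show ?thesis .
qed

lemma Tf_nth_0: "Tf z j $ 0 = 1"
  by (induction j) (simp_all add: Tf_def Gf_def fps_mult_nth_0)

lemma Tf_0_nth: "Tf z 0 $ k = mS z k"
  by (simp add: Tf_def Gf_def)

lemma Tf_nth_1: "Tf z n $ 1 = (\<Sum>i\<le>n. z i)"
proof (induction n)
  case 0
  show ?case by (subst Tf_0) (simp add: mult.assoc Tf_nth_0)
next
  case (Suc n)
  show ?case by (subst Tf_Suc) (simp add: mult.assoc Tf_nth_0 Suc[simplified])
qed

text \<open>By \<open>Tf_Suc\<close> the entry \<open>(j, k)\<close> is the sum of the entry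
  \<open>(j - 1, k)\<close> and \<open>z j\<close> times the entry \<open>(j + 1, k - 1)\<close>.
  Both have \<open>2 * k + j\<close> lowered by one, so each contributes at most half of the bound;
  for \<open>j = 0\<close> only the second term is present. The case \<open>j = 0\<close> is the
  source of the bound \<open>(4 * M) ^ k\<close> for the moments.\<close>

lemma Tf_bound:
  assumes z: "\<And>i. 0 \<le> z i" "\<And>i. z i \<le> M"
  shows "0 \<le> Tf z j $ k \<and> Tf z j $ k \<le> 2 ^ (2 * k + j) * M ^ k"
proof (induction "2 * k + j" arbitrary: j k rule: less_induct)
  case less
  have M: "M \<ge> 0" using z[of 0] by simp
  have *: "0 \<le> z j * Tf z (Suc j) $ i \<and> z j * Tf z (Suc j) $ i \<le> 2 ^ (2 * i + Suc j) * M ^ Suc i" if "k = Suc i" for i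
  proof -
    have IH: "0 \<le> Tf z (Suc j) $ i" "Tf z (Suc j) $ i \<le> 2 ^ (2 * i + Suc j) * M ^ i"
      using less[of i "Suc j"] that by auto
    have "z j * Tf z (Suc j) $ i \<le> M * (2 ^ (2 * i + Suc j) * M ^ i)"
      by (rule mult_mono) (use IH z M in auto)
    then show ?thesis using IH z by (simp add: mult.left_commute)
  qed
  show ?case
  proof (cases k)
    case 0
    then show ?thesis by (simp add: Tf_nth_0 one_le_power)
  next
    case k: (Suc i)
    show ?thesis
    proof (cases j)
      case 0
      have e: "Tf z 0 $ Suc i = z 0 * Tf z 1 $ i" by (subst Tf_0) (simp add: mult.assoc)
      have "(2::real) ^ (2 * i + 1) * M ^ Suc i \<le> 2 ^ (2 * Suc i) * M ^ Suc i"
        using M by (intro mult_right_mono power_increasing) auto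
      then show ?thesis using *[OF k] e 0 k by (auto simp: numeral_2_eq_2)
    next
      case (Suc l)
      have e: "Tf z (Suc l) $ Suc i = Tf z l $ Suc i + z (Suc l) * Tf z (Suc (Suc l)) $ i"
        by (subst Tf_Suc) (simp add: mult.assoc)
      have "0 \<le> Tf z l $ Suc i \<and> Tf z l $ Suc i \<le> 2 ^ (2 * Suc i + l) * M ^ Suc i"
        using less[of "Suc i" l] Suc k by auto
      moreover have "(2::real) ^ (2 * k + j) * M ^ k = 2 ^ (2 * Suc i + l) * M ^ Suc i + 2 ^ (2 * i + Suc j) * M ^ Suc i"
        using Suc k by (simp add: algebra_simps)
      ultimately show ?thesis using *[OF k] e Suc k by simp
    qed
  qed
qed

lemma mS_bound:
  assumes z: "\<And>i. 0 \<le> z i" "\<And>i. z i \<le> M"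
  shows "0 \<le> mS z k" "mS z k \<le> (4 * M) ^ k"
  using Tf_bound[of z M 0 k, OF z] by (simp_all add: Tf_0_nth power_mult power_mult_distrib)

text \<open>\<open>OA z j\<close> and \<open>OB z j\<close> are the monic orthogonal polynomials of \<open>\<mu>\<close> and of \<open>x d\<mu>(x)\<close>.\<close>

fun OA :: "(nat \<Rightarrow> real) \<Rightarrow> nat \<Rightarrow> real poly" and OB :: "(nat \<Rightarrow> real) \<Rightarrow> nat \<Rightarrow> real poly" where
  "OA z 0 = 1"
| "OA z (Suc j) = pCons 0 (OB z j) - smult (z (2 * j)) (OA z j)"
| "OB z 0 = 1"
| "OB z (Suc j) = OA z (Suc j) - smult (z (2 * j + 1)) (OB z j)"

lemma OA_OB_degree:
  "degree (OA z j) = j \<and> coeff (OA z j) j = 1 \<and> degree (OB z j) = j \<and> coeff (OB z j) j = 1"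
proof (induction j)
  case (Suc j)
  then have B: "degree (OB z j) = j" "coeff (OB z j) j = 1" and A: "degree (OA z j) = j" "coeff (OA z j) j = 1" by auto
  have "OB z j \<noteq> 0" using B by auto
  then have dp: "degree (pCons 0 (OB z j)) = Suc j" using B by simp
  have ca: "coeff (OA z (Suc j)) (Suc j) = 1" using B A by (simp add: coeff_eq_0)
  have "degree (OA z (Suc j)) \<le> Suc j" using dp A by (simp add: degree_diff_le del: degree_pCons_eq)
  then have da: "degree (OA z (Suc j)) = Suc j" using ca by (metis le_antisym le_degree zero_neq_one)
  have cb: "coeff (OB z (Suc j)) (Suc j) = 1" using ca B by (simp add: coeff_eq_0 del: OA.simps)
  have "degree (OB z (Suc j)) \<le> Suc j" using da B by (simp add: degree_diff_le del: OA.simps)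
  then have "degree (OB z (Suc j)) = Suc j" using cb by (metis le_antisym le_degree zero_neq_one)
  then show ?case using da ca cb by blast
qed simp

text \<open>Multiplication by the variable shifts coefficients, so the subleading coefficient is
  named without a case distinction: for \<open>j = 0\<close> both coefficients are 0 and both sums
  are empty, because \<open>2 * j - 1\<close> is 0 there.\<close>

lemma OA_OB_subcoeff:
  "coeff (pCons 0 (OA z j)) j = - (\<Sum>i<2 * j - 1. z i) \<and> coeff (pCons 0 (OB z j)) j = - (\<Sum>i<2 * j. z i)"
proof (induction j)
  case (Suc j)
  have A: "coeff (OA z (Suc j)) j = - (\<Sum>i<2 * j + 1. z i)"
    using Suc OA_OB_degree[of z j] by simp
  then have "coeff (OB z (Suc j)) j = - (\<Sum>i<2 * Suc j. z i)"
    using OA_OB_degree[of z j] by (simp del: OA.simps)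
  with A show ?case by (simp del: OA.simps OB.simps)
qed simp

section \<open>The moment functional and orthogonality relations\<close>

definition Lf :: "(nat \<Rightarrow> real) \<Rightarrow> real poly \<Rightarrow> real" where
  "Lf m p = (\<Sum>i\<le>degree p. coeff p i * m i)"

lemma Lf_altdef: "degree p \<le> n \<Longrightarrow> Lf m p = (\<Sum>i\<le>n. coeff p i * m i)"
  unfolding Lf_def by (rule sum.mono_neutral_left) (auto simp: coeff_eq_0)

lemma Lf_add: "Lf m (p + q) = Lf m p + Lf m q"
proof -
  define n where "n = max (degree p) (degree q)"
  have "degree p \<le> n" "degree q \<le> n" "degree (p + q) \<le> n" by (auto simp: n_def degree_add_le_max)
  then show ?thesis by (simp add: Lf_altdef[of _ n] sum.distrib distrib_right)
qed

lemma Lf_smult: "Lf m (smult c p) = c * Lf m p"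
  by (simp add: Lf_altdef[of "smult c p" "degree p"] Lf_def sum_distrib_left mult.assoc)

lemma Lf_diff: "Lf m (p - q) = Lf m p - Lf m q"
  using Lf_add[of m p "smult (-1) q"] Lf_smult[of m "-1" q] by simp

lemma Lf_0 [simp]: "Lf m 0 = 0" by (simp add: Lf_def)

lemma Lf_sum: "Lf m (\<Sum>i\<in>I. f i) = (\<Sum>i\<in>I. Lf m (f i))"
  by (induction I rule: infinite_finite_induct) (simp_all add: Lf_add)

lemma Lf_monom: "Lf m (monom c k) = c * m k"
  by (simp add: Lf_altdef[of "monom c k" k] degree_monom_le if_distrib[of "\<lambda>x. x * _"] cong: if_cong)

lemma Lf_mult: "Lf m (p * q) = (\<Sum>k\<le>degree p. coeff p k * Lf m (monom 1 k * q))"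
proof -
  have "p * q = (\<Sum>k\<le>degree p. smult (coeff p k) (monom 1 k * q))"
    by (subst poly_as_sum_of_monoms[symmetric, of p]) (simp add: sum_distrib_right smult_monom mult_smult_left[symmetric])
  then show ?thesis by (simp add: Lf_sum Lf_smult)
qed

definition hz :: "(nat \<Rightarrow> real) \<Rightarrow> nat \<Rightarrow> real" where "hz z n = (\<Prod>i<n. z i)"

text \<open>The factor \<open>fps_X ^ j\<close> expresses orthogonality to all lower powers, and the
  coefficients of \<open>Tf\<close> are the values from there on. In the induction step the
  recursions for \<open>OA\<close> and \<open>OB\<close> produce a difference of neighbouring
  \<open>Tf\<close>, which \<open>Tf_Suc\<close> turns into the next coefficient \<open>z\<close>
  and the next \<open>Tf\<close>. The shift to \<open>Suc k\<close> for \<open>OB\<close> reflects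
  its additional weight \<open>x\<close>.\<close>

lemma Lf_OA_OB:
  "\<forall>k. Lf (mS z) (monom 1 k * OA z j) = hz z (2 * j) * (fps_X ^ j * Tf z (2 * j)) $ k
     \<and> Lf (mS z) (monom 1 (Suc k) * OB z j) = hz z (2 * j + 1) * (fps_X ^ j * Tf z (2 * j + 1)) $ k"
proof (induction j)
  case 0
  have "mS z (Suc k) = z 0 * Tf z 1 $ k" for k
    unfolding Tf_0_nth[symmetric] by (subst Tf_0) (simp add: mult.assoc)
  then show ?case by (simp add: Lf_monom hz_def Tf_0_nth)
next
  case (Suc j)
  have x: "monom 1 k * pCons 0 p = monom (1::real) (Suc k) * p" for k p
    by (simp add: monom_Suc)
  have IA: "Lf (mS z) (monom 1 k * OA z j) = hz z (2 * j) * (fps_X ^ j * Tf z (2 * j)) $ k"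
    and IB: "Lf (mS z) (monom 1 (Suc k) * OB z j) = hz z (2 * j + 1) * (fps_X ^ j * Tf z (2 * j + 1)) $ k" for k
    using Suc by auto
  have A: "Lf (mS z) (monom 1 k * OA z (Suc j)) = hz z (2 * Suc j) * (fps_X ^ Suc j * Tf z (2 * Suc j)) $ k" for k
  proof -
    have "Lf (mS z) (monom 1 k * OA z (Suc j)) = hz z (2 * j + 1) * (fps_X ^ j * (Tf z (Suc (2 * j)) - Tf z (2 * j))) $ k"
      unfolding OA.simps right_diff_distrib Lf_diff mult_smult_right Lf_smult x IA IB
      by (simp add: hz_def algebra_simps)
    also have "Tf z (Suc (2 * j)) - Tf z (2 * j) = fps_const (z (Suc (2 * j))) * fps_X * Tf z (Suc (Suc (2 * j)))"
      by (subst Tf_Suc) simp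
    also have "fps_X ^ j * (fps_const (z (Suc (2 * j))) * fps_X * Tf z (Suc (Suc (2 * j)))) = fps_const (z (Suc (2 * j))) * (fps_X ^ Suc j * Tf z (2 * Suc j))"
      by (simp add: ac_simps)
    finally show ?thesis by (simp add: hz_def)
  qed
  have B: "Lf (mS z) (monom 1 (Suc k) * OB z (Suc j)) = hz z (2 * Suc j + 1) * (fps_X ^ Suc j * Tf z (2 * Suc j + 1)) $ k" for k
  proof -
    have "Lf (mS z) (monom 1 (Suc k) * OB z (Suc j)) =
      hz z (2 * Suc j) * (fps_X ^ Suc j * Tf z (2 * Suc j)) $ Suc k - z (2 * j + 1) * (hz z (2 * j + 1) * (fps_X ^ j * Tf z (2 * j + 1)) $ k)"
      unfolding OB.simps right_diff_distrib Lf_diff mult_smult_right Lf_smult A IB ..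
    also have "(fps_X ^ Suc j * Tf z (2 * Suc j)) $ Suc k = (fps_X ^ j * Tf z (2 * Suc j)) $ k"
      by (simp add: mult.assoc)
    also have "hz z (2 * Suc j) * (fps_X ^ j * Tf z (2 * Suc j)) $ k - z (2 * j + 1) * (hz z (2 * j + 1) * (fps_X ^ j * Tf z (2 * j + 1)) $ k) =
      hz z (2 * Suc j) * (fps_X ^ j * (Tf z (Suc (2 * j + 1)) - Tf z (2 * j + 1))) $ k"
      by (simp add: right_diff_distrib hz_def)
    also have "Tf z (Suc (2 * j + 1)) - Tf z (2 * j + 1) = fps_const (z (Suc (2 * j + 1))) * fps_X * Tf z (Suc (Suc (2 * j + 1)))"
      by (subst Tf_Suc) simp
    also have "fps_X ^ j * (fps_const (z (Suc (2 * j + 1))) * fps_X * Tf z (Suc (Suc (2 * j + 1)))) = fps_const (z (2 * Suc j)) * (fps_X ^ Suc j * Tf z (2 * Suc j + 1))"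
      by (simp add: ac_simps)
    finally show ?thesis by (simp add: hz_def)
  qed
  from A B show ?case by blast
qed

text \<open>Coefficients of \<open>p\<close> below index \<open>j\<close> are killed by the factor
  \<open>fps_X ^ j\<close>, and only the first two coefficients of \<open>Tf\<close> enter. Degree
  \<open>Suc j\<close> covers the norms as well as the entries of the Jacobi matrix, where
  \<open>p\<close> is the variable times an \<open>OA\<close>.\<close>

lemma Lf_mult_OA:
  assumes "degree p \<le> Suc j"
  shows "Lf (mS z) (p * OA z j) = hz z (2 * j) * (coeff p j + coeff p (Suc j) * (\<Sum>i\<le>2 * j. z i))"
proof -
  have "Lf (mS z) (p * OA z j) = (\<Sum>k\<le>degree p. coeff p k * (hz z (2 * j) * (fps_X ^ j * Tf z (2 * j)) $ k))"
    unfolding Lf_mult[of _ p] using Lf_OA_OB[of z j] by simp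
  also have "\<dots> = (\<Sum>k\<le>Suc j. coeff p k * (hz z (2 * j) * (fps_X ^ j * Tf z (2 * j)) $ k))"
    using assms by (intro sum.mono_neutral_left) (auto simp: coeff_eq_0)
  also have "\<dots> = (\<Sum>k\<in>{j, Suc j}. coeff p k * (hz z (2 * j) * (fps_X ^ j * Tf z (2 * j)) $ k))"
    by (rule sum.mono_neutral_right) (auto simp: fps_X_power_mult_nth)
  also have "\<dots> = hz z (2 * j) * (coeff p j + coeff p (Suc j) * (\<Sum>i\<le>2 * j. z i))"
    using Tf_nth_1[of z "2 * j"] by (simp add: fps_X_power_mult_nth Tf_nth_0 algebra_simps)
  finally show ?thesis .
qed

lemma Lf_OA_orth:
  assumes "i \<le> j"
  shows "Lf (mS z) (OA z i * OA z j) = (if i = j then hz z (2 * j) else 0)"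
proof -
  have "coeff (OA z i) j = (if i = j then 1 else 0)" "coeff (OA z i) (Suc j) = 0"
    using OA_OB_degree[of z i] assms by (auto simp: coeff_eq_0)
  then show ?thesis using OA_OB_degree[of z i] assms by (subst Lf_mult_OA) auto
qed

lemma Lf_OA_d:
  "Lf (mS z) (pCons 0 (OA z j) * OA z j) = hz z (2 * j) * ((if j = 0 then 0 else z (2 * j - 1)) + z (2 * j))"
proof -
  have "Lf (mS z) (pCons 0 (OA z j) * OA z j) = hz z (2 * j) * (- (\<Sum>i<2 * j - 1. z i) + (\<Sum>i\<le>2 * j. z i))"
    using OA_OB_degree[of z j] OA_OB_subcoeff[of z j] by (subst Lf_mult_OA) (auto simp: degree_pCons_le)
  also have "- (\<Sum>i<2 * j - 1. z i) + (\<Sum>i\<le>2 * j. z i) = (if j = 0 then 0 else z (2 * j - 1)) + z (2 * j)"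
  proof (cases j)
    case (Suc k)
    then show ?thesis by (simp add: lessThan_Suc_atMost[symmetric])
  qed simp
  finally show ?thesis .
qed

lemma Lf_OA_c:
  "Lf (mS z) (pCons 0 (OA z j) * OA z (Suc j)) = hz z (2 * Suc j)"
proof -
  have "coeff (pCons 0 (OA z j)) (Suc (Suc j)) = 0" using OA_OB_degree[of z j] by (simp add: coeff_eq_0)
  then show ?thesis
    using OA_OB_degree[of z j] by (subst Lf_mult_OA) (auto simp: degree_pCons_le le_SucI)
qed

section \<open>Orthonormal polynomials of a compactly supported measure\<close>

definition pint :: "real measure \<Rightarrow> real poly \<Rightarrow> real" where
  "pint \<mu> p = (\<integral>x. poly p x \<partial>\<mu>)"

definition mom :: "real measure \<Rightarrow> nat \<Rightarrow> real" where
  "mom \<mu> k = (\<integral>x. x ^ k \<partial>\<mu>)"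

text \<open>The complement of the support is covered by balls of measure zero, and by the Lindelof
  property countably many of them cover it.\<close>

lemma AE_msupp:
  assumes "sets \<mu> = sets borel"
  shows "AE x in \<mu>. x \<in> msupp \<mu>"
proof -
  define FF where "FF = {ball x e | x e. emeasure \<mu> (ball x e) = 0}"
  obtain F' where F': "F' \<subseteq> FF" "countable F'" "\<Union>F' = \<Union>FF"
    using Lindelof[of FF] unfolding FF_def by blast
  have "S \<in> null_sets \<mu>" if "S \<in> F'" for S
    using that F'(1) assms by (auto simp: FF_def null_sets_def)
  then have "\<Union>F' \<in> null_sets \<mu>" using null_sets_UN'[OF F'(2), of "\<lambda>S. S"] by simp
  moreover have "{x \<in> space \<mu>. x \<notin> msupp \<mu>} \<subseteq> \<Union>FF"
  proof
    fix x assume "x \<in> {x \<in> space \<mu>. x \<notin> msupp \<mu>}"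
    then obtain e where "e > 0" "emeasure \<mu> (ball x e) = 0" by (auto simp: msupp_def)
    then show "x \<in> \<Union>FF" unfolding FF_def by (intro UnionI[of "ball x e"]) auto
  qed
  ultimately show ?thesis using F'(3) by (intro AE_I'[of "\<Union>F'"]) auto
qed

lemma Mc_bounded:
  assumes "\<mu> \<in> Mc"
  obtains R where "R > 0" "AE x in \<mu>. \<bar>x\<bar> \<le> R"
proof -
  have "compact (msupp \<mu>)" "sets \<mu> = sets borel" using assms by (auto simp: Mc_def)
  then obtain R where R: "R > 0" "\<And>x. x \<in> msupp \<mu> \<Longrightarrow> norm x \<le> R"
    using compact_imp_bounded bounded_pos by metis
  have "AE x in \<mu>. \<bar>x\<bar> \<le> R" using AE_msupp[OF \<open>sets \<mu> = sets borel\<close>] by eventually_elim (use R in auto)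
  with R(1) show ?thesis by (rule that)
qed

lemma Mc_prob: "\<mu> \<in> Mc \<Longrightarrow> prob_space \<mu>" and Mc_sets: "\<mu> \<in> Mc \<Longrightarrow> sets \<mu> = sets borel"
  by (auto simp: Mc_def)

lemma integrable_Mc:
  fixes f :: "real \<Rightarrow> real"
  assumes "\<mu> \<in> Mc" "continuous_on UNIV f"
  shows "integrable \<mu> f"
proof -
  obtain R where R: "R > 0" "AE x in \<mu>. \<bar>x\<bar> \<le> R" by (rule Mc_bounded[OF assms(1)])
  have "compact (f ` {-R..R})" by (rule compact_continuous_image) (auto intro: continuous_on_subset[OF assms(2)])
  then obtain C where C: "\<And>x. x \<in> {-R..R} \<Longrightarrow> norm (f x) \<le> C"
    using compact_imp_bounded bounded_iff by (metis imageI)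
  interpret prob_space \<mu> by (rule Mc_prob[OF assms(1)])
  have "f \<in> borel_measurable \<mu>"
    using borel_measurable_continuous_onI[OF assms(2)] by (simp add: measurable_cong_sets[OF Mc_sets[OF assms(1)] refl])
  then show ?thesis
  proof (rule integrable_const_bound[rotated, where B = C])
    show "AE x in \<mu>. norm (f x) \<le> C" using R(2) by eventually_elim (rule C, simp add: abs_le_iff)
  qed
qed

lemma integrable_Mc_poly: "\<mu> \<in> Mc \<Longrightarrow> integrable \<mu> (poly p)"
  by (rule integrable_Mc) (auto intro: continuous_intros)

lemma pint_Lf:
  assumes "\<mu> \<in> Mc"
  shows "pint \<mu> p = Lf (mom \<mu>) p"
proof -
  have "pint \<mu> p = (\<integral>x. (\<Sum>i\<le>degree p. coeff p i * x ^ i) \<partial>\<mu>)" by (simp add: pint_def poly_altdef)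
  also have "\<dots> = (\<Sum>i\<le>degree p. \<integral>x. coeff p i * x ^ i \<partial>\<mu>)"
    by (rule Bochner_Integration.integral_sum, rule integrable_Mc[OF assms]) (intro continuous_intros)
  finally show ?thesis by (simp add: Lf_def mom_def)
qed

lemma orthonormal_polys_pint:
  "orthonormal_polys \<mu> N P \<longleftrightarrow> (\<forall>j<N. degree (P j) = j \<and> lead_coeff (P j) > 0) \<and>
     (\<forall>i<N. \<forall>j<N. pint \<mu> (P i * P j) = (if i = j then 1 else 0))"
  by (simp add: orthonormal_polys_def pint_def)

lemma poly_basis:
  assumes "\<And>i. i < j \<Longrightarrow> degree (P i) = i \<and> P i \<noteq> (0 :: real poly)" "degree p < j"
  shows "\<exists>a. p = (\<Sum>i<j. smult (a i) (P i))"
  using assms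
proof (induction j arbitrary: p)
  case (Suc j)
  define c where "c = coeff p j / coeff (P j) j"
  have Pj: "degree (P j) = j" "coeff (P j) j \<noteq> 0" using Suc.prems(1)[of j] leading_coeff_neq_0[of "P j"] by auto
  define r where "r = p - smult c (P j)"
  have r: "coeff r j = 0" "degree r \<le> j"
    using Pj Suc.prems(2) by (auto simp: r_def c_def intro!: degree_diff_le order.trans[OF degree_smult_le])
  show ?case
  proof (cases "r = 0")
    case True
    then have "p = (\<Sum>i<Suc j. smult ((\<lambda>i. if i = j then c else 0) i) (P i))" by (simp add: r_def)
    then show ?thesis by (rule exI[where x = "\<lambda>i. if i = j then c else 0"])
  next
    case False
    then have "degree r \<noteq> j" using r leading_coeff_neq_0 by metis
    then have "degree r < j" using r by simp
    then obtain a where "r = (\<Sum>i<j. smult (a i) (P i))" using Suc by (metis less_SucI)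
    then have "p = (\<Sum>i<Suc j. smult ((\<lambda>i. if i = j then c else a i) i) (P i))"
      by (simp add: r_def algebra_simps)
    then show ?thesis by (rule exI[where x = "\<lambda>i. if i = j then c else a i"])
  qed
qed simp

lemma pint_linear:
  assumes "\<mu> \<in> Mc"
  shows "pint \<mu> (p + q) = pint \<mu> p + pint \<mu> q" "pint \<mu> (p - q) = pint \<mu> p - pint \<mu> q"
    "pint \<mu> (smult c p) = c * pint \<mu> p" "pint \<mu> (\<Sum>i\<in>I. f i) = (\<Sum>i\<in>I. pint \<mu> (f i))"
  by (simp_all add: pint_Lf[OF assms] Lf_add Lf_diff Lf_smult Lf_sum)

lemma orthonormal_expand:
  assumes mu: "\<mu> \<in> Mc" and P: "orthonormal_polys \<mu> N P" and p: "degree p < j" "j \<le> N"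
  shows "p = (\<Sum>i<j. smult (pint \<mu> (p * P i)) (P i))"
proof -
  have deg: "degree (P i) = i \<and> P i \<noteq> 0" if "i < j" for i
  proof -
    have "i < N" using that p(2) by simp
    then have "degree (P i) = i" "lead_coeff (P i) > 0" using P unfolding orthonormal_polys_pint by blast+
    then show ?thesis by auto
  qed
  obtain a where a: "p = (\<Sum>i<j. smult (a i) (P i))" using poly_basis[OF deg p(1)] by blast
  have "pint \<mu> (p * P i) = a i" if i: "i < j" for i
  proof -
    have "pint \<mu> (p * P i) = (\<Sum>k<j. a k * pint \<mu> (P k * P i))"
      by (subst a) (simp add: sum_distrib_right pint_linear[OF mu])
    also have "\<dots> = (\<Sum>k<j. if k = i then a k else 0)"
      using P i p(2) by (intro sum.cong) (auto simp: orthonormal_polys_pint)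
    finally show ?thesis using i by simp
  qed
  then have "(\<Sum>i<j. smult (pint \<mu> (p * P i)) (P i)) = (\<Sum>i<j. smult (a i) (P i))" by (intro sum.cong) auto
  then show ?thesis using a by simp
qed

lemma orthonormal_zero_lower:
  assumes mu: "\<mu> \<in> Mc" and P: "orthonormal_polys \<mu> N P" and "degree p < j" "j < N"
  shows "pint \<mu> (p * P j) = 0"
proof -
  have "p = (\<Sum>i<j. smult (pint \<mu> (p * P i)) (P i))" by (rule orthonormal_expand[OF mu P]) (use assms in auto)
  then have "pint \<mu> (p * P j) = (\<Sum>i<j. pint \<mu> (p * P i) * pint \<mu> (P i * P j))"
    using pint_linear[OF mu] by (metis (mono_tags, lifting) mult_smult_left sum.cong sum_distrib_right)
  also have "\<dots> = 0" using P assms by (intro sum.neutral) (auto simp: orthonormal_polys_pint)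
  finally show ?thesis .
qed

text \<open>After the leading coefficients are matched, the difference has degree below
  \<open>j\<close> and is orthogonal to all lower polynomials, so it vanishes; normalization and
  positivity make the factor 1. This gives the definite description in \<open>orth_poly\<close> its
  value.\<close>

lemma orthonormal_unique:
  assumes mu: "\<mu> \<in> Mc" and P: "orthonormal_polys \<mu> N P" and Q: "orthonormal_polys \<mu> N Q" and j: "j < N"
  shows "P j = Q j"
proof -
  define c where "c = lead_coeff (Q j) / lead_coeff (P j)"
  have dP: "degree (P j) = j" "lead_coeff (P j) > 0" and dQ: "degree (Q j) = j" "lead_coeff (Q j) > 0"
    using P Q j by (auto simp: orthonormal_polys_pint)
  have c: "c > 0" using dP dQ by (simp add: c_def)
  define r where "r = Q j - smult c (P j)"
  have r0: "r = 0"
  proof (rule ccontr)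
    assume "r \<noteq> 0"
    have "degree r \<le> j" using dP dQ by (auto simp: r_def intro!: degree_diff_le order.trans[OF degree_smult_le])
    moreover have "coeff r j = 0" using dP dQ by (simp add: r_def c_def)
    ultimately have dr: "degree r < j" using \<open>r \<noteq> 0\<close> by (metis leading_coeff_neq_0 le_neq_implies_less)
    have "pint \<mu> (r * P i) = 0" if i: "i < j" for i
    proof -
      have "pint \<mu> (P i * Q j) = 0" "pint \<mu> (P i * P j) = 0"
        using orthonormal_zero_lower[OF mu Q _ j, of "P i"] orthonormal_zero_lower[OF mu P _ j, of "P i"] P i j
        by (auto simp: orthonormal_polys_pint)
      moreover have "r * P i = P i * Q j - smult c (P i * P j)" by (simp add: r_def left_diff_distrib right_diff_distrib mult.commute)
      ultimately show ?thesis by (simp only: pint_linear[OF mu])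
    qed
    then have "r = 0" using orthonormal_expand[OF mu P dr] j by simp
    then show False using \<open>r \<noteq> 0\<close> by contradiction
  qed
  then have Qj: "Q j = smult c (P j)" by (simp add: r_def)
  have "1 = pint \<mu> (Q j * Q j)" using Q j by (simp add: orthonormal_polys_pint)
  also have "\<dots> = c * c * pint \<mu> (P j * P j)" by (simp add: Qj pint_linear[OF mu])
  also have "\<dots> = c\<^sup>2" using P j by (simp add: orthonormal_polys_pint power2_eq_square)
  finally have "c = 1" using c by (simp add: power2_eq_1_iff)
  then show ?thesis using Qj by simp
qed

lemma orth_poly_eq:
  assumes mu: "\<mu> \<in> Mc" and P: "orthonormal_polys \<mu> (Suc j) P"
  shows "orth_poly \<mu> j = P j"
  unfolding orth_poly_def
proof (rule the_equality)
  show "\<exists>Q. orthonormal_polys \<mu> (Suc j) Q \<and> Q j = P j" using P by blast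
  fix p assume "\<exists>Q. orthonormal_polys \<mu> (Suc j) Q \<and> Q j = p"
  then obtain Q where Q: "orthonormal_polys \<mu> (Suc j) Q" "Q j = p" by blast
  show "p = P j" using orthonormal_unique[OF mu P Q(1), of j] Q(2) by simp
qed

lemma hz_pos: "(\<And>i. 0 < z i) \<Longrightarrow> 0 < hz z n"
  by (simp add: hz_def prod_pos)

text \<open>The monic polynomials \<open>OA z j\<close> divided by
  \<open>sqrt (hz z (2 * j))\<close> are orthonormal for \<open>\<mu>\<close>, and positivity of all
  \<open>z\<close> makes these norms nonzero in every degree. The entries of the Jacobi matrix are
  then read off from \<open>Lf_OA_d\<close> and \<open>Lf_OA_c\<close>.\<close>

lemma mS_imp_z_params:
  assumes mu: "\<mu> \<in> Mc" and m: "mom \<mu> = mS z" and z: "\<And>i. 0 < z i"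
  shows "z_params \<mu> (\<lambda>k. if k = 0 then 0 else z (k - 1))"
proof -
  define P where "P j = smult (1 / sqrt (hz z (2 * j))) (OA z j)" for j
  have h: "hz z n > 0" for n by (rule hz_pos[OF z])
  have pl: "pint \<mu> p = Lf (mS z) p" for p using pint_Lf[OF mu] m by simp
  have orth: "pint \<mu> (P i * P j) = (if i = j then 1 else 0)" if "i \<le> j" for i j
    using Lf_OA_orth[OF that, of z] h[of "2 * j"] by (simp add: P_def pl Lf_smult real_sqrt_mult[symmetric])
  have ON: "orthonormal_polys \<mu> N P" for N
    unfolding orthonormal_polys_pint
  proof (intro conjI allI impI)
    fix j
    show "degree (P j) = j" using OA_OB_degree[of z j] h[of "2 * j"] by (simp add: P_def)
    show "lead_coeff (P j) > 0" using OA_OB_degree[of z j] h[of "2 * j"] by (simp add: P_def)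
  next
    fix i j
    show "pint \<mu> (P i * P j) = (if i = j then 1 else 0)"
      using orth[of i j] orth[of j i] by (cases "i \<le> j") (auto simp: mult.commute)
  qed
  have has: "has_orth_poly \<mu> j" for j unfolding has_orth_poly_def using ON by blast
  have op: "orth_poly \<mu> j = P j" for j by (rule orth_poly_eq[OF mu ON])
  have d: "jacobi_d \<mu> (Suc j) = (if j = 0 then 0 else z (2 * j - 1)) + z (2 * j)" for j
  proof -
    have "jacobi_d \<mu> (Suc j) = pint \<mu> (pCons 0 (P j) * P j)"
      by (simp add: jacobi_d_def has op pint_def power2_eq_square mult.assoc)
    also have "\<dots> = Lf (mS z) (pCons 0 (OA z j) * OA z j) / hz z (2 * j)"
    proof -
      have "pCons 0 (P j) * P j = smult (1 / sqrt (hz z (2 * j)) * (1 / sqrt (hz z (2 * j)))) (pCons 0 (OA z j) * OA z j)"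
        by (simp add: P_def smult_add_right[symmetric])
      then show ?thesis using h[of "2 * j"] by (simp only: pl Lf_smult) (simp add: real_sqrt_mult[symmetric])
    qed
    also have "\<dots> = (if j = 0 then 0 else z (2 * j - 1)) + z (2 * j)" unfolding Lf_OA_d using h[of "2 * j"] by simp
    finally show ?thesis .
  qed
  have c: "jacobi_c \<mu> (Suc j) = sqrt (z (2 * j) * z (2 * j + 1))" for j
  proof -
    have "jacobi_c \<mu> (Suc j) = pint \<mu> (pCons 0 (P j) * P (Suc j))"
      by (simp add: jacobi_c_def has op pint_def mult.assoc)
    also have "pCons 0 (P j) * P (Suc j) = smult (1 / sqrt (hz z (2 * j)) * (1 / sqrt (hz z (2 * Suc j)))) (pCons 0 (OA z j) * OA z (Suc j))"
      by (simp add: P_def mult.commute del: OA.simps)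
    also have "pint \<mu> \<dots> = 1 / sqrt (hz z (2 * j)) * (1 / sqrt (hz z (2 * Suc j))) * hz z (2 * Suc j)"
      by (simp only: pl Lf_smult Lf_OA_c)
    also have "\<dots> = sqrt (hz z (2 * Suc j)) / sqrt (hz z (2 * j))"
    proof -
      have "1 / a * (1 / sqrt u) * u = sqrt u / a" if "u > 0" for a u :: real
        using that by (cases "a = 0") (simp_all add: field_simps)
      then show ?thesis using h[of "2 * Suc j"] by blast
    qed
    also have "\<dots> = sqrt (z (2 * j) * z (2 * j + 1))"
    proof -
      have "hz z (2 * Suc j) = hz z (2 * j) * (z (2 * j) * z (2 * j + 1))" by (simp add: hz_def)
      then show ?thesis using h[of "2 * j"] by (simp add: real_sqrt_mult)
    qed
    finally show ?thesis .
  qed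
  show ?thesis
    unfolding z_params_def
  proof (intro conjI allI impI)
    fix k :: nat
    show "0 \<le> (if k = 0 then 0 else z (k - 1))" using z by (simp add: less_imp_le)
  next
    fix k :: nat assume "1 \<le> k"
    then obtain j where k: "k = Suc j" by (cases k) auto
    show "jacobi_d \<mu> k = (if 2 * k - 2 = 0 then 0 else z (2 * k - 2 - 1)) + (if 2 * k - 1 = 0 then 0 else z (2 * k - 1 - 1))"
      unfolding k d by simp
    show "jacobi_c \<mu> k = sqrt ((if 2 * k - 1 = 0 then 0 else z (2 * k - 1 - 1)) * (if 2 * k = 0 then 0 else z (2 * k - 1)))"
      unfolding k c by simp
  qed simp
qed

unbundle no fps_syntax

section \<open>The rate function in terms of recursion coefficients\<close>

lemma OA_three_term:
  "OA z (Suc j) = pCons 0 (OA z j) - smult ((if j = 0 then 0 else z (2 * j - 1)) + z (2 * j)) (OA z j)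
     - (if j = 0 then 0 else smult (z (2 * j - 2) * z (2 * j - 1)) (OA z (j - 1)))"
proof (cases j)
  case (Suc k)
  have "pCons 0 (OB z (Suc k)) = pCons 0 (OA z (Suc k)) - smult (z (2 * k + 1)) (pCons 0 (OB z k))"
    by (simp del: OA.simps)
  also have "pCons 0 (OB z k) = OA z (Suc k) + smult (z (2 * k)) (OA z k)" by simp
  finally show ?thesis
    by (subst OA.simps(2)) (simp add: Suc smult_add_right smult_add_left algebra_simps del: OA.simps OB.simps)
qed simp

lemma orthonormal_polys_mono: "orthonormal_polys \<mu> N P \<Longrightarrow> M \<le> N \<Longrightarrow> orthonormal_polys \<mu> M P"
  unfolding orthonormal_polys_def by (meson less_le_trans)

lemma z_paramsD:
  assumes "z_params \<mu> z"
  shows "z 0 = 0" "jacobi_d \<mu> (Suc j) = z (2 * j) + z (2 * j + 1)"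
    "jacobi_c \<mu> (Suc j) = sqrt (z (2 * j + 1) * z (2 * j + 2))"
proof -
  have "z 0 = 0" and *: "\<forall>k\<ge>1. jacobi_d \<mu> k = z (2*k - 2) + z (2*k - 1) \<and> jacobi_c \<mu> k = sqrt (z (2*k - 1) * z (2*k))"
    using assms unfolding z_params_def by blast+
  then show "z 0 = 0" by simp
  show "jacobi_d \<mu> (Suc j) = z (2 * j) + z (2 * j + 1)" "jacobi_c \<mu> (Suc j) = sqrt (z (2 * j + 1) * z (2 * j + 2))"
    using spec[OF *, of "Suc j"] by simp_all
qed

text \<open>The entries of the Jacobi matrix make the orthonormal polynomials satisfy the three-term
  recursion of \<open>OA z\<close>, so the two families agree up to the factors \<open>S j\<close>.
  Thus both moment functionals coincide on the basis \<open>OA z\<close>, hence on every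
  monomial.\<close>

lemma z_params_imp_mS:
  assumes mu: "\<mu> \<in> Mc" and zp: "z_params \<mu> z'" and pos: "\<And>k. k \<ge> 1 \<Longrightarrow> 0 < z' k"
  shows "mom \<mu> = mS (\<lambda>i. z' (Suc i))"
proof -
  define z where "z i = z' (Suc i)" for i
  have z: "z i > 0" for i using pos[of "Suc i"] by (simp add: z_def)
  have jd: "jacobi_d \<mu> (Suc j) = (if j = 0 then 0 else z (2 * j - 1)) + z (2 * j)" for j
    using z_paramsD(2)[OF zp, of j] z_paramsD(1)[OF zp] by (cases j) (simp_all add: z_def)
  have jc: "jacobi_c \<mu> (Suc j) = sqrt (z (2 * j) * z (2 * j + 1))" for j
    using z_paramsD(3)[OF zp, of j] by (simp add: z_def)
  have jc_pos: "jacobi_c \<mu> (Suc j) > 0" for j using z by (simp add: jc)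
  \<comment> \<open>A missing orthonormal polynomial makes \<open>jacobi_c\<close> zero by default,
    so positive parameters yield polynomials of every degree.\<close>
  have has: "has_orth_poly \<mu> (Suc j)" for j
    using jc_pos[of j] unfolding jacobi_c_def by (auto split: if_splits)
  define P where "P = orth_poly \<mu>"
  have ON: "orthonormal_polys \<mu> N P" for N
  proof -
    obtain Q where Q: "orthonormal_polys \<mu> (Suc (Suc N)) Q" using has[of N] unfolding has_orth_poly_def by blast
    have "P j = Q j" if "j < N" for j
      unfolding P_def by (rule orth_poly_eq[OF mu orthonormal_polys_mono[OF Q]]) (use that in simp)
    then have eq: "j < N \<Longrightarrow> Q j = P j" for j by simp
    have "orthonormal_polys \<mu> N Q" by (rule orthonormal_polys_mono[OF Q]) simp
    then have *: "j < N \<Longrightarrow> degree (Q j) = j \<and> lead_coeff (Q j) > 0"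
      "i < N \<Longrightarrow> j < N \<Longrightarrow> (\<integral>x. poly (Q i) x * poly (Q j) x \<partial>\<mu>) = (if i = j then 1 else 0)" for i j
      unfolding orthonormal_polys_def by blast+
    show ?thesis
      unfolding orthonormal_polys_def
    proof (intro conjI allI impI)
      fix j assume j: "j < N"
      show "degree (P j) = j" "lead_coeff (P j) > 0" using *(1)[OF j] unfolding eq[OF j] by blast+
    next
      fix i j assume ij: "i < N" "j < N"
      show "(\<integral>x. poly (P i) x * poly (P j) x \<partial>\<mu>) = (if i = j then 1 else 0)"
        using *(2)[OF ij] unfolding eq[OF ij(1)] eq[OF ij(2)] .
    qed
  qed
  have has0: "has_orth_poly \<mu> j" for j unfolding has_orth_poly_def using ON by blast
  have deg: "degree (P j) = j" "lead_coeff (P j) > 0" for j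
    using ON[of "Suc j"] unfolding orthonormal_polys_def by blast+
  have orth: "pint \<mu> (P i * P j) = (if i = j then 1 else 0)" for i j
    using ON[of "Suc (max i j)"] unfolding orthonormal_polys_pint by (auto simp: less_Suc_eq_le)
  have d: "pint \<mu> (pCons 0 (P j) * P j) = (if j = 0 then 0 else z (2 * j - 1)) + z (2 * j)" for j
    using jd[of j] by (simp add: jacobi_d_def has0 P_def pint_def power2_eq_square mult.assoc)
  have c: "pint \<mu> (pCons 0 (P j) * P (Suc j)) = sqrt (z (2 * j) * z (2 * j + 1))" for j
    using jc[of j] by (simp add: jacobi_c_def has0 P_def pint_def mult.assoc)
  have rec: "pCons 0 (P j) = smult (sqrt (z (2 * j) * z (2 * j + 1))) (P (Suc j))
      + smult ((if j = 0 then 0 else z (2 * j - 1)) + z (2 * j)) (P j)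
      + (if j = 0 then 0 else smult (sqrt (z (2 * j - 2) * z (2 * j - 1))) (P (j - 1)))" for j
  proof -
    have "pCons 0 (P j) = (\<Sum>i<Suc (Suc j). smult (pint \<mu> (pCons 0 (P j) * P i)) (P i))"
      by (rule orthonormal_expand[OF mu ON _ order_refl]) (use deg(1)[of j] degree_pCons_le[of 0 "P j"] in linarith)
    also have "\<dots> = (\<Sum>i<j. smult (pint \<mu> (pCons 0 (P j) * P i)) (P i))
       + smult ((if j = 0 then 0 else z (2 * j - 1)) + z (2 * j)) (P j) + smult (sqrt (z (2 * j) * z (2 * j + 1))) (P (Suc j))"
      by (simp only: sum.lessThan_Suc d c)
    also have "(\<Sum>i<j. smult (pint \<mu> (pCons 0 (P j) * P i)) (P i)) = (if j = 0 then 0 else smult (sqrt (z (2 * j - 2) * z (2 * j - 1))) (P (j - 1)))"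
    proof (cases j)
      case (Suc k)
      have sw: "pCons 0 (P j) * P i = pCons 0 (P i) * P j" for i by (simp add: mult.commute)
      have "pint \<mu> (pCons 0 (P j) * P i) = 0" if "i < k" for i
        unfolding sw
        by (rule orthonormal_zero_lower[OF mu ON, of _ _ "Suc j"]) (use deg(1)[of i] degree_pCons_le[of 0 "P i"] that Suc in linarith)+
      then have "(\<Sum>i<j. smult (pint \<mu> (pCons 0 (P j) * P i)) (P i)) = smult (pint \<mu> (pCons 0 (P j) * P k)) (P k)"
        by (simp add: Suc)
      also have "pint \<mu> (pCons 0 (P j) * P k) = sqrt (z (2 * k) * z (2 * k + 1))"
        unfolding sw using c[of k] by (simp add: Suc)
      finally show ?thesis by (simp add: Suc)
    qed simp
    finally show ?thesis by (simp add: ac_simps)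
  qed
  define S where "S j = sqrt (hz z (2 * j))" for j
  have h: "hz z n > 0" for n by (rule hz_pos[OF z])
  have S: "S j > 0" for j using h by (simp add: S_def)
  have SS: "S (Suc j) = S j * sqrt (z (2 * j) * z (2 * j + 1))" for j
    by (simp add: S_def hz_def real_sqrt_mult)
  have P0: "P 0 = 1"
  proof -
    obtain p where p: "P 0 = [:p:]" using deg(1)[of 0] by (metis degree_eq_zeroE)
    interpret prob_space \<mu> by (rule Mc_prob[OF mu])
    have "p * p = 1" using orth[of 0 0] p by (simp add: pint_def prob_space)
    moreover have "p > 0" using deg(2)[of 0] p by simp
    ultimately have "p = 1" by (metis mult.left_neutral mult_less_cancel_right_disj not_less_iff_gr_or_eq zero_less_one mult_strict_mono less_imp_le)
    then show ?thesis using p by (simp add: one_pCons)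
  qed
  have PA: "smult (S j) (P j) = OA z j" for j
  proof (induction j rule: less_induct)
    case (less j)
    show ?case
    proof (cases j)
      case 0
      then show ?thesis using P0 by (simp add: S_def hz_def)
    next
      case (Suc k)
      have k: "smult (S k) (P k) = OA z k" using less[of k] Suc by simp
      have "smult (S (Suc k)) (P (Suc k)) = smult (S k) (smult (sqrt (z (2 * k) * z (2 * k + 1))) (P (Suc k)))"
        by (simp add: SS)
      also have "smult (sqrt (z (2 * k) * z (2 * k + 1))) (P (Suc k)) = pCons 0 (P k)
         - smult ((if k = 0 then 0 else z (2 * k - 1)) + z (2 * k)) (P k)
         - (if k = 0 then 0 else smult (sqrt (z (2 * k - 2) * z (2 * k - 1))) (P (k - 1)))"
        by (subst rec) simp
      also have "smult (S k) \<dots> = pCons 0 (smult (S k) (P k))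
         - smult ((if k = 0 then 0 else z (2 * k - 1)) + z (2 * k)) (smult (S k) (P k))
         - (if k = 0 then 0 else smult (S k * sqrt (z (2 * k - 2) * z (2 * k - 1))) (P (k - 1)))"
        by (simp add: smult_diff_right mult.commute)
      also have "(if k = 0 then 0 else smult (S k * sqrt (z (2 * k - 2) * z (2 * k - 1))) (P (k - 1))) =
         (if k = 0 then 0 else smult (z (2 * k - 2) * z (2 * k - 1)) (OA z (k - 1)))"
      proof (cases k)
        case (Suc i)
        have e: "S k * sqrt (z (2 * i) * z (2 * i + 1)) = (z (2 * i) * z (2 * i + 1)) * S i"
          using z[of "2 * i"] z[of "2 * i + 1"] unfolding Suc SS by simp
        have "smult (S i) (P i) = OA z i" using less[of i] \<open>j = Suc k\<close> Suc by simp
        then have "smult (S k * sqrt (z (2 * i) * z (2 * i + 1))) (P i) = smult (z (2 * i) * z (2 * i + 1)) (OA z i)"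
          unfolding e by (metis smult_smult)
        then show ?thesis by (simp add: Suc)
      qed simp
      finally show ?thesis unfolding k Suc by (simp only: OA_three_term[of z k])
    qed
  qed
  have eq: "Lf (mom \<mu>) (OA z j) = Lf (mS z) (OA z j)" for j
  proof -
    have "Lf (mom \<mu>) (OA z j) = S j * pint \<mu> (P 0 * P j)"
      unfolding PA[symmetric] by (simp add: pint_Lf[OF mu, symmetric] pint_linear[OF mu] P0)
    also have "\<dots> = (if j = 0 then 1 else 0)" using orth[of 0 j] by (simp add: S_def hz_def)
    also have "\<dots> = Lf (mS z) (OA z 0 * OA z j)" using Lf_OA_orth[of 0 j z] by (simp add: hz_def)
    finally show ?thesis by simp
  qed
  show ?thesis
  proof
    fix k
    have "\<exists>a. monom 1 k = (\<Sum>i<Suc k. smult (a i) (OA z i))"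
    proof (rule poly_basis)
      fix i assume "i < Suc k"
      show "degree (OA z i) = i \<and> OA z i \<noteq> 0" using OA_OB_degree[of z i] by auto
    qed (simp add: degree_monom_eq)
    then obtain a where "monom 1 k = (\<Sum>i<Suc k. smult (a i) (OA z i))" by blast
    then have "Lf (mom \<mu>) (monom 1 k) = Lf (mS z) (monom 1 k)" by (simp only: Lf_sum Lf_smult eq)
    then show "mom \<mu> k = mS (\<lambda>i. z' (Suc i)) k" by (simp add: Lf_monom z_def[abs_def])
  qed
qed

section \<open>The rate as a series in the coefficients\<close>

definition rterm :: "real \<Rightarrow> (nat \<Rightarrow> real) \<Rightarrow> nat \<Rightarrow> ereal" where
  "rterm \<tau> z k = gfun (z (2 * k)) + ereal \<tau> * gfun (z (2 * k + 1) / \<tau>)"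

definition Irate :: "real \<Rightarrow> (nat \<Rightarrow> real) \<Rightarrow> ereal" where
  "Irate \<tau> z = (\<Sum>k. rterm \<tau> z k)"

lemma gfun_nonneg: "0 \<le> gfun x"
  using ln_le_minus_one[of x] by (auto simp: gfun_def)

lemma rterm_nonneg: "0 \<le> \<tau> \<Longrightarrow> 0 \<le> rterm \<tau> z k"
  by (simp add: rterm_def gfun_nonneg)

lemma I_L_Irate:
  "I_L \<tau> \<mu> = (if msupp \<mu> \<subseteq> {0..} then (\<Sqinter>z'\<in>{z'. z_params \<mu> z'}. Irate \<tau> (\<lambda>i. z' (Suc i))) else \<infinity>)"
  by (simp add: I_L_def Irate_def rterm_def)

lemma Irate_le_term:
  assumes "0 \<le> \<tau>"
  shows "rterm \<tau> z k \<le> Irate \<tau> z"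
proof -
  have "(\<Sum>i<Suc k. rterm \<tau> z i) \<le> Irate \<tau> z"
    unfolding Irate_def by (rule suminf_upper) (rule rterm_nonneg[OF assms])
  moreover have "rterm \<tau> z k \<le> (\<Sum>i<Suc k. rterm \<tau> z i)"
    using sum_nonneg[of "{..<k}" "rterm \<tau> z"] rterm_nonneg[OF assms] by (simp add: add_increasing)
  ultimately show ?thesis by (rule order.trans[rotated])
qed

lemma Irate_finite_pos:
  assumes "Irate \<tau> z \<noteq> \<infinity>" "0 < \<tau>"
  shows "0 < z i"
proof -
  obtain k where k: "i = 2 * k \<or> i = 2 * k + 1" by (metis oddE evenE)
  have "rterm \<tau> z k \<noteq> \<infinity>" using Irate_le_term[of \<tau> z k] assms by auto
  then have "gfun (z (2 * k)) \<noteq> \<infinity> \<and> gfun (z (2 * k + 1) / \<tau>) \<noteq> \<infinity>" using assms(2) gfun_nonneg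
    by (auto simp: rterm_def)
  then show ?thesis using k assms(2) by (auto simp: gfun_def zero_less_divide_iff split: if_splits)
qed

lemma I_L_le_Irate:
  assumes "\<mu> \<in> Mc" "msupp \<mu> \<subseteq> {0..}" "mom \<mu> = mS z" "\<And>i. 0 < z i"
  shows "I_L \<tau> \<mu> \<le> Irate \<tau> z"
proof -
  have "z_params \<mu> (\<lambda>k. if k = 0 then 0 else z (k - 1))" by (rule mS_imp_z_params[OF assms(1,3,4)])
  then have "I_L \<tau> \<mu> \<le> Irate \<tau> (\<lambda>i. (\<lambda>k. if k = 0 then 0 else z (k - 1)) (Suc i))"
    unfolding I_L_Irate using assms(2) by (simp only: if_True) (rule INF_lower, simp)
  then show ?thesis by simp
qed

text \<open>A diagonal entry determines an odd parameter from the even one before it; an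
  off-diagonal entry then determines the next even parameter after division by that odd one, which
  is positive. So positivity of one of the two sequences carries the induction.\<close>

lemma z_params_unique:
  assumes "z_params \<mu> z" "z_params \<mu> z'" "\<And>k. k \<ge> 1 \<Longrightarrow> 0 < z k"
  shows "z = z'"
proof
  fix k show "z k = z' k"
  proof (induction k rule: less_induct)
    case (less k)
    have z: "z 0 = 0" "z' 0 = 0" using assms by (auto simp: z_params_def)
    have d: "z (2 * j) + z (2 * j + 1) = z' (2 * j) + z' (2 * j + 1)" for j
      using z_paramsD(2)[OF assms(1), of j] z_paramsD(2)[OF assms(2), of j] by simp
    have c: "sqrt (z (2 * j + 1) * z (2 * j + 2)) = sqrt (z' (2 * j + 1) * z' (2 * j + 2))" for j
      using z_paramsD(3)[OF assms(1), of j] z_paramsD(3)[OF assms(2), of j] by simp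
    show ?case
    proof (cases k)
      case 0
      then show ?thesis using z by simp
    next
      case k: (Suc i)
      show ?thesis
      proof (cases "even i")
        case True
        then obtain j where j: "i = 2 * j" by (auto elim: evenE)
        have "z (2 * j) = z' (2 * j)" using less[of "2 * j"] k j by simp
        then show ?thesis using d[of j] k j by simp
      next
        case False
        then obtain j where j: "i = 2 * j + 1" by (auto elim: oddE)
        have "z (2 * j + 1) = z' (2 * j + 1)" using less[of "2 * j + 1"] k j by simp
        moreover have "z (2 * j + 1) > 0" by (rule assms(3)) simp
        ultimately show ?thesis using c[of j] k j by simp
      qed
    qed
  qed
qed

text \<open>A finite infimum provides one admissible sequence with finite rate. Finiteness of each
  term makes that sequence positive, hence it is the only admissible one and the infimum is its
  rate.\<close>

lemma I_L_finite:
  assumes mu: "\<mu> \<in> Mc" and fin: "I_L \<tau> \<mu> \<noteq> \<infinity>" and tau: "0 < \<tau>"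
  obtains z where "\<And>i. 0 < z i" "mom \<mu> = mS z" "Irate \<tau> z = I_L \<tau> \<mu>" "msupp \<mu> \<subseteq> {0..}"
proof -
  have supp: "msupp \<mu> \<subseteq> {0..}" using fin by (auto simp: I_L_Irate split: if_splits)
  then have I: "I_L \<tau> \<mu> = (\<Sqinter>z'\<in>{z'. z_params \<mu> z'}. Irate \<tau> (\<lambda>i. z' (Suc i)))" by (simp add: I_L_Irate)
  have "\<exists>z'. z_params \<mu> z' \<and> Irate \<tau> (\<lambda>i. z' (Suc i)) \<noteq> \<infinity>"
  proof (rule ccontr)
    assume a: "\<not> ?thesis"
    have "\<infinity> \<le> I_L \<tau> \<mu>" unfolding I by (rule INF_greatest) (use a in auto)
    then show False using fin by simp
  qed
  then obtain z' where z': "z_params \<mu> z'" "Irate \<tau> (\<lambda>i. z' (Suc i)) \<noteq> \<infinity>" by blast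
  have pos: "0 < z' (Suc i)" for i using Irate_finite_pos[OF z'(2) tau, of i] by simp
  then have pos': "k \<ge> 1 \<Longrightarrow> 0 < z' k" for k by (cases k) auto
  have "I_L \<tau> \<mu> = Irate \<tau> (\<lambda>i. z' (Suc i))"
  proof (rule antisym)
    show "I_L \<tau> \<mu> \<le> Irate \<tau> (\<lambda>i. z' (Suc i))" unfolding I using z'(1) by (intro INF_lower) simp
    show "Irate \<tau> (\<lambda>i. z' (Suc i)) \<le> I_L \<tau> \<mu>"
      unfolding I
    proof (rule INF_greatest)
      fix y assume "y \<in> {z'. z_params \<mu> z'}"
      then have "z' = y" using z_params_unique[OF z'(1) _ pos'] by simp
      then show "Irate \<tau> (\<lambda>i. z' (Suc i)) \<le> Irate \<tau> (\<lambda>i. y (Suc i))" by simp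
    qed
  qed
  then show ?thesis
    using that[of "\<lambda>i. z' (Suc i)"] pos z_params_imp_mS[OF mu z'(1) pos'] supp by simp
qed

section \<open>The weak topology and moments\<close>

definition KR :: "real \<Rightarrow> real measure set" where
  "KR R = {\<mu> \<in> Mc. msupp \<mu> \<subseteq> {0..R}}"

lemma msupp_subset_closed:
  assumes "sets \<mu> = sets borel" "closed S" "AE x in \<mu>. x \<in> S"
  shows "msupp \<mu> \<subseteq> S"
proof
  fix x assume x: "x \<in> msupp \<mu>"
  show "x \<in> S"
  proof (rule ccontr)
    assume "x \<notin> S"
    then obtain e where e: "e > 0" "ball x e \<subseteq> - S"
      using assms(2) open_contains_ball[of "- S"] by auto
    have "AE y in \<mu>. y \<notin> ball x e" using assms(3) by eventually_elim (use e in auto)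
    then have "emeasure \<mu> (ball x e) = 0"
      using assms(1) by (subst (asm) AE_iff_null) (auto simp: null_sets_def ball_def sets_eq_imp_space_eq[OF assms(1)])
    with x e(1) show False by (auto simp: msupp_def)
  qed
qed

lemma closed_msupp:
  assumes "sets \<mu> = sets borel"
  shows "closed (msupp \<mu>)"
  proof (subst closed_def, rule openI)
    fix x assume "x \<in> - msupp \<mu>"
    then obtain e where e: "e > 0" "emeasure \<mu> (ball x e) = 0" by (auto simp: msupp_def)
    have "ball x (e/2) \<subseteq> - msupp \<mu>"
    proof
      fix y assume y: "y \<in> ball x (e/2)"
      have "ball y (e/2) \<subseteq> ball x e"
      proof
        fix w assume "w \<in> ball y (e/2)"
        then show "w \<in> ball x e" using y dist_triangle[of x w y] by simp
      qed
      then have "emeasure \<mu> (ball y (e/2)) \<le> emeasure \<mu> (ball x e)"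
        using assms by (intro emeasure_mono) auto
      then show "y \<in> - msupp \<mu>" using e by (auto simp: msupp_def intro!: exI[of _ "e/2"])
    qed
    then show "\<exists>e>0. ball x e \<subseteq> - msupp \<mu>" using e(1) by (intro exI[of _ "e/2"]) auto
  qed

lemma KR_AE:
  assumes "\<mu> \<in> KR R" shows "AE x in \<mu>. 0 \<le> x \<and> x \<le> R"
proof -
  have "sets \<mu> = sets borel" "msupp \<mu> \<subseteq> {0..R}" using assms by (auto simp: KR_def Mc_def)
  from AE_msupp[OF this(1)] show ?thesis by eventually_elim (use \<open>msupp \<mu> \<subseteq> {0..R}\<close> in auto)
qed

lemma KR_Mc: "\<mu> \<in> KR R \<Longrightarrow> \<mu> \<in> Mc" by (simp add: KR_def)

lemma KR_I:
  assumes "sets \<mu> = sets borel" "prob_space \<mu>" "AE x in \<mu>. 0 \<le> x \<and> x \<le> R"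
  shows "\<mu> \<in> KR R"
proof -
  have s: "msupp \<mu> \<subseteq> {0..R}" by (rule msupp_subset_closed[OF assms(1)]) (use assms(3) in auto)
  have "closed (msupp \<mu>)" using assms(1) by (rule closed_msupp)
  then have "compact (msupp \<mu>)" using s by (meson bounded_closed_interval bounded_subset compact_eq_bounded_closed)
  with s assms show ?thesis by (simp add: KR_def Mc_def)
qed

text \<open>Markov's inequality for the \<open>k\<close>-th power at the threshold
  \<open>R * q\<close> with \<open>q > 1\<close> bounds the mass above it by
  \<open>(1 / q) ^ k\<close>, which tends to 0. Countably many \<open>q\<close> decreasing to 1 give
  the result.\<close>

lemma KR_if_mom_le:
  assumes mu: "\<mu> \<in> Mc" "msupp \<mu> \<subseteq> {0..}" and R: "R > 0" and m: "\<And>k. mom \<mu> k \<le> R ^ k"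
  shows "\<mu> \<in> KR R"
proof (rule KR_I)
  interpret prob_space \<mu> by (rule Mc_prob[OF mu(1)])
  have s[measurable_cong]: "sets \<mu> = sets borel" by (rule Mc_sets[OF mu(1)])
  have p: "AE x in \<mu>. 0 \<le> x" using AE_msupp[OF s] by eventually_elim (use mu(2) in auto)
  have *: "AE x in \<mu>. x < R * (1 + 1 / real (Suc j))" for j
  proof -
    define q where "q = 1 + 1 / real (Suc j)"
    have q: "q > 1" by (simp add: q_def)
    have le: "prob {x \<in> space \<mu>. R * q \<le> x} \<le> (1 / q) ^ k" for k
    proof -
      have "prob {x \<in> space \<mu>. R * q \<le> x} = (\<integral>x. indicator {x \<in> space \<mu>. R * q \<le> x} x \<partial>\<mu>)" by simp
      also have "\<dots> \<le> (\<integral>x. (1 / (R * q)) ^ k * x ^ k \<partial>\<mu>)"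
      proof (rule integral_mono_AE)
        show "AE x in \<mu>. indicator {x \<in> space \<mu>. R * q \<le> x} x \<le> (1 / (R * q)) ^ k * x ^ k"
          using p
        proof eventually_elim
          case (elim x)
          have "1 \<le> (1 / (R * q) * x) ^ k" if "R * q \<le> x"
            using that q R by (intro one_le_power) (simp add: field_simps)
          moreover have "0 \<le> (1 / (R * q) * x) ^ k" using elim q R by simp
          ultimately show ?case unfolding power_mult_distrib by (auto simp: indicator_def)
        qed
        show "integrable \<mu> (\<lambda>x. (1 / (R * q)) ^ k * x ^ k)" by (rule integrable_Mc[OF mu(1)]) (intro continuous_intros)
      qed (auto simp: s integrable_indicator_iff emeasure_eq_measure)
      also have "\<dots> = (1 / (R * q)) ^ k * mom \<mu> k" by (simp add: mom_def)
      also have "\<dots> \<le> (1 / (R * q)) ^ k * R ^ k" using m R q by (intro mult_left_mono) auto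
      also have "\<dots> = (1 / q) ^ k" unfolding power_mult_distrib[symmetric] using R by simp
      finally show ?thesis .
    qed
    have "(\<lambda>k. (1 / q) ^ k) \<longlonglongrightarrow> 0" using q by (intro LIMSEQ_realpow_zero) auto
    then have "prob {x \<in> space \<mu>. R * q \<le> x} \<le> 0" by (rule LIMSEQ_le_const) (use le in auto)
    then have "prob {x \<in> space \<mu>. R * q \<le> x} = 0" using measure_nonneg by (metis antisym)
    then have "AE x in \<mu>. \<not> R * q \<le> x"
      by (subst (asm) prob_eq_0) auto
    then show ?thesis unfolding q_def by eventually_elim auto
  qed
  then have "AE x in \<mu>. \<forall>j. x < R * (1 + 1 / real (Suc j))" by (simp add: AE_all_countable)
  with p show "AE x in \<mu>. 0 \<le> x \<and> x \<le> R"
  proof eventually_elim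
    case (elim x)
    have "(\<lambda>j. R * (1 + 1 / real (Suc j))) \<longlonglongrightarrow> R * (1 + 0)"
      by (intro tendsto_intros LIMSEQ_Suc[OF lim_1_over_n])
    then have "x \<le> R * (1 + 0)" by (rule LIMSEQ_le_const) (use elim in \<open>auto intro: less_imp_le\<close>)
    with elim show ?case by simp
  qed
qed (use mu in \<open>auto simp: Mc_def\<close>)

section \<open>Moment sequences of measures on a compact interval\<close>

lemma poly_approx:
  assumes "continuous_on UNIV (f :: real \<Rightarrow> real)" "e > 0"
  obtains p where "\<And>x. 0 \<le> x \<Longrightarrow> x \<le> R \<Longrightarrow> \<bar>f x - poly p x\<bar> < e"
proof -
  obtain g where g: "real_polynomial_function g" "\<And>x. x \<in> {0..R} \<Longrightarrow> \<bar>f x - g x\<bar> < e"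
    by (rule Stone_Weierstrass_real_polynomial_function[of "{0..R}" f e])
       (use assms in \<open>auto intro: continuous_on_subset\<close>)
  obtain a n where a: "g = (\<lambda>x. \<Sum>i\<le>n. a i * x ^ i)" using g(1) real_polynomial_function_iff_sum by blast
  have "poly (\<Sum>i\<le>n. monom (a i) i) x = g x" for x by (simp add: a poly_sum poly_monom)
  then show ?thesis using g(2) that[of "\<Sum>i\<le>n. monom (a i) i"] by simp
qed

lemma integral_Lf_diff:
  assumes "\<mu> \<in> KR R" "continuous_on UNIV f" "\<And>x. 0 \<le> x \<Longrightarrow> x \<le> R \<Longrightarrow> \<bar>f x - poly p x\<bar> < e"
  shows "\<bar>(\<integral>x. f x \<partial>\<mu>) - Lf (mom \<mu>) p\<bar> \<le> e"
proof -
  have mu: "\<mu> \<in> Mc" using assms(1) by (rule KR_Mc)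
  interpret prob_space \<mu> by (rule Mc_prob[OF mu])
  have i: "integrable \<mu> f" "integrable \<mu> (poly p)"
    using integrable_Mc[OF mu assms(2)] integrable_Mc_poly[OF mu] by auto
  have "(\<integral>x. f x \<partial>\<mu>) - Lf (mom \<mu>) p = (\<integral>x. f x - poly p x \<partial>\<mu>)"
    using i by (simp add: pint_Lf[OF mu, symmetric] pint_def)
  also have "\<bar>\<dots>\<bar> \<le> (\<integral>x. \<bar>f x - poly p x\<bar> \<partial>\<mu>)" by (rule integral_abs_bound)
  also have "\<dots> \<le> (\<integral>x. e \<partial>\<mu>)"
  proof (rule integral_mono_AE)
    show "AE x in \<mu>. \<bar>f x - poly p x\<bar> \<le> e"
      using KR_AE[OF assms(1)] by eventually_elim (use assms(3) in \<open>auto intro: less_imp_le\<close>)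
  qed (use i in auto)
  finally show ?thesis by (simp add: prob_space)
qed

text \<open>By polynomial approximation on \<open>{0..R}\<close> the moments determine the integrals
  of all continuous functions, in particular of sine and cosine, and therefore the characteristic
  function.\<close>

lemma mom_inj:
  assumes "\<mu> \<in> KR R" "\<nu> \<in> KR R" "mom \<mu> = mom \<nu>"
  shows "\<mu> = \<nu>"
proof -
  have M: "\<mu> \<in> Mc" "\<nu> \<in> Mc" using assms KR_Mc by auto
  have eq: "(\<integral>x. f x \<partial>\<mu>) = (\<integral>x. f x \<partial>\<nu>)" if f: "continuous_on UNIV f" for f :: "real \<Rightarrow> real"
  proof (rule ccontr)
    assume ne: "(\<integral>x. f x \<partial>\<mu>) \<noteq> (\<integral>x. f x \<partial>\<nu>)"
    define e where "e = \<bar>(\<integral>x. f x \<partial>\<mu>) - (\<integral>x. f x \<partial>\<nu>)\<bar> / 3"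
    have e: "e > 0" using ne by (simp add: e_def)
    obtain p where p: "\<And>x. 0 \<le> x \<Longrightarrow> x \<le> R \<Longrightarrow> \<bar>f x - poly p x\<bar> < e"
      using poly_approx[OF f e, of R] by blast
    have "\<bar>(\<integral>x. f x \<partial>\<mu>) - Lf (mom \<nu>) p\<bar> \<le> e" "\<bar>(\<integral>x. f x \<partial>\<nu>) - Lf (mom \<nu>) p\<bar> \<le> e"
      using integral_Lf_diff[OF assms(1) f p] integral_Lf_diff[OF assms(2) f p] unfolding assms(3) by auto
    moreover have "\<bar>(\<integral>x. f x \<partial>\<mu>) - (\<integral>x. f x \<partial>\<nu>)\<bar> = 3 * e" by (simp add: e_def)
    ultimately show False using e by linarith
  qed
  interpret m: real_distribution \<mu> by (intro real_distribution.intro Mc_prob M real_distribution_axioms.intro Mc_sets)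
  interpret n: real_distribution \<nu> by (intro real_distribution.intro Mc_prob M real_distribution_axioms.intro Mc_sets)
  have "char \<mu> t = char \<nu> t" for t
  proof (rule complex_eqI)
    have "Re (char \<mu> t) = (\<integral>x. cos (t * x) \<partial>\<mu>)"
      unfolding char_def by (subst integral_Re[symmetric], rule m.integrable_const_bound[where B = 1]) (auto simp: Re_exp)
    moreover have "Re (char \<nu> t) = (\<integral>x. cos (t * x) \<partial>\<nu>)"
      unfolding char_def by (subst integral_Re[symmetric], rule n.integrable_const_bound[where B = 1]) (auto simp: Re_exp)
    moreover have "Im (char \<mu> t) = (\<integral>x. sin (t * x) \<partial>\<mu>)"
      unfolding char_def by (subst integral_Im[symmetric], rule m.integrable_const_bound[where B = 1]) (auto simp: Im_exp)
    moreover have "Im (char \<nu> t) = (\<integral>x. sin (t * x) \<partial>\<nu>)"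
      unfolding char_def by (subst integral_Im[symmetric], rule n.integrable_const_bound[where B = 1]) (auto simp: Im_exp)
    moreover have "continuous_on UNIV (\<lambda>x. cos (t * x))" "continuous_on UNIV (\<lambda>x. sin (t * x))"
      by (intro continuous_intros)+
    ultimately show "Re (char \<mu> t) = Re (char \<nu> t)" "Im (char \<mu> t) = Im (char \<nu> t)"
      using eq[of "\<lambda>x. cos (t * x)"] eq[of "\<lambda>x. sin (t * x)"] by auto
  qed
  then show ?thesis by (intro Levy_uniqueness m.real_distribution_axioms n.real_distribution_axioms ext)
qed

lemma topspace_weak_top: "topspace weak_top = Mc"
proof -
  have "{\<mu> \<in> Mc. (\<integral>x. (\<lambda>_. 0::real) x \<partial>\<mu>) \<in> UNIV} \<in> {{\<mu> \<in> Mc. (\<integral>x. f x \<partial>\<mu>) \<in> U} | (f :: real \<Rightarrow> real) U.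
        continuous_on UNIV f \<and> bounded (range f) \<and> open U}"
    by (rule CollectI, rule exI[of _ "\<lambda>_. 0"], rule exI[of _ UNIV]) (simp add: image_constant_conv)
  then have "Mc \<subseteq> topspace weak_top" unfolding weak_top_def topology_generated_by_topspace by auto
  moreover have "topspace weak_top \<subseteq> Mc" unfolding weak_top_def topology_generated_by_topspace by auto
  ultimately show ?thesis by blast
qed

lemma continuous_map_weak_top:
  assumes "\<And>x. x \<in> topspace T \<Longrightarrow> h x \<in> Mc"
    and "\<And>f :: real \<Rightarrow> real. continuous_on UNIV f \<Longrightarrow> bounded (range f) \<Longrightarrow> continuous_map T euclideanreal (\<lambda>x. \<integral>y. f y \<partial>h x)"
  shows "continuous_map T weak_top h"
  unfolding weak_top_def
proof (rule continuous_on_generated_topo)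
  fix U assume "U \<in> {{\<mu> \<in> Mc. (\<integral>x. f x \<partial>\<mu>) \<in> U} | (f :: real \<Rightarrow> real) U.
        continuous_on UNIV f \<and> bounded (range f) \<and> open U}"
  then obtain f V where f: "U = {\<mu> \<in> Mc. (\<integral>x. f x \<partial>\<mu>) \<in> V}" "continuous_on UNIV (f :: real \<Rightarrow> real)" "bounded (range f)" "open V" by auto
  have "h -` U \<inter> topspace T = {x \<in> topspace T. (\<integral>y. f y \<partial>h x) \<in> V}" using assms(1) f(1) by auto
  also have "openin T \<dots>"
    by (rule openin_continuous_map_preimage[OF assms(2)[OF f(2,3)]]) (use f(4) in simp)
  finally show "openin T (h -` U \<inter> topspace T)" .
next
  show "h ` topspace T \<subseteq> \<Union>{{\<mu> \<in> Mc. (\<integral>x. f x \<partial>\<mu>) \<in> U} | (f :: real \<Rightarrow> real) U.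
        continuous_on UNIV f \<and> bounded (range f) \<and> open U}"
    unfolding topology_generated_by_topspace[symmetric] using assms(1) topspace_weak_top unfolding weak_top_def by auto
qed

text \<open>Outside \<open>mom ` KR R\<close> the value of \<open>unmom R\<close> is unspecified.\<close>

definition unmom :: "real \<Rightarrow> (nat \<Rightarrow> real) \<Rightarrow> real measure" where
  "unmom R = the_inv_into (KR R) mom"

lemma unmom_mom: "\<mu> \<in> KR R \<Longrightarrow> unmom R (mom \<mu>) = \<mu>"
  unfolding unmom_def by (rule the_inv_into_f_f) (auto intro: inj_onI mom_inj)

lemma continuous_Lf: "continuous_on S (\<lambda>m. Lf m p)"
  unfolding Lf_def by (intro continuous_intros continuous_on_product_then_coordinatewise continuous_on_id)

text \<open>An integral of a continuous function is, uniformly over \<open>KR R\<close>, a limit of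
  polynomial integrals, and each of these is a linear combination of finitely many moments.\<close>

lemma continuous_unmom: "continuous_map (top_of_set (mom ` KR R)) weak_top (unmom R)"
proof (rule continuous_map_weak_top)
  fix f :: "real \<Rightarrow> real" assume f: "continuous_on UNIV f"
  have "\<exists>p. \<forall>x. 0 \<le> x \<longrightarrow> x \<le> R \<longrightarrow> \<bar>f x - poly p x\<bar> < 1 / real (Suc n)" for n
    using poly_approx[OF f, of "1 / real (Suc n)" R] by (metis of_nat_0_less_iff zero_less_Suc zero_less_divide_1_iff)
  then obtain p where p: "\<And>n x. 0 \<le> x \<Longrightarrow> x \<le> R \<Longrightarrow> \<bar>f x - poly (p n) x\<bar> < 1 / real (Suc n)" by metis
  have "uniform_limit (mom ` KR R) (\<lambda>n m. Lf m (p n)) (\<lambda>m. \<integral>y. f y \<partial>unmom R m) sequentially"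
  proof (rule uniform_limitI)
    fix e :: real assume "e > 0"
    then obtain n0 where n0: "1 / real (Suc n0) < e" using nat_approx_posE by blast
    show "\<forall>\<^sub>F n in sequentially. \<forall>m\<in>mom ` KR R. dist (Lf m (p n)) (\<integral>y. f y \<partial>unmom R m) < e"
      using eventually_ge_at_top[of n0]
    proof eventually_elim
      case (elim n)
      show ?case
      proof
        fix m assume "m \<in> mom ` KR R"
        then obtain \<mu> where mu: "\<mu> \<in> KR R" "m = mom \<mu>" by auto
        have "1 / real (Suc n) \<le> 1 / real (Suc n0)" using elim by (simp add: frac_le)
        then show "dist (Lf m (p n)) (\<integral>y. f y \<partial>unmom R m) < e"
          using integral_Lf_diff[OF mu(1) f p, of n] n0 by (simp add: mu unmom_mom dist_real_def abs_minus_commute)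
      qed
    qed
  qed
  then have "continuous_on (mom ` KR R) (\<lambda>m. \<integral>y. f y \<partial>unmom R m)"
    by (rule uniform_limit_theorem[rotated]) (simp_all add: continuous_Lf)
  then show "continuous_map (top_of_set (mom ` KR R)) euclideanreal (\<lambda>m. \<integral>y. f y \<partial>unmom R m)" by simp
qed (auto simp: unmom_mom KR_Mc)

lemma tendsto_funI:
  assumes "\<And>k. ((\<lambda>n. f n k) \<longlongrightarrow> (l k :: real)) F"
  shows "(f \<longlongrightarrow> l) F"
proof -
  have "limitin (product_topology (\<lambda>i. euclidean) UNIV) f l F"
    unfolding limitin_componentwise using assms by simp
  then show ?thesis by (simp add: euclidean_product_topology)
qed

text \<open>Measures on a common bounded interval are tight, so every sequence has a weakly
  convergent subsequence. It remains to see that the limit is again supported in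
  \<open>{0..R}\<close> and that moments converge along the subsequence.\<close>

lemma compact_mom_KR: "compact (mom ` KR R)"
  unfolding compact_eq_seq_compact_metric seq_compact_def
proof (intro allI impI)
  fix f :: "nat \<Rightarrow> nat \<Rightarrow> real" assume "\<forall>n. f n \<in> mom ` KR R"
  then have "\<forall>n. \<exists>\<nu>. \<nu> \<in> KR R \<and> f n = mom \<nu>" by auto
  then obtain \<nu> where nu: "\<And>n. \<nu> n \<in> KR R" "\<And>n. f n = mom (\<nu> n)" by metis
  have rd: "real_distribution (\<nu> n)" for n
    using nu(1)[THEN KR_Mc] by (intro real_distribution.intro Mc_prob real_distribution_axioms.intro Mc_sets)
  have "tight \<nu>"
    unfolding tight_def
  proof (intro conjI allI impI rd)
    fix e :: real assume e: "e > 0"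
    have "measure (\<nu> n) {-1<..\<bar>R\<bar>+1} = 1" for n
    proof -
      interpret real_distribution "\<nu> n" by (rule rd)
      have "AE x in \<nu> n. x \<in> {-1<..\<bar>R\<bar>+1}" using KR_AE[OF nu(1)[of n]] by eventually_elim auto
      then show ?thesis by (subst prob_eq_1) auto
    qed
    then show "\<exists>a b. a < b \<and> (\<forall>n. 1 - e < measure (\<nu> n) {a<..b})"
      using e by (intro exI[of _ "-1"] exI[of _ "\<bar>R\<bar>+1"]) auto
  qed
  from tight_imp_convergent_subsubsequence[OF this strict_mono_id]
  obtain r M where r: "strict_mono r" "real_distribution M" "weak_conv_m (\<nu> \<circ> r) M" by auto
  interpret M: real_distribution M by (rule r(2))
  have conv: "(\<lambda>n. \<integral>x. g x \<partial>\<nu> (r n)) \<longlonglongrightarrow> (\<integral>x. g x \<partial>M)"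
    if "continuous_on UNIV g" "\<And>x. norm (g x) \<le> B" for g :: "real \<Rightarrow> real" and B
    using weak_conv_imp_integral_bdd_continuous_conv[of "\<nu> \<circ> r" M g B] rd r that
    by (simp add: continuous_on_eq_continuous_at)
  \<comment> \<open>A bounded continuous function that vanishes exactly on \<open>{0..R}\<close>;
    its integrals along the sequence are 0, so the limit lives on the interval as well.\<close>
  define g where "g = (\<lambda>x. min 1 (max 0 (- x) + max 0 (x - R)))"
  have gc: "continuous_on UNIV g" unfolding g_def by (intro continuous_intros)
  have g0: "0 \<le> g x" "norm (g x) \<le> 1" for x by (auto simp: g_def)
  have gz: "g x = 0 \<longleftrightarrow> 0 \<le> x \<and> x \<le> R" for x by (auto simp: g_def min_def max_def)
  have "(\<integral>x. g x \<partial>\<nu> n) = 0" for n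
    using KR_AE[OF nu(1)[of n]] by (intro integral_eq_zero_AE) (auto simp: gz)
  then have "(\<integral>x. g x \<partial>M) = 0" using conv[OF gc g0(2)] by (simp add: LIMSEQ_const_iff)
  moreover have "integrable M g"
    using g0 borel_measurable_continuous_onI[OF gc] by (intro M.integrable_const_bound[where B = 1]) auto
  ultimately have "AE x in M. g x = 0"
    using integral_nonneg_eq_0_iff_AE[of M g] g0 by auto
  then have aM: "AE x in M. 0 \<le> x \<and> x \<le> R" by (simp add: gz)
  then have M: "M \<in> KR R" by (intro KR_I M.prob_space_axioms) auto
  have "(\<lambda>n. mom (\<nu> (r n)) k) \<longlonglongrightarrow> mom M k" for k
  proof -
    \<comment> \<open>Powers are unbounded, so weak convergence is applied to powers of a truncated
      variable; for members of \<open>KR R\<close> they agree almost everywhere with the powers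
      themselves.\<close>
    have c: "continuous_on UNIV (\<lambda>x. (max 0 (min \<bar>R\<bar> x)) ^ k)" by (intro continuous_intros)
    have e: "(\<integral>x. (max 0 (min \<bar>R\<bar> x)) ^ k \<partial>\<mu>) = mom \<mu> k" if "\<mu> \<in> KR R" for \<mu>
      unfolding mom_def
    proof (rule integral_cong_AE)
      show "AE x in \<mu>. (max 0 (min \<bar>R\<bar> x)) ^ k = x ^ k"
        using KR_AE[OF that] by eventually_elim auto
    qed (use Mc_sets[OF KR_Mc[OF that]] in \<open>auto simp: measurable_cong_sets[OF Mc_sets[OF KR_Mc[OF that]] refl]\<close>)
    have "norm ((max 0 (min \<bar>R\<bar> x)) ^ k) \<le> \<bar>R\<bar> ^ k" for x
      unfolding norm_power by (rule power_mono) auto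
    from conv[OF c this] show ?thesis by (simp add: e nu(1) M)
  qed
  then have "(\<lambda>n. mom (\<nu> (r n))) \<longlonglongrightarrow> mom M" by (rule tendsto_funI)
  then show "\<exists>l\<in>mom ` KR R. \<exists>r. strict_mono r \<and> (f \<circ> r) \<longlonglongrightarrow> l"
    using M r(1) nu(2) by (intro bexI[of _ "mom M"] exI[of _ r]) (auto simp: comp_def)
qed

text \<open>The inverse of the moment map is continuous on the moments of \<open>KR R\<close>, so
  inside \<open>KR R\<close> weakly open events become open conditions on moments, for which the law
  of the canonical moments is available.\<close>

lemma open_mom:
  assumes "openin weak_top G"
  obtains V where "open V" "\<And>\<mu>. \<mu> \<in> KR R \<Longrightarrow> mom \<mu> \<in> V \<longleftrightarrow> \<mu> \<in> G"
proof -
  have "openin (top_of_set (mom ` KR R)) {m \<in> mom ` KR R. unmom R m \<in> G}"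
    using openin_continuous_map_preimage[OF continuous_unmom assms, of R] by simp
  then obtain V where V: "open V" "{m \<in> mom ` KR R. unmom R m \<in> G} = mom ` KR R \<inter> V"
    by (metis openin_open)
  have "mom \<mu> \<in> V \<longleftrightarrow> \<mu> \<in> G" if "\<mu> \<in> KR R" for \<mu>
  proof -
    have "mom \<mu> \<in> {m \<in> mom ` KR R. unmom R m \<in> G} \<longleftrightarrow> \<mu> \<in> G" using that unmom_mom[OF that] by auto
    then show ?thesis unfolding V(2) using that by auto
  qed
  with V(1) show ?thesis by (rule that)
qed

lemma compact_mom_closed:
  assumes "closedin weak_top F"
  shows "compact (mom ` (F \<inter> KR R))"
proof -
  have op: "openin weak_top (Mc - F)" using assms by (simp add: closedin_def topspace_weak_top)
  obtain V where V: "open V" "\<And>\<mu>. \<mu> \<in> KR R \<Longrightarrow> mom \<mu> \<in> V \<longleftrightarrow> \<mu> \<in> Mc - F"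
    using open_mom[OF op, of R] by blast
  have "mom ` (F \<inter> KR R) = mom ` KR R \<inter> (- V)"
  proof (intro equalityI subsetI)
    fix m assume "m \<in> mom ` KR R \<inter> (- V)"
    then obtain \<mu> where "\<mu> \<in> KR R" "m = mom \<mu>" "mom \<mu> \<notin> V" by auto
    then show "m \<in> mom ` (F \<inter> KR R)" using V(2) KR_Mc by blast
  qed (use V(2) in auto)
  then show ?thesis using compact_mom_KR[of R] V(1) by (auto intro: compact_Int_closed)
qed

lemma compactin_weak_top:
  assumes "compact C" "C \<subseteq> mom ` KR R"
  shows "compactin weak_top {\<mu> \<in> KR R. mom \<mu> \<in> C}"
proof -
  have "compactin (top_of_set (mom ` KR R)) C" using assms by (simp add: compactin_subtopology)
  then have "compactin weak_top (unmom R ` C)" by (rule image_compactin[OF _ continuous_unmom])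
  also have "unmom R ` C = {\<mu> \<in> KR R. mom \<mu> \<in> C}"
  proof (intro equalityI subsetI)
    fix \<mu> assume "\<mu> \<in> unmom R ` C"
    then obtain m where "m \<in> C" "\<mu> = unmom R m" by auto
    then show "\<mu> \<in> {\<mu> \<in> KR R. mom \<mu> \<in> C}" using assms(2) unmom_mom by fastforce
  next
    fix \<mu> assume "\<mu> \<in> {\<mu> \<in> KR R. mom \<mu> \<in> C}"
    then show "\<mu> \<in> unmom R ` C" by (intro image_eqI[of _ _ "mom \<mu>"]) (auto simp: unmom_mom)
  qed
  finally show ?thesis .
qed

section \<open>The spectral measure of the ensemble\<close>

text \<open>\<open>measure_of\<close> yields the intended measure only for a countably additive set
  function; the description as an image of a point measure provides this and makes integrals
  accessible. The \<open>max 0\<close> mirrors that \<open>ennreal\<close> sends negative weights to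
  0.\<close>

lemma spectral_measure_distr:
  "spectral_measure n x w = distr (point_measure {..<n} (\<lambda>i. ennreal (max 0 (w i)))) borel x"
proof -
  let ?D = "distr (point_measure {..<n} (\<lambda>i. ennreal (max 0 (w i)))) borel x"
  have m: "x \<in> measurable (point_measure {..<n} (\<lambda>i. ennreal (max 0 (w i)))) borel"
    by (auto simp: point_measure_def intro!: measurable_space)
  have "spectral_measure n x w = measure_of UNIV (sets borel) (emeasure ?D)"
    unfolding spectral_measure_def
  proof (rule measure_of_eq)
    fix A :: "real set" assume "A \<in> sigma_sets UNIV (sets borel)"
    then have A: "A \<in> sets borel" using sets.sigma_sets_eq[of "borel :: real measure"] by simp
    have "emeasure ?D A = (\<Sum>i\<in>x -` A \<inter> {..<n}. ennreal (max 0 (w i)))"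
      using A by (subst emeasure_distr[OF m A]) (auto simp: space_point_measure intro!: emeasure_point_measure_finite)
    also have "\<dots> = (\<Sum>i<n. ennreal (w i) * indicator A (x i))"
      by (rule sum.mono_neutral_cong_left) (auto simp: ennreal_max_0 indicator_def)
    finally show "(\<Sum>i<n. ennreal (w i) * indicator A (x i)) = emeasure ?D A" ..
  qed auto
  also have "\<dots> = ?D" using measure_of_of_measure[of ?D] by simp
  finally show ?thesis .
qed

lemma sets_spectral_measure [simp]: "sets (spectral_measure n x w) = sets borel"
  by (simp add: spectral_measure_distr)

lemma integral_spectral_measure:
  fixes f :: "real \<Rightarrow> real"
  assumes "f \<in> borel_measurable borel"
  shows "(\<integral>y. f y \<partial>spectral_measure n x w) = (\<Sum>i<n. max 0 (w i) * f (x i))"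
proof -
  have m: "x \<in> measurable (point_measure {..<n} (\<lambda>i. ennreal (max 0 (w i)))) borel"
    by (auto simp: point_measure_def intro!: measurable_space)
  show ?thesis unfolding spectral_measure_distr
    by (subst integral_distr[OF m assms], subst lebesgue_integral_point_measure_finite) auto
qed

lemma emeasure_spectral_measure_UNIV:
  "emeasure (spectral_measure n x w) UNIV = ennreal (\<Sum>i<n. max 0 (w i))"
proof -
  have m: "x \<in> measurable (point_measure {..<n} (\<lambda>i. ennreal (max 0 (w i)))) borel"
    by (auto simp: point_measure_def intro!: measurable_space)
  show ?thesis unfolding spectral_measure_distr
    by (subst emeasure_distr[OF m]) (auto simp: space_point_measure emeasure_point_measure_finite sum_ennreal[symmetric])
qed

lemma AE_spectral_measure:
  assumes "\<And>i. i < n \<Longrightarrow> P (x i)" "{y. P y} \<in> sets borel"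
  shows "AE y in spectral_measure n x w. P y"
proof -
  have m: "x \<in> measurable (point_measure {..<n} (\<lambda>i. ennreal (max 0 (w i)))) borel"
    by (auto simp: point_measure_def intro!: measurable_space)
  show ?thesis unfolding spectral_measure_distr
    using assms by (subst AE_distr_iff[OF m]) (auto simp: space_point_measure intro!: AE_I2)
qed

lemma spectral_measure_Mc: "spectral_measure n x w \<in> Mc \<longleftrightarrow> (\<Sum>i<n. max 0 (w i)) = 1"
proof
  assume "spectral_measure n x w \<in> Mc"
  then interpret prob_space "spectral_measure n x w" by (rule Mc_prob)
  have "space (spectral_measure n x w) = UNIV" by (simp add: spectral_measure_distr)
  then show "(\<Sum>i<n. max 0 (w i)) = 1"
    using emeasure_space_1 emeasure_spectral_measure_UNIV[of n x w] by simp
next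
  assume s: "(\<Sum>i<n. max 0 (w i)) = 1"
  have "prob_space (spectral_measure n x w)"
    by (rule prob_spaceI) (simp add: s emeasure_spectral_measure_UNIV spectral_measure_distr[of n x w, THEN arg_cong[of _ _ space]])
  moreover have "msupp (spectral_measure n x w) \<subseteq> x ` {..<n}"
    by (rule msupp_subset_closed) (auto intro!: finite_imp_closed AE_spectral_measure borel_closed)
  then have "bounded (msupp (spectral_measure n x w))"
    by (rule bounded_subset[rotated]) (simp add: finite_imp_bounded)
  then have "compact (msupp (spectral_measure n x w))"
    using closed_msupp[of "spectral_measure n x w"] by (simp add: compact_eq_bounded_closed)
  ultimately show "spectral_measure n x w \<in> Mc" by (simp add: Mc_def)
qed

text \<open>The spectral measure belongs to \<open>Mc\<close> only on the closed set where the positive parts of the weights sum to one, and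
it depends continuously on nodes and weights there.\<close>

lemma spectral_measure_event_measurable:
  assumes "openin weak_top G"
  shows "{p \<in> space (Leb n \<Otimes>\<^sub>M Leb n). spectral_measure n (\<lambda>i. c * fst p i) (snd p) \<in> G} \<in> sets (Leb n \<Otimes>\<^sub>M Leb n)"
proof -
  define W where "W = {p :: (nat \<Rightarrow> real) \<times> (nat \<Rightarrow> real). (\<Sum>i<n. max 0 (snd p i)) = 1}"
  define S where "S p = spectral_measure n (\<lambda>i. c * fst p i) (snd p)" for p
  have cfst: "continuous_on X (\<lambda>p :: (nat \<Rightarrow> real) \<times> (nat \<Rightarrow> real). fst p i)" for i X
    by (rule continuous_on_product_then_coordinatewise[where f = fst]) (intro continuous_intros)
  have csnd: "continuous_on X (\<lambda>p :: (nat \<Rightarrow> real) \<times> (nat \<Rightarrow> real). snd p i)" for i X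
    by (rule continuous_on_product_then_coordinatewise[where f = snd]) (intro continuous_intros)
  have "continuous_map (top_of_set W) weak_top S"
  proof (rule continuous_map_weak_top)
    fix f :: "real \<Rightarrow> real" assume f: "continuous_on UNIV f"
    have "continuous_on W (\<lambda>p. \<Sum>i<n. max 0 (snd p i) * f (c * fst p i))"
      by (intro continuous_intros csnd continuous_on_compose2[OF f] cfst) auto
    then show "continuous_map (top_of_set W) euclideanreal (\<lambda>p. \<integral>y. f y \<partial>S p)"
      by (simp add: S_def integral_spectral_measure[OF borel_measurable_continuous_onI[OF f]])
  qed (simp add: S_def spectral_measure_Mc W_def)
  from openin_continuous_map_preimage[OF this assms]
  have "openin (top_of_set W) {p \<in> W. S p \<in> G}" by (simp only: topspace_euclidean_subtopology)
  then obtain V where V: "open V" "{p \<in> W. S p \<in> G} = W \<inter> V" unfolding openin_open by blast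
  have "G \<subseteq> Mc" using openin_subset[OF assms] by (simp add: topspace_weak_top)
  then have "S p \<in> G \<Longrightarrow> p \<in> W" for p using spectral_measure_Mc unfolding S_def W_def by blast
  then have eq: "{p. S p \<in> G} = W \<inter> V" using V(2) by auto
  have "closed W" unfolding W_def by (intro closed_Collect_eq continuous_intros csnd)
  then have "W \<inter> V \<in> sets borel" using V(1) by auto
  also have "sets (borel :: ((nat \<Rightarrow> real) \<times> (nat \<Rightarrow> real)) measure) = sets (Mseq \<Otimes>\<^sub>M Mseq)"
    by (simp add: borel_prod[symmetric] sets_PiM_equal_borel cong: sets_pair_measure_cong)
  finally have m: "W \<inter> V \<in> sets (Mseq \<Otimes>\<^sub>M Mseq)" .
  have comp: "(\<lambda>u. u i) \<in> borel_measurable (Leb n)" for i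
  proof (cases "i < n")
    case False
    then have "u i = undefined" if "u \<in> space (Leb n)" for u using that by (auto simp: space_PiM PiE_def extensional_def)
    then show ?thesis by (subst measurable_cong[where g = "\<lambda>_. undefined"]) auto
  qed (auto intro: measurable_Leb_component)
  have "(\<lambda>p. (fst p, snd p)) \<in> measurable (Leb n \<Otimes>\<^sub>M Leb n) (Mseq \<Otimes>\<^sub>M Mseq)"
    by (intro measurable_Pair measurable_MseqI measurable_compose[OF measurable_fst comp] measurable_compose[OF measurable_snd comp])
  from measurable_sets[OF this m] show ?thesis
    unfolding eq[symmetric] by (simp add: S_def vimage_def Int_def conj_commute)
qed

lemma mom_spectral_measure:
  assumes "\<And>i. i < n \<Longrightarrow> 0 \<le> w i"
  shows "mom (spectral_measure n (\<lambda>i. c * x i) w) k = c ^ k * wmom n x w k"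
  unfolding mom_def using assms
  by (subst integral_spectral_measure) (auto simp: wmom_def sum_distrib_left power_mult_distrib max_absorb2 ac_simps intro!: sum.cong)

section \<open>From events of spectral measures to events of moment sequences\<close>

context jacobi_params
begin

definition zc :: "(nat \<Rightarrow> real) \<Rightarrow> nat \<Rightarrow> real" where "zc p i = b / a * zz p i"

lemma ab_pos: "a > 0" "b > 0"
  using a b mult_nonneg_nonneg[of "\<beta> / 2" "real m"] beta by linarith+

lemma good_spectral:
  defines "S p \<equiv> spectral_measure (Suc m) (\<lambda>i. b / a * fst p i) (snd p)"
  shows "AE p in EE. S p \<in> Mc \<and> msupp (S p) \<subseteq> {0..} \<and> mom (S p) = (\<lambda>k. (b / a) ^ k * wmom (Suc m) (fst p) (snd p) k)"
  using AE_EE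
proof eventually_elim
  case (elim p)
  have mx: "(\<Sum>i<Suc m. max 0 (snd p i)) = (\<Sum>i<Suc m. snd p i)" by (rule sum.cong) (use elim in \<open>auto intro: less_imp_le\<close>)
  have "S p \<in> Mc" unfolding S_def spectral_measure_Mc mx using elim by blast
  moreover have "msupp (S p) \<subseteq> {0..}"
  proof (rule msupp_subset_closed)
    show "AE x in S p. x \<in> {0..}"
      unfolding S_def by (rule AE_spectral_measure) (use elim ab_pos in \<open>auto intro!: mult_nonneg_nonneg less_imp_le\<close>)
  qed (auto simp: S_def)
  moreover have "mom (S p) k = (b / a) ^ k * wmom (Suc m) (fst p) (snd p) k" for k
    unfolding S_def by (rule mom_spectral_measure) (use elim in \<open>auto intro: less_imp_le\<close>)
  ultimately show ?case by auto
qed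

lemma measurable_scaled:
  "(\<lambda>u k. (b / a) ^ k * u k) \<in> measurable Mseq Mseq"
  by (rule measurable_MseqI) measurable

lemma measurable_mS_zc [measurable]: "(\<lambda>p. mS (zc p)) \<in> measurable PP Mseq"
proof -
  have "mS (zc p) = (\<lambda>k. (b / a) ^ k * mS (zz p) k)" for p
    using mS_scale[of "b / a" "zz p"] by (auto simp: zc_def[abs_def])
  then show ?thesis using measurable_compose[OF measurable_mS_zz measurable_scaled] by simp
qed

lemma emeasure_EE_scaled:
  assumes X: "X \<in> sets Mseq"
  shows "measure EE {p \<in> space EE. (\<lambda>k. (b / a) ^ k * wmom (Suc m) (fst p) (snd p) k) \<in> X} = measure PP {p \<in> space PP. mS (zc p) \<in> X}"
proof -
  have "mS (zc p) = (\<lambda>k. (b / a) ^ k * mS (zz p) k)" for p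
    using mS_scale[of "b / a" "zz p"] by (auto simp: zc_def[abs_def])
  moreover have "{u. (\<lambda>k. (b / a) ^ k * u k) \<in> X} \<in> sets Mseq"
    using measurable_sets[OF measurable_scaled X] by (simp add: vimage_def space_PiM)
  from emeasure_EE_wmom[OF this]
  have "measure EE {p \<in> space EE. (\<lambda>k. (b / a) ^ k * wmom (Suc m) (fst p) (snd p) k) \<in> X} = measure PP {p \<in> space PP. (\<lambda>k. (b / a) ^ k * mS (zz p) k) \<in> X}"
    by (simp add: measure_def)
  ultimately show ?thesis by simp
qed

definition momle :: "real \<Rightarrow> (nat \<Rightarrow> real) set" where "momle R = {u. \<forall>k. u k \<le> R ^ k}"

lemma momle_sets [measurable]: "momle R \<in> sets Mseq"
proof -
  have "{u \<in> space Mseq. \<forall>k. u k \<le> R ^ k} \<in> sets Mseq" by measurable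
  then show ?thesis by (simp add: momle_def space_PiM)
qed

text \<open>On the event \<open>momle R\<close> the growth of the moments puts the spectral measure
  into \<open>KR R\<close>, where membership in \<open>F\<close> is tested by moments. The second
  term pays for leaving this event.\<close>

lemma jacobi_prob_le:
  assumes C: "C \<in> sets Mseq" and R: "R > 0" and F: "\<And>\<mu>. \<mu> \<in> F \<Longrightarrow> \<mu> \<in> KR R \<Longrightarrow> mom \<mu> \<in> C"
  shows "jacobi_prob (Suc m) \<beta> a b F \<le> measure PP {p \<in> space PP. mS (zc p) \<in> C} + measure PP {p \<in> space PP. mS (zc p) \<notin> momle R}"
proof -
  let ?u = "\<lambda>p k. (b / a) ^ k * wmom (Suc m) (fst p) (snd p) k"
  have um: "?u \<in> measurable EE Mseq" using measurable_compose[OF wmom_EE measurable_scaled] by simp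
  have C': "- momle R \<in> sets Mseq" using sets.compl_sets[OF momle_sets[of R]] by (simp add: space_PiM Compl_eq_Diff_UNIV)
  have ms: "{p \<in> space EE. ?u p \<in> X} \<in> sets EE" if "X \<in> sets Mseq" for X
    using measurable_sets[OF um that] by (simp add: vimage_def Int_def conj_commute)
  have "jacobi_prob (Suc m) \<beta> a b F \<le> measure EE ({p \<in> space EE. ?u p \<in> C} \<union> {p \<in> space EE. ?u p \<in> - momle R})"
    unfolding jacobi_prob_def EE_def[symmetric]
  proof (rule EE.finite_measure_mono_AE)
    show "AE p in EE. p \<in> {p \<in> space EE. spectral_measure (Suc m) (\<lambda>i. b / a * fst p i) (snd p) \<in> F} \<longrightarrow>
      p \<in> {p \<in> space EE. ?u p \<in> C} \<union> {p \<in> space EE. ?u p \<in> - momle R}"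
      using good_spectral
    proof eventually_elim
      case (elim p)
      show ?case
      proof (intro impI)
        assume p: "p \<in> {p \<in> space EE. spectral_measure (Suc m) (\<lambda>i. b / a * fst p i) (snd p) \<in> F}"
        show "p \<in> {p \<in> space EE. ?u p \<in> C} \<union> {p \<in> space EE. ?u p \<in> - momle R}"
        proof (cases "?u p \<in> momle R")
          case True
          then have "spectral_measure (Suc m) (\<lambda>i. b / a * fst p i) (snd p) \<in> KR R"
            using elim by (intro KR_if_mom_le R) (auto simp: momle_def)
          then have "?u p \<in> C" using F elim p by force
          with p show ?thesis by simp
        qed (use p in simp)
      qed
    qed
  qed (intro sets.Un ms C C')
  also have "\<dots> \<le> measure EE {p \<in> space EE. ?u p \<in> C} + measure EE {p \<in> space EE. ?u p \<in> - momle R}"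
    by (intro measure_Un_le ms C C')
  finally show ?thesis using emeasure_EE_scaled[OF C] emeasure_EE_scaled[OF C'] by simp
qed

lemma jacobi_prob_ge:
  assumes G: "openin weak_top G" and V: "V \<in> sets Mseq" and R: "R > 0" and VG: "\<And>\<mu>. \<mu> \<in> KR R \<Longrightarrow> mom \<mu> \<in> V \<Longrightarrow> \<mu> \<in> G"
  shows "measure PP {p \<in> space PP. mS (zc p) \<in> V} - measure PP {p \<in> space PP. mS (zc p) \<notin> momle R} \<le> jacobi_prob (Suc m) \<beta> a b G"
proof -
  let ?u = "\<lambda>p k. (b / a) ^ k * wmom (Suc m) (fst p) (snd p) k"
  let ?E = "{p \<in> space EE. spectral_measure (Suc m) (\<lambda>i. b / a * fst p i) (snd p) \<in> G}"
  \<comment> \<open>Here the event of the ensemble sits on the larger side of the inclusion, and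
    monotonicity of \<open>measure\<close> requires that side to be measurable; this is where
    openness of \<open>G\<close> in the weak topology is used.\<close>
  have Em: "?E \<in> sets EE"
    using spectral_measure_event_measurable[OF G, of "Suc m" "b / a"] sets_EE sets_eq_imp_space_eq[OF sets_EE] by simp
  have um: "?u \<in> measurable EE Mseq" using measurable_compose[OF wmom_EE measurable_scaled] by simp
  have C': "- momle R \<in> sets Mseq" using sets.compl_sets[OF momle_sets[of R]] by (simp add: space_PiM Compl_eq_Diff_UNIV)
  have ms: "{p \<in> space EE. ?u p \<in> X} \<in> sets EE" if "X \<in> sets Mseq" for X
    using measurable_sets[OF um that] by (simp add: vimage_def Int_def conj_commute)
  have "measure EE {p \<in> space EE. ?u p \<in> V} \<le> measure EE (?E \<union> {p \<in> space EE. ?u p \<in> - momle R})"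
  proof (rule EE.finite_measure_mono_AE)
    show "AE p in EE. p \<in> {p \<in> space EE. ?u p \<in> V} \<longrightarrow> p \<in> ?E \<union> {p \<in> space EE. ?u p \<in> - momle R}"
      using good_spectral
    proof eventually_elim
      case (elim p)
      show ?case
      proof (intro impI)
        assume p: "p \<in> {p \<in> space EE. ?u p \<in> V}"
        show "p \<in> ?E \<union> {p \<in> space EE. ?u p \<in> - momle R}"
        proof (cases "?u p \<in> momle R")
          case True
          then have "spectral_measure (Suc m) (\<lambda>i. b / a * fst p i) (snd p) \<in> KR R"
            using elim by (intro KR_if_mom_le R) (auto simp: momle_def)
          then have "spectral_measure (Suc m) (\<lambda>i. b / a * fst p i) (snd p) \<in> G"
            by (rule VG) (use elim p in simp)
          with p show ?thesis by simp
        qed (use p in simp)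
      qed
    qed
  qed (intro sets.Un ms Em C')
  also have "\<dots> \<le> measure EE ?E + measure EE {p \<in> space EE. ?u p \<in> - momle R}"
    by (intro measure_Un_le ms Em C')
  finally show ?thesis using emeasure_EE_scaled[OF V] emeasure_EE_scaled[OF C']
    by (simp add: jacobi_prob_def EE_def)
qed

end

section \<open>Large deviations of Beta variables\<close>

lemma beta_distr_emeasure:
  assumes "\<alpha> > 0" "\<gamma> > 0" "E \<in> sets borel"
  shows "ennreal (Beta \<alpha> \<gamma> * measure (beta_distr \<alpha> \<gamma>) E) =
    (\<integral>\<^sup>+p. (if 0 < p \<and> p < 1 then ennreal (p powr (\<alpha> - 1) * (1 - p) powr (\<gamma> - 1)) * indicator E p else 0) \<partial>lborel)"
proof -
  interpret prob_space "beta_distr \<alpha> \<gamma>" by (rule prob_space_beta_distr[OF assms(1,2)])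
  have "ennreal (Beta \<alpha> \<gamma>) * (\<integral>\<^sup>+p. indicator E p \<partial>beta_distr \<alpha> \<gamma>) = ennreal (Beta \<alpha> \<gamma> * measure (beta_distr \<alpha> \<gamma>) E)"
    using assms Beta_real_pos[OF assms(1,2)] by (simp add: emeasure_eq_measure ennreal_mult)
  then show ?thesis using nn_integral_beta_distr[of "indicator E" \<alpha> \<gamma>] assms by simp
qed

lemma beta_distr_upper:
  assumes "\<alpha> > 0" "\<gamma> > 0" "E \<in> sets borel" "E \<subseteq> {x..y}" "x \<le> y" "H \<ge> 0"
    and H: "\<And>p. p \<in> E \<Longrightarrow> 0 < p \<Longrightarrow> p < 1 \<Longrightarrow> p powr (\<alpha> - 1) * (1 - p) powr (\<gamma> - 1) \<le> H"
  shows "Beta \<alpha> \<gamma> * measure (beta_distr \<alpha> \<gamma>) E \<le> H * (y - x)"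
proof -
  have "ennreal (Beta \<alpha> \<gamma> * measure (beta_distr \<alpha> \<gamma>) E) \<le> (\<integral>\<^sup>+p. ennreal H * indicator {x..y} p \<partial>lborel)"
    unfolding beta_distr_emeasure[OF assms(1-3)]
    by (rule nn_integral_mono) (use assms(4) in \<open>auto simp: indicator_def intro!: ennreal_leI H\<close>)
  also have "\<dots> = ennreal (H * (y - x))" using assms(5,6) by (simp add: nn_integral_cmult_indicator ennreal_mult)
  finally show ?thesis using assms(5,6) by (subst (asm) ennreal_le_iff) auto
qed

lemma beta_distr_lower:
  assumes "\<alpha> > 0" "\<gamma> > 0" "E \<in> sets borel" "{x..y} \<subseteq> E" "{x..y} \<subseteq> {0<..<1}" "x \<le> y" "H \<ge> 0"
    and H: "\<And>p. x \<le> p \<Longrightarrow> p \<le> y \<Longrightarrow> H \<le> p powr (\<alpha> - 1) * (1 - p) powr (\<gamma> - 1)"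
  shows "H * (y - x) \<le> Beta \<alpha> \<gamma> * measure (beta_distr \<alpha> \<gamma>) E"
proof -
  have "ennreal (H * (y - x)) = (\<integral>\<^sup>+p. ennreal H * indicator {x..y} p \<partial>lborel)"
    using assms(6,7) by (simp add: nn_integral_cmult_indicator ennreal_mult)
  also have "\<dots> \<le> ennreal (Beta \<alpha> \<gamma> * measure (beta_distr \<alpha> \<gamma>) E)"
    unfolding beta_distr_emeasure[OF assms(1-3)]
    by (rule nn_integral_mono) (use assms(4,5) in \<open>auto simp: indicator_def subset_iff intro!: ennreal_leI H\<close>)
  finally show ?thesis using Beta_real_pos[OF assms(1,2)] by (subst (asm) ennreal_le_iff) auto
qed

lemma one_minus_powr_le:
  fixes p c :: real
  assumes "0 \<le> p" "p < 1" "c \<ge> 0"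
  shows "(1 - p) powr c \<le> exp (- c * p)"
proof -
  have "ln (1 - p) \<le> - p" using ln_le_minus_one[of "1 - p"] assms by simp
  then have "c * ln (1 - p) \<le> c * (- p)" using assms(3) by (rule mult_left_mono)
  then show ?thesis using assms by (simp add: powr_def)
qed

text \<open>Part \<open>\<kappa>\<close> of the decay of \<open>exp (- (\<gamma> - 1) * p)\<close>
  is spent on \<open>p powr (\<alpha> - 1)\<close>, whose product with
  \<open>exp (- \<kappa> * p)\<close> is maximal at \<open>p = (\<alpha> - 1) / \<kappa>\<close>;
  this maximum is the exponential in the bound. The decay that is left integrates to the reciprocal
  of \<open>\<gamma> - 1 - \<kappa>\<close>.\<close>

lemma Beta_upper:
  fixes \<alpha> \<gamma> \<kappa> :: real
  assumes "\<alpha> > 1" "0 < \<kappa>" "\<kappa> < \<gamma> - 1"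
  shows "Beta \<alpha> \<gamma> \<le> exp ((\<alpha> - 1) * (ln ((\<alpha> - 1) / \<kappa>) - 1)) / (\<gamma> - 1 - \<kappa>)"
proof -
  let ?K = "exp ((\<alpha> - 1) * (ln ((\<alpha> - 1) / \<kappa>) - 1))"
  define q where "q = \<gamma> - 1 - \<kappa>"
  have q: "q > 0" using assms by (simp add: q_def)
  have le: "p powr (\<alpha> - 1) * (1 - p) powr (\<gamma> - 1) \<le> ?K * exp (- q * p)" if "0 < p" "p < 1" for p
  proof -
    have "ln (p * \<kappa> / (\<alpha> - 1)) \<le> p * \<kappa> / (\<alpha> - 1) - 1" using that assms by (intro ln_le_minus_one) auto
    moreover have "ln (p * \<kappa> / (\<alpha> - 1)) = ln p - ln ((\<alpha> - 1) / \<kappa>)" using that assms by (simp add: ln_mult ln_div)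
    ultimately have "ln p \<le> p * \<kappa> / (\<alpha> - 1) - 1 + ln ((\<alpha> - 1) / \<kappa>)" by simp
    then have "(\<alpha> - 1) * ln p \<le> (\<alpha> - 1) * (p * \<kappa> / (\<alpha> - 1) - 1 + ln ((\<alpha> - 1) / \<kappa>))"
      using assms(1) by (intro mult_left_mono) auto
    also have "\<dots> = (\<alpha> - 1) * (ln ((\<alpha> - 1) / \<kappa>) - 1) + \<kappa> * p" using assms(1) by (simp add: field_simps)
    finally have "p powr (\<alpha> - 1) \<le> ?K * exp (\<kappa> * p)" using that by (simp add: powr_def mult_exp_exp)
    moreover have "(1 - p) powr (\<gamma> - 1) \<le> exp (- (\<gamma> - 1) * p)" using that assms by (intro one_minus_powr_le) auto
    ultimately have "p powr (\<alpha> - 1) * (1 - p) powr (\<gamma> - 1) \<le> ?K * exp (\<kappa> * p) * exp (- (\<gamma> - 1) * p)"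
      by (intro mult_mono) auto
    also have "\<dots> = ?K * exp (- q * p)" by (simp add: mult_exp_exp q_def algebra_simps)
    finally show ?thesis .
  qed
  have "ennreal (Beta \<alpha> \<gamma>) \<le> (\<integral>\<^sup>+p. ennreal (?K * exp (- q * p)) * indicator {0..} p \<partial>lborel)"
    using assms by (subst nn_integral_Beta[symmetric]) (auto intro!: nn_integral_mono ennreal_leI le[simplified] simp: indicator_def)
  also have "\<dots> = ennreal (0 - (- (?K / q) * exp (- q * 0)))"
  proof (rule nn_integral_FTC_atLeast)
    show "DERIV (\<lambda>p. - (?K / q) * exp (- q * p)) x :> ?K * exp (- q * x)" for x
      using q by (auto intro!: derivative_eq_intros)
    have "((\<lambda>p. exp (- q * p)) \<longlongrightarrow> 0) at_top"
      by (rule filterlim_compose[OF exp_at_bot], rule filterlim_tendsto_neg_mult_at_bot[OF tendsto_const]) (use q in \<open>auto intro: filterlim_ident\<close>)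
    from tendsto_mult_right[OF this, of "- (?K / q)"] show "((\<lambda>p. - (?K / q) * exp (- q * p)) \<longlongrightarrow> 0) at_top" by (simp add: mult.commute)
  qed auto
  finally show ?thesis using q by (subst (asm) ennreal_le_iff) (auto simp: q_def)
qed

lemma nn_integral_beta_power:
  assumes "\<alpha> > 0" "\<gamma> > 0"
  shows "(\<integral>\<^sup>+p. ennreal (p ^ k) \<partial>beta_distr \<alpha> \<gamma>) = ennreal (Beta (\<alpha> + k) \<gamma> / Beta \<alpha> \<gamma>)" (is "?lhs = _")
proof -
  note B = Beta_real_pos[OF assms] Beta_real_pos[of "\<alpha> + k" \<gamma>]
  have "ennreal (Beta \<alpha> \<gamma>) * ?lhs =
    (\<integral>\<^sup>+p. (if 0 < p \<and> p < 1 then ennreal (p powr (\<alpha> - 1) * (1 - p) powr (\<gamma> - 1)) * ennreal (p ^ k) else 0) \<partial>lborel)"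
    by (rule nn_integral_beta_distr[symmetric]) (use assms in auto)
  also have "\<dots> = (\<integral>\<^sup>+p. ennreal (indicator {0<..<1} p * (p powr (\<alpha> + k - 1) * (1 - p) powr (\<gamma> - 1))) \<partial>lborel)"
  proof (rule nn_integral_cong)
    fix p :: real
    have "p powr (\<alpha> + k - 1) = p powr (\<alpha> - 1) * p ^ k" if "0 < p"
      using that by (simp add: powr_realpow[symmetric] powr_add[symmetric] algebra_simps)
    then show "(if 0 < p \<and> p < 1 then ennreal (p powr (\<alpha> - 1) * (1 - p) powr (\<gamma> - 1)) * ennreal (p ^ k) else 0) =
      ennreal (indicator {0<..<1} p * (p powr (\<alpha> + k - 1) * (1 - p) powr (\<gamma> - 1)))"
      by (auto simp: indicator_def ennreal_mult[symmetric] ac_simps)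
  qed
  also have "\<dots> = ennreal (Beta (\<alpha> + k) \<gamma>)" by (rule nn_integral_Beta) (use assms in auto)
  also have "\<dots> = ennreal (Beta \<alpha> \<gamma>) * ennreal (Beta (\<alpha> + k) \<gamma> / Beta \<alpha> \<gamma>)"
    using B assms by (subst ennreal_mult[symmetric]) auto
  finally show ?thesis using B(1) unfolding ennreal_mult_cancel_left by simp
qed

lemma Beta_ratio_le:
  fixes \<alpha> \<gamma> :: real
  assumes "\<alpha> > 0" "\<gamma> > 0"
  shows "Beta (\<alpha> + real k) \<gamma> / Beta \<alpha> \<gamma> \<le> ((\<alpha> + real k) / \<gamma>) ^ k"
proof -
  have "Beta (\<alpha> + real i) \<gamma> \<le> ((\<alpha> + real k) / \<gamma>) ^ i * Beta \<alpha> \<gamma>" if "i \<le> k" for i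
    using that
  proof (induction i)
    case (Suc i)
    have p: "\<alpha> + real i > 0" using assms by simp
    then have "\<alpha> + real i \<notin> \<int>\<^sub>\<le>\<^sub>0" by (metis nonpos_Ints_nonpos not_le)
    from Beta_plus1_left[OF this, of \<gamma>]
    have "Beta (\<alpha> + real (Suc i)) \<gamma> = (\<alpha> + real i) / (\<alpha> + real i + \<gamma>) * Beta (\<alpha> + real i) \<gamma>"
      using p assms by (simp add: field_simps)
    also have "\<dots> \<le> (\<alpha> + real k) / \<gamma> * (((\<alpha> + real k) / \<gamma>) ^ i * Beta \<alpha> \<gamma>)"
    proof (rule mult_mono)
      show "(\<alpha> + real i) / (\<alpha> + real i + \<gamma>) \<le> (\<alpha> + real k) / \<gamma>"
        using p assms Suc.prems by (intro frac_le) auto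
    qed (use Suc p assms Beta_real_pos[OF p assms(2)] in auto)
    finally show ?case by (simp add: mult.assoc)
  qed simp
  from this[of k] show ?thesis using Beta_real_pos[OF assms] by (simp add: pos_divide_le_eq)
qed

text \<open>Markov's inequality for the \<open>k\<close>-th moment. The order \<open>k\<close> stays
  free because it will be chosen of the size of the speed.\<close>

lemma beta_distr_tail:
  assumes "\<alpha> > 0" "\<gamma> > 0" "t > 0"
  shows "measure (beta_distr \<alpha> \<gamma>) {p. t < p} \<le> ((\<alpha> + real k) / (\<gamma> * t)) ^ k"
proof -
  interpret prob_space "beta_distr \<alpha> \<gamma>" by (rule prob_space_beta_distr[OF assms(1,2)])
  have "ennreal (measure (beta_distr \<alpha> \<gamma>) {p. t < p}) = (\<integral>\<^sup>+p. indicator {p. t < p} p \<partial>beta_distr \<alpha> \<gamma>)"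
    by (subst nn_integral_indicator) (auto simp: emeasure_eq_measure)
  also have "\<dots> \<le> (\<integral>\<^sup>+p. ennreal ((1 / t) ^ k) * ennreal (p ^ k) \<partial>beta_distr \<alpha> \<gamma>)"
  proof (rule nn_integral_mono)
    fix p :: real
    show "indicator {p. t < p} p \<le> ennreal ((1 / t) ^ k) * ennreal (p ^ k)"
    proof (cases "t < p")
      case True
      then have "1 \<le> (1 / t * p) ^ k" using assms by (intro one_le_power) auto
      then have "1 \<le> ennreal ((1 / t) ^ k * p ^ k)" unfolding power_mult_distrib[symmetric] by (simp add: ennreal_ge_1)
      then show ?thesis using True assms by (simp add: ennreal_mult)
    qed simp
  qed
  also have "\<dots> = ennreal ((1 / t) ^ k * (Beta (\<alpha> + k) \<gamma> / Beta \<alpha> \<gamma>))"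
    using assms Beta_real_pos[OF assms(1,2)] Beta_real_pos[of "\<alpha> + k" \<gamma>]
    by (subst nn_integral_cmult) (auto simp: nn_integral_beta_power ennreal_mult[symmetric])
  finally have "measure (beta_distr \<alpha> \<gamma>) {p. t < p} \<le> (1 / t) ^ k * (Beta (\<alpha> + k) \<gamma> / Beta \<alpha> \<gamma>)"
    using assms Beta_real_pos[OF assms(1,2)] Beta_real_pos[of "\<alpha> + k" \<gamma>] by (subst (asm) ennreal_le_iff) auto
  also have "\<dots> \<le> (1 / t) ^ k * ((\<alpha> + real k) / \<gamma>) ^ k"
    using assms by (intro mult_left_mono Beta_ratio_le) auto
  also have "\<dots> = ((\<alpha> + real k) / (\<gamma> * t)) ^ k" unfolding power_mult_distrib[symmetric] by (simp add: mult.commute)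
  finally show ?thesis .
qed

text \<open>Here \<open>b / a\<close> times a Beta variable concentrates at \<open>\<theta>\<close> with rate \<open>y - \<theta> * ln (y / \<theta>) - \<theta>\<close>.\<close>

locale beta_regime =
  fixes \<alpha> \<gamma> a b :: "nat \<Rightarrow> real" and \<theta> :: real
  assumes \<theta>: "\<theta> > 0"
    and a_top: "filterlim a at_top sequentially"
    and ab_0: "(\<lambda>n. a n / b n) \<longlonglongrightarrow> 0"
    and b_pos: "\<forall>\<^sub>F n in sequentially. b n > 0"
    and \<alpha>_lim: "(\<lambda>n. \<alpha> n / a n) \<longlonglongrightarrow> \<theta>"
    and \<gamma>_lim: "(\<lambda>n. \<gamma> n / b n) \<longlonglongrightarrow> 1"
begin

lemma a_pos: "\<forall>\<^sub>F n in sequentially. a n > 0"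
  using a_top by (simp add: filterlim_at_top_dense)

lemma inv_a: "(\<lambda>n. c / a n) \<longlonglongrightarrow> 0"
  by (rule tendsto_divide_0[OF tendsto_const filterlim_at_top_imp_at_infinity[OF a_top]])

lemma ab_at_right: "filterlim (\<lambda>n. a n / b n) (at_right 0) sequentially"
  unfolding filterlim_at using ab_0 a_pos b_pos by (auto elim: eventually_elim2)

lemma \<alpha>1_lim: "(\<lambda>n. (\<alpha> n - 1) / a n) \<longlonglongrightarrow> \<theta>"
  using tendsto_diff[OF \<alpha>_lim inv_a[of 1]] by (simp add: diff_divide_distrib)

lemma \<gamma>1_lim: "(\<lambda>n. (\<gamma> n - 1) / b n) \<longlonglongrightarrow> 1"
proof -
  have "(\<lambda>n. a n / b n * (1 / a n)) \<longlonglongrightarrow> 0 * 0" by (intro tendsto_mult ab_0 inv_a)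
  moreover have "\<forall>\<^sub>F n in sequentially. a n / b n * (1 / a n) = 1 / b n" using a_pos by eventually_elim simp
  ultimately have "(\<lambda>n. 1 / b n) \<longlonglongrightarrow> 0" by (simp add: tendsto_cong)
  from tendsto_diff[OF \<gamma>_lim this] show ?thesis by (simp add: diff_divide_distrib)
qed

lemma ln_lim: "(\<lambda>n. (\<gamma> n - 1) / a n * ln (1 - a n / b n * t)) \<longlonglongrightarrow> - t"
proof -
  have "DERIV (\<lambda>r. ln (1 - r * t)) 0 :> - t" by (auto intro!: derivative_eq_intros)
  then have "((\<lambda>r. ln (1 - r * t) / r) \<longlongrightarrow> - t) (at 0)" by (simp add: DERIV_def)
  from filterlim_compose[OF this filterlim_mono[OF ab_at_right at_le order_refl]]
  have "(\<lambda>n. ln (1 - a n / b n * t) / (a n / b n)) \<longlonglongrightarrow> - t" by simp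
  from tendsto_mult[OF \<gamma>1_lim this]
  have "(\<lambda>n. (\<gamma> n - 1) / b n * (ln (1 - a n / b n * t) / (a n / b n))) \<longlonglongrightarrow> - t" by simp
  then show ?thesis
  proof (rule Lim_transform_eventually)
    show "\<forall>\<^sub>F n in sequentially. (\<gamma> n - 1) / b n * (ln (1 - a n / b n * t) / (a n / b n)) = (\<gamma> n - 1) / a n * ln (1 - a n / b n * t)"
      using a_pos b_pos by eventually_elim simp
  qed
qed

lemma \<alpha>_gt_1: "\<forall>\<^sub>F n in sequentially. \<alpha> n > 1"
  using order_tendstoD(1)[OF \<alpha>1_lim \<theta>] a_pos by eventually_elim (simp add: zero_less_divide_iff)

lemma \<gamma>_gt_1: "\<forall>\<^sub>F n in sequentially. \<gamma> n > 1"
  using order_tendstoD(1)[OF \<gamma>1_lim zero_less_one] b_pos by eventually_elim (simp add: zero_less_divide_iff)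

lemma ab_small: "\<epsilon> > 0 \<Longrightarrow> \<forall>\<^sub>F n in sequentially. a n / b n * t < \<epsilon>"
  using order_tendstoD(2)[OF tendsto_mult_right[OF ab_0, of t]] by simp

definition slab :: "nat \<Rightarrow> real \<Rightarrow> real \<Rightarrow> real set" where
  "slab n u v = {a n / b n * u .. a n / b n * v}"

text \<open>On the slab the two factors of the density are bounded at opposite ends, the power of
  \<open>p\<close> at \<open>v\<close> and the power of \<open>1 - p\<close> at \<open>u\<close>,
  which gives the rate its mixed form. The normalizing constant is bounded below by the integral of
  the density over a short interval starting at the scaled centre \<open>\<theta>\<close>.\<close>

lemma beta_ld_upper:
  assumes "0 \<le> u" "u < v" and c: "c < u - \<theta> * ln (v / \<theta>) - \<theta>"
  shows "\<forall>\<^sub>F n in sequentially. measure (beta_distr (\<alpha> n) (\<gamma> n)) (slab n u v) \<le> exp (- a n * c)"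
proof -
  \<comment> \<open>Length of the interval used for the normalizing constant. It worsens the
    exponent by \<open>\<eta>\<close>, half of the available gap, so the limit of \<open>X\<close>
    is \<open>- c - \<eta>\<close>.\<close>
  define \<eta> where "\<eta> = (u - \<theta> * ln (v / \<theta>) - \<theta> - c) / 2"
  have \<eta>: "\<eta> > 0" using c by (simp add: \<eta>_def)
  define X where "X n = ln ((v - u) / \<eta>) / a n + (\<alpha> n - 1) / a n * ln (v / \<theta>) - (\<gamma> n - 1) / b n * u
    - (\<gamma> n - 1) / a n * ln (1 - a n / b n * (\<theta> + \<eta>))" for n
  have "X \<longlonglongrightarrow> 0 + \<theta> * ln (v / \<theta>) - 1 * u - - (\<theta> + \<eta>)"
    unfolding X_def by (intro tendsto_diff tendsto_add tendsto_mult tendsto_const inv_a \<alpha>1_lim \<gamma>1_lim ln_lim)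
  moreover have "0 + \<theta> * ln (v / \<theta>) - 1 * u - - (\<theta> + \<eta>) < - c" using c by (simp add: \<eta>_def field_simps)
  ultimately have "\<forall>\<^sub>F n in sequentially. X n < - c" by (rule order_tendstoD(2))
  moreover note a_pos b_pos \<alpha>_gt_1 \<gamma>_gt_1 ab_small[OF zero_less_one, of "\<theta> + \<eta>"]
  ultimately show ?thesis
  proof eventually_elim
    case (elim n)
    define r where "r = a n / b n"
    have r: "r > 0" "r * (\<theta> + \<eta>) < 1" using elim by (simp_all add: r_def)
    have pos: "\<alpha> n > 0" "\<gamma> n > 0" using elim by auto
    interpret prob_space "beta_distr (\<alpha> n) (\<gamma> n)" by (rule prob_space_beta_distr[OF pos])
    define B where "B = Beta (\<alpha> n) (\<gamma> n)"
    define P where "P = measure (beta_distr (\<alpha> n) (\<gamma> n)) (slab n u v)"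
    define H1 where "H1 = (r * v) powr (\<alpha> n - 1) * exp (- (\<gamma> n - 1) * (r * u))"
    define H2 where "H2 = (r * \<theta>) powr (\<alpha> n - 1) * (1 - r * (\<theta> + \<eta>)) powr (\<gamma> n - 1)"
    have "B * P \<le> H1 * (r * v - r * u)"
      unfolding B_def P_def
    proof (rule beta_distr_upper)
      fix p assume p: "p \<in> slab n u v" "0 < p" "p < 1"
      have "(1 - p) powr (\<gamma> n - 1) \<le> exp (- (\<gamma> n - 1) * p)" using p elim by (intro one_minus_powr_le) auto
      also have "exp (- (\<gamma> n - 1) * p) \<le> exp (- (\<gamma> n - 1) * (r * u))"
      proof -
        have "(\<gamma> n - 1) * (r * u) \<le> (\<gamma> n - 1) * p"
          using p elim unfolding slab_def r_def by (intro mult_left_mono) auto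
        then show ?thesis unfolding mult_minus_left by simp
      qed
      finally show "p powr (\<alpha> n - 1) * (1 - p) powr (\<gamma> n - 1) \<le> H1"
        unfolding H1_def using p elim by (intro mult_mono powr_mono2) (auto simp: slab_def r_def)
    qed (use pos r assms in \<open>auto simp: slab_def r_def[symmetric] H1_def\<close>)
    moreover have "H2 * (r * (\<theta> + \<eta>) - r * \<theta>) \<le> B * prob UNIV"
      unfolding B_def
    proof (rule beta_distr_lower)
      fix p assume p: "r * \<theta> \<le> p" "p \<le> r * (\<theta> + \<eta>)"
      show "H2 \<le> p powr (\<alpha> n - 1) * (1 - p) powr (\<gamma> n - 1)"
        unfolding H2_def using p elim r \<theta> by (intro mult_mono powr_mono2) auto
    qed (use pos r \<theta> \<eta> in \<open>auto simp: H2_def intro: less_le_trans[OF mult_pos_pos]\<close>)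
    then have "H2 * (r * \<eta>) \<le> B" using prob_space by (simp add: algebra_simps)
    moreover have "P \<ge> 0" by (simp add: P_def)
    ultimately have "H2 * (r * \<eta>) * P \<le> H1 * (r * v - r * u)" using mult_right_mono order_trans by blast
    then have "P \<le> H1 * (r * v - r * u) / (H2 * (r * \<eta>))"
      using r \<eta> \<theta> by (subst pos_le_divide_eq) (auto simp: H2_def mult.commute)
    also have "\<dots> = (v - u) / \<eta> * (H1 / H2)"
    proof -
      have "H1 * (r * v - r * u) / (H2 * (r * \<eta>)) = (r * (H1 * (v - u))) / (r * (H2 * \<eta>))" by (simp add: algebra_simps)
      also have "\<dots> = (v - u) / \<eta> * (H1 / H2)" using r by (simp add: mult.commute)
      finally show ?thesis .
    qed
    also have "\<dots> = exp (ln ((v - u) / \<eta>)) * (exp ((\<alpha> n - 1) * ln (r * v)) * exp (- (\<gamma> n - 1) * (r * u)) /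
        (exp ((\<alpha> n - 1) * ln (r * \<theta>)) * exp ((\<gamma> n - 1) * ln (1 - r * (\<theta> + \<eta>)))))"
      using assms \<eta> r \<theta> by (simp add: H1_def H2_def powr_def)
    also have "\<dots> = exp (ln ((v - u) / \<eta>) + (\<alpha> n - 1) * ln (r * v) - (\<gamma> n - 1) * (r * u)
        - (\<alpha> n - 1) * ln (r * \<theta>) - (\<gamma> n - 1) * ln (1 - r * (\<theta> + \<eta>)))"
      by (simp add: exp_add exp_diff exp_minus field_simps)
    also have "ln ((v - u) / \<eta>) + (\<alpha> n - 1) * ln (r * v) - (\<gamma> n - 1) * (r * u)
        - (\<alpha> n - 1) * ln (r * \<theta>) - (\<gamma> n - 1) * ln (1 - r * (\<theta> + \<eta>)) = a n * X n"
    proof -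
      have "ln (r * v) - ln (r * \<theta>) = ln (v / \<theta>)" using r assms \<theta> by (simp add: ln_mult ln_div)
      then have "(\<alpha> n - 1) * ln (r * v) - (\<alpha> n - 1) * ln (r * \<theta>) = (\<alpha> n - 1) * ln (v / \<theta>)"
        by (simp flip: right_diff_distrib)
      moreover have "a n * X n = ln ((v - u) / \<eta>) + (\<alpha> n - 1) * ln (v / \<theta>) - (\<gamma> n - 1) * (r * u) - (\<gamma> n - 1) * ln (1 - r * (\<theta> + \<eta>))"
        using elim(2) unfolding X_def r_def right_diff_distrib[of "a n"] distrib_left[of "a n"] by simp
      ultimately show ?thesis by simp
    qed
    also have "exp (a n * X n) \<le> exp (- a n * c)" using elim mult_left_mono[of "X n" "- c" "a n"] by simp
    finally show ?case by (simp add: P_def)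
  qed
qed

text \<open>The roles of the endpoints are reversed against the upper bound, and the normalizing
  constant is bounded above by \<open>Beta_upper\<close>.\<close>

lemma beta_ld_lower:
  assumes "0 < u" "u < v" and c: "c > v - \<theta> * ln (u / \<theta>) - \<theta>"
  shows "\<forall>\<^sub>F n in sequentially. measure (beta_distr (\<alpha> n) (\<gamma> n)) (slab n u v) \<ge> exp (- a n * c)"
proof -
  \<comment> \<open>\<open>\<theta> * \<delta>\<close> is half of the gap between \<open>c\<close>
    and the rate. Taking \<open>\<kappa> = q * (\<gamma> - 1)\<close> with
    \<open>q = exp (- \<delta>)\<close> in \<open>Beta_upper\<close> costs exactly
    \<open>\<theta> * \<delta>\<close> in the exponent and leaves the positive share
    \<open>1 - q\<close> for the denominator.\<close>
  define \<delta> where "\<delta> = (c - v + \<theta> * ln (u / \<theta>) + \<theta>) / (2 * \<theta>)"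
  have \<delta>: "\<delta> > 0" using c \<theta> by (simp add: \<delta>_def)
  define q where "q = exp (- \<delta>)"
  have q: "0 < q" "q < 1" "ln q = - \<delta>" using \<delta> by (simp_all add: q_def)
  define X where "X n = (ln (a n) / a n + ln ((v - u) * (1 - q) * ((\<gamma> n - 1) / b n)) / a n) + (\<alpha> n - 1) / a n * (ln (u * q * ((\<gamma> n - 1) / b n) / ((\<alpha> n - 1) / a n)) + 1)
    + (\<gamma> n - 1) / a n * ln (1 - a n / b n * v)" for n
  have l: "(\<lambda>n. ln ((v - u) * (1 - q) * ((\<gamma> n - 1) / b n))) \<longlonglongrightarrow> ln ((v - u) * (1 - q) * 1)"
    by (intro tendsto_ln tendsto_mult tendsto_const \<gamma>1_lim) (use q assms in auto)
  have "X \<longlonglongrightarrow> (0 + 0) + \<theta> * (ln (u * q * 1 / \<theta>) + 1) + - v"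
    unfolding X_def
  proof (intro tendsto_add tendsto_mult tendsto_const tendsto_ln tendsto_divide \<alpha>1_lim \<gamma>1_lim ln_lim)
    show "(\<lambda>n. ln (a n) / a n) \<longlonglongrightarrow> 0" by (rule filterlim_compose[OF ln_x_over_x_tendsto_0 a_top])
    show "(\<lambda>n. ln ((v - u) * (1 - q) * ((\<gamma> n - 1) / b n)) / a n) \<longlonglongrightarrow> 0"
      by (rule tendsto_divide_0[OF l filterlim_at_top_imp_at_infinity[OF a_top]])
  qed (use \<theta> q assms in auto)
  moreover have "- c < (0 + 0) + \<theta> * (ln (u * q * 1 / \<theta>) + 1) + - v"
  proof -
    have "ln (u * q * 1 / \<theta>) = ln (u / \<theta>) - \<delta>" using q assms \<theta> by (simp add: ln_mult ln_div)
    moreover have "\<theta> * \<delta> = (c - v + \<theta> * ln (u / \<theta>) + \<theta>) / 2" using \<theta> by (simp add: \<delta>_def)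
    ultimately show ?thesis using c by (simp add: distrib_left right_diff_distrib)
  qed
  ultimately have "\<forall>\<^sub>F n in sequentially. - c < X n" by (rule order_tendstoD(1))
  moreover note a_pos b_pos \<alpha>_gt_1 \<gamma>_gt_1 ab_small[OF zero_less_one, of v]
  ultimately show ?thesis
  proof eventually_elim
    case (elim n)
    define r where "r = a n / b n"
    have r: "r > 0" "r * v < 1" using elim by (simp_all add: r_def)
    have pos: "\<alpha> n > 0" "\<gamma> n > 0" using elim by auto
    define B where "B = Beta (\<alpha> n) (\<gamma> n)"
    define P where "P = measure (beta_distr (\<alpha> n) (\<gamma> n)) (slab n u v)"
    define H where "H = (r * u) powr (\<alpha> n - 1) * (1 - r * v) powr (\<gamma> n - 1)"
    define \<kappa> where "\<kappa> = q * (\<gamma> n - 1)"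
    have \<kappa>: "0 < \<kappa>" "\<kappa> < \<gamma> n - 1" using q elim by (simp_all add: \<kappa>_def)
    have "H * (r * v - r * u) \<le> B * P"
      unfolding B_def P_def
    proof (rule beta_distr_lower)
      fix p assume p: "r * u \<le> p" "p \<le> r * v"
      show "H \<le> p powr (\<alpha> n - 1) * (1 - p) powr (\<gamma> n - 1)"
        unfolding H_def using p elim r assms by (intro mult_mono powr_mono2) auto
    qed (use pos r assms in \<open>auto simp: H_def slab_def r_def[symmetric] intro: less_le_trans[OF mult_pos_pos]\<close>)
    also have "\<dots> \<le> exp ((\<alpha> n - 1) * (ln ((\<alpha> n - 1) / \<kappa>) - 1)) / (\<gamma> n - 1 - \<kappa>) * P"
      unfolding B_def by (intro mult_right_mono Beta_upper \<kappa>) (use elim in \<open>auto simp: P_def\<close>)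
    finally have "H * (r * v - r * u) * ((\<gamma> n - 1 - \<kappa>) / exp ((\<alpha> n - 1) * (ln ((\<alpha> n - 1) / \<kappa>) - 1))) \<le> P"
      using \<kappa> by (simp add: field_simps)
    also have "H * (r * v - r * u) * ((\<gamma> n - 1 - \<kappa>) / exp ((\<alpha> n - 1) * (ln ((\<alpha> n - 1) / \<kappa>) - 1))) =
      (a n * ((v - u) * (1 - q) * ((\<gamma> n - 1) / b n))) * (H / exp ((\<alpha> n - 1) * (ln ((\<alpha> n - 1) / \<kappa>) - 1)))"
    proof -
      have "(r * v - r * u) * (\<gamma> n - 1 - \<kappa>) = a n * ((v - u) * (1 - q) * ((\<gamma> n - 1) / b n))"
        unfolding \<kappa>_def r_def by algebra
      then have "a n * ((v - u) * (1 - q) * ((\<gamma> n - 1) / b n)) = (r * v - r * u) * (\<gamma> n - 1 - \<kappa>)" by (rule sym)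
      then show ?thesis by (simp only: times_divide_eq_right times_divide_eq_left ac_simps)
    qed
    also have "\<dots> = exp (ln (a n) + ln ((v - u) * (1 - q) * ((\<gamma> n - 1) / b n))) *
       (exp ((\<alpha> n - 1) * ln (r * u)) * exp ((\<gamma> n - 1) * ln (1 - r * v)) / exp ((\<alpha> n - 1) * (ln ((\<alpha> n - 1) / \<kappa>) - 1)))"
      using elim q assms r by (simp add: H_def powr_def exp_add)
    also have "\<dots> = exp (ln (a n) + ln ((v - u) * (1 - q) * ((\<gamma> n - 1) / b n)) +
       (\<alpha> n - 1) * ln (r * u) + (\<gamma> n - 1) * ln (1 - r * v) - (\<alpha> n - 1) * (ln ((\<alpha> n - 1) / \<kappa>) - 1))"
      by (simp add: exp_add exp_diff)
    also have "ln (a n) + ln ((v - u) * (1 - q) * ((\<gamma> n - 1) / b n)) +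
       (\<alpha> n - 1) * ln (r * u) + (\<gamma> n - 1) * ln (1 - r * v) - (\<alpha> n - 1) * (ln ((\<alpha> n - 1) / \<kappa>) - 1) = a n * X n"
    proof -
      have "ln (u * q * ((\<gamma> n - 1) / b n) / ((\<alpha> n - 1) / a n)) = ln (r * u / ((\<alpha> n - 1) / \<kappa>))"
        by (rule arg_cong[of _ _ ln]) (use elim q in \<open>simp add: \<kappa>_def r_def field_simps\<close>)
      also have "\<dots> = ln (r * u) - ln ((\<alpha> n - 1) / \<kappa>)" using r assms elim \<kappa> by (intro ln_divide_pos) auto
      finally have e: "ln (u * q * ((\<gamma> n - 1) / b n) / ((\<alpha> n - 1) / a n)) = ln (r * u) - ln ((\<alpha> n - 1) / \<kappa>)" .
      have "a n * X n = ln (a n) + ln ((v - u) * (1 - q) * ((\<gamma> n - 1) / b n)) + (\<alpha> n - 1) * (ln (r * u) - ln ((\<alpha> n - 1) / \<kappa>) + 1)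
        + (\<gamma> n - 1) * ln (1 - r * v)"
        using elim unfolding X_def e by (simp add: r_def distrib_left)
      then show ?thesis by (simp add: algebra_simps)
    qed
    finally have "exp (a n * X n) \<le> P" .
    moreover have "exp (- a n * c) \<le> exp (a n * X n)" using elim mult_left_mono[of "- c" "X n" "a n"] by simp
    ultimately show ?case unfolding P_def by (rule order_trans[rotated])
  qed
qed

end

section \<open>Tail and cylinder estimates for the recursion coefficients\<close>

context jacobi_params
begin

lemma alj_even: "2 * i < N \<Longrightarrow> alj (2 * i) = a - real i * (\<beta> / 2)"
proof -
  assume "2 * i < N"
  then have i: "i \<le> m" by (simp add: N_def)
  define k where "k = m - i"
  have k: "N - 2 * i = 2 * k + 1" "real k = real m - real i" using i by (simp_all add: N_def k_def)
  have "alj (2 * i) = real k * (\<beta> / 2) + A + 1" unfolding alj_def al_def k(1) by (simp add: s_def)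
  then show ?thesis unfolding k(2) by (simp add: A_def algebra_simps diff_divide_distrib)
qed

lemma alj_odd: "2 * i + 1 < N \<Longrightarrow> alj (2 * i + 1) = (real m - real i) * (\<beta> / 2)"
proof -
  assume "2 * i + 1 < N"
  then have i: "i < m" by (simp add: N_def)
  then have "N - (2 * i + 1) = 2 * (m - i)" by (simp add: N_def)
  then show ?thesis using i by (simp add: alj_def al_def s_def of_nat_diff)
qed

lemma gaj_even: "2 * i < N \<Longrightarrow> gaj (2 * i) = b - real i * (\<beta> / 2)"
proof -
  assume "2 * i < N"
  then have i: "i \<le> m" by (simp add: N_def)
  define k where "k = m - i"
  have k: "N - Suc (2 * i) = 2 * k" "real k = real m - real i" using i by (simp_all add: N_def k_def)
  have "gaj (2 * i) = real k * (\<beta> / 2) + B + 1" unfolding gaj_def ee_def k(1) by (simp add: s_def)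
  then show ?thesis unfolding k(2) by (simp add: B_def algebra_simps diff_divide_distrib)
qed

lemma gaj_odd: "2 * i + 1 < N \<Longrightarrow> gaj (2 * i + 1) = a + b - (real m + real i + 1) * (\<beta> / 2)"
proof -
  assume "2 * i + 1 < N"
  then have i: "i < m" by (simp add: N_def)
  define k where "k = m - i - 1"
  have k: "N - Suc (2 * i + 1) = 2 * k + 1" "real k = real m - real i - 1" using i by (auto simp: N_def k_def)
  have "gaj (2 * i + 1) = real k * (\<beta> / 2) + 1 + A + B + 1" unfolding gaj_def ee_def k(1) by (simp add: s_def)
  then show ?thesis unfolding k(2) by (simp add: A_def B_def algebra_simps add_divide_distrib)
qed

lemma alj_pos: "j < N \<Longrightarrow> alj j > 0"
  unfolding alj_def by (rule al_pos) auto

lemma gaj_pos: "gaj j > 0"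
  unfolding gaj_def by (rule ee_pos)

lemma alj_le:
  assumes "j < N" shows "alj j \<le> 2 * a"
proof (cases "even j")
  case True
  then obtain i where i: "j = 2 * i" by (auto elim: evenE)
  have "0 \<le> real i * (\<beta> / 2)" using beta by simp
  then show ?thesis using alj_even[of i] assms ab_pos unfolding i by linarith
next
  case False
  then obtain i where i: "j = 2 * i + 1" by (auto elim: oddE)
  have "(real m - real i) * (\<beta> / 2) \<le> real m * (\<beta> / 2)" using beta by (intro mult_right_mono) auto
  then show ?thesis using alj_odd[of i] assms ab_pos a unfolding i by (simp add: mult.commute)
qed

lemma gaj_ge:
  assumes "j < N" shows "b - real m * (\<beta> / 2) \<le> gaj j"
proof (cases "even j")
  case True
  then obtain i where i: "j = 2 * i" by (auto elim: evenE)
  have "real i * (\<beta> / 2) \<le> real m * (\<beta> / 2)" using beta assms i by (intro mult_right_mono) (auto simp: N_def)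
  then show ?thesis using gaj_even[of i] assms unfolding i by linarith
next
  case False
  then obtain i where i: "j = 2 * i + 1" by (auto elim: oddE)
  have "(real m + real i + 1) * (\<beta> / 2) \<le> (2 * real m) * (\<beta> / 2)" using beta assms i by (intro mult_right_mono) (auto simp: N_def)
  moreover have "(2 * real m) * (\<beta> / 2) = real m * (\<beta> / 2) + \<beta> / 2 * real m" by simp
  ultimately show ?thesis using gaj_odd[of i] assms a unfolding i by linarith
qed

section \<open>Independence, and coefficients compared with rescaled canonical moments\<close>

lemma box_measure:
  assumes "K \<le> N" "\<And>j. j < K \<Longrightarrow> S j \<in> sets borel"
  shows "{p \<in> space PP. \<forall>j<K. p j \<in> S j} \<in> sets PP"
    and "PP.prob {p \<in> space PP. \<forall>j<K. p j \<in> S j} = (\<Prod>j<K. measure (beta_distr (alj j) (gaj j)) (S j))"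
proof -
  have e: "{p \<in> space PP. \<forall>j<K. p j \<in> S j} = Pb.emb {0..<N} {..<K} (Pi\<^sub>E {..<K} S)"
    using assms(1) by (auto simp: PP_def prod_emb_def space_PiM PiE_iff extensional_def)
  have K: "{..<K} \<subseteq> {0..<N}" using assms(1) by auto
  show "{p \<in> space PP. \<forall>j<K. p j \<in> S j} \<in> sets PP"
    unfolding e unfolding PP_def by (intro sets_PiM_I K) (use assms in auto)
  have "PP.prob {p \<in> space PP. \<forall>j<K. p j \<in> S j} = (\<Prod>j<K. measure (Pb j) (S j))"
    unfolding e unfolding PP_def by (rule Pb.measure_PiM_emb[OF K]) (use assms in auto)
  also have "\<dots> = (\<Prod>j<K. measure (beta_distr (alj j) (gaj j)) (S j))"
    using assms(1) by (intro prod.cong) (auto simp: Pb_eq)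
  finally show "PP.prob {p \<in> space PP. \<forall>j<K. p j \<in> S j} = (\<Prod>j<K. measure (beta_distr (alj j) (gaj j)) (S j))" .
qed

lemma AE_PP: "AE p in PP. \<forall>j<N. 0 < p j \<and> p j < 1"
proof -
  have "AE p in PP. p j \<in> {0<..<1}" if "j < N" for j
  proof -
    have "AE x in beta_distr (alj j) (gaj j). x \<in> {0<..<1}"
      unfolding beta_distr_def by (subst AE_density) (auto simp: indicator_def)
    then have "AE x in Pb j. x \<in> {0<..<1}" unfolding Pb_eq[OF that] .
    then show ?thesis unfolding PP_def using that by (intro Pb.AE_component) auto
  qed
  then have "AE p in PP. \<forall>j\<in>{..<N}. p j \<in> {0<..<1}" by (subst AE_finite_all) auto
  then show ?thesis by eventually_elim auto
qed

lemma zc_eq: "j < N \<Longrightarrow> zc p j = (1 - (if j = 0 then 0 else p (j - 1))) * (b / a * p j)"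
  by (simp add: zc_def zz_def zv_def trunc_def split: nat.splits)

lemma zc_ge_N: "N \<le> j \<Longrightarrow> zc p j = 0"
  by (simp add: zc_def zz_def zv_def trunc_def)

lemma zc_bounds:
  assumes "\<forall>j<N. 0 < p j \<and> p j < 1" "\<forall>j<N. b / a * p j \<le> M" "M > 0"
  shows "0 \<le> zc p j \<and> zc p j \<le> M"
proof (cases "j < N")
  case True
  define q where "q = (if j = 0 then 0 else p (j - 1))"
  have q: "0 \<le> q" "q \<le> 1" using assms(1)[rule_format, of "j - 1"] True less_imp_diff_less[OF True, of 1] by (auto simp: q_def less_imp_le)
  have y: "0 \<le> b / a * p j" "b / a * p j \<le> M" using assms True ab_pos by auto
  have "(1 - q) * (b / a * p j) \<le> 1 * M" using q y by (intro mult_mono[of "1 - q" 1 "b / a * p j" M]) linarith+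
  moreover have "0 \<le> (1 - q) * (b / a * p j)" using q y by (intro mult_nonneg_nonneg[of "1 - q"]) linarith+
  ultimately show ?thesis using zc_eq[OF True, of p] by (simp add: q_def)
qed (use assms zc_ge_N in simp)

text \<open>If the rescaled moments are at most \<open>M\<close>, the preceding moment is at most
  \<open>a / b * M\<close>, so the factor \<open>1 - p (j - 1)\<close> changes the coefficient by at
  most that times \<open>M\<close>.\<close>

lemma zc_close:
  assumes "\<forall>i\<le>j. 0 \<le> p i \<and> p i < 1 \<and> b / a * p i \<le> M" "j < N"
  shows "\<bar>zc p j - b / a * p j\<bar> \<le> a / b * M\<^sup>2"
proof -
  define q where "q = (if j = 0 then 0 else p (j - 1))"
  have y: "0 \<le> b / a * p j" "b / a * p j \<le> M" using assms(1)[rule_format, of j] ab_pos by auto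
  have "q \<le> a / b * M"
  proof (cases j)
    case (Suc i)
    have "b / a * p i \<le> M" using assms(1)[rule_format, of i] Suc by simp
    then show ?thesis using ab_pos Suc by (simp add: q_def field_simps)
  qed (use y ab_pos in \<open>auto simp: q_def\<close>)
  moreover have q: "0 \<le> q" using assms(1)[rule_format, of "j - 1"] by (auto simp: q_def)
  ultimately have "q * (b / a * p j) \<le> (a / b * M) * M" using y by (intro mult_mono[of q _ "b / a * p j"]) linarith+
  moreover have "zc p j - b / a * p j = - (q * (b / a * p j))"
    using zc_eq[OF assms(2), of p] by (simp add: q_def algebra_simps)
  moreover have "0 \<le> q * (b / a * p j)" by (rule mult_nonneg_nonneg[OF q y(1)])
  ultimately show ?thesis by (simp add: power2_eq_square)
qed

definition tail :: "real \<Rightarrow> (nat \<Rightarrow> real) set" where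
  "tail M = {p \<in> space PP. \<exists>j<N. M < b / a * p j}"

lemma tail_sets [measurable]: "tail M \<in> sets PP"
proof -
  have "tail M = (\<Union>j\<in>{..<N}. {p \<in> space PP. M < b / a * p j})" by (auto simp: tail_def)
  moreover have "{p \<in> space PP. M < b / a * p j} \<in> sets PP" if "j < N" for j
  proof -
    note [measurable] = measurable_PP_component[OF that]
    show ?thesis by measurable
  qed
  ultimately show ?thesis by auto
qed

text \<open>Markov's bound for each index and a union bound over all \<open>N\<close> indices. The
  constant 8 is \<open>4 * a\<close> for \<open>alj j + k\<close>, divided by \<open>b / 2\<close>
  for \<open>gaj j\<close> times the threshold \<open>a / b * M\<close>.\<close>

lemma tail_prob:
  assumes "M > 0" "real m * (\<beta> / 2) \<le> b / 2" "real k \<le> 2 * a"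
  shows "PP.prob (tail M) \<le> real N * (8 / M) ^ k"
proof -
  have ms: "{p \<in> space PP. M < b / a * p j} \<in> sets PP" if "j < N" for j
  proof -
    note [measurable] = measurable_PP_component[OF that]
    show ?thesis by measurable
  qed
  have "tail M = (\<Union>j\<in>{..<N}. {p \<in> space PP. M < b / a * p j})" by (auto simp: tail_def)
  then have "PP.prob (tail M) \<le> (\<Sum>j<N. PP.prob {p \<in> space PP. M < b / a * p j})"
    using ms by (auto intro!: PP.finite_measure_subadditive_finite)
  also have "\<dots> \<le> (\<Sum>j<N. (8 / M) ^ k)"
  proof (rule sum_mono)
    fix j assume "j \<in> {..<N}"
    then have j: "j < N" by simp
    define t where "t = a / b * M"
    have t: "t > 0" using ab_pos assms by (simp add: t_def)
    have "{p \<in> space PP. M < b / a * p j} = {p \<in> space PP. p j \<in> {p. t < p}}"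
      using ab_pos by (auto simp: t_def field_simps)
    also have "PP.prob \<dots> = measure (Pb j) {p. t < p}"
      unfolding PP_def using Pb.emeasure_PiM_Collect_single[of j "{p. t < p}"] j by (simp add: measure_def)
    also have "\<dots> \<le> ((alj j + real k) / (gaj j * t)) ^ k"
      unfolding Pb_eq[OF j] by (rule beta_distr_tail[OF alj_pos[OF j] gaj_pos t])
    also have "\<dots> \<le> (8 / M) ^ k"
    proof (rule power_mono)
      have "gaj j \<ge> b / 2" using gaj_ge[OF j] assms(2) by linarith
      then have "(alj j + real k) / (gaj j * t) \<le> (4 * a) / (b / 2 * t)"
        using alj_le[OF j] assms(3) t ab_pos alj_pos[OF j] by (intro frac_le mult_right_mono) auto
      also have "\<dots> = 8 / M" using ab_pos assms(1) by (simp add: t_def)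
      finally show "(alj j + real k) / (gaj j * t) \<le> 8 / M" .
      show "0 \<le> (alj j + real k) / (gaj j * t)" using alj_pos[OF j] gaj_pos[of j] t by simp
    qed
    finally show "PP.prob {p \<in> space PP. M < b / a * p j} \<le> (8 / M) ^ k" .
  qed
  finally show ?thesis by simp
qed

lemma momle_prob: "M > 0 \<Longrightarrow> PP.prob {p \<in> space PP. mS (zc p) \<notin> momle (4 * M)} \<le> PP.prob (tail M)"
proof (rule PP.finite_measure_mono_AE)
  assume M: "M > 0"
  show "AE p in PP. p \<in> {p \<in> space PP. mS (zc p) \<notin> momle (4 * M)} \<longrightarrow> p \<in> tail M"
    using AE_PP
  proof eventually_elim
    case (elim p)
    show ?case
    proof (intro impI, rule ccontr)
      assume p: "p \<in> {p \<in> space PP. mS (zc p) \<notin> momle (4 * M)}" "p \<notin> tail M"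
      then have "\<forall>j<N. b / a * p j \<le> M" by (auto simp: tail_def)
      from zc_bounds[OF elim this M] have "mS (zc p) k \<le> (4 * M) ^ k" for k by (intro mS_bound) auto
      with p show False by (simp add: momle_def)
    qed
  qed
qed simp

text \<open>Off the tail event the coefficients lie in the box, so one of the finitely many
  cylinders contains them. Passing from coefficients to rescaled moments costs another
  \<open>\<delta> \<zeta>\<close>, hence the doubled width, and positivity of the moments allows the
  cut at 0.\<close>

lemma prob_cover:
  assumes M: "M > 0" and C: "C \<in> sets Mseq" and D: "finite D"
    and cov: "\<And>z. (\<And>i. 0 \<le> z i \<and> z i \<le> M) \<Longrightarrow> mS z \<in> C \<Longrightarrow> \<exists>\<zeta>\<in>D. \<forall>i<K \<zeta>. \<bar>z i - \<zeta> i\<bar> < \<delta> \<zeta>"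
    and K: "\<And>\<zeta>. \<zeta> \<in> D \<Longrightarrow> K \<zeta> \<le> N" and small: "a / b * M < 1" "\<And>\<zeta>. \<zeta> \<in> D \<Longrightarrow> a / b * M\<^sup>2 \<le> \<delta> \<zeta>"
  shows "PP.prob {p \<in> space PP. mS (zc p) \<in> C} \<le> PP.prob (tail M) +
    (\<Sum>\<zeta>\<in>D. \<Prod>j<K \<zeta>. measure (beta_distr (alj j) (gaj j)) {a / b * max 0 (\<zeta> j - 2 * \<delta> \<zeta>) .. a / b * (\<zeta> j + 2 * \<delta> \<zeta>)})"
proof -
  let ?S = "\<lambda>\<zeta> j. {a / b * max 0 (\<zeta> j - 2 * \<delta> \<zeta>) .. a / b * (\<zeta> j + 2 * \<delta> \<zeta>)}"
  let ?B = "\<lambda>\<zeta>. {p \<in> space PP. \<forall>j<K \<zeta>. p j \<in> ?S \<zeta> j}"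
  have Bm: "?B \<zeta> \<in> sets PP" if "\<zeta> \<in> D" for \<zeta> using K[OF that] by (intro box_measure) auto
  have Um: "(\<Union>\<zeta>\<in>D. ?B \<zeta>) \<in> sets PP" by (rule sets.finite_UN[OF D Bm])
  have "PP.prob {p \<in> space PP. mS (zc p) \<in> C} \<le> PP.prob (tail M \<union> (\<Union>\<zeta>\<in>D. ?B \<zeta>))"
  proof (rule PP.finite_measure_mono_AE)
    show "AE p in PP. p \<in> {p \<in> space PP. mS (zc p) \<in> C} \<longrightarrow> p \<in> tail M \<union> (\<Union>\<zeta>\<in>D. ?B \<zeta>)"
      using AE_PP
    proof eventually_elim
      case (elim p)
      show ?case
      proof (intro impI, rule ccontr)
        assume p: "p \<in> {p \<in> space PP. mS (zc p) \<in> C}" "p \<notin> tail M \<union> (\<Union>\<zeta>\<in>D. ?B \<zeta>)"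
        then have t: "\<forall>j<N. b / a * p j \<le> M" by (auto simp: tail_def)
        from cov[of "zc p", OF zc_bounds[OF elim t M]] p
        obtain \<zeta> where z: "\<zeta> \<in> D" "\<forall>i<K \<zeta>. \<bar>zc p i - \<zeta> i\<bar> < \<delta> \<zeta>" by auto
        have "p j \<in> ?S \<zeta> j" if "j < K \<zeta>" for j
        proof -
          have j: "j < N" using that K[OF z(1)] by simp
          have "\<bar>zc p j - b / a * p j\<bar> \<le> a / b * M\<^sup>2"
            by (rule zc_close[OF _ j]) (use elim t j in \<open>auto intro: less_imp_le\<close>)
          then have "\<bar>b / a * p j - \<zeta> j\<bar> \<le> 2 * \<delta> \<zeta>" using z(2)[rule_format, OF that] small(2)[OF z(1)] by linarith
          moreover have "0 \<le> b / a * p j" using elim[rule_format, OF j] ab_pos by simp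
          ultimately have "max 0 (\<zeta> j - 2 * \<delta> \<zeta>) \<le> b / a * p j" "b / a * p j \<le> \<zeta> j + 2 * \<delta> \<zeta>" by auto
          then show ?thesis using ab_pos by (auto simp: field_simps max_def split: if_splits)
        qed
        then have "p \<in> ?B \<zeta>" using p(1) by blast
        with p(2) z(1) show False by blast
      qed
    qed
    show "tail M \<union> (\<Union>\<zeta>\<in>D. ?B \<zeta>) \<in> PP.events" by (rule sets.Un[OF tail_sets Um])
  qed
  also have "\<dots> \<le> PP.prob (tail M) + PP.prob (\<Union>\<zeta>\<in>D. ?B \<zeta>)"
    by (rule measure_Un_le[OF tail_sets Um])
  also have "PP.prob (\<Union>\<zeta>\<in>D. ?B \<zeta>) \<le> (\<Sum>\<zeta>\<in>D. PP.prob (?B \<zeta>))"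
    by (rule PP.finite_measure_subadditive_finite[OF D]) (use Bm in blast)
  also have "\<dots> = (\<Sum>\<zeta>\<in>D. \<Prod>j<K \<zeta>. measure (beta_distr (alj j) (gaj j)) (?S \<zeta> j))"
    using K by (intro sum.cong refl box_measure(2)) auto
  finally show ?thesis by simp
qed

text \<open>Half of \<open>\<delta>\<close> is reserved for the intervals of the rescaled moments
  and half for their distance to the coefficients. Coordinates from \<open>K\<close> on are
  unrestricted, so the probability is a product of \<open>K\<close> Beta probabilities.\<close>

lemma prob_box_ge:
  assumes C: "C \<in> sets Mseq" and K: "K \<le> N" and M: "M > 0"
    and sub: "\<And>z. (\<And>i. i < K \<Longrightarrow> \<bar>z i - \<zeta> i\<bar> < \<delta>) \<Longrightarrow> mS z \<in> C"
    and uv: "\<And>j. j < K \<Longrightarrow> 0 \<le> u j \<and> \<zeta> j - \<delta> / 2 \<le> u j \<and> v j \<le> \<zeta> j + \<delta> / 2 \<and> v j \<le> M"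
    and small: "a / b * M < 1" "a / b * M\<^sup>2 < \<delta> / 2"
  shows "(\<Prod>j<K. measure (beta_distr (alj j) (gaj j)) {a / b * u j .. a / b * v j}) \<le> PP.prob {p \<in> space PP. mS (zc p) \<in> C}"
proof -
  have "(\<Prod>j<K. measure (beta_distr (alj j) (gaj j)) {a / b * u j .. a / b * v j}) =
    PP.prob {p \<in> space PP. \<forall>j<K. p j \<in> {a / b * u j .. a / b * v j}}"
    using K by (intro box_measure(2)[symmetric]) auto
  also have "\<dots> \<le> PP.prob {p \<in> space PP. mS (zc p) \<in> C}"
  proof (rule PP.finite_measure_mono)
    show "{p \<in> space PP. \<forall>j<K. p j \<in> {a / b * u j .. a / b * v j}} \<subseteq> {p \<in> space PP. mS (zc p) \<in> C}"
    proof
      fix p assume "p \<in> {p \<in> space PP. \<forall>j<K. p j \<in> {a / b * u j .. a / b * v j}}"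
      then have p: "p \<in> space PP" "\<And>j. j < K \<Longrightarrow> p j \<in> {a / b * u j .. a / b * v j}" by auto
      have y: "u j \<le> b / a * p j \<and> b / a * p j \<le> v j" if "j < K" for j
        using p(2)[OF that] ab_pos by (simp add: field_simps)
      have good: "0 \<le> p j \<and> p j < 1 \<and> b / a * p j \<le> M" if j: "j < K" for j
      proof -
        have "b / a * p j \<le> M" using y[OF j] uv[OF j] by linarith
        moreover have "0 \<le> b / a * p j" using y[OF j] uv[OF j] by linarith
        then have "0 \<le> p j" using ab_pos by (simp add: zero_le_mult_iff zero_le_divide_iff)
        moreover have "p j \<le> a / b * M" using calculation(1) ab_pos by (simp add: field_simps)
        ultimately show ?thesis using small(1) by linarith
      qed
      have "mS (zc p) \<in> C"
      proof (rule sub)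
        fix i assume i: "i < K"
        have "\<bar>zc p i - b / a * p i\<bar> \<le> a / b * M\<^sup>2"
          by (rule zc_close) (use good i K in auto)
        then show "\<bar>zc p i - \<zeta> i\<bar> < \<delta>" using y[OF i] uv[OF i] small(2) by linarith
      qed
      with p(1) show "p \<in> {p \<in> space PP. mS (zc p) \<in> C}" by simp
    qed
    show "{p \<in> space PP. mS (zc p) \<in> C} \<in> PP.events"
      using measurable_sets[OF measurable_mS_zc C] by (simp add: vimage_def Int_def conj_commute)
  qed
  finally show ?thesis .
qed

end

section \<open>The rate function is good\<close>

definition beta_rate :: "real \<Rightarrow> real \<Rightarrow> ereal" where
  "beta_rate \<theta> x = ereal \<theta> * gfun (x / \<theta>)"

lemma beta_rate_pos: "\<theta> > 0 \<Longrightarrow> x > 0 \<Longrightarrow> beta_rate \<theta> x = ereal (x - \<theta> * ln (x / \<theta>) - \<theta>)"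
  by (simp add: beta_rate_def gfun_def field_simps)

lemma beta_rate_nonpos: "\<theta> > 0 \<Longrightarrow> x \<le> 0 \<Longrightarrow> beta_rate \<theta> x = \<infinity>"
  by (simp add: beta_rate_def gfun_def not_less divide_nonpos_pos)

lemma beta_rate_nonneg: "\<theta> > 0 \<Longrightarrow> 0 \<le> beta_rate \<theta> x"
  by (simp add: beta_rate_def gfun_nonneg)

lemma rate_upper:
  assumes "\<theta> > 0" "x \<ge> 0" "ereal c < beta_rate \<theta> x"
  shows "\<forall>\<^sub>F \<delta> in at_right 0. c < max 0 (x - 2 * \<delta>) - \<theta> * ln ((x + 2 * \<delta>) / \<theta>) - \<theta>"
proof (cases "x = 0")
  case False
  then have x: "x > 0" using assms by simp
  have "((\<lambda>\<delta>. max 0 (x - 2 * \<delta>) - \<theta> * ln ((x + 2 * \<delta>) / \<theta>) - \<theta>) \<longlongrightarrow> max 0 (x - 2 * 0) - \<theta> * ln ((x + 2 * 0) / \<theta>) - \<theta>) (at_right 0)"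
    by (intro tendsto_intros) (use x assms in auto)
  then show ?thesis by (rule order_tendstoD) (use assms x beta_rate_pos[OF assms(1) x] in simp)
next
  case True
  \<comment> \<open>At \<open>x = 0\<close> the rate is infinite and every real \<open>c\<close> has
    to be beaten. For \<open>\<delta>\<close> below this value
    \<open>ln (2 * \<delta> / \<theta>)\<close> is at most
    \<open>- (\<bar>c\<bar> / \<theta> + 2)\<close>, which makes the expression at least
    \<open>\<bar>c\<bar> + \<theta>\<close>.\<close>
  define d where "d = \<theta> * exp (- (\<bar>c\<bar> / \<theta> + 2)) / 2"
  have d: "d > 0" using assms by (simp add: d_def)
  have "c < max 0 (x - 2 * \<delta>) - \<theta> * ln ((x + 2 * \<delta>) / \<theta>) - \<theta>" if "0 < \<delta>" "\<delta> < d" for \<delta>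
  proof -
    have "2 * \<delta> / \<theta> \<le> exp (- (\<bar>c\<bar> / \<theta> + 2))" using that assms(1) by (simp add: d_def field_simps)
    then have "ln (2 * \<delta> / \<theta>) \<le> ln (exp (- (\<bar>c\<bar> / \<theta> + 2)))" using that assms(1) by (subst ln_le_cancel_iff) auto
    then have "\<theta> * ln (2 * \<delta> / \<theta>) \<le> \<theta> * (- (\<bar>c\<bar> / \<theta> + 2))" using assms(1) by (intro mult_left_mono) auto
    also have "\<dots> = - \<bar>c\<bar> - 2 * \<theta>" using assms(1) by (simp add: field_simps)
    finally show ?thesis using True that assms(1) by simp
  qed
  then show ?thesis unfolding eventually_at_right_field using d by blast
qed

lemma rate_lower:
  assumes "\<theta> > 0" "x > 0" "beta_rate \<theta> x < ereal c"
  shows "\<forall>\<^sub>F \<delta> in at_right 0. 0 < x - \<delta> \<and> (x + \<delta>) - \<theta> * ln ((x - \<delta>) / \<theta>) - \<theta> < c"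
proof (rule eventually_conj)
  have "((\<lambda>\<delta>. (x + \<delta>) - \<theta> * ln ((x - \<delta>) / \<theta>) - \<theta>) \<longlongrightarrow> (x + 0) - \<theta> * ln ((x - 0) / \<theta>) - \<theta>) (at_right 0)"
    by (intro tendsto_intros) (use assms in auto)
  then show "\<forall>\<^sub>F \<delta> in at_right 0. (x + \<delta>) - \<theta> * ln ((x - \<delta>) / \<theta>) - \<theta> < c"
    by (rule order_tendstoD) (use assms beta_rate_pos[OF assms(1,2)] in simp)
  show "\<forall>\<^sub>F \<delta> in at_right 0. 0 < x - \<delta>"
    unfolding eventually_at_right_field using assms(2) by (intro exI[of _ x]) auto
qed

text \<open>A strict lower bound for a sum of nonnegative extended reals is spread over the
  summands; an infinite summand can take over the whole bound. The real thresholds for single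
  coordinates are what the Beta estimates accept.\<close>

lemma ereal_sum_less:
  fixes f :: "nat \<Rightarrow> ereal"
  assumes "\<And>j. j < K \<Longrightarrow> (0::ereal) \<le> f j" "ereal c < (\<Sum>j<K. f j)"
  shows "\<exists>c'. (\<forall>j<K. ereal (c' j) < f j) \<and> c < (\<Sum>j<K. c' j)"
  using assms
proof (induction K arbitrary: c)
  case 0
  then show ?case by simp
next
  case (Suc K)
  have S: "0 \<le> (\<Sum>j<K. f j)" using Suc.prems(1) by (intro sum_nonneg) auto
  have f: "0 \<le> f K" using Suc.prems(1) by simp
  have lt: "ereal c < (\<Sum>j<K. f j) + f K" using Suc.prems(2) by simp
  have "\<exists>c1 c2. ereal c1 < (\<Sum>j<K. f j) \<and> ereal c2 < f K \<and> c < c1 + c2"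
  proof (cases "\<Sum>j<K. f j"; cases "f K")
    fix s r assume sr: "(\<Sum>j<K. f j) = ereal s" "f K = ereal r"
    then have "c < s + r" using lt by simp
    then show ?thesis unfolding sr
      by (intro exI[of _ "s - (s + r - c) / 3"] exI[of _ "r - (s + r - c) / 3"]) (auto simp: field_simps)
  next
    assume i: "f K = \<infinity>"
    fix s assume s: "(\<Sum>j<K. f j) = ereal s"
    show ?thesis using S unfolding i s by (intro exI[of _ "-1"] exI[of _ "c + 2"]) auto
  next
    assume s: "(\<Sum>j<K. f j) = \<infinity>"
    fix r assume i: "f K = ereal r"
    show ?thesis using f unfolding i s by (intro exI[of _ "c + 2"] exI[of _ "-1"]) auto
  next
    assume "(\<Sum>j<K. f j) = \<infinity>" "f K = \<infinity>"
    then show ?thesis by (intro exI[of _ "c + 1"] exI[of _ 0]) auto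
  qed (use S f in auto)
  then obtain c1 c2 where c: "ereal c1 < (\<Sum>j<K. f j)" "ereal c2 < f K" "c < c1 + c2" by blast
  from Suc.IH[OF _ c(1)] Suc.prems(1) obtain c' where c': "\<forall>j<K. ereal (c' j) < f j" "c1 < (\<Sum>j<K. c' j)" by auto
  have "(\<Sum>j<K. (c'(K := c2)) j) = (\<Sum>j<K. c' j)" by (intro sum.cong) auto
  then show ?case using c c' by (intro exI[of _ "c'(K := c2)"]) (auto simp: less_Suc_eq)
qed

text \<open>The point at which \<open>b / a\<close> times the \<open>j\<close>-th canonical moment
  concentrates.\<close>

definition shape :: "real \<Rightarrow> nat \<Rightarrow> real" where "shape \<tau> j = (if even j then 1 else \<tau>)"

lemma shape_pos: "\<tau> > 0 \<Longrightarrow> shape \<tau> j > 0"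
  by (simp add: shape_def)

lemma sum_rterm: "(\<Sum>k<K. rterm \<tau> z k) = (\<Sum>j<2 * K. beta_rate (shape \<tau> j) (z j))"
  by (induction K) (simp_all add: rterm_def beta_rate_def shape_def one_ereal_def[symmetric] add.assoc)

lemma sum_beta_rate_le_Irate:
  assumes "\<tau> > 0" shows "(\<Sum>j<K. beta_rate (shape \<tau> j) (z j)) \<le> Irate \<tau> z"
proof -
  have "(\<Sum>j<K. beta_rate (shape \<tau> j) (z j)) \<le> (\<Sum>j<2 * K. beta_rate (shape \<tau> j) (z j))"
    by (rule sum_mono2) (auto intro: beta_rate_nonneg shape_pos assms)
  also have "\<dots> \<le> Irate \<tau> z" unfolding sum_rterm[symmetric] Irate_def
    by (rule suminf_upper) (use assms in \<open>auto intro: rterm_nonneg\<close>)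
  finally show ?thesis .
qed

lemma beta_rate_le_Irate:
  assumes "\<tau> > 0" shows "beta_rate (shape \<tau> j) (z j) \<le> Irate \<tau> z"
proof -
  have "beta_rate (shape \<tau> j) (z j) \<le> (\<Sum>j<Suc j. beta_rate (shape \<tau> j) (z j))"
    using sum_nonneg[of "{..<j}" "\<lambda>j. beta_rate (shape \<tau> j) (z j)"] beta_rate_nonneg[OF shape_pos[OF assms]]
    by (simp add: add_increasing)
  also note sum_beta_rate_le_Irate[OF assms]
  finally show ?thesis .
qed

text \<open>Some partial sum already exceeds \<open>c\<close>, and its finitely many terms keep
  their bounds when each coordinate is replaced by a short interval, with the linear part taken at
  the left end and the logarithm at the right end. These are the expressions that
  \<open>beta_ld_upper\<close> handles.\<close>

lemma local_rate:
  assumes \<tau>: "\<tau> > 0" and z: "\<And>j. \<zeta> j \<ge> 0" and c: "ereal c < Irate \<tau> \<zeta>"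
  shows "\<exists>K \<delta> c'. 0 < \<delta> \<and> c < (\<Sum>j<K. c' j) \<and>
    (\<forall>j<K. c' j < max 0 (\<zeta> j - 2 * \<delta>) - shape \<tau> j * ln ((\<zeta> j + 2 * \<delta>) / shape \<tau> j) - shape \<tau> j)"
proof -
  have "Irate \<tau> \<zeta> = (SUP K. \<Sum>k<K. rterm \<tau> \<zeta> k)"
    unfolding Irate_def by (rule suminf_ereal_eq_SUP) (use \<tau> in \<open>auto intro: rterm_nonneg\<close>)
  with c obtain K0 where "ereal c < (\<Sum>k<K0. rterm \<tau> \<zeta> k)" by (auto simp: less_SUP_iff)
  then have "ereal c < (\<Sum>j<2 * K0. beta_rate (shape \<tau> j) (\<zeta> j))" by (simp add: sum_rterm)
  from ereal_sum_less[OF _ this] obtain c' where c': "\<And>j. j < 2 * K0 \<Longrightarrow> ereal (c' j) < beta_rate (shape \<tau> j) (\<zeta> j)" "c < (\<Sum>j<2 * K0. c' j)"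
    using beta_rate_nonneg shape_pos[OF \<tau>] by metis
  have "\<forall>\<^sub>F \<delta> in at_right 0. \<forall>j\<in>{..<2 * K0}. c' j < max 0 (\<zeta> j - 2 * \<delta>) - shape \<tau> j * ln ((\<zeta> j + 2 * \<delta>) / shape \<tau> j) - shape \<tau> j"
    by (intro eventually_ball_finite ballI rate_upper shape_pos \<tau> z c'(1)) auto
  moreover have "\<forall>\<^sub>F \<delta> in at_right (0::real). 0 < \<delta>" by (simp add: eventually_at_filter)
  ultimately have "\<forall>\<^sub>F \<delta> in at_right 0. 0 < \<delta> \<and> (\<forall>j\<in>{..<2 * K0}. c' j < max 0 (\<zeta> j - 2 * \<delta>) - shape \<tau> j * ln ((\<zeta> j + 2 * \<delta>) / shape \<tau> j) - shape \<tau> j)"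
    by eventually_elim simp
  from eventually_happens[OF this] obtain \<delta> where "0 < \<delta>"
    "\<forall>j\<in>{..<2 * K0}. c' j < max 0 (\<zeta> j - 2 * \<delta>) - shape \<tau> j * ln ((\<zeta> j + 2 * \<delta>) / shape \<tau> j) - shape \<tau> j"
    by auto
  with c'(2) show ?thesis by (intro exI[of _ "2 * K0"] exI[of _ \<delta>] exI[of _ c']) auto
qed

lemma open_cylinder:
  "open {u :: nat \<Rightarrow> real. \<forall>i<K. \<bar>u i - \<zeta> i\<bar> < \<delta>}"
proof -
  have "{u :: nat \<Rightarrow> real. \<forall>i<K. \<bar>u i - \<zeta> i\<bar> < \<delta>} = (\<Inter>i\<in>{..<K}. {u. \<bar>u i - \<zeta> i\<bar> < \<delta>})" by auto
  also have "open \<dots>" by (intro open_INT ballI open_Collect_less continuous_intros continuous_on_product_then_coordinatewise continuous_on_id) auto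
  finally show ?thesis .
qed

lemma open_contains_cylinder:
  assumes "open (U :: (nat \<Rightarrow> real) set)" "z \<in> U"
  obtains K \<delta> where "\<delta> > 0" "\<And>u. (\<And>i. i < K \<Longrightarrow> \<bar>u i - z i\<bar> < \<delta>) \<Longrightarrow> u \<in> U"
proof -
  have "openin (product_topology (\<lambda>_. euclidean) UNIV) U" using assms(1) by (simp add: euclidean_product_topology)
  from product_topology_open_contains_basis[OF this assms(2)]
  obtain X where X: "z \<in> (\<Pi>\<^sub>E i\<in>UNIV. X i)" "\<And>i. open (X i)" "finite {i. X i \<noteq> UNIV}" "(\<Pi>\<^sub>E i\<in>UNIV. X i) \<subseteq> U"
    by auto
  obtain K where K: "\<And>i. X i \<noteq> UNIV \<Longrightarrow> i < K"
    using finite_nat_bounded[OF X(3)] by auto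
  have "\<forall>i. \<exists>e>0. ball (z i) e \<subseteq> X i" using X(1,2) open_contains_ball by (metis PiE_mem UNIV_I)
  then obtain e where e: "\<And>i. e i > 0" "\<And>i. ball (z i) (e i) \<subseteq> X i" by metis
  define \<delta> where "\<delta> = Min (insert 1 (e ` {..<K}))"
  have "\<delta> > 0" unfolding \<delta>_def using e(1) by (subst Min_gr_iff) auto
  moreover have "u \<in> U" if u: "\<And>i. i < K \<Longrightarrow> \<bar>u i - z i\<bar> < \<delta>" for u
  proof -
    have "u i \<in> X i" for i
    proof (cases "i < K")
      case True
      then have "\<delta> \<le> e i" unfolding \<delta>_def by (intro Min_le) auto
      then show ?thesis using u[OF True] e(2)[of i] by (auto simp: dist_real_def abs_minus_commute subset_iff)
    qed (use K[of i] in auto)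
    then show ?thesis using X(4) by auto
  qed
  ultimately show ?thesis by (rule that)
qed

lemma compact_box: "compact {z :: nat \<Rightarrow> real. \<forall>i. 0 \<le> z i \<and> z i \<le> M}"
proof -
  have "compactin (product_topology (\<lambda>_::nat. euclideanreal) UNIV) (Pi\<^sub>E UNIV (\<lambda>_. {0..M}))"
    by (subst compactin_PiE) auto
  moreover have "Pi\<^sub>E UNIV (\<lambda>_. {0..M}) = {z :: nat \<Rightarrow> real. \<forall>i. 0 \<le> z i \<and> z i \<le> M}" by auto
  ultimately show ?thesis by (simp add: euclidean_product_topology)
qed

lemma continuous_mS_UNIV: "continuous_on S mS"
proof (rule continuous_on_coordinatewise_then_product)
  fix k show "continuous_on S (\<lambda>z. mS z k)"
    by (rule continuous_mS) (rule continuous_on_product_then_coordinatewise[OF continuous_on_id])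
qed

text \<open>Lower semicontinuity: by \<open>local_rate\<close> a rate above \<open>c\<close>
  persists on a cylinder around the point, so within the compact box the sublevel set is the
  complement of an open set.\<close>

lemma compact_Irate_le:
  assumes "\<tau> > 0"
  shows "compact {z. (\<forall>i. 0 \<le> z i \<and> z i \<le> M) \<and> Irate \<tau> z \<le> ereal c}"
proof -
  let ?box = "{z :: nat \<Rightarrow> real. \<forall>i. 0 \<le> z i \<and> z i \<le> M}"
  have ex: "\<exists>T. open T \<and> \<zeta> \<in> T \<and> (\<forall>z\<in>?box \<inter> T. ereal c < Irate \<tau> z)" if z: "\<zeta> \<in> ?box" "ereal c < Irate \<tau> \<zeta>" for \<zeta>
  proof -
    obtain K \<delta> c' where k: "0 < \<delta>" "c < (\<Sum>j<K. c' j)"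
      "\<And>j. j < K \<Longrightarrow> c' j < max 0 (\<zeta> j - 2 * \<delta>) - shape \<tau> j * ln ((\<zeta> j + 2 * \<delta>) / shape \<tau> j) - shape \<tau> j"
      using local_rate[OF assms _ z(2)] z(1) by auto
    have "ereal c < Irate \<tau> z" if zz: "z \<in> ?box" "\<forall>i<K. \<bar>z i - \<zeta> i\<bar> < \<delta>" for z
    proof -
      have "ereal (c' j) \<le> beta_rate (shape \<tau> j) (z j)" if j: "j < K" for j
      proof (cases "z j > 0")
        case True
        have b: "z j \<le> \<zeta> j + 2 * \<delta>" "max 0 (\<zeta> j - 2 * \<delta>) \<le> z j" using zz(2) j True k(1) by (auto simp: abs_less_iff)
        then have "ln (z j / shape \<tau> j) \<le> ln ((\<zeta> j + 2 * \<delta>) / shape \<tau> j)"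
          using True shape_pos[OF assms, of j] by (subst ln_le_cancel_iff) (auto intro!: divide_right_mono divide_pos_pos)
        then have "shape \<tau> j * ln (z j / shape \<tau> j) \<le> shape \<tau> j * ln ((\<zeta> j + 2 * \<delta>) / shape \<tau> j)"
          using shape_pos[OF assms, of j] by (intro mult_left_mono) auto
        with b k(3)[OF j] have "c' j \<le> z j - shape \<tau> j * ln (z j / shape \<tau> j) - shape \<tau> j" by linarith
        then show ?thesis by (simp add: beta_rate_pos[OF shape_pos[OF assms] True])
      next
        case False
        then show ?thesis by (simp add: beta_rate_nonpos shape_pos assms)
      qed
      then have "(\<Sum>j<K. ereal (c' j)) \<le> (\<Sum>j<K. beta_rate (shape \<tau> j) (z j))" by (intro sum_mono) auto
      also have "\<dots> \<le> Irate \<tau> z" by (rule sum_beta_rate_le_Irate[OF assms])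
      finally show ?thesis using k(2) by (simp add: less_le_trans[of "ereal c" "ereal (\<Sum>j<K. c' j)"])
    qed
    then show ?thesis
      using k(1) by (intro exI[of _ "{u. \<forall>i<K. \<bar>u i - \<zeta> i\<bar> < \<delta>}"]) (auto intro: open_cylinder)
  qed
  define T where "T \<zeta> = (SOME T. open T \<and> \<zeta> \<in> T \<and> (\<forall>z\<in>?box \<inter> T. ereal c < Irate \<tau> z))" for \<zeta>
  have T: "open (T \<zeta>) \<and> \<zeta> \<in> T \<zeta> \<and> (\<forall>z\<in>?box \<inter> T \<zeta>. ereal c < Irate \<tau> z)" if "\<zeta> \<in> ?box" "ereal c < Irate \<tau> \<zeta>" for \<zeta>
    unfolding T_def by (rule someI_ex[OF ex[OF that]])
  define W where "W = (\<Union>\<zeta>\<in>{\<zeta>\<in>?box. ereal c < Irate \<tau> \<zeta>}. T \<zeta>)"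
  have "open W" unfolding W_def by (rule open_UN) (use T in blast)
  moreover have "{z. (\<forall>i. 0 \<le> z i \<and> z i \<le> M) \<and> Irate \<tau> z \<le> ereal c} = ?box \<inter> - W"
  proof (intro equalityI subsetI)
    fix z assume z: "z \<in> {z. (\<forall>i. 0 \<le> z i \<and> z i \<le> M) \<and> Irate \<tau> z \<le> ereal c}"
    then have zb: "z \<in> ?box" "\<not> ereal c < Irate \<tau> z" by auto
    have "z \<notin> T \<zeta>" if "\<zeta> \<in> ?box" "ereal c < Irate \<tau> \<zeta>" for \<zeta>
      using T[OF that] zb by blast
    with zb show "z \<in> ?box \<inter> - W" by (auto simp: W_def)
  next
    fix z assume z: "z \<in> ?box \<inter> - W"
    have "\<not> ereal c < Irate \<tau> z"
    proof
      assume l: "ereal c < Irate \<tau> z"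
      have "z \<in> T z" using T[OF _ l] z by blast
      with z l show False by (auto simp: W_def)
    qed
    with z show "z \<in> {z. (\<forall>i. 0 \<le> z i \<and> z i \<le> M) \<and> Irate \<tau> z \<le> ereal c}" by auto
  qed
  ultimately show ?thesis using compact_Int_closed[OF compact_box[of M] closed_Compl[of W]] by simp
qed

text \<open>Because \<open>ln y \<le> y / 2\<close>, the logarithmic term eats at most half of
  \<open>x\<close>, and the other half is bounded by \<open>c + \<theta>\<close>.\<close>

lemma beta_rate_le_bound:
  assumes "\<theta> > 0" "\<theta> \<le> 1" "beta_rate \<theta> x \<le> ereal c"
  shows "x \<le> 2 * c + 2"
proof -
  have x: "x > 0" using beta_rate_nonpos[OF assms(1), of x] assms(3) by (cases "x > 0") auto
  have "ln (x / \<theta> / 2) \<le> x / \<theta> / 2 - 1" using x assms(1) by (intro ln_le_minus_one) auto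
  moreover have "ln (x / \<theta> / 2) = ln (x / \<theta>) - ln 2" using x assms(1) by (intro ln_divide_pos) auto
  moreover have "ln 2 \<le> (1::real)" using ln_le_minus_one[of "2::real"] by simp
  ultimately have "ln (x / \<theta>) \<le> x / \<theta> / 2" by linarith
  then have "\<theta> * ln (x / \<theta>) \<le> \<theta> * (x / \<theta> / 2)" using assms(1) by (intro mult_left_mono) auto
  also have "\<dots> = x / 2" using assms(1) by simp
  finally have "\<theta> * ln (x / \<theta>) \<le> x / 2" .
  moreover have "x - \<theta> * ln (x / \<theta>) - \<theta> \<le> c" using assms(3) beta_rate_pos[OF assms(1) x] by simp
  ultimately show ?thesis using assms(2) by linarith
qed

lemma I_L_nonneg: "\<tau> > 0 \<Longrightarrow> 0 \<le> I_L \<tau> \<mu>"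
  unfolding I_L_Irate Irate_def by (auto intro!: INF_greatest suminf_0_le rterm_nonneg)

text \<open>A rate at most \<open>c\<close> bounds every coefficient by \<open>2 * c + 2\<close> and
  thereby the support, so the level set lies in a single \<open>KR (4 * M)\<close>, where it is the
  preimage of a compact set of moment sequences.\<close>

theorem good_rate_function_I_L:
  assumes \<tau>: "0 < \<tau>" "\<tau> \<le> 1"
  shows "good_rate_function weak_top (I_L \<tau>)"
  unfolding good_rate_function_def
proof (intro conjI ballI allI)
  fix c :: real
  show "compactin weak_top {\<mu> \<in> topspace weak_top. I_L \<tau> \<mu> \<le> ereal c}"
  proof (cases "c < 0")
    case True
    have "\<not> I_L \<tau> \<mu> \<le> ereal c" for \<mu>
    proof
      assume "I_L \<tau> \<mu> \<le> ereal c"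
      then have "0 \<le> ereal c" using I_L_nonneg[OF \<tau>(1)] order_trans by blast
      with True show False by simp
    qed
    then show ?thesis by simp
  next
    case False
    define M where "M = 2 * c + 2"
    have M: "M > 0" using False by (simp add: M_def)
    define Z where "Z = {z. (\<forall>i. 0 \<le> z i \<and> z i \<le> M) \<and> Irate \<tau> z \<le> ereal c}"
    have "compact (mS ` Z)"
      unfolding Z_def by (intro compact_continuous_image continuous_mS_UNIV compact_Irate_le \<tau>)
    \<comment> \<open>Intersecting with the moments of \<open>KR (4 * M)\<close> selects those
      sequences in \<open>mS\<close> that already belong to a measure, so no representing measure
      has to be constructed.\<close>
    then have C: "compact (mom ` KR (4 * M) \<inter> mS ` Z)" by (intro compact_Int compact_mom_KR)
    have "{\<mu> \<in> topspace weak_top. I_L \<tau> \<mu> \<le> ereal c} = {\<mu> \<in> KR (4 * M). mom \<mu> \<in> mom ` KR (4 * M) \<inter> mS ` Z}"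
    proof (intro equalityI subsetI)
      fix \<mu> assume "\<mu> \<in> {\<mu> \<in> topspace weak_top. I_L \<tau> \<mu> \<le> ereal c}"
      then have mu: "\<mu> \<in> Mc" "I_L \<tau> \<mu> \<le> ereal c" by (auto simp: topspace_weak_top)
      then have fin: "I_L \<tau> \<mu> \<noteq> \<infinity>" by auto
      obtain z where z: "\<And>i. 0 < z i" "mom \<mu> = mS z" "Irate \<tau> z = I_L \<tau> \<mu>" "msupp \<mu> \<subseteq> {0..}"
        using I_L_finite[OF mu(1) fin \<tau>(1)] by blast
      have zM: "z i \<le> M" for i
      proof -
        have "beta_rate (shape \<tau> i) (z i) \<le> ereal c" using beta_rate_le_Irate[OF \<tau>(1)] z(3) mu(2) order_trans by metis
        then show ?thesis unfolding M_def by (rule beta_rate_le_bound[rotated 2]) (use \<tau> in \<open>auto simp: shape_def\<close>)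
      qed
      have "\<mu> \<in> KR (4 * M)"
        using mS_bound(2)[of z M] z(1) zM M by (intro KR_if_mom_le mu z) (auto simp: z(2) intro: less_imp_le)
      moreover have "z \<in> Z" unfolding Z_def using z(1,3) zM mu(2) by (auto intro: less_imp_le)
      moreover have "mom \<mu> \<in> mS ` Z" using calculation(2) z(2) by simp
      ultimately show "\<mu> \<in> {\<mu> \<in> KR (4 * M). mom \<mu> \<in> mom ` KR (4 * M) \<inter> mS ` Z}" by blast
    next
      fix \<mu> assume "\<mu> \<in> {\<mu> \<in> KR (4 * M). mom \<mu> \<in> mom ` KR (4 * M) \<inter> mS ` Z}"
      then obtain z where mu: "\<mu> \<in> KR (4 * M)" and z: "mom \<mu> = mS z" "z \<in> Z" by auto
      have Iz: "Irate \<tau> z \<le> ereal c" using z(2) by (simp add: Z_def)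
      then have "Irate \<tau> z \<noteq> \<infinity>" by auto
      from Irate_finite_pos[OF this \<tau>(1)] have "z i > 0" for i .
      then have "I_L \<tau> \<mu> \<le> Irate \<tau> z"
        using mu z by (intro I_L_le_Irate) (auto simp: KR_def)
      with Iz mu show "\<mu> \<in> {\<mu> \<in> topspace weak_top. I_L \<tau> \<mu> \<le> ereal c}"
        by (auto simp: topspace_weak_top KR_Mc)
    qed
    then show ?thesis using compactin_weak_top[OF C] by simp
  qed
qed (use I_L_nonneg \<tau> in blast)

section \<open>The large deviation principle\<close>

locale jacobi_regime =
  fixes \<beta> \<tau> :: real and a b :: "nat \<Rightarrow> real"
  assumes beta0: "\<beta> > 0" and tau: "0 < \<tau>" "\<tau> \<le> 1"
    and ab_gt: "\<forall>n\<ge>1. a n > \<beta> / 2 * (real n - 1) \<and> b n > \<beta> / 2 * (real n - 1)"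
    and lim_a: "(\<lambda>n. \<beta> / 2 * real n / a n) \<longlonglongrightarrow> \<tau>"
    and lim_b: "filterlim (\<lambda>n. b n / real n) at_top sequentially"
begin

sublocale J: jacobi_params m \<beta> "a (Suc m)" "b (Suc m)" for m
  using beta0 ab_gt[rule_format, of "Suc m"] by unfold_locales auto

lemma na_lim: "(\<lambda>m. real (Suc m) * (\<beta> / 2) / a (Suc m)) \<longlonglongrightarrow> \<tau>"
  using LIMSEQ_Suc[OF lim_a] by (simp add: mult.commute)

lemma Suc_top: "filterlim (\<lambda>m. real (Suc m)) at_top sequentially"
  by (rule filterlim_compose[OF filterlim_real_sequentially filterlim_Suc])

lemma an_lim: "(\<lambda>m. a (Suc m) / real (Suc m)) \<longlonglongrightarrow> \<beta> / 2 / \<tau>"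
proof -
  have "(\<lambda>m. \<beta> / 2 / (real (Suc m) * (\<beta> / 2) / a (Suc m))) \<longlonglongrightarrow> \<beta> / 2 / \<tau>"
    using tau by (intro tendsto_divide tendsto_const na_lim) auto
  moreover have "\<beta> / 2 / (real (Suc m) * (\<beta> / 2) / a (Suc m)) = a (Suc m) / real (Suc m)" for m
    using beta0 by (simp del: of_nat_Suc)
  ultimately show ?thesis by simp
qed

lemma a_top: "filterlim (\<lambda>m. a (Suc m)) at_top sequentially"
proof -
  have "filterlim (\<lambda>m. a (Suc m) / real (Suc m) * real (Suc m)) at_top sequentially"
    by (rule filterlim_tendsto_pos_mult_at_top[OF an_lim _ Suc_top]) (use beta0 tau in simp)
  then show ?thesis by (simp del: of_nat_Suc)
qed

lemma nb_lim: "(\<lambda>m. real (Suc m) / b (Suc m)) \<longlonglongrightarrow> 0"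
proof -
  have "filterlim (\<lambda>m. b (Suc m) / real (Suc m)) at_top sequentially"
    by (rule filterlim_compose[OF lim_b filterlim_Suc])
  from tendsto_inverse_0_at_top[OF this] show ?thesis by (simp add: inverse_eq_divide)
qed

lemma ab_lim: "(\<lambda>m. a (Suc m) / b (Suc m)) \<longlonglongrightarrow> 0"
proof -
  have "(\<lambda>m. a (Suc m) / real (Suc m) * (real (Suc m) / b (Suc m))) \<longlonglongrightarrow> \<beta> / 2 / \<tau> * 0"
    by (intro tendsto_mult an_lim nb_lim)
  then show ?thesis by (simp del: of_nat_Suc)
qed

lemma const_a: "(\<lambda>m. c / a (Suc m)) \<longlonglongrightarrow> 0"
  by (rule tendsto_divide_0[OF tendsto_const filterlim_at_top_imp_at_infinity[OF a_top]])

lemma b_top: "filterlim (\<lambda>m. b (Suc m)) at_top sequentially"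
proof -
  have "filterlim (\<lambda>m. b (Suc m) / real (Suc m) * real (Suc m)) at_top sequentially"
    by (rule filterlim_at_top_mult_at_top[OF filterlim_compose[OF lim_b filterlim_Suc] Suc_top])
  then show ?thesis by (simp del: of_nat_Suc)
qed

lemma const_b: "(\<lambda>m. c / b (Suc m)) \<longlonglongrightarrow> 0"
  by (rule tendsto_divide_0[OF tendsto_const filterlim_at_top_imp_at_infinity[OF b_top]])

lemma a_pos: "a (Suc m) > 0" and b_pos: "b (Suc m) > 0"
  using J.ab_pos by auto

text \<open>The parameters differ from their main terms by multiples of \<open>\<beta> / 2\<close>.
  The first one has main term \<open>a\<close> at even index and \<open>n * \<beta> / 2\<close>,
  asymptotically \<open>\<tau> * a\<close>, at odd index. The second is of order \<open>b\<close> in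
  both cases, since \<open>a\<close> and \<open>n\<close> are negligible against
  \<open>b\<close>.\<close>

lemma index_regime: "beta_regime (\<lambda>m. J.alj m j) (\<lambda>m. J.gaj m j) (\<lambda>m. a (Suc m)) (\<lambda>m. b (Suc m)) (shape \<tau> j)"
proof
  define i where "i = j div 2"
  have N: "\<forall>\<^sub>F m in sequentially. j < J.N m"
    using eventually_ge_at_top[of j] by eventually_elim (simp add: J.N_def)
  show "(\<lambda>m. J.alj m j / a (Suc m)) \<longlonglongrightarrow> shape \<tau> j"
  proof (cases "even j")
    case True
    have "(\<lambda>m. 1 - real i * (\<beta> / 2) / a (Suc m)) \<longlonglongrightarrow> 1 - 0" by (intro tendsto_intros const_a)
    moreover have "\<forall>\<^sub>F m in sequentially. 1 - real i * (\<beta> / 2) / a (Suc m) = J.alj m j / a (Suc m)"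
      using N
    proof eventually_elim
      case (elim m)
      have "j = 2 * i" using True by (simp add: i_def)
      then show ?case using J.alj_even[of i m] elim a_pos[of m] by (simp add: diff_divide_distrib)
    qed
    ultimately show ?thesis using True by (simp add: shape_def tendsto_cong)
  next
    case False
    have "(\<lambda>m. real (Suc m) * (\<beta> / 2) / a (Suc m) - (1 + real i) * (\<beta> / 2) / a (Suc m)) \<longlonglongrightarrow> \<tau> - 0"
      by (intro tendsto_intros const_a na_lim)
    moreover have "\<forall>\<^sub>F m in sequentially. real (Suc m) * (\<beta> / 2) / a (Suc m) - (1 + real i) * (\<beta> / 2) / a (Suc m) = J.alj m j / a (Suc m)"
      using N
    proof eventually_elim
      case (elim m)
      have "j = 2 * i + 1" using False by (simp add: i_def)
      then have "J.alj m j = real (Suc m) * (\<beta> / 2) - (1 + real i) * (\<beta> / 2)"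
        using J.alj_odd[of i m] elim by (simp add: algebra_simps diff_divide_distrib add_divide_distrib)
      then show ?case by (simp only: diff_divide_distrib)
    qed
    ultimately show ?thesis using False by (simp add: shape_def tendsto_cong)
  qed
  show "(\<lambda>m. J.gaj m j / b (Suc m)) \<longlonglongrightarrow> 1"
  proof (cases "even j")
    case True
    have "(\<lambda>m. 1 - real i * (\<beta> / 2) / b (Suc m)) \<longlonglongrightarrow> 1 - 0" by (intro tendsto_intros const_b)
    moreover have "\<forall>\<^sub>F m in sequentially. 1 - real i * (\<beta> / 2) / b (Suc m) = J.gaj m j / b (Suc m)"
      using N
    proof eventually_elim
      case (elim m)
      have "j = 2 * i" using True by (simp add: i_def)
      then show ?case using J.gaj_even[of i m] elim b_pos[of m] by (simp add: diff_divide_distrib)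
    qed
    ultimately show ?thesis by (simp add: tendsto_cong)
  next
    case False
    have "(\<lambda>m. a (Suc m) / b (Suc m) + 1 - (real (Suc m) / b (Suc m) * (\<beta> / 2) + real i * (\<beta> / 2) / b (Suc m))) \<longlonglongrightarrow> 0 + 1 - (0 * (\<beta> / 2) + 0)"
      by (intro tendsto_intros const_b ab_lim nb_lim)
    moreover have "\<forall>\<^sub>F m in sequentially. a (Suc m) / b (Suc m) + 1 - (real (Suc m) / b (Suc m) * (\<beta> / 2) + real i * (\<beta> / 2) / b (Suc m)) = J.gaj m j / b (Suc m)"
      using N
    proof eventually_elim
      case (elim m)
      have "j = 2 * i + 1" using False by (simp add: i_def)
      then have "J.gaj m j = a (Suc m) + b (Suc m) - (real (Suc m) * (\<beta> / 2) + real i * (\<beta> / 2))"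
        using J.gaj_odd[of i m] elim by (simp add: algebra_simps diff_divide_distrib add_divide_distrib)
      then have "J.gaj m j / b (Suc m) = a (Suc m) / b (Suc m) + b (Suc m) / b (Suc m) - (real (Suc m) * (\<beta> / 2) / b (Suc m) + real i * (\<beta> / 2) / b (Suc m))"
        by (simp only: diff_divide_distrib add_divide_distrib)
      then show ?case using b_pos[of m] by (simp del: of_nat_Suc)
    qed
    ultimately show ?thesis by (simp add: tendsto_cong)
  qed
qed (use tau in \<open>auto simp: shape_pos a_top ab_lim b_pos\<close>)

lemma ev_a_gt: "\<forall>\<^sub>F m in sequentially. C < a (Suc m)"
  using a_top by (simp add: filterlim_at_top_dense)

lemma const_absorb:
  assumes "c < c1"
  shows "\<forall>\<^sub>F m in sequentially. C * exp (- a (Suc m) * c1) \<le> exp (- a (Suc m) * c)"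
proof -
  have "\<forall>\<^sub>F m in sequentially. ln (max 1 C) / (c1 - c) < a (Suc m)" by (rule ev_a_gt)
  then show ?thesis
  proof eventually_elim
    case (elim m)
    then have "ln (max 1 C) \<le> a (Suc m) * (c1 - c)" using assms by (simp add: pos_divide_less_eq)
    then have "exp (ln (max 1 C)) \<le> exp (a (Suc m) * (c1 - c))" by (subst exp_le_cancel_iff)
    moreover have "exp (ln (max 1 C)) = max 1 C" by (intro exp_ln) auto
    ultimately have "C \<le> exp (a (Suc m) * (c1 - c))" by linarith
    then have "C * exp (- a (Suc m) * c1) \<le> exp (a (Suc m) * (c1 - c)) * exp (- a (Suc m) * c1)" by (intro mult_right_mono) auto
    also have "\<dots> = exp (- a (Suc m) * c)" by (simp add: mult_exp_exp algebra_simps)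
    finally show ?case .
  qed
qed

text \<open>The order of the moment in \<open>tail_prob\<close> is taken to be the speed rounded up.
  Each index then contributes at most \<open>(8 / M)\<close> to the power of the speed, and a large
  \<open>M\<close> makes this base as small as desired.\<close>

lemma tail_ld: "\<exists>M0>0. \<forall>M\<ge>M0. \<forall>\<^sub>F m in sequentially. measure (J.PP m) (J.tail m M) \<le> exp (- a (Suc m) * c)"
proof -
  \<comment> \<open>The summand 1 pays for the union bound, whose factor \<open>J.N m\<close> is
    eventually at most the exponential of the speed.\<close>
  define q where "q = \<bar>c\<bar> + 1"
  define M0 where "M0 = 8 * exp q"
  define D where "D = 2 * \<tau> / \<beta> + 1"
  have D: "D > 0" using tau beta0 by (simp add: D_def add_pos_pos)
  have na: "\<forall>\<^sub>F m in sequentially. real (Suc m) * (\<beta> / 2) / a (Suc m) < \<tau> + \<beta> / 2"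
    by (rule order_tendstoD(2)[OF na_lim]) (use beta0 in simp)
  have nb: "\<forall>\<^sub>F m in sequentially. real (Suc m) / b (Suc m) < 1 / \<beta>"
    by (rule order_tendstoD(2)[OF nb_lim]) (use beta0 in simp)
  have "\<forall>\<^sub>F m in sequentially. measure (J.PP m) (J.tail m M) \<le> exp (- a (Suc m) * c)" if M: "M \<ge> M0" for M
    using na nb ev_a_gt[of 1] ev_a_gt[of "4 * D"]
  proof eventually_elim
    case (elim m)
    define A where "A = a (Suc m)"
    define k where "k = nat \<lceil>A\<rceil>"
    have A: "A > 1" "A > 4 * D" using elim by (simp_all add: A_def)
    have k: "A \<le> real k" "real k \<le> 2 * A" using A(1) unfolding k_def by linarith+
    have M1: "M > 0" using M by (simp add: M0_def less_le_trans[of 0 "8 * exp q"])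
    have "real (Suc m) * (\<beta> / 2) < (\<tau> + \<beta> / 2) * A" using elim(1) a_pos[of m] by (simp add: pos_divide_less_eq A_def)
    then have nD: "real (Suc m) \<le> D * A" using beta0 by (simp add: D_def field_simps)
    have "real (Suc m) * \<beta> < b (Suc m)" using elim(2) b_pos[of m] beta0 by (simp add: field_simps)
    moreover have "real m * \<beta> \<le> real (Suc m) * \<beta>" using beta0 by simp
    ultimately have "measure (J.PP m) (J.tail m M) \<le> real (J.N m) * (8 / M) ^ k"
      using k M1 by (intro J.tail_prob) (auto simp: A_def)
    also have "\<dots> \<le> exp A * exp (- q * A)"
    proof (rule mult_mono)
      have "real (J.N m) \<le> 2 * real (Suc m)" by (simp add: J.N_def)
      also have "\<dots> \<le> 2 * (D * A)" using nD by simp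
      also have "\<dots> \<le> A\<^sup>2 / 2" using A D by (simp add: power2_eq_square)
      also have "\<dots> \<le> exp A" using exp_lower_Taylor_quadratic[of A] A by simp
      finally show "real (J.N m) \<le> exp A" .
      have qk: "q * A \<le> q * real k" using k(1) by (intro mult_left_mono) (simp_all add: q_def)
      have "8 / M \<le> 8 / M0" using M by (intro divide_left_mono) (auto simp: M0_def mult_pos_pos M1)
      also have "8 / M0 = exp (- q)" by (simp add: M0_def exp_minus field_simps)
      finally have "(8 / M) ^ k \<le> exp (- q) ^ k" using M1 by (intro power_mono) auto
      also have "\<dots> = exp (- q * real k)" by (rule exp_of_nat2_mult[symmetric])
      also have "\<dots> \<le> exp (- q * A)" using qk by simp
      finally show "(8 / M) ^ k \<le> exp (- q * A)" .
    qed (use M1 in auto)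
    also have "\<dots> = exp (- \<bar>c\<bar> * A)" by (simp add: mult_exp_exp q_def algebra_simps)
    also have "\<dots> \<le> exp (- A * c)" using A by (simp add: mult.commute mult_left_mono abs_le_iff)
    finally show ?case by (simp add: A_def)
  qed
  then show ?thesis by (intro exI[of _ M0]) (auto simp: M0_def)
qed

lemma ab_small: "\<epsilon> > 0 \<Longrightarrow> \<forall>\<^sub>F m in sequentially. a (Suc m) / b (Suc m) * t < \<epsilon>"
  using order_tendstoD(2)[OF tendsto_mult_right[OF ab_lim, of t]] by simp

text \<open>The coefficients in the box whose moments come from \<open>F\<close> form a compact set
  \<open>Z\<close>, on which the rate exceeds a level above \<open>c\<close>. Finitely many
  cylinders cover it, and independence turns each of them into a product of one-dimensional Beta
  estimates.\<close>

lemma ld_upper: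
  assumes F: "closedin weak_top F" and c: "ereal c < (\<Sqinter>\<mu>\<in>F. I_L \<tau> \<mu>)"
  shows "\<forall>\<^sub>F m in sequentially. jacobi_prob (Suc m) \<beta> (a (Suc m)) (b (Suc m)) F \<le> exp (- a (Suc m) * c)"
proof -
  \<comment> \<open>The slack between \<open>c\<close> and \<open>c1\<close> absorbs the number of
    terms: one for each cylinder and two tail probabilities, one from restricting to
    \<open>KR R\<close> and one from restricting to the box.\<close>
  obtain c1 where c1: "c < c1" "ereal c1 < (\<Sqinter>\<mu>\<in>F. I_L \<tau> \<mu>)"
    using ereal_dense2[OF c] by auto
  obtain M where M: "M > 0" and tail: "\<forall>\<^sub>F m in sequentially. measure (J.PP m) (J.tail m M) \<le> exp (- a (Suc m) * c1)"
    using tail_ld[of c1] by auto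
  define R where "R = 4 * M"
  have R: "R > 0" using M by (simp add: R_def)
  define C where "C = mom ` (F \<inter> KR R)"
  have C: "compact C" unfolding C_def by (rule compact_mom_closed[OF F])
  then have Cs: "C \<in> sets Mseq" by (simp add: sets_PiM_equal_borel borel_compact)
  define Z where "Z = {z :: nat \<Rightarrow> real. \<forall>i. 0 \<le> z i \<and> z i \<le> M} \<inter> mS -` C"
  have "closed (mS -` C)"
    by (rule continuous_closed_vimage[OF compact_imp_closed[OF C]]) (use continuous_mS_UNIV[of UNIV] in \<open>simp add: continuous_on_eq_continuous_at\<close>)
  then have Z: "compact Z" unfolding Z_def by (rule compact_Int_closed[OF compact_box])
  \<comment> \<open>If the rate of \<open>\<zeta>\<close> is finite, then \<open>\<zeta>\<close> is
    positive and hence consists of the recursion coefficients of a measure in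
    \<open>F\<close>.\<close>
  have rate: "ereal c1 < Irate \<tau> \<zeta>" if "\<zeta> \<in> Z" for \<zeta>
  proof (cases "Irate \<tau> \<zeta> = \<infinity>")
    case False
    have "mS \<zeta> \<in> C" using that by (simp add: Z_def)
    then obtain \<mu> where "\<mu> \<in> F \<inter> KR R" "mS \<zeta> = mom \<mu>" unfolding C_def by blast
    then have mu: "\<mu> \<in> F" "\<mu> \<in> KR R" "mom \<mu> = mS \<zeta>" by auto
    have "I_L \<tau> \<mu> \<le> Irate \<tau> \<zeta>"
      using mu Irate_finite_pos[OF False tau(1)] by (intro I_L_le_Irate) (auto simp: KR_def)
    moreover have "(\<Sqinter>\<mu>\<in>F. I_L \<tau> \<mu>) \<le> I_L \<tau> \<mu>" using mu(1) by (rule INF_lower)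
    ultimately show ?thesis using c1(2) by simp
  qed simp
  have "\<exists>K \<delta> c'. 0 < \<delta> \<and> c1 < (\<Sum>j<K. c' j) \<and>
    (\<forall>j<K. c' j < max 0 (\<zeta> j - 2 * \<delta>) - shape \<tau> j * ln ((\<zeta> j + 2 * \<delta>) / shape \<tau> j) - shape \<tau> j)" if "\<zeta> \<in> Z" for \<zeta>
    by (rule local_rate[OF tau(1) _ rate[OF that]]) (use that in \<open>auto simp: Z_def\<close>)
  then obtain K \<delta> c' where loc: "\<And>\<zeta>. \<zeta> \<in> Z \<Longrightarrow> 0 < \<delta> \<zeta>" "\<And>\<zeta>. \<zeta> \<in> Z \<Longrightarrow> c1 < (\<Sum>j<K \<zeta>. c' \<zeta> j)"
    "\<And>\<zeta> j. \<zeta> \<in> Z \<Longrightarrow> j < K \<zeta> \<Longrightarrow> c' \<zeta> j < max 0 (\<zeta> j - 2 * \<delta> \<zeta>) - shape \<tau> j * ln ((\<zeta> j + 2 * \<delta> \<zeta>) / shape \<tau> j) - shape \<tau> j"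
    by metis
  obtain D where D: "D \<subseteq> Z" "finite D" "Z \<subseteq> (\<Union>\<zeta>\<in>D. {u. \<forall>i<K \<zeta>. \<bar>u i - \<zeta> i\<bar> < \<delta> \<zeta>})"
  proof (rule compactE_image[OF Z, of Z "\<lambda>\<zeta>. {u. \<forall>i<K \<zeta>. \<bar>u i - \<zeta> i\<bar> < \<delta> \<zeta>}"])
    show "open {u. \<forall>i<K \<zeta>. \<bar>u i - \<zeta> i\<bar> < \<delta> \<zeta>}" for \<zeta> :: "nat \<Rightarrow> real" by (rule open_cylinder)
    show "Z \<subseteq> (\<Union>\<zeta>\<in>Z. {u. \<forall>i<K \<zeta>. \<bar>u i - \<zeta> i\<bar> < \<delta> \<zeta>})" using loc(1) by auto
  qed
  have "\<forall>\<^sub>F m in sequentially. \<forall>\<zeta>\<in>D. \<forall>j\<in>{..<K \<zeta>}. measure (beta_distr (J.alj m j) (J.gaj m j))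
      {a (Suc m) / b (Suc m) * max 0 (\<zeta> j - 2 * \<delta> \<zeta>) .. a (Suc m) / b (Suc m) * (\<zeta> j + 2 * \<delta> \<zeta>)} \<le> exp (- a (Suc m) * c' \<zeta> j)"
  proof (intro eventually_ball_finite ballI D(2) finite_lessThan)
    fix \<zeta> j assume zj: "\<zeta> \<in> D" "j \<in> {..<K \<zeta>}"
    then have z: "\<zeta> \<in> Z" "j < K \<zeta>" using D(1) by auto
    interpret beta_regime "\<lambda>m. J.alj m j" "\<lambda>m. J.gaj m j" "\<lambda>m. a (Suc m)" "\<lambda>m. b (Suc m)" "shape \<tau> j"
      by (rule index_regime)
    have "\<zeta> j \<ge> 0" using z(1) by (auto simp: Z_def)
    then have "max 0 (\<zeta> j - 2 * \<delta> \<zeta>) < \<zeta> j + 2 * \<delta> \<zeta>" using loc(1)[OF z(1)] by auto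
    from beta_ld_upper[OF _ this loc(3)[OF z]]
    show "\<forall>\<^sub>F m in sequentially. measure (beta_distr (J.alj m j) (J.gaj m j))
      {a (Suc m) / b (Suc m) * max 0 (\<zeta> j - 2 * \<delta> \<zeta>) .. a (Suc m) / b (Suc m) * (\<zeta> j + 2 * \<delta> \<zeta>)} \<le> exp (- a (Suc m) * c' \<zeta> j)"
      by (simp add: slab_def)
  qed
  moreover have "\<forall>\<^sub>F m in sequentially. \<forall>\<zeta>\<in>D. K \<zeta> \<le> J.N m \<and> a (Suc m) / b (Suc m) * M\<^sup>2 < \<delta> \<zeta>"
  proof (intro eventually_ball_finite ballI D(2) eventually_conj ab_small)
    fix \<zeta> assume z: "\<zeta> \<in> D"
    show "\<forall>\<^sub>F m in sequentially. K \<zeta> \<le> J.N m"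
      using eventually_ge_at_top[of "K \<zeta>"] by eventually_elim (simp add: J.N_def)
    show "0 < \<delta> \<zeta>" using z D(1) loc(1) by auto
  qed
  moreover have "\<forall>\<^sub>F m in sequentially. a (Suc m) / b (Suc m) * M < 1" by (rule ab_small) simp
  moreover note tail const_absorb[OF c1(1), of "2 + real (card D)"]
  ultimately show ?thesis
  proof eventually_elim
    case (elim m)
    let ?S = "\<lambda>\<zeta> j. {a (Suc m) / b (Suc m) * max 0 (\<zeta> j - 2 * \<delta> \<zeta>) .. a (Suc m) / b (Suc m) * (\<zeta> j + 2 * \<delta> \<zeta>)}"
    have "jacobi_prob (Suc m) \<beta> (a (Suc m)) (b (Suc m)) F \<le>
      measure (J.PP m) {p \<in> space (J.PP m). mS (J.zc m p) \<in> C} + measure (J.PP m) {p \<in> space (J.PP m). mS (J.zc m p) \<notin> J.momle R}"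
      by (rule J.jacobi_prob_le[OF Cs R]) (auto simp: C_def)
    moreover have "measure (J.PP m) {p \<in> space (J.PP m). mS (J.zc m p) \<notin> J.momle R} \<le> measure (J.PP m) (J.tail m M)"
      unfolding R_def by (rule J.momle_prob[OF M])
    moreover have "measure (J.PP m) {p \<in> space (J.PP m). mS (J.zc m p) \<in> C} \<le> measure (J.PP m) (J.tail m M) +
      (\<Sum>\<zeta>\<in>D. \<Prod>j<K \<zeta>. measure (beta_distr (J.alj m j) (J.gaj m j)) (?S \<zeta> j))"
    proof (rule J.prob_cover[OF M Cs D(2)])
      fix z assume "\<And>i. 0 \<le> z i \<and> z i \<le> M" "mS z \<in> C"
      then have "z \<in> Z" by (simp add: Z_def)
      then show "\<exists>\<zeta>\<in>D. \<forall>i<K \<zeta>. \<bar>z i - \<zeta> i\<bar> < \<delta> \<zeta>" using D(3) by auto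
    qed (use elim in \<open>auto intro: less_imp_le\<close>)
    moreover have "(\<Sum>\<zeta>\<in>D. \<Prod>j<K \<zeta>. measure (beta_distr (J.alj m j) (J.gaj m j)) (?S \<zeta> j)) \<le> (\<Sum>\<zeta>\<in>D. exp (- a (Suc m) * c1))"
    proof (rule sum_mono)
      fix \<zeta> assume z: "\<zeta> \<in> D"
      have "(\<Prod>j<K \<zeta>. measure (beta_distr (J.alj m j) (J.gaj m j)) (?S \<zeta> j)) \<le> (\<Prod>j<K \<zeta>. exp (- a (Suc m) * c' \<zeta> j))"
        by (rule prod_mono) (use elim(1) z in auto)
      also have "\<dots> = exp (- a (Suc m) * (\<Sum>j<K \<zeta>. c' \<zeta> j))" by (simp add: exp_sum sum_distrib_left)
      also have "\<dots> \<le> exp (- a (Suc m) * c1)"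
        using loc(2)[of \<zeta>] z D(1) a_pos[of m] by (auto intro!: mult_left_mono less_imp_le)
      finally show "(\<Prod>j<K \<zeta>. measure (beta_distr (J.alj m j) (J.gaj m j)) (?S \<zeta> j)) \<le> exp (- a (Suc m) * c1)" .
    qed
    ultimately have "jacobi_prob (Suc m) \<beta> (a (Suc m)) (b (Suc m)) F \<le> 2 * exp (- a (Suc m) * c1) + (\<Sum>\<zeta>\<in>D. exp (- a (Suc m) * c1))"
      using elim(4) by linarith
    also have "\<dots> = (2 + real (card D)) * exp (- a (Suc m) * c1)" by (simp add: algebra_simps)
    also have "\<dots> \<le> exp (- a (Suc m) * c)" by (rule elim(5))
    finally show ?case .
  qed
qed

text \<open>A finite rate provides positive coefficients \<open>z\<close> of \<open>\<mu>\<close>.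
  Since \<open>mS\<close> is continuous, a cylinder around \<open>z\<close> is mapped into the open
  set of moments that describes \<open>G\<close> on \<open>KR R\<close>. It restricts only
  \<open>K\<close> coordinates, whose partial rate is below \<open>c\<close>.\<close>

lemma ld_lower:
  assumes G: "openin weak_top G" and mu: "\<mu> \<in> G" and c: "I_L \<tau> \<mu> < ereal c"
  shows "\<forall>\<^sub>F m in sequentially. exp (- a (Suc m) * c) \<le> jacobi_prob (Suc m) \<beta> (a (Suc m)) (b (Suc m)) G"
proof -
  obtain c1 where c1: "c1 < c" "I_L \<tau> \<mu> < ereal c1"
  proof -
    obtain e where e: "I_L \<tau> \<mu> < e" "e < ereal c" using dense[OF c] by blast
    then have "e \<noteq> \<infinity>" "e \<noteq> -\<infinity>" by auto
    then obtain r where "e = ereal r" by (cases e) auto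
    with e that show ?thesis by auto
  qed
  have muM: "\<mu> \<in> Mc" using openin_subset[OF G] mu by (auto simp: topspace_weak_top)
  have fin: "I_L \<tau> \<mu> \<noteq> \<infinity>" using c by auto
  obtain z where z: "\<And>i. 0 < z i" "mom \<mu> = mS z" "Irate \<tau> z = I_L \<tau> \<mu>" "msupp \<mu> \<subseteq> {0..}"
    using I_L_finite[OF muM fin tau(1)] by blast
  obtain M0 where M0: "M0 > 0" "\<And>M. M \<ge> M0 \<Longrightarrow> \<forall>\<^sub>F m in sequentially. measure (J.PP m) (J.tail m M) \<le> exp (- a (Suc m) * c)"
    using tail_ld[of c] by auto
  obtain R0 where R0: "R0 > 0" "\<And>x. x \<in> msupp \<mu> \<Longrightarrow> norm x \<le> R0"
    using muM compact_imp_bounded[of "msupp \<mu>"] bounded_pos[of "msupp \<mu>"] by (auto simp: Mc_def)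
  \<comment> \<open>\<open>R0\<close> brings \<open>\<mu>\<close> itself into \<open>KR R\<close>,
    and \<open>M0\<close> makes the tail smaller than \<open>exp (- a (Suc m) * c)\<close>, the
    amount subtracted at the end.\<close>
  define M where "M = max M0 R0"
  have M: "M > 0" "M \<ge> M0" "M \<ge> R0" using M0 by (auto simp: M_def)
  define R where "R = 4 * M"
  have R: "R > 0" using M by (simp add: R_def)
  have muR: "\<mu> \<in> KR R" using muM z(4) R0(2) M by (force simp: KR_def R_def)
  obtain V where V: "open V" "\<And>\<nu>. \<nu> \<in> KR R \<Longrightarrow> mom \<nu> \<in> V \<longleftrightarrow> \<nu> \<in> G"
    using open_mom[OF G, of R] by blast
  have Vs: "V \<in> sets Mseq" using V(1) by (simp add: sets_PiM_equal_borel)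
  have "open (mS -` V)"
    using continuous_mS_UNIV[of UNIV] V(1) by (simp add: continuous_on_open_vimage)
  moreover have "z \<in> mS -` V" using V(2)[OF muR] mu z(2) by simp
  ultimately obtain K \<delta> where K: "\<delta> > 0" "\<And>u. (\<And>i. i < K \<Longrightarrow> \<bar>u i - z i\<bar> < \<delta>) \<Longrightarrow> u \<in> mS -` V"
    by (rule open_contains_cylinder) blast
  define \<rho> where "\<rho> j = z j - shape \<tau> j * ln (z j / shape \<tau> j) - shape \<tau> j" for j
  have \<rho>: "beta_rate (shape \<tau> j) (z j) = ereal (\<rho> j)" for j
    unfolding \<rho>_def by (rule beta_rate_pos[OF shape_pos[OF tau(1)] z(1)])
  have "ereal (\<Sum>j<K. \<rho> j) \<le> Irate \<tau> z" using sum_beta_rate_le_Irate[OF tau(1), where K = K and z = z] by (simp add: \<rho>)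
  then have "ereal (\<Sum>j<K. \<rho> j) < ereal c1" using c1(2) unfolding z(3) by (rule le_less_trans)
  then have gap: "(\<Sum>j<K. \<rho> j) < c1" by simp
  \<comment> \<open>The gap is shared among the \<open>K\<close> coordinates; the denominator
    \<open>real K + 1\<close> also covers \<open>K = 0\<close>.\<close>
  define \<epsilon> where "\<epsilon> = (c1 - (\<Sum>j<K. \<rho> j)) / (real K + 1)"
  have \<epsilon>: "\<epsilon> > 0" using gap by (simp add: \<epsilon>_def)
  have sum_c: "(\<Sum>j<K. \<rho> j + \<epsilon>) \<le> c1"
  proof -
    have "real K * \<epsilon> \<le> (real K + 1) * \<epsilon>" using \<epsilon> by simp
    also have "\<dots> = c1 - (\<Sum>j<K. \<rho> j)" by (simp add: \<epsilon>_def)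
    finally show ?thesis by (simp add: sum.distrib)
  qed
  have "\<forall>\<^sub>F d in at_right 0. \<forall>j\<in>{..<K}. 0 < z j - d \<and> (z j + d) - shape \<tau> j * ln ((z j - d) / shape \<tau> j) - shape \<tau> j < \<rho> j + \<epsilon>"
    by (intro eventually_ball_finite ballI rate_lower shape_pos tau z) (use \<rho> \<epsilon> in auto)
  moreover have "\<forall>\<^sub>F d in at_right 0. 0 < d \<and> d < \<delta> / 2"
    unfolding eventually_at_right_field using K(1) by (intro exI[of _ "\<delta> / 2"]) auto
  ultimately have "\<forall>\<^sub>F d in at_right 0. (0 < d \<and> d < \<delta> / 2) \<and>
      (\<forall>j\<in>{..<K}. 0 < z j - d \<and> (z j + d) - shape \<tau> j * ln ((z j - d) / shape \<tau> j) - shape \<tau> j < \<rho> j + \<epsilon>)"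
    by eventually_elim simp
  from eventually_happens[OF this] obtain d where d: "0 < d" "d < \<delta> / 2"
    "\<And>j. j < K \<Longrightarrow> 0 < z j - d" "\<And>j. j < K \<Longrightarrow> (z j + d) - shape \<tau> j * ln ((z j - d) / shape \<tau> j) - shape \<tau> j < \<rho> j + \<epsilon>"
    by auto
  \<comment> \<open>A common bound for the right ends of the \<open>K\<close> intervals. All
    \<open>z j\<close> are positive, so their sum dominates each of them, and \<open>d\<close> makes
    the bound positive for \<open>K = 0\<close>.\<close>
  define L where "L = (\<Sum>j<K. z j) + d"
  have zL: "z j \<le> (\<Sum>j<K. z j)" if "j < K" for j
    using that z(1) by (intro member_le_sum) (auto intro: less_imp_le)
  have L: "L > 0" unfolding L_def using d(1) z(1) by (intro add_nonneg_pos sum_nonneg) (auto intro: less_imp_le)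
  have "\<forall>\<^sub>F m in sequentially. \<forall>j\<in>{..<K}. exp (- a (Suc m) * (\<rho> j + \<epsilon>)) \<le> measure (beta_distr (J.alj m j) (J.gaj m j))
      {a (Suc m) / b (Suc m) * (z j - d) .. a (Suc m) / b (Suc m) * (z j + d)}"
  proof (intro eventually_ball_finite ballI finite_lessThan)
    fix j assume "j \<in> {..<K}"
    then have j: "j < K" by simp
    interpret beta_regime "\<lambda>m. J.alj m j" "\<lambda>m. J.gaj m j" "\<lambda>m. a (Suc m)" "\<lambda>m. b (Suc m)" "shape \<tau> j"
      by (rule index_regime)
    have "z j - d < z j + d" using d(1) by simp
    from beta_ld_lower[OF d(3)[OF j] this d(4)[OF j]]
    show "\<forall>\<^sub>F m in sequentially. exp (- a (Suc m) * (\<rho> j + \<epsilon>)) \<le> measure (beta_distr (J.alj m j) (J.gaj m j))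
      {a (Suc m) / b (Suc m) * (z j - d) .. a (Suc m) / b (Suc m) * (z j + d)}"
      by (simp add: slab_def)
  qed
  moreover have "\<forall>\<^sub>F m in sequentially. K \<le> J.N m"
    using eventually_ge_at_top[of K] by eventually_elim (simp add: J.N_def)
  moreover have "\<forall>\<^sub>F m in sequentially. a (Suc m) / b (Suc m) * L < 1" by (rule ab_small) simp
  moreover have "\<forall>\<^sub>F m in sequentially. a (Suc m) / b (Suc m) * L\<^sup>2 < \<delta> / 2" by (rule ab_small) (use K(1) in simp)
  moreover note M0(2)[OF M(2)] const_absorb[OF c1(1), of 2]
  ultimately show ?thesis
  proof eventually_elim
    case (elim m)
    let ?S = "\<lambda>j. {a (Suc m) / b (Suc m) * (z j - d) .. a (Suc m) / b (Suc m) * (z j + d)}"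
    have "2 * exp (- a (Suc m) * c) \<le> exp (- a (Suc m) * c1)" by (rule elim(6))
    also have "\<dots> \<le> exp (- a (Suc m) * (\<Sum>j<K. \<rho> j + \<epsilon>))" using sum_c a_pos[of m] by (simp add: mult_left_mono)
    also have "\<dots> = (\<Prod>j<K. exp (- a (Suc m) * (\<rho> j + \<epsilon>)))" by (simp add: exp_sum sum_distrib_left del: sum.distrib)
    also have "\<dots> \<le> (\<Prod>j<K. measure (beta_distr (J.alj m j) (J.gaj m j)) (?S j))"
      by (rule prod_mono) (use elim(1) in auto)
    also have "\<dots> \<le> measure (J.PP m) {p \<in> space (J.PP m). mS (J.zc m p) \<in> V}"
    proof (rule J.prob_box_ge[OF Vs elim(2) L])
      fix w assume "\<And>i. i < K \<Longrightarrow> \<bar>w i - z i\<bar> < \<delta>"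
      then show "mS w \<in> V" using K(2) by auto
    next
      fix j assume j: "j < K"
      show "0 \<le> z j - d \<and> z j - \<delta> / 2 \<le> z j - d \<and> z j + d \<le> z j + \<delta> / 2 \<and> z j + d \<le> L"
        using d(1,2) d(3)[OF j] zL[OF j] by (simp add: L_def)
    qed (use elim in auto)
    finally have A: "2 * exp (- a (Suc m) * c) \<le> measure (J.PP m) {p \<in> space (J.PP m). mS (J.zc m p) \<in> V}" .
    have B: "measure (J.PP m) {p \<in> space (J.PP m). mS (J.zc m p) \<in> V} - measure (J.PP m) {p \<in> space (J.PP m). mS (J.zc m p) \<notin> J.momle R}
      \<le> jacobi_prob (Suc m) \<beta> (a (Suc m)) (b (Suc m)) G"
      by (rule J.jacobi_prob_ge[OF G Vs R]) (use V(2) in blast)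
    have "measure (J.PP m) {p \<in> space (J.PP m). mS (J.zc m p) \<notin> J.momle R} \<le> measure (J.PP m) (J.tail m M)"
      unfolding R_def by (rule J.momle_prob[OF M(1)])
    with A B elim(5) show ?case by linarith
  qed
qed

text \<open>Estimates at real levels suffice: real numbers approximate the infimum from either side,
  and a vanishing probability has \<open>eln\<close> equal to \<open>-\<infinity>\<close>. The
  estimates are indexed by dimension \<open>Suc m\<close>, and shifting a sequence by one index does
  not change its limits.\<close>

lemma LDP_jacobi: "LDP weak_top (\<lambda>n A. jacobi_prob n \<beta> (a n) (b n) A) a (I_L \<tau>)"
  unfolding LDP_def
proof (intro conjI allI impI)
  fix F assume F: "closedin weak_top F"
  let ?L = "limsup (\<lambda>n. eln (jacobi_prob n \<beta> (a n) (b n) F) / ereal (a n))"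
  have "(\<Sqinter>\<mu>\<in>F. I_L \<tau> \<mu>) \<le> - ?L"
  proof (rule dense_le)
    fix x assume x: "x < (\<Sqinter>\<mu>\<in>F. I_L \<tau> \<mu>)"
    show "x \<le> - ?L"
    proof (cases x)
      case (real c)
      have "\<forall>\<^sub>F m in sequentially. eln (jacobi_prob (Suc m) \<beta> (a (Suc m)) (b (Suc m)) F) / ereal (a (Suc m)) \<le> ereal (- c)"
        using ld_upper[OF F x[unfolded real]]
      proof eventually_elim
        case (elim m)
        define P where "P = jacobi_prob (Suc m) \<beta> (a (Suc m)) (b (Suc m)) F"
        have ap: "a (Suc m) > 0" by (rule a_pos)
        show ?case
        proof (cases "P > 0")
          case True
          then have "ln P \<le> ln (exp (- a (Suc m) * c))" using elim by (subst ln_le_cancel_iff) (auto simp: P_def)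
          then have "ln P / a (Suc m) \<le> - c" using ap by (simp add: field_simps)
          then show ?thesis using True ap by (simp add: eln_def P_def)
        next
          case False
          then show ?thesis using ap by (simp add: eln_def P_def)
        qed
      qed
      then have "\<forall>\<^sub>F n in sequentially. eln (jacobi_prob n \<beta> (a n) (b n) F) / ereal (a n) \<le> ereal (- c)"
        by (subst (asm) eventually_sequentially_Suc)
      then have "?L \<le> ereal (- c)" by (rule Limsup_bounded)
      then have "- ereal (- c) \<le> - ?L" by (simp only: ereal_minus_le_minus)
      then show ?thesis unfolding real by simp
    qed (use x in auto)
  qed
  then have "- (- ?L) \<le> - (\<Sqinter>\<mu>\<in>F. I_L \<tau> \<mu>)" by (simp only: ereal_minus_le_minus)
  then show "?L \<le> - (\<Sqinter>\<mu>\<in>F. I_L \<tau> \<mu>)" by simp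
next
  fix G assume G: "openin weak_top G"
  let ?L = "liminf (\<lambda>n. eln (jacobi_prob n \<beta> (a n) (b n) G) / ereal (a n))"
  have "- ?L \<le> (\<Sqinter>\<mu>\<in>G. I_L \<tau> \<mu>)"
  proof (rule INF_greatest, rule dense_ge)
    fix \<mu> x assume mu: "\<mu> \<in> G" and x: "I_L \<tau> \<mu> < x"
    show "- ?L \<le> x"
    proof (cases x)
      case (real c)
      have "\<forall>\<^sub>F m in sequentially. ereal (- c) \<le> eln (jacobi_prob (Suc m) \<beta> (a (Suc m)) (b (Suc m)) G) / ereal (a (Suc m))"
        using ld_lower[OF G mu x[unfolded real]]
      proof eventually_elim
        case (elim m)
        define P where "P = jacobi_prob (Suc m) \<beta> (a (Suc m)) (b (Suc m)) G"
        have ap: "a (Suc m) > 0" by (rule a_pos)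
        have le: "exp (- a (Suc m) * c) \<le> P" using elim by (simp add: P_def)
        then have P: "P > 0" by (rule less_le_trans[rotated]) simp
        have "ln (exp (- a (Suc m) * c)) \<le> ln P" using le P by (subst ln_le_cancel_iff) auto
        then have "- c \<le> ln P / a (Suc m)" using ap by (simp add: field_simps)
        then show ?case using P ap by (simp add: eln_def P_def)
      qed
      then have "\<forall>\<^sub>F n in sequentially. ereal (- c) \<le> eln (jacobi_prob n \<beta> (a n) (b n) G) / ereal (a n)"
        by (subst (asm) eventually_sequentially_Suc)
      then have "ereal (- c) \<le> ?L" by (rule Liminf_bounded)
      then have "- ?L \<le> - ereal (- c)" by (simp only: ereal_minus_le_minus)
      then show ?thesis unfolding real by simp
    qed (use x in auto)
  qed
  then show "- (\<Sqinter>\<mu>\<in>G. I_L \<tau> \<mu>) \<le> ?L" by (subst ereal_uminus_le_reorder)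
qed

end

theorem theorem2p5:
  fixes \<beta> \<tau> :: real and a b :: "nat \<Rightarrow> real"
  assumes "\<beta> > 0"
    and "0 < \<tau>" and "\<tau> \<le> 1"
    and "\<forall>n\<ge>1. a n > \<beta> / 2 * (real n - 1) \<and> b n > \<beta> / 2 * (real n - 1)"
    and "(\<lambda>n. \<beta> / 2 * real n / a n) \<longlonglongrightarrow> \<tau>"
    and "filterlim (\<lambda>n. b n / real n) at_top sequentially"
  shows "LDP weak_top (\<lambda>n A. jacobi_prob n \<beta> (a n) (b n) A) a (I_L \<tau>)
         \<and> good_rate_function weak_top (I_L \<tau>)"
proof -
  interpret jacobi_regime \<beta> \<tau> a b using assms by unfold_locales auto
  show ?thesis using LDP_jacobi good_rate_function_I_L[OF tau] by blast
qed

end
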